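(* Let $N\ge 3$, $2\le p<N$, $\alpha,\beta\in\mathbb{R}$ with $p-N<\alpha<p+\beta$, and $p^*_{\alpha,\beta}=\frac{p(N+\beta)}{N-p+\alpha}$. Then there exists a constant $B_1=B_1(N,p,\alpha,\beta)>0$ such that for every $u\in\mathcal{D}^{1,p}_{\alpha,r}(\mathbb{R}^N)$, $$\int_{\mathbb{R}^N}|x|^{\alpha}|\nabla u|^p\,dx-S^{rad}_p(\alpha,\beta)\left(\int_{\mathbb{R}^N}|x|^{\beta}|u|^{p^*_{\alpha,\beta}}\,dx\right)^{\frac{p}{p^*_{\alpha,\beta}}}\ge B_1\,\mathrm{dist}(u,\mathcal{M})^p .$$
   Context: $\mathcal{D}^{1,p}_\alpha(\mathbb{R}^N)$ is the completion of $C^\infty_c(\mathbb{R}^N)$ with respect to $\|\phi\|=\left(\int_{\mathbb{R}^N}|x|^{\alpha}|\nabla\phi|^p dx\right)^{1/p}$, and $\mathcal{D}^{1,p}_{\alpha,r}(\mathbb{R}^N)$ is the subset of radial functions $u(x)=u(|x|)$. $S^{rad}_p(\alpha,\beta)$ is the best constant $\inf\left\{\int_{\mathbb{R}^N}|x|^\alpha|\nabla u|^p dx\big/\left(\int_{\mathbb{R}^N}|x|^\beta|u|^{p^*_{\alpha,\beta}}dx\right)^{p/p^*_{\alpha,\beta}} : u\in\mathcal{D}^{1,p}_{\alpha,r}(\mathbb{R}^N)\setminus\{0\}\right\}$. For $\lambda>0$, $U_\lambda(x)=\frac{C_{N,\alpha,\beta}\lambda^{\frac{N-p+\alpha}{p}}}{(1+\lambda^{\frac{p+\beta-\alpha}{p-1}}|x|^{\frac{p+\beta-\alpha}{p-1}})^{\frac{N-p+\alpha}{p+\beta-\alpha}}}$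 with $C_{N,\alpha,\beta}=\left[(N+\beta)\left(\frac{N-p+\alpha}{p-1}\right)^{p-1}\right]^{\frac{N-p+\alpha}{p(p+\beta-\alpha)}}$; $\mathcal{M}=\{cU_\lambda: c\in\mathbb{R},\lambda>0\}$ and $\mathrm{dist}(u,\mathcal{M})=\inf_{c\in\mathbb{R},\lambda>0}\|u-cU_\lambda\|$. *)

theory Defs
  imports "HOL-Analysis.Analysis"
begin

definition pderiv_dir :: "'a::euclidean_space \<Rightarrow> ('a \<Rightarrow> real) \<Rightarrow> 'a \<Rightarrow> real" where
  "pderiv_dir b f x = frechet_derivative f (at x) b"

definition grad :: "('a::euclidean_space \<Rightarrow> real) \<Rightarrow> 'a \<Rightarrow> 'a" where
  "grad f x = (\<Sum>b\<in>Basis. frechet_derivative f (at x) b *\<^sub>R b)"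

definition smooth :: "('a::euclidean_space \<Rightarrow> real) \<Rightarrow> bool" where
  "smooth f \<longleftrightarrow> (\<forall>bs. set bs \<subseteq> Basis \<longrightarrow>
      (\<forall>x. foldr pderiv_dir bs f differentiable (at x)))"

definition test_fun :: "('a::euclidean_space \<Rightarrow> real) \<Rightarrow> bool" where
  "test_fun f \<longleftrightarrow> smooth f \<and> compact (closure {x. f x \<noteq> 0})"

text \<open>Elements of D^{1,p}_alpha(R^N), the completion of C_c^infinity with respect to
  (int |x|^alpha |grad phi|^p)^(1/p).  An element is represented by a (Borel) function u
  together with its gradient G: there is a sequence of test functions phi_k which converges
  to u almost everywhere and whose gradients converge to G in the weighted L^p norm.\<close>
definition in_D :: "real \<Rightarrow> real \<Rightarrow> ('a::euclidean_space \<Rightarrow> real) \<Rightarrow> ('a \<Rightarrow> 'a) \<Rightarrow> bool" where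
  "in_D p \<alpha> u G \<longleftrightarrow> u \<in> borel_measurable lborel \<and> G \<in> borel_measurable lborel \<and>
     (\<exists>\<phi> :: nat \<Rightarrow> 'a \<Rightarrow> real. (\<forall>k. test_fun (\<phi> k)) \<and>
        (AE x in lborel. (\<lambda>k. \<phi> k x) \<longlonglongrightarrow> u x) \<and>
        (\<lambda>k. \<integral>\<^sup>+ x. ennreal (norm x powr \<alpha> * norm (grad (\<phi> k) x - G x) powr p) \<partial>lborel)
          \<longlonglongrightarrow> 0)"

definition radial :: "('a::real_normed_vector \<Rightarrow> real) \<Rightarrow> bool" where
  "radial u \<longleftrightarrow> (\<forall>x y. norm x = norm y \<longrightarrow> u x = u y)"

definition Dnorm_p :: "real \<Rightarrow> real \<Rightarrow> ('a::euclidean_space \<Rightarrow> 'a) \<Rightarrow> real" where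
  "Dnorm_p p \<alpha> G = (\<integral>x. norm x powr \<alpha> * norm (G x) powr p \<partial>lborel)"

definition crit_exp :: "nat \<Rightarrow> real \<Rightarrow> real \<Rightarrow> real \<Rightarrow> real" where
  "crit_exp N p \<alpha> \<beta> = p * (real N + \<beta>) / (real N - p + \<alpha>)"

definition weighted_Lq :: "real \<Rightarrow> real \<Rightarrow> ('a::euclidean_space \<Rightarrow> real) \<Rightarrow> real" where
  "weighted_Lq \<beta> q u = (\<integral>x. norm x powr \<beta> * \<bar>u x\<bar> powr q \<partial>lborel)"

definition S_rad :: "'a::euclidean_space itself \<Rightarrow> real \<Rightarrow> real \<Rightarrow> real \<Rightarrow> real" where
  "S_rad TYPE('a) p \<alpha> \<beta> = Inf {Dnorm_p p \<alpha> G /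
        (weighted_Lq \<beta> (crit_exp DIM('a) p \<alpha> \<beta>) u) powr (p / crit_exp DIM('a) p \<alpha> \<beta>) |
      (u :: 'a \<Rightarrow> real) G. in_D p \<alpha> u G \<and> radial u \<and> Dnorm_p p \<alpha> G \<noteq> 0}"

definition C_const :: "nat \<Rightarrow> real \<Rightarrow> real \<Rightarrow> real \<Rightarrow> real" where
  "C_const N p \<alpha> \<beta> = ((real N + \<beta>) * ((real N - p + \<alpha>) / (p - 1)) powr (p - 1))
      powr ((real N - p + \<alpha>) / (p * (p + \<beta> - \<alpha>)))"

definition U_ext :: "real \<Rightarrow> real \<Rightarrow> real \<Rightarrow> real \<Rightarrow> 'a::euclidean_space \<Rightarrow> real" where
  "U_ext p \<alpha> \<beta> lam x = C_const DIM('a) p \<alpha> \<beta> * lam powr ((real DIM('a) - p + \<alpha>) / p) /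
     (1 + lam powr ((p + \<beta> - \<alpha>) / (p - 1)) * norm x powr ((p + \<beta> - \<alpha>) / (p - 1)))
       powr ((real DIM('a) - p + \<alpha>) / (p + \<beta> - \<alpha>))"

definition dist_M :: "real \<Rightarrow> real \<Rightarrow> real \<Rightarrow> ('a::euclidean_space \<Rightarrow> 'a) \<Rightarrow> real" where
  "dist_M p \<alpha> \<beta> G = Inf {Dnorm_p p \<alpha> (\<lambda>x. G x - c *\<^sub>R grad (U_ext p \<alpha> \<beta> lam) x) powr (1 / p) |
      c lam. lam > 0}"

end

theory Submission
  imports Defs
begin

text \<open>
  For a radial \<open>u\<close> everything is one-dimensional in \<open>t = ln (norm x)\<close>.  Splitting \<open>- u'\<close> into its
  positive and negative part reduces the claim to positive nonincreasing \<open>u\<close>, by strict concavity of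
  \<open>x powr (p / q)\<close>.  Normalise the weighted \<open>L\<^sup>q\<close> masses of \<open>u\<close> and of the extremal \<open>U\<close> to be
  equal and let \<open>m\<close> be the monotone map transporting the mass density of \<open>U\<close> to that of \<open>u\<close>.
  The mass transport proof of the sharp inequality (uniform convexity of the \<open>p\<close>-th power, integration
  by parts, weighted arithmetic-geometric mean inequality for \<open>1\<close> and \<open>m'\<close>) leaves two nonnegative
  terms in the deficit: the \<open>p\<close>-th power of the \<open>L\<^sup>p\<close> distance between the energy density of \<open>u\<close>
  pulled back by \<open>m\<close> and that of \<open>U\<close> (both raised to the power \<open>1 / p\<close>), and a weighted integral
  of the gap in the arithmetic-geometric mean inequality.  By Hardy's inequality the gap controls the
  relative entropy, hence the squared Hellinger distance, between the energy density of \<open>U\<close> and its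
  pullback under \<open>m\<close> followed by a translation; since \<open>p \<ge> 2\<close> this dominates the corresponding
  \<open>p\<close>-th power distance.  Where \<open>m'\<close> is large the gap is not coercive, but monotonicity of \<open>u\<close>
  then keeps \<open>m'\<close> large on an interval of fixed length, and the gap is bounded below there.
\<close>

section \<open>Elementary inequalities\<close>

text \<open>The transport argument wants a regular profile: \<open>F\<close> continuous,
  \<open>u\<close> positive, and a tail that is an exact multiple of \<open>U\<close>, so that the
  boundary term at infinity vanishes. Adding \<open>\<epsilon> * f\<close> to a compactly supported
  continuous function produces such profiles; general \<open>F\<close> are reached by density. The
  good \<open>c\<close> and \<open>\<theta>\<close> of the approximants need not converge, so after
  this limit every stability statement carries an arbitrary additive error \<open>e\<close>,
  harmless because the distance is an infimum. The sharp one-dimensional inequality is a by-product: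
  the distance is nonnegative, hence so is the deficit. \<open>S_rad\<close> enters through an upper
  bound by the quotient of \<open>U\<close>, obtained from smooth truncations. An element of the
  completion is a pair of \<open>u\<close> and \<open>G\<close>, and \<open>in_D\<close> does not
  state how they are related pointwise: integration along almost every ray recovers \<open>u\<close>
  from the component of \<open>G\<close> along \<open>x\<close>, and the component orthogonal to
  \<open>x\<close> only adds energy, which the deficit pays for.\<close>

lemma ge_value_at_one_if_deriv_sign:
  fixes h h' :: "real \<Rightarrow> real"
  assumes der: "\<And>x. 0 < x \<Longrightarrow> x \<le> K \<Longrightarrow> (h has_real_derivative h' x) (at x)"
    and sgn: "\<And>x. 0 < x \<Longrightarrow> x \<le> K \<Longrightarrow> 0 \<le> (x - 1) * h' x"
    and K: "1 \<le> K" and x: "0 < x" "x \<le> K"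
  shows "h 1 \<le> h x"
proof (cases "1 \<le> x")
  case True
  show ?thesis
  proof (rule DERIV_nonneg_imp_increasing_open[OF True])
    fix y assume y: "1 < y" "y < x"
    then show "\<exists>d. (h has_real_derivative d) (at y) \<and> 0 \<le> d"
      using der[of y] sgn[of y] x by (auto simp: zero_le_mult_iff intro!: exI[of _ "h' y"])
  next
    show "continuous_on {1..x} h"
      by (intro continuous_at_imp_continuous_on ballI DERIV_isCont[OF der]) (use x in auto)
  qed
next
  case False
  then have "x \<le> 1" by simp
  then show ?thesis
  proof (rule DERIV_nonpos_imp_decreasing_open)
    fix y assume y: "x < y" "y < 1"
    then show "\<exists>d. (h has_real_derivative d) (at y) \<and> d \<le> 0"
      using der[of y] sgn[of y] x K by (auto simp: zero_le_mult_iff intro!: exI[of _ "h' y"])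
  next
    show "continuous_on {x..1} h"
      by (intro continuous_at_imp_continuous_on ballI DERIV_isCont[OF der]) (use x K in auto)
  qed
qed

text \<open>Convexity of the power, reduced by homogeneity to Bernoulli's inequality for
  \<open>x = s / r\<close>. The cases \<open>r = 0\<close> and \<open>s = 0\<close>, out of reach of
  this quotient, are done directly.\<close>

lemma powr_ge_tangent:
  fixes r s p :: real
  assumes "1 \<le> p" "0 \<le> r" "0 \<le> s"
  shows "r powr p + p * r powr (p - 1) * (s - r) \<le> s powr p"
proof (cases "r = 0 \<or> s = 0")
  case True
  have "s = 0 \<Longrightarrow> 0 < r \<Longrightarrow> r powr p = r powr (p - 1) * r"
    using assms by (simp add: powr_diff)
  with True assms show ?thesis by (cases "r = 0") (auto simp: algebra_simps mult_right_mono)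
next
  case False
  then have rs: "0 < r" "0 < s" using assms by auto
  define x where "x = s / r"
  have x0: "0 < x" using rs by (simp add: x_def)
  have "(\<lambda>x. x powr p - p * x) 1 \<le> (\<lambda>x. x powr p - p * x) x"
  proof (rule ge_value_at_one_if_deriv_sign[where K = "max 1 x" and h' = "\<lambda>x. p * x powr (p - 1) - p"])
    fix y :: real assume y: "0 < y"
    show "((\<lambda>x. x powr p - p * x) has_real_derivative p * y powr (p - 1) - p) (at y)"
      using y by (auto intro!: derivative_eq_intros)
    have yp: "0 \<le> (y - 1) * (y powr (p - 1) - 1)"
      using assms y powr_mono2[of "p - 1" y 1] ge_one_powr_ge_zero[of y "p - 1"]
      by (cases "1 \<le> y") (auto simp: zero_le_mult_iff)
    have "0 \<le> p * ((y - 1) * (y powr (p - 1) - 1))"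
      by (rule mult_nonneg_nonneg[OF _ yp]) (use assms in auto)
    then show "0 \<le> (y - 1) * (p * y powr (p - 1) - p)"
      by (simp add: algebra_simps)
  qed (use x0 in auto)
  then have "1 + p * (x - 1) \<le> x powr p" by (simp add: algebra_simps)
  then have "r powr p * (1 + p * (x - 1)) \<le> r powr p * x powr p"
    by (intro mult_left_mono) auto
  also have "\<dots> = s powr p" using rs by (simp add: x_def powr_divide)
  also have "r powr p * (1 + p * (x - 1)) = r powr p + p * r powr (p - 1) * (s - r)"
    using rs by (simp add: x_def powr_diff field_simps)
  finally show ?thesis .
qed

text \<open>Each summand is \<open>Z * Z powr (r - 1)\<close>, and the second factor only grows when
  \<open>Z\<close> is replaced by the whole sum.\<close>

lemma powr_add_le_add_powr:
  fixes X Y r :: real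
  assumes "0 \<le> X" "0 \<le> Y" "1 \<le> r"
  shows "X powr r + Y powr r \<le> (X + Y) powr r"
proof -
  have *: "Z powr r \<le> Z * (X + Y) powr (r - 1)" if "0 \<le> Z" "Z \<le> X + Y" for Z
  proof (cases "Z = 0")
    case False
    then have "Z powr r = Z * Z powr (r - 1)" using that by (simp add: powr_diff)
    also have "\<dots> \<le> Z * (X + Y) powr (r - 1)"
      using that assms by (intro mult_left_mono powr_mono2) auto
    finally show ?thesis .
  qed auto
  have "X powr r + Y powr r \<le> (X + Y) * (X + Y) powr (r - 1)"
    using *[of X] *[of Y] assms by (simp add: algebra_simps)
  also have "\<dots> = (X + Y) powr r"
    using assms by (cases "X + Y = 0") (auto simp: powr_diff)
  finally show ?thesis .
qed

text \<open>The tangent at the mean is applied to both points; the linear terms cancel.\<close>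

lemma powr_mean_le:
  fixes X Y r :: real
  assumes "0 \<le> X" "0 \<le> Y" "1 \<le> r"
  shows "((X + Y) / 2) powr r \<le> (X powr r + Y powr r) / 2"
proof -
  define M where "M = (X + Y) / 2"
  have M: "M powr r + r * M powr (r - 1) * (X - M) \<le> X powr r"
       "M powr r + r * M powr (r - 1) * (Y - M) \<le> Y powr r"
    using assms by (auto intro!: powr_ge_tangent simp: M_def)
  have "Y - M = - (X - M)" by (simp add: M_def field_simps)
  then have "r * M powr (r - 1) * (Y - M) = - (r * M powr (r - 1) * (X - M))"
    by (metis mult_minus_right)
  with M have "M powr r \<le> (X powr r + Y powr r) / 2" by argo
  then show ?thesis by (simp add: M_def)
qed

lemma add_powr_le:
  fixes X Y r :: real
  assumes "0 \<le> X" "0 \<le> Y" "1 \<le> r"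
  shows "(X + Y) powr r \<le> 2 powr (r - 1) * (X powr r + Y powr r)"
proof -
  have "2 * ((X + Y) / 2) = X + Y" by (simp add: field_simps)
  then have "(X + Y) powr r = (2 * ((X + Y) / 2)) powr r" by (simp only:)
  also have "\<dots> = 2 powr r * ((X + Y) / 2) powr r"
    by (rule powr_mult)
  also have "\<dots> \<le> 2 powr r * ((X powr r + Y powr r) / 2)"
    using powr_mean_le[OF assms] by (intro mult_left_mono) auto
  also have "\<dots> = 2 powr (r - 1) * (X powr r + Y powr r)"
    by (simp add: powr_diff)
  finally show ?thesis .
qed

lemma norm_diff_powr_le:
  fixes x y z :: "'b::real_normed_vector"
  assumes "1 \<le> p"
  shows "norm (x - z) powr p \<le> 2 powr (p - 1) * (norm (x - y) powr p + norm (y - z) powr p)"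
proof -
  have "norm (x - z) \<le> norm (x - y) + norm (y - z)"
    by (metis diff_add_cancel add_diff_eq norm_triangle_ineq)
  then have "norm (x - z) powr p \<le> (norm (x - y) + norm (y - z)) powr p"
    using assms by (intro powr_mono2) auto
  also have "\<dots> \<le> 2 powr (p - 1) * (norm (x - y) powr p + norm (y - z) powr p)"
    using assms by (intro add_powr_le) auto
  finally show ?thesis .
qed

text \<open>Pythagoras, then superadditivity of the power \<open>p / 2 \<ge> 1\<close>. It separates
  the part of \<open>G\<close> along \<open>x\<close> from the part orthogonal to it.\<close>

lemma norm_powr_orthogonal:
  fixes x y :: "'b::real_inner"
  assumes "x \<bullet> y = 0" "2 \<le> p"
  shows "norm x powr p + norm y powr p \<le> norm (x + y) powr p"
proof -
  have *: "norm z powr p = (norm z ^ 2) powr (p / 2)" for z :: 'b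
    by (cases "z = 0") (simp_all add: powr_powr flip: powr_numeral)
  have "norm (x + y) ^ 2 = norm x ^ 2 + norm y ^ 2"
    using assms(1) by (simp add: power2_norm_eq_inner inner_add inner_commute)
  then show ?thesis
    unfolding * using powr_add_le_add_powr[of "norm x ^ 2" "norm y ^ 2" "p / 2"] assms by simp
qed

text \<open>Clarkson's inequality for the midpoint of \<open>R\<close> and \<open>P\<close>, combined with the tangent
  inequality at that midpoint.\<close>
lemma powr_uniformly_convex:
  fixes P R p :: real
  assumes "2 \<le> p" "0 \<le> R" "0 \<le> P"
  shows "R powr p + p * R powr (p - 1) * (P - R) + 2 powr (1 - p) * \<bar>P - R\<bar> powr p \<le> P powr p"
proof -
  have sq: "z powr p = (z ^ 2) powr (p / 2)" if "0 \<le> z" for z :: real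
    using that by (cases "z = 0") (simp_all add: powr_powr flip: powr_numeral)
  let ?M = "(R + P) / 2" and ?d = "\<bar>P - R\<bar> / 2"
  have "?M powr p + ?d powr p \<le> (?M ^ 2 + ?d ^ 2) powr (p / 2)"
    using powr_add_le_add_powr[of "?M ^ 2" "?d ^ 2" "p / 2"] assms by (simp add: sq)
  also have "?M ^ 2 + ?d ^ 2 = (R ^ 2 + P ^ 2) / 2"
    by (simp add: power_divide power2_eq_square field_simps)
  also have "((R ^ 2 + P ^ 2) / 2) powr (p / 2) \<le> ((R ^ 2) powr (p / 2) + (P ^ 2) powr (p / 2)) / 2"
    using assms by (intro powr_mean_le) auto
  also have "\<dots> = (R powr p + P powr p) / 2"
    using assms by (simp add: sq)
  finally have 1: "?M powr p + ?d powr p \<le> (R powr p + P powr p) / 2" .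
  have 2: "R powr p + p * R powr (p - 1) * (?M - R) \<le> ?M powr p"
    using assms by (intro powr_ge_tangent) auto
  have "?M - R = (P - R) / 2" by (simp add: field_simps)
  then have 3: "p * R powr (p - 1) * (?M - R) = p * R powr (p - 1) * (P - R) / 2"
    by simp
  have 4: "2 powr (1 - p) * \<bar>P - R\<bar> powr p = 2 * ?d powr p"
    by (simp add: powr_divide powr_diff)
  show ?thesis using 1 2 unfolding 3 4 by argo
qed

text \<open>For \<open>Y \<le> X\<close>, superadditivity of the power \<open>p / 2\<close> applied
  to \<open>X powr (1/p) = D + Y powr (1/p)\<close> gives
  \<open>D powr (p/2) \<le> sqrt X - sqrt Y\<close>; squaring finishes. This is how an entropy
  estimate comes to control an \<open>L^p\<close> distance.\<close>

lemma root_diff_powr_le_Hellinger: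
  fixes X Y p :: real
  assumes "2 \<le> p" "0 \<le> X" "0 \<le> Y"
  shows "\<bar>X powr (1/p) - Y powr (1/p)\<bar> powr p \<le> (sqrt X - sqrt Y)\<^sup>2"
proof -
  have *: "(X powr (1/p) - Y powr (1/p)) powr p \<le> (sqrt X - sqrt Y)\<^sup>2"
    if XY: "0 \<le> Y" "Y \<le> X" for X Y
  proof -
    define D where "D = X powr (1/p) - Y powr (1/p)"
    have D0: "0 \<le> D" using XY assms by (simp add: D_def powr_mono2)
    have sqr: "(Z powr (1/p)) powr (p/2) = sqrt Z" if "0 \<le> Z" for Z
      using that assms by (simp add: powr_powr powr_half_sqrt)
    have "D powr (p/2) + (Y powr (1/p)) powr (p/2) \<le> (D + Y powr (1/p)) powr (p/2)"
      using D0 assms by (intro powr_add_le_add_powr) auto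
    also have "D + Y powr (1/p) = X powr (1/p)" by (simp add: D_def)
    finally have "D powr (p/2) \<le> sqrt X - sqrt Y" using XY by (simp add: sqr)
    then have "(D powr (p/2))\<^sup>2 \<le> (sqrt X - sqrt Y)\<^sup>2" by (intro power_mono) auto
    also have "(D powr (p/2))\<^sup>2 = D powr p"
      by (simp add: power2_eq_square flip: powr_add)
    finally show ?thesis by (simp add: D_def)
  qed
  show ?thesis
  proof (cases "Y \<le> X")
    case True
    then have "Y powr (1/p) \<le> X powr (1/p)" using assms by (simp add: powr_mono2)
    then show ?thesis using *[of Y X] True assms by simp
  next
    case False
    then have "X powr (1/p) \<le> Y powr (1/p)" using assms by (simp add: powr_mono2)
    then show ?thesis using *[of X Y] False assms by (simp add: power2_commute)
  qed
qed

text \<open>Tangent at \<open>X\<close>, then \<open>X powr (e - 1) \<le> Y powr (e - 1)\<close>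
  because \<open>Y \<le> X\<close>. What matters is the factor \<open>e < 1\<close> in place of the
  1 of plain subadditivity: in \<open>stability\<close> it leaves the share \<open>1 - p / q\<close>
  of the energy of the smaller part.\<close>

lemma powr_add_concave_le:
  fixes X Y e :: real
  assumes "0 \<le> Y" "Y \<le> X" "0 < e" "e < 1"
  shows "(X + Y) powr e \<le> X powr e + e * Y powr e"
proof (cases "Y = 0")
  case False
  then have pos: "0 < Y" "0 < X" using assms by auto
  show ?thesis
  proof -
    have "X powr e + e * X powr (e - 1) * Y \<ge> (X + Y) powr e"
    proof -
      define z where "z = (X + Y) / X"
      have z: "1 \<le> z" using pos by (simp add: z_def)
      have "z powr e \<le> 1 + e * (z - 1)"
      proof -
        have "(\<lambda>x. e * x - x powr e) 1 \<le> (\<lambda>x. e * x - x powr e) z"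
        proof (rule ge_value_at_one_if_deriv_sign[where K = z and h' = "\<lambda>x. e - e * x powr (e - 1)"])
          fix y :: real assume y: "0 < y"
          show "((\<lambda>x. e * x - x powr e) has_real_derivative e - e * y powr (e - 1)) (at y)"
            using y by (auto intro!: derivative_eq_intros)
          have "0 \<le> (y - 1) * (1 - y powr (e - 1))"
          proof (cases "1 \<le> y")
            case True
            then have "y powr (e - 1) \<le> 1" using assms powr_mono2'[of "e - 1" 1 y] by simp
            then show ?thesis using True by simp
          next
            case False
            then have "1 \<le> y powr (e - 1)" using assms y powr_mono2'[of "e - 1" y 1] by simp
            then show ?thesis using False by (simp add: mult_nonpos_nonpos)
          qed
          from mult_nonneg_nonneg[OF less_imp_le[OF assms(3)] this]
          show "0 \<le> (y - 1) * (e - e * y powr (e - 1))"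
            by (simp add: algebra_simps)
        qed (use z in auto)
        then show ?thesis by (simp add: algebra_simps)
      qed
      then have "X powr e * z powr e \<le> X powr e * (1 + e * (z - 1))"
        by (intro mult_left_mono) auto
      also have "X powr e * z powr e = (X + Y) powr e"
        using pos by (simp add: z_def powr_divide)
      also have "X powr e * (1 + e * (z - 1)) = X powr e + e * X powr (e - 1) * Y"
        using pos by (simp add: z_def powr_diff field_simps)
      finally show ?thesis .
    qed
    moreover have "X powr (e - 1) * Y \<le> Y powr (e - 1) * Y"
      using assms pos by (intro mult_right_mono powr_mono2') auto
    moreover have "Y powr (e - 1) * Y = Y powr e" using pos by (simp add: powr_diff)
    ultimately show ?thesis
      using assms by (smt (verit, ccfv_threshold) mult.assoc mult_left_mono)
  qed
qed auto

text \<open>For \<open>x > 0\<close> this is \<open>(e + (1 - e) * x) / x powr (1 - e) - 1\<close>,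
  the relative gap between the weighted arithmetic and geometric means of 1 and \<open>x\<close>. It
  vanishes to second order at 1 and grows only like \<open>x powr e\<close> at infinity.\<close>

definition amgm_gap :: "real \<Rightarrow> real \<Rightarrow> real" where
  "amgm_gap e x = (1 - e) * x powr e + e * x powr (e - 1) - 1"

lemma DERIV_amgm_gap:
  "0 < x \<Longrightarrow> (amgm_gap e has_real_derivative e * (1 - e) * x powr (e - 2) * (x - 1)) (at x)"
proof -
  assume x: "0 < x"
  have "((\<lambda>x. (1 - e) * x powr e + e * x powr (e - 1) - 1) has_real_derivative
      (1 - e) * (e * x powr (e - 1)) + e * ((e - 1) * x powr (e - 1 - 1))) (at x)"
    using x by (auto intro!: derivative_eq_intros has_real_derivative_powr)
  moreover have "x powr (e - 1) = x powr (e - 2) * x" "x powr (e - 1 - 1) = x powr (e - 2)"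
    using x powr_add[of x "e - 2" 1] by (auto simp: algebra_simps)
  then have "(1 - e) * (e * x powr (e - 1)) + e * ((e - 1) * x powr (e - 1 - 1))
      = e * (1 - e) * x powr (e - 2) * (x - 1)" by (simp add: algebra_simps)
  ultimately show ?thesis unfolding amgm_gap_def[abs_def] by simp
qed

text \<open>Both functions vanish at 1 and their derivatives share the factor \<open>x - 1\<close>,
  so comparing the remaining factors up to \<open>K\<close> is enough.\<close>

lemma amgm_gap_dominates:
  fixes h h' :: "real \<Rightarrow> real"
  assumes e: "0 < e" "e < 1" and K: "1 \<le> K" and x: "0 < x" "x \<le> K"
    and der: "\<And>x. 0 < x \<Longrightarrow> (h has_real_derivative h' x * (x - 1)) (at x)" and h1: "h 1 = 0"
    and le: "\<And>x. 0 < x \<Longrightarrow> x \<le> K \<Longrightarrow> h' x \<le> C * (e * (1 - e) * x powr (e - 2))"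
  shows "h x \<le> C * amgm_gap e x"
proof -
  have "(\<lambda>x. C * amgm_gap e x - h x) 1 \<le> (\<lambda>x. C * amgm_gap e x - h x) x"
  proof (rule ge_value_at_one_if_deriv_sign[where K = K and
      h' = "\<lambda>x. (C * (e * (1 - e) * x powr (e - 2)) - h' x) * (x - 1)"])
    fix y assume y: "0 < y" "y \<le> K"
    show "((\<lambda>x. C * amgm_gap e x - h x) has_real_derivative
        (C * (e * (1 - e) * y powr (e - 2)) - h' y) * (y - 1)) (at y)"
      using y by (auto intro!: derivative_eq_intros der DERIV_amgm_gap simp: algebra_simps)
    have "0 \<le> (C * (e * (1 - e) * y powr (e - 2)) - h' y) * (y - 1)\<^sup>2"
      using le[OF y] by (intro mult_nonneg_nonneg) auto
    then show "0 \<le> (y - 1) * ((C * (e * (1 - e) * y powr (e - 2)) - h' y) * (y - 1))"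
      by (simp add: power2_eq_square algebra_simps)
  qed (use K x in auto)
  then show ?thesis using h1 by (simp add: amgm_gap_def)
qed

text \<open>\<open>C\<close> has to depend on \<open>K\<close>: the left-hand sides grow at least
  linearly, the gap sublinearly.\<close>

lemma amgm_gap_bounds:
  assumes e: "0 < e" "e < 1" and K: "1 \<le> K"
  obtains C where "0 < C" "\<And>x. 0 < x \<Longrightarrow> x \<le> K \<Longrightarrow> x - 1 - ln x \<le> C * amgm_gap e x"
    "\<And>x. 0 < x \<Longrightarrow> x \<le> K \<Longrightarrow> (x - 1)\<^sup>2 \<le> C * amgm_gap e x"
proof -
  define C where "C = 2 * K\<^sup>2 / (e * (1 - e))"
  have C0: "0 < C" using e K by (simp add: C_def)
  \<comment> \<open>The power \<open>e - 2\<close> is compared with what is left of the derivatives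
    after removing \<open>x - 1\<close>: \<open>j = -1\<close> for \<open>1 / x\<close> in the
    logarithmic bound, \<open>j = 0\<close> for the constant 2 in the quadratic one.\<close>
  have pw: "K\<^sup>2 * y powr (e - 2) \<ge> y powr j" if y: "0 < y" "y \<le> K" and j: "j \<in> {-1, 0}" for y j :: real
  proof -
    have "y powr (j + 2 - e) \<le> K powr (j + 2 - e)" using y j e by (intro powr_mono2) auto
    also have "\<dots> \<le> K powr 2" using K j e by (intro powr_mono) auto
    finally have "y powr (j + 2 - e) \<le> K\<^sup>2" using K by (simp add: powr_numeral)
    then have "y powr (j + 2 - e) * y powr (e - 2) \<le> K\<^sup>2 * y powr (e - 2)"
      by (intro mult_right_mono) auto
    then show ?thesis using y by (simp flip: powr_add)
  qed
  have cc: "C * (e * (1 - e) * z) = 2 * K\<^sup>2 * z" for z using e by (simp add: C_def)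
  show thesis
  proof
    show "0 < C" by fact
    fix x assume x: "0 < x" "x \<le> K"
    show "x - 1 - ln x \<le> C * amgm_gap e x"
    proof (rule amgm_gap_dominates[OF e K x, where h' = "\<lambda>x. 1/x"])
      fix y :: real assume y: "0 < y"
      show "((\<lambda>x. x - 1 - ln x) has_real_derivative 1 / y * (y - 1)) (at y)"
        using y by (auto intro!: derivative_eq_intros simp: field_simps)
      assume "y \<le> K"
      then show "1 / y \<le> C * (e * (1 - e) * y powr (e - 2))"
        using pw[of y "-1"] y unfolding cc by (simp add: powr_minus field_simps)
    qed simp
    show "(x - 1)\<^sup>2 \<le> C * amgm_gap e x"
    proof (rule amgm_gap_dominates[OF e K x, where h' = "\<lambda>x. 2"])
      fix y :: real assume y: "0 < y"
      show "((\<lambda>x. (x - 1)\<^sup>2) has_real_derivative 2 * (y - 1)) (at y)"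
        by (auto intro!: derivative_eq_intros)
      assume "y \<le> K"
      then show "2 \<le> C * (e * (1 - e) * y powr (e - 2))"
        using pw[of y 0] y unfolding cc by simp
    qed simp
  qed
qed

lemma amgm_gap_nonneg:
  assumes "0 < e" "e < 1" "0 < x"
  shows "0 \<le> amgm_gap e x"
proof -
  obtain C where "0 < C" "(x - 1)\<^sup>2 \<le> C * amgm_gap e x"
    using amgm_gap_bounds[OF assms(1,2), of "max 1 x"] assms(3)
    by (metis max.cobounded1 max.cobounded2)
  then show ?thesis by (smt (verit) mult_pos_neg zero_le_power2)
qed

text \<open>Beyond 1 the gap increases, and at 2 it is positive by the quadratic bound. This floor
  takes over where \<open>m'\<close> is too large for \<open>amgm_gap_bounds\<close>.\<close>

lemma amgm_gap_ge_at_two: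
  assumes "0 < e" "e < 1"
  obtains c where "0 < c" "\<And>x. 2 \<le> x \<Longrightarrow> c \<le> amgm_gap e x"
proof
  obtain C where C: "0 < C" "(2 - 1)\<^sup>2 \<le> C * amgm_gap e 2"
    using amgm_gap_bounds[OF assms, of 2] by (metis one_le_numeral order_refl zero_less_numeral)
  then have "0 < C * amgm_gap e 2" by simp
  then show "0 < amgm_gap e 2" using C(1) by (rule zero_less_mult_pos)
  fix x :: real assume x: "2 \<le> x"
  show "amgm_gap e 2 \<le> amgm_gap e x"
  proof (rule DERIV_nonneg_imp_nondecreasing[OF x])
    fix y :: real assume "2 \<le> y"
    then show "\<exists>d. (amgm_gap e has_real_derivative d) (at y) \<and> 0 \<le> d"
      using DERIV_amgm_gap[of y e] assms by (intro exI conjI) auto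
  qed
qed

section \<open>Relative entropy on a half line\<close>

text \<open>Reduces an estimate on a compact interval to exhibiting a function whose derivative
  dominates the integrand; its boundary values then have to be controlled.\<close>

lemma integral_le_by_antiderivative:
  fixes f H H' :: "real \<Rightarrow> real"
  assumes "a \<le> b" "continuous_on {a..b} f"
    and der: "\<And>x. a \<le> x \<Longrightarrow> x \<le> b \<Longrightarrow> (H has_real_derivative H' x) (at x)"
    and le: "\<And>x. a \<le> x \<Longrightarrow> x \<le> b \<Longrightarrow> f x \<le> H' x"
  shows "integral {a..b} f \<le> H b - H a"
proof -
  have "(H' has_integral H b - H a) {a..b}"
    using assms(1) der by (intro fundamental_theorem_of_calculus)
      (auto simp: has_real_derivative_iff_has_vector_derivative[symmetric] intro: DERIV_subset)
  moreover have "(f has_integral integral {a..b} f) {a..b}"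
    using assms(2) by (intro integrable_integral integrable_continuous_interval)
  ultimately show ?thesis
    using le by (meson has_integral_le atLeastAtMost_iff)
qed

lemma amgm_gap_continuous_on:
  "continuous_on S f \<Longrightarrow> (\<And>x. x \<in> S \<Longrightarrow> 0 < f x) \<Longrightarrow> continuous_on S (\<lambda>x. amgm_gap e (f x))"
  unfolding amgm_gap_def by (intro continuous_intros) force+

text \<open>Here \<open>exp \<beta>\<close> is a density on the half line and \<open>m\<close> a change of variables fixing 0.  The
  defect bounds the squared Hellinger distance between the density and its pullback under \<open>m\<close>.\<close>
locale half_line =
  fixes a b \<beta> \<beta>' m m' :: "real \<Rightarrow> real" and kap c1 c2 C2 Cg K e :: real
  assumes kap: "0 < kap" and c: "0 < c1" "0 < c2" "0 \<le> C2" "0 < Cg"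
    and a_cont: "continuous_on UNIV a"
    and a_ge: "\<And>t. 0 \<le> t \<Longrightarrow> c1 * exp (- (kap * t)) \<le> a t"
    and b_eq: "\<And>t. b t = exp (\<beta> t)"
    and b_le: "\<And>t. 0 \<le> t \<Longrightarrow> b t \<le> c2 * exp (- (kap * t))"
    and \<beta>_der: "\<And>t. (\<beta> has_real_derivative \<beta>' t) (at t)"
    and \<beta>_taylor: "\<And>s t. \<beta> t + \<beta>' t * (s - t) - C2 * (s - t)\<^sup>2 \<le> \<beta> s"
    and m0: "m 0 = 0" and m_der: "\<And>t. (m has_real_derivative m' t) (at t)"
    and m'_cont: "continuous_on UNIV m'" and m'_pos: "\<And>t. 0 < m' t"
    and e: "0 < e" "e < 1"
    and g1: "\<And>x. 0 < x \<Longrightarrow> x \<le> K \<Longrightarrow> x - 1 - ln x \<le> Cg * amgm_gap e x"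
    and g2: "\<And>x. 0 < x \<Longrightarrow> x \<le> K \<Longrightarrow> (x - 1)\<^sup>2 \<le> Cg * amgm_gap e x"
begin

abbreviation defect :: "real \<Rightarrow> real" where
  "defect t \<equiv> b t - sqrt (b t * b (m t) * m' t)"

abbreviation gap :: "real \<Rightarrow> real" where
  "gap t \<equiv> a t * amgm_gap e (m' t)"

text \<open>Weight of the Hardy term in the function \<open>W\<close> below. The summand
  \<open>C2 * c2 / kap\<close> absorbs the Taylor remainder of \<open>\<beta>\<close>; the summand
  \<open>c2\<close> keeps the boundary term at \<open>T\<close> bounded whatever \<open>m T\<close>
  is.\<close>

definition lam :: real where "lam = C2 * c2 / kap + c2"

text \<open>The first summand is the price of the entropy \<open>m' - 1 - ln m'\<close>, the second
  that of the cross term in Hardy's inequality; \<open>c1\<close> enters when exponentials are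
  replaced by \<open>a\<close>.\<close>

definition C3 :: real where "C3 = (c2 / c1) * Cg / 2 + (2 * lam / kap) * Cg / c1"

lemma m_cont: "continuous_on S m"
  by (meson m_der DERIV_isCont continuous_at_imp_continuous_on)

lemma \<beta>_cont: "continuous_on S \<beta>"
  by (meson \<beta>_der DERIV_isCont continuous_at_imp_continuous_on)

lemma defect_cont: "continuous_on S defect"
proof -
  have "continuous_on S (\<lambda>t. \<beta> (m t))"
    using continuous_on_compose2[OF \<beta>_cont[of UNIV] m_cont] by auto
  then show ?thesis unfolding b_eq
    by (intro continuous_intros \<beta>_cont continuous_on_subset[OF m'_cont]) auto
qed

lemma gap_cont: "continuous_on S gap"
  by (intro continuous_intros amgm_gap_continuous_on continuous_on_subset[OF m'_cont]
      continuous_on_subset[OF a_cont] m'_pos) auto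

lemma lam_pos: "c2 \<le> lam" "0 < lam"
  using kap c by (auto simp: lam_def add_nonneg_pos)

lemma C3_nonneg: "0 \<le> C3"
  using kap c lam_pos by (auto simp: C3_def)

lemma a_pos: "0 \<le> t \<Longrightarrow> 0 < a t"
  using a_ge[of t] c by (smt (verit) exp_gt_zero mult_pos_pos)

lemma gap_nonneg: "0 \<le> t \<Longrightarrow> 0 \<le> gap t"
  using a_pos[of t] amgm_gap_nonneg[OF e m'_pos[of t]] by simp

text \<open>The defect is \<open>b t * (1 - exp y)\<close>, where \<open>y\<close> is half the
  logarithm of the ratio of the two densities, and \<open>exp y \<ge> 1 + y\<close>.\<close>

lemma defect_le_entropy: "defect t \<le> b t / 2 * (\<beta> t - \<beta> (m t) - ln (m' t))"
proof -
  have "b t * b (m t) * m' t = exp (2 * \<beta> t + (\<beta> (m t) - \<beta> t + ln (m' t)))"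
    using m'_pos[of t] by (simp add: b_eq exp_add exp_diff flip: exp_double)
  also have "\<dots> = (exp (\<beta> t + (\<beta> (m t) - \<beta> t + ln (m' t)) / 2))\<^sup>2"
    by (simp add: exp_double[symmetric] field_simps)
  finally have "sqrt (b t * b (m t) * m' t) = exp (\<beta> t + (\<beta> (m t) - \<beta> t + ln (m' t)) / 2)"
    by simp
  also have "\<dots> = b t * exp ((\<beta> (m t) - \<beta> t + ln (m' t)) / 2)"
    by (simp add: b_eq exp_add)
  also have "\<dots> \<ge> b t * (1 + (\<beta> (m t) - \<beta> t + ln (m' t)) / 2)"
    by (intro mult_left_mono exp_ge_add_one_self) (simp add: b_eq)
  finally show ?thesis by (simp add: field_simps)
qed

text \<open>The entropy integrand is an exact derivative up to \<open>gap\<close> and a term \<open>(m t - t)\<^sup>2\<close>; the latter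
  is absorbed by the exact derivative coming from Hardy's inequality.\<close>
lemma defect_integral_le:
  assumes T: "0 \<le> T" and mK: "\<And>t. 0 \<le> t \<Longrightarrow> t \<le> T \<Longrightarrow> m' t \<le> K"
  shows "integral {0..T} defect \<le> C3 * integral {0..T} gap + c2 * exp (- (kap * T))"
proof -
  define F where "F t = m t - t" for t
  define E where "E t = exp (- (kap * t))" for t
  \<comment> \<open>The first term is a primitive of the first-order part of the entropy integrand,
    because \<open>b\<close> has derivative \<open>b * \<beta>'\<close>. The second differentiates
    to a positive multiple of \<open>E * F^2\<close> and a cross term: Hardy's inequality in
    differential form.\<close>
  define W where "W t = - (b t * F t) / 2 - lam * (E t * (F t)\<^sup>2)" for t
  define W' where "W' t = - (b t * \<beta>' t * F t + b t * (m' t - 1)) / 2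
      - lam * (- kap * E t * (F t)\<^sup>2 + E t * (2 * F t * (m' t - 1)))" for t
  have F_der: "(F has_real_derivative m' t - 1) (at t)" for t
    unfolding F_def[abs_def] by (auto intro!: derivative_eq_intros m_der)
  have E_der: "(E has_real_derivative - kap * E t) (at t)" for t
    unfolding E_def[abs_def] by (auto intro!: derivative_eq_intros)
  have b_der: "(b has_real_derivative b t * \<beta>' t) (at t)" for t
    unfolding b_eq[abs_def] by (auto intro!: derivative_eq_intros \<beta>_der)
  have W_der: "(W has_real_derivative W' t) (at t)" for t
    unfolding W_def[abs_def] W'_def
    by (rule derivative_eq_intros F_der E_der b_der refl | simp)+ (simp add: field_simps)
  have "integral {0..T} (\<lambda>t. defect t - C3 * gap t) \<le> W T - W 0"
  proof (rule integral_le_by_antiderivative[OF T _ W_der])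
    show "continuous_on {0..T} (\<lambda>t. defect t - C3 * gap t)"
      by (intro continuous_on_diff continuous_on_mult_left defect_cont gap_cont)
    fix t assume t: "0 \<le> t" "t \<le> T"
    define G where "G = amgm_gap e (m' t)"
    have mt: "0 < m' t" "m' t \<le> K" using m'_pos mK t by auto
    have E0: "0 < E t" by (simp add: E_def)
    have b0: "0 < b t" by (simp add: b_eq)
    have bE: "b t \<le> c2 * E t" using b_le[OF t(1)] by (simp add: E_def)
    have aE: "c1 * E t \<le> a t" using a_ge[OF t(1)] by (simp add: E_def)
    have G0: "0 \<le> G" unfolding G_def using amgm_gap_nonneg[OF e mt(1)] .
    have G1: "m' t - 1 - ln (m' t) \<le> Cg * G" and G2: "(m' t - 1)\<^sup>2 \<le> Cg * G"
      using g1[OF mt] g2[OF mt] by (auto simp: G_def)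
    have "defect t \<le> b t / 2 * (\<beta> t - \<beta> (m t) - ln (m' t))" by (rule defect_le_entropy)
    also have "\<dots> \<le> b t / 2 * (- \<beta>' t * F t + C2 * (F t)\<^sup>2 - ln (m' t))"
      using \<beta>_taylor[of t "m t"] b0 by (intro mult_left_mono) (auto simp: F_def)
    also have "\<dots> = - (b t * \<beta>' t * F t + b t * (m' t - 1)) / 2 + b t / 2 * (m' t - 1 - ln (m' t))
        + C2 / 2 * (b t * (F t)\<^sup>2)" by (simp add: field_simps)
    finally have 1: "defect t \<le> \<dots>" .
    have EG: "E t * G \<le> a t * G / c1"
      using mult_right_mono[OF aE G0] c by (simp add: field_simps)
    have "b t / 2 * (m' t - 1 - ln (m' t)) \<le> b t / 2 * (Cg * G)"
      using b0 G1 by (intro mult_left_mono) auto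
    also have "\<dots> \<le> c2 * E t / 2 * (Cg * G)"
      using bE G0 c by (intro mult_right_mono) auto
    also have "\<dots> = c2 * Cg / 2 * (E t * G)" by simp
    also have "\<dots> \<le> c2 * Cg / 2 * (a t * G / c1)" using EG c by (intro mult_left_mono) auto
    finally have 2: "b t / 2 * (m' t - 1 - ln (m' t)) \<le> (c2 / c1) * Cg / 2 * (a t * G)"
      by (simp add: mult_ac)
    have "C2 / 2 * (b t * (F t)\<^sup>2) \<le> C2 / 2 * (c2 * E t * (F t)\<^sup>2)"
      using bE c by (intro mult_left_mono mult_right_mono) auto
    also have "\<dots> = (C2 * c2 / kap) * kap / 2 * (E t * (F t)\<^sup>2)" using kap by simp
    also have "\<dots> \<le> lam * kap / 2 * (E t * (F t)\<^sup>2)"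
      using kap c E0 by (intro mult_right_mono divide_right_mono) (auto simp: lam_def)
    finally have 3: "C2 / 2 * (b t * (F t)\<^sup>2) \<le> lam * kap / 2 * (E t * (F t)\<^sup>2)" .
    \<comment> \<open>The weights \<open>kap / 2\<close> and \<open>2 / kap\<close> spend half of
      the available \<open>lam * kap * E * F^2\<close>; the other half pays for the Taylor
      remainder.\<close>
    have "0 \<le> (kap * F t - 2 * (m' t - 1))\<^sup>2" by simp
    then have "2 * F t * (m' t - 1) * (2 * kap) \<le> kap * kap * (F t)\<^sup>2 + 4 * (m' t - 1)\<^sup>2"
      by (simp add: power2_eq_square algebra_simps)
    then have "2 * F t * (m' t - 1) \<le> kap / 2 * (F t)\<^sup>2 + 2 / kap * (m' t - 1)\<^sup>2"
      using kap by (simp add: field_simps)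
    also have "\<dots> \<le> kap / 2 * (F t)\<^sup>2 + 2 / kap * (Cg * G)"
      using kap G2 by (intro add_left_mono mult_left_mono) auto
    finally have "E t * (2 * F t * (m' t - 1)) \<le> E t * (kap / 2 * (F t)\<^sup>2 + 2 / kap * (Cg * G))"
      using E0 by (intro mult_left_mono) auto
    also have "\<dots> = kap / 2 * (E t * (F t)\<^sup>2) + 2 / kap * Cg * (E t * G)" by (simp add: algebra_simps)
    also have "\<dots> \<le> kap / 2 * (E t * (F t)\<^sup>2) + 2 / kap * Cg * (a t * G / c1)"
      using EG kap c by (intro add_left_mono mult_left_mono) auto
    finally have "lam * (E t * (2 * F t * (m' t - 1)))
        \<le> lam * (kap / 2 * (E t * (F t)\<^sup>2) + 2 / kap * Cg * (a t * G / c1))"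
      using lam_pos by (intro mult_left_mono) auto
    also have "\<dots> = lam * kap / 2 * (E t * (F t)\<^sup>2) + (2 * lam / kap) * Cg / c1 * (a t * G)"
      by (simp add: algebra_simps)
    finally have 4: "lam * (E t * (2 * F t * (m' t - 1))) \<le> \<dots>" .
    have "C3 * (a t * G) = (c2 / c1) * Cg / 2 * (a t * G) + (2 * lam / kap) * Cg / c1 * (a t * G)"
      by (simp add: C3_def algebra_simps)
    moreover have "W' t = - (b t * \<beta>' t * F t + b t * (m' t - 1)) / 2
      + lam * kap * (E t * (F t)\<^sup>2) - lam * (E t * (2 * F t * (m' t - 1)))"
      by (simp add: W'_def algebra_simps)
    ultimately show "defect t - C3 * (a t * amgm_gap e (m' t)) \<le> W' t"
      using 1 2 3 4 unfolding G_def by argo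
  qed
  moreover have "integral {0..T} (\<lambda>t. defect t - C3 * gap t) = integral {0..T} defect - C3 * integral {0..T} gap"
    by (subst Henstock_Kurzweil_Integration.integral_diff)
      (auto intro!: integrable_continuous_interval continuous_on_mult_left defect_cont gap_cont)
  moreover have "W 0 = 0" by (simp add: W_def F_def m0)
  \<comment> \<open>\<open>F T\<close> is arbitrary here: its linear contribution is dominated by
    the negative quadratic term because \<open>c2 \<le> lam\<close>.\<close>
  moreover have "W T \<le> c2 * E T"
  proof -
    have "- (b T * F T) / 2 \<le> b T * \<bar>F T\<bar> / 2"
      using mult_left_mono[OF abs_ge_minus_self[of "F T"], of "b T"] by (simp add: b_eq)
    also have "\<dots> \<le> c2 * E T * \<bar>F T\<bar> / 2"
      using b_le[OF T] by (intro divide_right_mono mult_right_mono) (auto simp: E_def)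
    also have "\<dots> = c2 * E T * (\<bar>F T\<bar> / 2)" by simp
    also have "\<dots> \<le> c2 * E T * (1 + (F T)\<^sup>2)"
    proof (intro mult_left_mono)
      have "0 \<le> (\<bar>F T\<bar> - 1)\<^sup>2" by simp
      then have "2 * \<bar>F T\<bar> \<le> 1 + (F T)\<^sup>2" unfolding power2_diff by simp
      then show "\<bar>F T\<bar> / 2 \<le> 1 + (F T)\<^sup>2" by simp
    qed (use c in \<open>auto simp: E_def\<close>)
    also have "\<dots> \<le> c2 * E T + lam * (E T * (F T)\<^sup>2)"
      using mult_right_mono[OF lam_pos(1), of "E T * (F T)\<^sup>2"] by (simp add: E_def algebra_simps)
    finally show ?thesis by (simp add: W_def)
  qed
  ultimately show ?thesis by (simp add: E_def)
qed

text \<open>Let \<open>t1\<close> be the first time with \<open>K \<le> m'\<close>. Up to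
  \<open>t1\<close> the entropy estimate applies. After it the defect is bounded trivially by
  \<open>b\<close>, whose remaining integral is at most a multiple of
  \<open>exp (- (kap * t1))\<close>, and \<open>thr\<close> charges this to
  \<open>\<Gamma>\<close>.\<close>

lemma defect_integral_bound:
  assumes T: "0 \<le> T" and \<Gamma>: "\<And>T. 0 \<le> T \<Longrightarrow> integral {0..T} gap \<le> \<Gamma>"
    and c3: "0 < c3" and thr: "\<And>t. 0 \<le> t \<Longrightarrow> K \<le> m' t \<Longrightarrow> c3 * exp (- (kap * t)) \<le> \<Gamma>"
  shows "integral {0..T} defect \<le> (C3 + (c2 + c2 / kap) / c3) * \<Gamma> + c2 * exp (- (kap * T))"
proof -
  have \<Gamma>0: "0 \<le> \<Gamma>" using \<Gamma>[of 0] by simp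
  have C30: "0 \<le> (c2 + c2 / kap) / c3 * \<Gamma>" using c kap c3 \<Gamma>0 by auto
  have I: "C3 * integral {0..t} gap \<le> C3 * \<Gamma>" if "0 \<le> t" for t
    using \<Gamma>[OF that] C3_nonneg by (rule mult_left_mono)
  show ?thesis
  proof (cases "\<forall>t\<in>{0..T}. m' t \<le> K")
    case True
    then show ?thesis
      using defect_integral_le[OF T] I[OF T] C30 by (simp add: algebra_simps)
  next
    case False
    define S where "S = {0..T} \<inter> m' -` {K..}"
    have "closed S" unfolding S_def
      by (intro continuous_closed_preimage closed_atLeastAtMost continuous_on_subset[OF m'_cont]) auto
    moreover have "bounded S"
      by (rule bounded_subset[OF bounded_closed_interval[of 0 T]]) (simp add: S_def)
    ultimately have "compact S" by (simp add: compact_eq_bounded_closed)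
    moreover have "S \<noteq> {}"
    proof -
      obtain t where "t \<in> {0..T}" "\<not> m' t \<le> K" using False by blast
      then have "t \<in> S" by (simp add: S_def)
      then show ?thesis by blast
    qed
    ultimately have "\<exists>s\<in>S. \<forall>t\<in>S. s \<le> t" by (rule compact_attains_inf)
    then obtain t1 where t1: "t1 \<in> S" "\<forall>t\<in>S. t1 \<le> t" ..
    have t1T: "0 \<le> t1" "t1 \<le> T" "K \<le> m' t1" using t1(1) by (simp_all add: S_def)
    have below: "m' t < K" if "0 \<le> t" "t < t1" for t
    proof (rule ccontr)
      assume "\<not> m' t < K"
      then have "t \<in> S" using that t1T by (simp add: S_def)
      then show False using bspec[OF t1(2), of t] that by simp
    qed
    have first: "integral {0..t1} defect \<le> C3 * \<Gamma> + c2 * exp (- (kap * t1))"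
    proof (cases "t1 = 0")
      case True
      then show ?thesis using C3_nonneg \<Gamma>0 c by simp
    next
      case False
      then have "0 < t1" using t1T by simp
      \<comment> \<open>By the intermediate value theorem \<open>m'\<close> cannot jump over
        \<open>K\<close>, so the estimate for \<open>m' \<le> K\<close> is valid up to and including
        \<open>t1\<close>.\<close>
      have "m' t1 \<le> K"
      proof (rule ccontr)
        assume "\<not> m' t1 \<le> K"
        moreover have "m' 0 \<le> K" using below[of 0] \<open>0 < t1\<close> by simp
        ultimately obtain t where "0 \<le> t" "t \<le> t1" "m' t = K"
          using IVT'[of m' 0 K t1] t1T continuous_on_subset[OF m'_cont] by auto
        then show False using below[of t] \<open>\<not> m' t1 \<le> K\<close> by (cases "t = t1") auto
      qed
      then have "m' t \<le> K" if "0 \<le> t" "t \<le> t1" for t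
        using below[of t] that by (cases "t = t1") auto
      then have "integral {0..t1} defect \<le> C3 * integral {0..t1} gap + c2 * exp (- (kap * t1))"
        by (intro defect_integral_le t1T)
      then show ?thesis using I[OF t1T(1)] by simp
    qed
    have "integral {t1..T} defect \<le> - (c2 / kap) * exp (- (kap * T)) - (- (c2 / kap) * exp (- (kap * t1)))"
    proof (rule integral_le_by_antiderivative[OF t1T(2) defect_cont])
      fix t assume t: "t1 \<le> t" "t \<le> T"
      show "((\<lambda>t. - (c2 / kap) * exp (- (kap * t))) has_real_derivative c2 * exp (- (kap * t))) (at t)"
        using kap by (auto intro!: derivative_eq_intros)
      have "0 \<le> sqrt (b t * b (m t) * m' t)" using m'_pos[of t] by (simp add: b_eq less_imp_le)
      then show "defect t \<le> c2 * exp (- (kap * t))" using b_le[of t] t t1T by linarith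
    qed
    also have "\<dots> \<le> c2 / kap * exp (- (kap * t1))" using c kap by simp
    finally have second: "integral {t1..T} defect \<le> c2 / kap * exp (- (kap * t1))" .
    have split: "integral {0..T} defect = integral {0..t1} defect + integral {t1..T} defect"
      by (rule Henstock_Kurzweil_Integration.integral_combine[symmetric])
        (use t1T in \<open>auto intro!: integrable_continuous_interval defect_cont\<close>)
    have "(c2 + c2 / kap) * exp (- (kap * t1)) \<le> (c2 + c2 / kap) * (\<Gamma> / c3)"
      using thr[OF t1T(1,3)] c kap c3 by (intro mult_left_mono) (auto simp: field_simps)
    moreover have "0 \<le> c2 * exp (- (kap * T))" using c by simp
    moreover have "(c2 + c2 / kap) * exp (- (kap * t1)) = c2 * exp (- (kap * t1)) + c2 / kap * exp (- (kap * t1))"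
      by (rule distrib_right)
    moreover have "(C3 + (c2 + c2 / kap) / c3) * \<Gamma> = C3 * \<Gamma> + (c2 + c2 / kap) * (\<Gamma> / c3)"
      by (simp only: distrib_right times_divide_eq_left times_divide_eq_right)
    ultimately show ?thesis using split first second by linarith
  qed
qed

end

section \<open>The extremal profile\<close>

text \<open>In the variable \<open>t = ln (norm x)\<close> and up to the area of the sphere, the two functionals of
  \<open>u\<close> with \<open>F = - u'\<close> are the integrals of \<open>\<bar>F t\<bar> powr p * exp (\<gamma> * t)\<close> and
  \<open>\<bar>u t\<bar> powr q * exp (B * t)\<close>, where \<open>\<gamma> = N - p + \<alpha>\<close> and \<open>B = N + \<beta>\<close>.  The extremals are the
  multiples of the translates of \<open>U\<close>, and \<open>f = - U'\<close>.\<close>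
locale bliss =
  fixes p \<gamma> B :: real
  assumes p2: "2 \<le> p" and \<gamma>_pos: "0 < \<gamma>" and \<gamma>_less: "\<gamma> < B"
begin

text \<open>\<open>q\<close> is the critical exponent, \<open>\<sigma>\<close> and \<open>k\<close>
  are the inner and outer exponents of the extremal, \<open>\<kappa> = k * \<sigma>\<close> is its
  decay rate at infinity, and \<open>\<iota> = 1 / p - 1 / q\<close> will be the weight of 1 in the
  arithmetic-geometric mean inequality.\<close>

definition q :: real where "q = p * B / \<gamma>"
definition \<sigma> :: real where "\<sigma> = (B - \<gamma>) / (p - 1)"
definition k :: real where "k = \<gamma> / (B - \<gamma>)"
definition \<iota> :: real where "\<iota> = (B - \<gamma>) / (p * B)"
definition \<kappa> :: real where "\<kappa> = \<gamma> / (p - 1)"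

definition L :: "real \<Rightarrow> real" where "L t = 1 + exp (\<sigma> * t)"
definition U :: "real \<Rightarrow> real" where "U t = L t powr (- k)"
definition f :: "real \<Rightarrow> real" where "f t = \<kappa> * exp (\<sigma> * t) * L t powr (- k - 1)"
text \<open>Equal to \<open>U t powr (q * (1 - \<iota>)) * exp (B * t)\<close>, and the weight of
  the gap in the deficit. At both ends it is bounded below by the exponentials that bound the energy
  density \<open>wb\<close> from above, which is what \<open>half_line\<close> asks for.\<close>

definition wa :: "real \<Rightarrow> real" where "wa t = exp (B * t) * L t powr (1 - q * k)"
definition wb :: "real \<Rightarrow> real" where "wb t = f t powr p * exp (\<gamma> * t)"
definition wh :: "real \<Rightarrow> real" where "wh t = U t powr q * exp (B * t)"
text \<open>The logarithm of \<open>wb\<close>, in the form in which its second-order behaviour can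
  be read off.\<close>

definition \<beta> :: "real \<Rightarrow> real" where "\<beta> t = p * ln \<kappa> + (B + \<sigma>) * t - q * k * ln (L t)"
definition \<beta>' :: "real \<Rightarrow> real" where "\<beta>' t = (B + \<sigma>) - q * k * (\<sigma> * exp (\<sigma> * t) / L t)"

lemma B_pos: "0 < B" and p_pos: "0 < p" and p1_pos: "0 < p - 1"
  and q_pos: "0 < q" and \<sigma>_pos: "0 < \<sigma>" and k_pos: "0 < k" and \<kappa>_pos: "0 < \<kappa>"
  using p2 \<gamma>_pos \<gamma>_less by (auto simp: q_def \<sigma>_def k_def \<kappa>_def)

lemma \<iota>_pos: "0 < \<iota>" and \<iota>_less: "\<iota> < 1 / p" and \<iota>_less1: "\<iota> < 1"
proof -
  show "0 < \<iota>" using B_pos p_pos \<gamma>_less by (simp add: \<iota>_def)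
  have "\<iota> = (B - \<gamma>) / B / p" by (simp add: \<iota>_def)
  also have "\<dots> < 1 / p" using B_pos p_pos \<gamma>_pos by (intro divide_strict_right_mono) auto
  finally show "\<iota> < 1 / p" .
  also have "\<dots> \<le> 1" using p2 by simp
  finally show "\<iota> < 1" .
qed

lemma k\<sigma>: "k * \<sigma> = \<kappa>"
  using \<gamma>_less by (simp add: k_def \<sigma>_def \<kappa>_def)

lemma qk: "q * k = p * (k + 1)" "q * k = p * B / (B - \<gamma>)"
  using \<gamma>_pos \<gamma>_less by (simp_all add: q_def k_def field_simps)

lemma qk_gt: "p < q * k" "1 < q * k"
proof -
  show "p < q * k" using p2 k_pos by (simp add: qk(1))
  then show "1 < q * k" using p2 by linarith
qed

lemma p\<sigma>: "p * \<sigma> + \<gamma> = B + \<sigma>"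
  using p1_pos by (simp add: \<sigma>_def field_simps)

lemma qk\<sigma>: "q * k * \<sigma> = p * B / (p - 1)" "B + \<sigma> - q * k * \<sigma> = - \<kappa>"
proof -
  show 1: "q * k * \<sigma> = p * B / (p - 1)" using \<gamma>_less by (simp add: qk(2) \<sigma>_def)
  show "B + \<sigma> - q * k * \<sigma> = - \<kappa>"
    unfolding 1 unfolding \<sigma>_def \<kappa>_def using p1_pos by (simp add: divide_simps) (simp add: algebra_simps)
qed

lemma L_pos: "0 < L t" "1 < L t"
  by (simp_all add: L_def add_pos_pos)

lemma L_der: "(L has_real_derivative \<sigma> * exp (\<sigma> * t)) (at t)"
  unfolding L_def[abs_def] by (auto intro!: derivative_eq_intros)

lemma U_pos: "0 < U t" and f_pos: "0 < f t" and wa_pos: "0 < wa t" and wb_pos: "0 < wb t"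
  and wh_pos: "0 < wh t"
  using L_pos(1)[of t] \<kappa>_pos by (auto simp: U_def f_def wa_def wb_def wh_def)

lemma U_der: "(U has_real_derivative - f t) (at t)"
proof -
  have "((\<lambda>t. L t powr (- k)) has_real_derivative
     L t powr (- k) * ((\<sigma> * exp (\<sigma> * t)) * (- k) / L t)) (at t)"
    using L_pos[of t] by (auto intro!: derivative_eq_intros L_der simp: powr_diff)
  moreover have "L t powr (- k - 1) = L t powr (- k) / L t"
    using L_pos[of t] by (simp add: powr_diff)
  then have "L t powr (- k) * ((\<sigma> * exp (\<sigma> * t)) * (- k) / L t) = - f t"
    by (simp add: f_def k\<sigma>[symmetric])
  ultimately show ?thesis unfolding U_def[abs_def] by simp
qed

lemma L_cont [continuous_intros]: "continuous_on S L"
  unfolding L_def by (intro continuous_intros)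

lemma U_cont [continuous_intros]: "continuous_on S U"
  unfolding U_def using L_pos(1) by (intro continuous_intros) (auto simp: less_imp_neq[symmetric])

lemma f_cont [continuous_intros]: "continuous_on S f"
  unfolding f_def using L_pos(1) by (intro continuous_intros) (auto simp: less_imp_neq[symmetric])

lemma wa_cont [continuous_intros]: "continuous_on S wa"
  unfolding wa_def using L_pos(1) by (intro continuous_intros) (auto simp: less_imp_neq[symmetric])

lemma wb_cont [continuous_intros]: "continuous_on S wb"
  unfolding wb_def using f_pos by (intro continuous_intros) (auto simp: less_imp_neq[symmetric])

lemma wh_cont [continuous_intros]: "continuous_on S wh"
  unfolding wh_def using U_pos by (intro continuous_intros) (auto simp: less_imp_neq[symmetric])

lemma wb_eq_exp: "wb t = exp (\<beta> t)"
proof -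
  have "ln (f t) = ln \<kappa> + \<sigma> * t + (- k - 1) * ln (L t)"
    using \<kappa>_pos L_pos[of t] by (simp add: f_def ln_mult ln_powr)
  then have "wb t = exp (p * (ln \<kappa> + \<sigma> * t + (- k - 1) * ln (L t)) + \<gamma> * t)"
    using f_pos[of t] unfolding wb_def powr_def exp_add by simp
  also have "p * (ln \<kappa> + \<sigma> * t + (- k - 1) * ln (L t)) + \<gamma> * t
     = p * ln \<kappa> + (p * \<sigma> + \<gamma>) * t - p * (k + 1) * ln (L t)" by (simp add: algebra_simps)
  also have "\<dots> = \<beta> t" by (simp add: p\<sigma> qk(1) \<beta>_def)
  finally show ?thesis .
qed

lemma wb_eq: "wb t = \<kappa> powr p * exp ((B + \<sigma>) * t) * L t powr (- (q * k))"
  using \<kappa>_pos L_pos[of t] by (simp add: wb_eq_exp \<beta>_def powr_def exp_add exp_diff exp_minus field_simps)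

lemma wh_eq: "wh t = exp (B * t) * L t powr (- (q * k))"
  using L_pos[of t] by (simp add: wh_def U_def powr_powr mult.commute)

lemma \<beta>_deriv: "(\<beta> has_real_derivative \<beta>' t) (at t)"
  unfolding \<beta>_def[abs_def] \<beta>'_def using L_pos[of t] by (auto intro!: derivative_eq_intros L_der)

text \<open>The quotient is the logistic function of \<open>\<sigma> * t\<close>, whose derivative
  \<open>\<sigma> * exp (\<sigma> * x) / (L x)^2\<close> lies between 0 and
  \<open>\<sigma>\<close>.\<close>

lemma logistic_lipschitz:
  "\<bar>exp (\<sigma> * s) / L s - exp (\<sigma> * t) / L t\<bar> \<le> \<sigma> * \<bar>s - t\<bar>"
proof -
  have *: "\<bar>exp (\<sigma> * s) / L s - exp (\<sigma> * t) / L t\<bar> \<le> \<sigma> * \<bar>s - t\<bar>" if st: "s < t" for s t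
  proof -
    have D: "((\<lambda>t. exp (\<sigma> * t) / L t) has_real_derivative \<sigma> * exp (\<sigma> * x) / (L x)\<^sup>2) (at x)" for x
    proof -
      have "((\<lambda>t. exp (\<sigma> * t) / L t) has_real_derivative
          (exp (\<sigma> * x) * \<sigma> * L x - exp (\<sigma> * x) * (\<sigma> * exp (\<sigma> * x))) / (L x * L x)) (at x)"
        using L_pos[of x] by (auto intro!: derivative_eq_intros L_der)
      also have "exp (\<sigma> * x) * \<sigma> * L x - exp (\<sigma> * x) * (\<sigma> * exp (\<sigma> * x)) = \<sigma> * exp (\<sigma> * x)"
        by (simp add: L_def algebra_simps)
      finally show ?thesis by (simp add: power2_eq_square)
    qed
    obtain \<xi> where \<xi>: "s < \<xi>" "exp (\<sigma> * t) / L t - exp (\<sigma> * s) / L s = (t - s) * (\<sigma> * exp (\<sigma> * \<xi>) / (L \<xi>)\<^sup>2)"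
      using MVT2[OF st, of "\<lambda>t. exp (\<sigma> * t) / L t" "\<lambda>x. \<sigma> * exp (\<sigma> * x) / (L x)\<^sup>2"] D by blast
    have "exp (\<sigma> * \<xi>) \<le> L \<xi>" "L \<xi> \<le> (L \<xi>)\<^sup>2"
      using L_pos[of \<xi>] by (auto simp: L_def power2_eq_square)
    then have D1: "\<sigma> * exp (\<sigma> * \<xi>) / (L \<xi>)\<^sup>2 \<le> \<sigma>" and D0: "0 \<le> \<sigma> * exp (\<sigma> * \<xi>) / (L \<xi>)\<^sup>2"
      using \<sigma>_pos L_pos[of \<xi>] by (auto simp: field_simps)
    have "(t - s) * (\<sigma> * exp (\<sigma> * \<xi>) / (L \<xi>)\<^sup>2) \<le> (t - s) * \<sigma>"
      using D1 st by (intro mult_left_mono) linarith+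
    moreover have "0 \<le> (t - s) * (\<sigma> * exp (\<sigma> * \<xi>) / (L \<xi>)\<^sup>2)"
      using D0 st by (intro mult_nonneg_nonneg) linarith+
    ultimately have "\<bar>exp (\<sigma> * s) / L s - exp (\<sigma> * t) / L t\<bar> \<le> (t - s) * \<sigma>"
      unfolding \<xi>(2)[symmetric] by (simp add: abs_le_iff)
    then show ?thesis using st by (simp add: mult.commute)
  qed
  show ?thesis using *[of s t] *[of t s] by (cases s t rule: linorder_cases) auto
qed

text \<open>\<open>\<beta>'\<close> varies only through the logistic function. The mean value
  theorem for \<open>ln (L t)\<close> and the Lipschitz bound for the logistic function give the
  quadratic remainder.\<close>

lemma \<beta>_taylor: "\<beta> t + \<beta>' t * (s - t) - q * k * \<sigma>\<^sup>2 * (s - t)\<^sup>2 \<le> \<beta> s"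
proof -
  have D: "((\<lambda>t. ln (L t)) has_real_derivative \<sigma> * (exp (\<sigma> * x) / L x)) (at x)" for x
    using L_pos[of x] by (auto intro!: derivative_eq_intros L_der)
  have "\<exists>\<xi>. \<bar>\<xi> - t\<bar> \<le> \<bar>s - t\<bar> \<and> ln (L s) - ln (L t) = (s - t) * (\<sigma> * (exp (\<sigma> * \<xi>) / L \<xi>))"
  proof (cases s t rule: linorder_cases)
    case less
    then obtain \<xi> where "s < \<xi>" "\<xi> < t" "ln (L t) - ln (L s) = (t - s) * (\<sigma> * (exp (\<sigma> * \<xi>) / L \<xi>))"
      using MVT2[OF less, of "\<lambda>t. ln (L t)" "\<lambda>x. \<sigma> * (exp (\<sigma> * x) / L x)"] D by blast
    moreover have "(t - s) * X = - ((s - t) * X)" for X :: real by (simp add: left_diff_distrib)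
    ultimately show ?thesis by (intro exI[of _ \<xi>]) auto
  next
    case greater
    then obtain \<xi> where "t < \<xi>" "\<xi> < s" "ln (L s) - ln (L t) = (s - t) * (\<sigma> * (exp (\<sigma> * \<xi>) / L \<xi>))"
      using MVT2[OF greater, of "\<lambda>t. ln (L t)" "\<lambda>x. \<sigma> * (exp (\<sigma> * x) / L x)"] D by blast
    then show ?thesis by (intro exI[of _ \<xi>]) auto
  qed auto
  then obtain \<xi> where \<xi>: "\<bar>\<xi> - t\<bar> \<le> \<bar>s - t\<bar>" "ln (L s) - ln (L t) = (s - t) * (\<sigma> * (exp (\<sigma> * \<xi>) / L \<xi>))"
    by blast
  define d where "d = exp (\<sigma> * \<xi>) / L \<xi> - exp (\<sigma> * t) / L t"
  have "\<bar>d\<bar> \<le> \<sigma> * \<bar>s - t\<bar>"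
    unfolding d_def using \<sigma>_pos
    by (intro order_trans[OF logistic_lipschitz[of \<xi> t]] mult_left_mono[OF \<xi>(1)]) simp
  then have "\<bar>s - t\<bar> * \<bar>d\<bar> \<le> \<bar>s - t\<bar> * (\<sigma> * \<bar>s - t\<bar>)" by (intro mult_left_mono) auto
  also have "\<dots> = \<sigma> * (\<bar>s - t\<bar> * \<bar>s - t\<bar>)" by (simp only: mult_ac)
  also have "\<bar>s - t\<bar> * \<bar>s - t\<bar> = (s - t)\<^sup>2" by (simp only: abs_mult_self_eq power2_eq_square)
  finally have "(s - t) * d \<le> \<sigma> * (s - t)\<^sup>2"
    using abs_ge_self[of "(s - t) * d"] by (simp only: abs_mult)
  then have "q * k * \<sigma> * ((s - t) * d) \<le> q * k * \<sigma> * (\<sigma> * (s - t)\<^sup>2)"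
    using q_pos k_pos \<sigma>_pos by (intro mult_left_mono) auto
  moreover have "\<beta> s - (\<beta> t + \<beta>' t * (s - t)) = - (q * k * \<sigma> * ((s - t) * d))"
  proof -
    have "\<beta> s - \<beta> t = (B + \<sigma>) * (s - t) - q * k * (ln (L s) - ln (L t))"
      by (simp add: \<beta>_def algebra_simps)
    then show ?thesis unfolding \<xi>(2) by (simp add: \<beta>'_def d_def algebra_simps)
  qed
  ultimately show ?thesis by (simp add: power2_eq_square mult_ac)
qed

lemma L_bounds_right: "0 \<le> t \<Longrightarrow> exp (\<sigma> * t) \<le> L t" "0 \<le> t \<Longrightarrow> L t \<le> 2 * exp (\<sigma> * t)"
  using \<sigma>_pos by (auto simp: L_def)

lemma L_bounds_left: "1 \<le> L t" "t \<le> 0 \<Longrightarrow> L t \<le> 2"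
  using \<sigma>_pos by (auto simp: L_def mult_nonneg_nonpos)

definition c1 :: real where "c1 = 2 powr (1 - q * k)"
definition c2 :: real where "c2 = \<kappa> powr p"

lemma c1_pos: "0 < c1" and c2_pos: "0 < c2"
  using \<kappa>_pos by (auto simp: c1_def c2_def)

lemma wa_ge_right: "0 \<le> t \<Longrightarrow> c1 * exp (- (\<kappa> * t)) \<le> wa t"
proof -
  assume t: "0 \<le> t"
  have "- (\<kappa> * t) = B * t + (1 - q * k) * (\<sigma> * t)"
    using arg_cong[OF qk\<sigma>(2), of "\<lambda>x. x * t"] by (simp add: algebra_simps)
  then have "c1 * exp (- (\<kappa> * t)) = exp (B * t) * (2 * exp (\<sigma> * t)) powr (1 - q * k)"
    by (simp add: c1_def powr_mult exp_add) (simp add: powr_def)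
  also have "\<dots> \<le> wa t" unfolding wa_def
    using L_bounds_right[OF t] L_pos[of t] qk_gt by (intro mult_left_mono powr_mono2') auto
  finally show ?thesis .
qed

lemma wa_ge_left: "t \<le> 0 \<Longrightarrow> c1 * exp (B * t) \<le> wa t"
  unfolding wa_def c1_def using L_bounds_left[of t] L_pos[of t] qk_gt
  by (subst mult.commute) (intro mult_left_mono powr_mono2', auto)

lemma wb_le_right: "0 \<le> t \<Longrightarrow> wb t \<le> c2 * exp (- (\<kappa> * t))"
proof -
  assume t: "0 \<le> t"
  have "wb t \<le> \<kappa> powr p * exp ((B + \<sigma>) * t) * exp (\<sigma> * t) powr (- (q * k))"
    unfolding wb_eq using L_bounds_right[OF t] L_pos[of t] qk_gt \<kappa>_pos
    by (intro mult_left_mono powr_mono2') auto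
  also have "\<dots> = c2 * exp ((B + \<sigma>) * t + - (q * k) * (\<sigma> * t))"
    by (simp only: c2_def exp_add) (simp add: powr_def)
  also have "(B + \<sigma>) * t + - (q * k) * (\<sigma> * t) = - (\<kappa> * t)"
    using arg_cong[OF qk\<sigma>(2), of "\<lambda>x. x * t"] by (simp add: algebra_simps)
  finally show ?thesis .
qed

lemma wb_le_left: "t \<le> 0 \<Longrightarrow> wb t \<le> c2 * exp (B * t)"
proof -
  assume t: "t \<le> 0"
  have "wb t \<le> \<kappa> powr p * exp ((B + \<sigma>) * t) * 1 powr (- (q * k))"
    unfolding wb_eq using L_bounds_left[of t] L_pos[of t] qk_gt \<kappa>_pos
    by (intro mult_left_mono powr_mono2') auto
  also have "\<dots> \<le> c2 * exp (B * t)"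
    using mult_nonneg_nonpos[of \<sigma> t] t \<sigma>_pos \<kappa>_pos by (simp add: c2_def distrib_right)
  finally show ?thesis .
qed

definition \<Lambda> :: real where "\<Lambda> = B + q * k * \<sigma>"

lemma \<Lambda>_pos: "0 < \<Lambda>" unfolding \<Lambda>_def using B_pos q_pos k_pos \<sigma>_pos by (intro add_pos_pos mult_pos_pos)

text \<open>The logarithmic derivative of \<open>wh\<close> is at least \<open>- \<Lambda>\<close>,
  since \<open>L\<close> grows at most at the rate \<open>\<sigma>\<close>. This Harnack-type bound
  is used on intervals of length at most 1.\<close>

lemma wh_le: "s \<le> t \<Longrightarrow> wh s \<le> exp (\<Lambda> * (t - s)) * wh t"
proof -
  assume st: "s \<le> t"
  have "L t \<le> exp (\<sigma> * (t - s)) * L s"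
  proof -
    have "1 \<le> exp (\<sigma> * (t - s))" using st \<sigma>_pos by simp
    moreover have "exp (\<sigma> * (t - s)) * exp (\<sigma> * s) = exp (\<sigma> * t)"
      by (simp add: algebra_simps flip: exp_add)
    ultimately show ?thesis by (simp add: L_def distrib_left)
  qed
  then have "(exp (\<sigma> * (t - s)) * L s) powr (- (q * k)) \<le> L t powr (- (q * k))"
    using L_pos[of t] qk_gt by (intro powr_mono2') auto
  then have "exp (- (q * k * \<sigma>) * (t - s)) * L s powr (- (q * k)) \<le> L t powr (- (q * k))"
    by (simp add: powr_mult) (simp add: powr_def mult_ac)
  then have "L s powr (- (q * k)) \<le> exp (q * k * \<sigma> * (t - s)) * L t powr (- (q * k))"
    by (simp add: exp_minus inverse_eq_divide pos_divide_le_eq mult.commute)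
  moreover have "exp (B * s) \<le> exp (B * (t - s)) * exp (B * t)"
    using st B_pos by (simp flip: exp_add) (simp add: algebra_simps)
  ultimately have "exp (B * s) * L s powr (- (q * k))
     \<le> (exp (B * (t - s)) * exp (B * t)) * (exp (q * k * \<sigma> * (t - s)) * L t powr (- (q * k)))"
    by (intro mult_mono) auto
  then show ?thesis unfolding wh_eq \<Lambda>_def distrib_right exp_add by (simp only: mult_ac)
qed

end

section \<open>From the gap to the Hellinger distance\<close>

context bliss
begin

text \<open>For the transport map of a nonincreasing \<open>u\<close>, the function in the
  \<open>mono\<close> hypothesis is \<open>u (m t) powr (- q)\<close>. With the Harnack bound for
  \<open>wh\<close> it makes \<open>exp (B * m t) * m' t\<close> increasing up to the factor
  \<open>exp \<Lambda>\<close> over unit length, whereas \<open>exp (B * m t)\<close>, its primitive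
  up to a factor, cannot catch up within \<open>\<epsilon>\<close>. So \<open>m'\<close> stays
  large.\<close>

lemma threshold:
  obtains K \<epsilon> where "1 \<le> K" "0 < \<epsilon>"
    "\<And>m m' t1 t. (\<And>t. (m has_real_derivative m' t) (at t)) \<Longrightarrow> (\<And>t. 0 < m' t) \<Longrightarrow>
      mono (\<lambda>t. exp (B * m t) * m' t / wh t) \<Longrightarrow> K \<le> m' t1 \<Longrightarrow> t1 \<le> t \<Longrightarrow> t \<le> t1 + \<epsilon> \<Longrightarrow> 2 \<le> m' t"
proof -
  \<comment> \<open>\<open>K\<close> makes \<open>exp (B * m t1)\<close> at most a quarter of
    \<open>w t * wh t\<close>, and \<open>\<epsilon>\<close> lets it grow by at most another
    quarter. As \<open>w t * wh t\<close> is \<open>exp (B * m t) * m' t\<close>, the resulting half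
    means \<open>2 \<le> m' t\<close>.\<close>
  define \<epsilon> where "\<epsilon> = min 1 (1 / (4 * B * exp \<Lambda>))"
  define K where "K = 4 * exp \<Lambda>"
  have eps: "0 < \<epsilon>" "\<epsilon> \<le> 1" "exp \<Lambda> * (\<epsilon> * B) \<le> 1 / 4"
  proof -
    show "0 < \<epsilon>" "\<epsilon> \<le> 1" using B_pos by (auto simp: \<epsilon>_def)
    have "\<epsilon> * (B * exp \<Lambda>) \<le> 1 / (4 * B * exp \<Lambda>) * (B * exp \<Lambda>)"
      using B_pos by (intro mult_right_mono) (auto simp: \<epsilon>_def)
    also have "\<dots> = 1 / 4" using B_pos by simp
    finally show "exp \<Lambda> * (\<epsilon> * B) \<le> 1 / 4" by (simp add: mult_ac)
  qed
  have K1: "1 \<le> K"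
    using one_le_exp_iff[of \<Lambda>] \<Lambda>_pos unfolding K_def by linarith
  show thesis
  proof
    show "1 \<le> K" "0 < \<epsilon>" by fact+
    fix m m' :: "real \<Rightarrow> real" and t1 t
    assume m: "\<And>t. (m has_real_derivative m' t) (at t)" and pos: "\<And>t. 0 < m' t"
      and mono: "mono (\<lambda>t. exp (B * m t) * m' t / wh t)"
      and t1: "K \<le> m' t1" "t1 \<le> t" "t \<le> t1 + \<epsilon>"
    define w where "w s = exp (B * m s) * m' s / wh s" for s
    have w_mono: "w s \<le> w s'" if "s \<le> s'" for s s'
      using monoD[OF mono that] by (simp add: w_def)
    have w_pos: "0 < w s" for s using pos wh_pos by (simp add: w_def)
    have wwh: "exp (B * m s) * m' s = w s * wh s" for s
      using wh_pos[of s] by (simp add: w_def)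
    have bound: "w s * wh s \<le> exp \<Lambda> * (w t * wh t)" if s: "t1 \<le> s" "s \<le> t" for s
    proof -
      have "wh s \<le> exp (\<Lambda> * (t - s)) * wh t" using wh_le s by auto
      also have "\<dots> \<le> exp \<Lambda> * wh t"
      proof -
        have "\<Lambda> * (t - s) \<le> \<Lambda> * 1" using s t1 eps \<Lambda>_pos by (intro mult_left_mono) auto
        then show ?thesis using wh_pos[of t] by simp
      qed
      finally have "wh s \<le> exp \<Lambda> * wh t" .
      then have "w s * wh s \<le> w t * (exp \<Lambda> * wh t)"
        using w_mono s w_pos[of t] wh_pos[of s] by (intro mult_mono) (auto simp: less_imp_le)
      then show ?thesis by (simp add: mult_ac)
    qed
    have "exp (B * m t) \<le> exp (B * m t1) + \<epsilon> * (B * (exp \<Lambda> * (w t * wh t)))"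
    proof (cases "t1 = t")
      case True
      then show ?thesis using eps B_pos w_pos[of t] wh_pos[of t] by (simp add: less_imp_le)
    next
      case False
      then have "t1 < t" using t1 by simp
      moreover have "((\<lambda>t. exp (B * m t)) has_real_derivative B * (exp (B * m s) * m' s)) (at s)" for s
        by (auto intro!: derivative_eq_intros m)
      ultimately obtain s where s: "t1 < s" "s < t"
        "exp (B * m t) - exp (B * m t1) = (t - t1) * (B * (exp (B * m s) * m' s))"
        using MVT2[of t1 t "\<lambda>t. exp (B * m t)" "\<lambda>s. B * (exp (B * m s) * m' s)"] by blast
      have "(t - t1) * (B * (exp (B * m s) * m' s)) \<le> \<epsilon> * (B * (exp \<Lambda> * (w t * wh t)))"
        unfolding wwh
      proof (rule mult_mono)
        show "B * (w s * wh s) \<le> B * (exp \<Lambda> * (w t * wh t))"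
          using bound[of s] s B_pos by (intro mult_left_mono) auto
      qed (use t1 eps B_pos w_pos[of s] wh_pos[of s] in \<open>auto simp: less_imp_le\<close>)
      then show ?thesis using s(3) by linarith
    qed
    moreover have "exp (B * m t1) * K \<le> exp \<Lambda> * (w t * wh t)"
    proof -
      have "exp (B * m t1) * K \<le> exp (B * m t1) * m' t1" using t1 by simp
      also have "\<dots> \<le> exp \<Lambda> * (w t * wh t)" unfolding wwh using bound t1 by auto
      finally show ?thesis .
    qed
    then have "exp (B * m t1) \<le> w t * wh t / 4" by (simp add: K_def)
    moreover have "\<epsilon> * (B * (exp \<Lambda> * (w t * wh t))) \<le> w t * wh t / 4"
      using mult_right_mono[OF eps(3), of "w t * wh t"] w_pos[of t] wh_pos[of t]
      by (simp add: mult_ac)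
    ultimately have "exp (B * m t) \<le> w t * wh t / 2" by linarith
    then have "exp (B * m t) * 2 \<le> exp (B * m t) * m' t" unfolding wwh by linarith
    then show "2 \<le> m' t" by simp
  qed
qed

text \<open>\<open>half_line\<close> is applied twice: on the right with rate
  \<open>\<kappa>\<close>, and after reflection on the left with rate \<open>B\<close>. The
  remaining exponentials vanish as \<open>T\<close> grows.\<close>

theorem Hellinger_bound:
  obtains CH where "0 < CH"
    "\<And>m m' \<Gamma> T. m 0 = 0 \<Longrightarrow> (\<And>t. (m has_real_derivative m' t) (at t)) \<Longrightarrow>
      continuous_on UNIV m' \<Longrightarrow> (\<And>t. 0 < m' t) \<Longrightarrow>
      mono (\<lambda>t. exp (B * m t) * m' t / wh t) \<Longrightarrow>
      (\<And>T. 0 \<le> T \<Longrightarrow> integral {-T..T} (\<lambda>t. wa t * amgm_gap \<iota> (m' t)) \<le> \<Gamma>) \<Longrightarrow> 0 \<le> T \<Longrightarrow>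
      integral {-T..T} (\<lambda>t. wb t - sqrt (wb t * wb (m t) * m' t))
        \<le> CH * \<Gamma> + c2 * (exp (- (\<kappa> * T)) + exp (- (B * T)))"
proof -
  obtain K \<epsilon> where K: "1 \<le> K" and eps: "0 < \<epsilon>"
    and thr: "\<And>m m' t1 t. (\<And>t. (m has_real_derivative m' t) (at t)) \<Longrightarrow> (\<And>t. 0 < m' t) \<Longrightarrow>
      mono (\<lambda>t. exp (B * m t) * m' t / wh t) \<Longrightarrow> K \<le> m' t1 \<Longrightarrow> t1 \<le> t \<Longrightarrow> t \<le> t1 + \<epsilon> \<Longrightarrow> 2 \<le> m' t"
    using threshold by blast
  obtain Cg where Cg: "0 < Cg"
    "\<And>x. 0 < x \<Longrightarrow> x \<le> K \<Longrightarrow> x - 1 - ln x \<le> Cg * amgm_gap \<iota> x"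
    "\<And>x. 0 < x \<Longrightarrow> x \<le> K \<Longrightarrow> (x - 1)\<^sup>2 \<le> Cg * amgm_gap \<iota> x"
    using amgm_gap_bounds[OF \<iota>_pos \<iota>_less1 K] by blast
  obtain g2 where g2: "0 < g2" "\<And>x. 2 \<le> x \<Longrightarrow> g2 \<le> amgm_gap \<iota> x"
    using amgm_gap_ge_at_two[OF \<iota>_pos \<iota>_less1] by blast
  define C2 where "C2 = q * k * \<sigma>\<^sup>2"
  have C2: "0 \<le> C2" using q_pos k_pos by (simp add: C2_def)
  \<comment> \<open>\<open>lam\<close> and \<open>C3\<close> of \<open>half_line\<close> as
    functions of the rate: the final constant has to be fixed before \<open>m\<close> is.\<close>
  define lamf where "lamf x = C2 * c2 / x + c2" for x
  define C3f where "C3f x = (c2 / c1) * Cg / 2 + (2 * lamf x / x) * Cg / c1" for x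
  \<comment> \<open>Length of an interval times floor of the gap times a lower bound for
    \<open>wa\<close> there; \<open>exp (- (\<kappa> * \<epsilon>))\<close> accounts for the decay
    of \<open>wa\<close> along the interval.\<close>
  define c3 where "c3 = \<epsilon> * (g2 * (c1 * exp (- (\<kappa> * \<epsilon>))))"
  have c3: "0 < c3" using eps g2 c1_pos by (simp add: c3_def)
  define C4f where "C4f x = C3f x + (c2 + c2 / x) / c3" for x
  have C4_pos: "0 < C4f x" if "0 < x" for x
    using that c1_pos c2_pos c3 C2 Cg(1) unfolding C4f_def C3f_def lamf_def
    by (intro add_nonneg_pos add_nonneg_nonneg mult_nonneg_nonneg divide_nonneg_pos divide_pos_pos add_pos_pos) auto
  show thesis
  proof
    show "0 < C4f \<kappa> + C4f B" using C4_pos B_pos \<kappa>_pos by (simp add: add_pos_pos)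
    fix m m' :: "real \<Rightarrow> real" and \<Gamma> T :: real
    assume m0: "m 0 = 0" and m: "\<And>t. (m has_real_derivative m' t) (at t)"
      and cont: "continuous_on UNIV m'" and pos: "\<And>t. 0 < m' t"
      and mono: "mono (\<lambda>t. exp (B * m t) * m' t / wh t)"
      and \<Gamma>: "\<And>T. 0 \<le> T \<Longrightarrow> integral {-T..T} (\<lambda>t. wa t * amgm_gap \<iota> (m' t)) \<le> \<Gamma>"
      and T: "0 \<le> T"
    let ?g = "\<lambda>t. wa t * amgm_gap \<iota> (m' t)"
    let ?d = "\<lambda>t. wb t - sqrt (wb t * wb (m t) * m' t)"
    have g_cont: "continuous_on S ?g" for S
      by (intro continuous_intros amgm_gap_continuous_on continuous_on_subset[OF cont] pos) auto
    have g_int: "?g integrable_on {s..t}" for s t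
      by (intro integrable_continuous_interval g_cont)
    have g_nn: "0 \<le> ?g t" for t
      using wa_pos[of t] amgm_gap_nonneg[OF \<iota>_pos \<iota>_less1 pos] by simp
    have sub: "integral {s..t} ?g \<le> \<Gamma>" for s t
    proof -
      define R where "R = max \<bar>s\<bar> \<bar>t\<bar>"
      have "integral {s..t} ?g \<le> integral {-R..R} ?g"
        by (intro integral_subset_le g_int) (auto simp: g_nn R_def)
      also have "\<dots> \<le> \<Gamma>" by (intro \<Gamma>) (simp add: R_def)
      finally show ?thesis .
    qed
    \<comment> \<open>A single point with \<open>K \<le> m'\<close> forces \<open>2 \<le> m'\<close>
      on the interval of length \<open>\<epsilon>\<close> to its right, and thereby a definite
      amount of gap.\<close>
    have big: "\<epsilon> * (g2 * c) \<le> \<Gamma>" if t1: "K \<le> m' t1" and c: "\<And>s. t1 \<le> s \<Longrightarrow> s \<le> t1 + \<epsilon> \<Longrightarrow> c \<le> wa s" "0 \<le> c" for t1 c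
    proof -
      have "\<epsilon> * (g2 * c) = integral {t1..t1 + \<epsilon>} (\<lambda>_. g2 * c)" using eps by simp
      also have "\<dots> \<le> integral {t1..t1 + \<epsilon>} ?g"
      proof (intro integral_le g_int integrable_const_ivl)
        fix s assume "s \<in> {t1..t1 + \<epsilon>}"
        then have s: "t1 \<le> s" "s \<le> t1 + \<epsilon>" by auto
        have "g2 \<le> amgm_gap \<iota> (m' s)" using g2(2) thr[OF m pos mono t1 s] by blast
        then have "c * g2 \<le> wa s * amgm_gap \<iota> (m' s)"
          using c(1)[OF s] c(2) g2(1) wa_pos[of s] by (intro mult_mono) auto
        then show "g2 * c \<le> ?g s" by (simp add: mult.commute)
      qed
      also have "\<dots> \<le> \<Gamma>" by (rule sub)
      finally show ?thesis .
    qed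
    interpret R: half_line wa wb \<beta> \<beta>' m m' \<kappa> c1 c2 C2 Cg K \<iota>
      by unfold_locales
        (use \<kappa>_pos c1_pos c2_pos C2 Cg wa_ge_right wb_le_right wb_eq_exp \<beta>_deriv \<beta>_taylor m0 m cont pos
          \<iota>_pos \<iota>_less1 in \<open>auto simp: C2_def intro: wa_cont\<close>)
    have right: "integral {0..T} ?d \<le> C4f \<kappa> * \<Gamma> + c2 * exp (- (\<kappa> * T))"
    proof -
      have "integral {0..T} ?d \<le> (R.C3 + (c2 + c2 / \<kappa>) / c3) * \<Gamma> + c2 * exp (- (\<kappa> * T))"
      proof (rule R.defect_integral_bound[OF T _ c3])
        show "integral {0..T} ?g \<le> \<Gamma>" for T by (rule sub)
        fix t assume t: "0 \<le> t" "K \<le> m' t"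
        have "\<epsilon> * (g2 * (c1 * exp (- (\<kappa> * (t + \<epsilon>))))) \<le> \<Gamma>"
        proof (rule big[OF t(2)])
          fix s assume s: "t \<le> s" "s \<le> t + \<epsilon>"
          have "c1 * exp (- (\<kappa> * (t + \<epsilon>))) \<le> c1 * exp (- (\<kappa> * s))"
            using s c1_pos \<kappa>_pos by simp
          also have "\<dots> \<le> wa s" using wa_ge_right s t by simp
          finally show "c1 * exp (- (\<kappa> * (t + \<epsilon>))) \<le> wa s" .
        qed (use c1_pos in simp)
        moreover have "exp (- (\<kappa> * (t + \<epsilon>))) = exp (- (\<kappa> * \<epsilon>)) * exp (- (\<kappa> * t))"
          by (simp add: distrib_left flip: exp_add)
        ultimately show "c3 * exp (- (\<kappa> * t)) \<le> \<Gamma>" unfolding c3_def by (simp only: mult_ac)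
      qed
      then show ?thesis by (simp add: C4f_def C3f_def lamf_def R.C3_def R.lam_def)
    qed
    have mr: "((\<lambda>t. - m (- t)) has_real_derivative m' (- t)) (at t)" for t
      using DERIV_minus[OF DERIV_chain'[OF DERIV_minus[OF DERIV_ident] m[of "- t"]]] by simp
    have \<beta>r: "((\<lambda>t. \<beta> (- t)) has_real_derivative - \<beta>' (- t)) (at t)" for t
      using DERIV_chain'[OF DERIV_minus[OF DERIV_ident] \<beta>_deriv[of "- t"]] by simp
    have cr: "continuous_on UNIV (\<lambda>t. m' (- t))" "continuous_on UNIV (\<lambda>t. wa (- t))"
      by (intro continuous_on_compose2[OF cont] continuous_on_compose2[OF wa_cont[of UNIV]] continuous_intros; simp)+
    interpret Le: half_line "\<lambda>t. wa (- t)" "\<lambda>t. wb (- t)" "\<lambda>t. \<beta> (- t)" "\<lambda>t. - \<beta>' (- t)"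
      "\<lambda>t. - m (- t)" "\<lambda>t. m' (- t)" B c1 c2 C2 Cg K \<iota>
    proof unfold_locales
      fix s t
      show "\<beta> (- t) + - \<beta>' (- t) * (s - t) - C2 * (s - t)\<^sup>2 \<le> \<beta> (- s)"
        using \<beta>_taylor[of "- t" "- s"] by (simp add: C2_def power2_commute algebra_simps)
    next
      fix t :: real assume "0 \<le> t"
      then show "c1 * exp (- (B * t)) \<le> wa (- t)" "wb (- t) \<le> c2 * exp (- (B * t))"
        using wa_ge_left[of "- t"] wb_le_left[of "- t"] by auto
    qed (use B_pos c1_pos c2_pos C2 Cg wb_eq_exp \<beta>r m0 mr pos \<iota>_pos \<iota>_less1 cr in auto)
    have left: "integral {-T..0} ?d \<le> C4f B * \<Gamma> + c2 * exp (- (B * T))"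
    proof -
      have refl: "integral {0..s} (\<lambda>t. h (- t)) = integral {-s..0} h" for s and h :: "real \<Rightarrow> real"
        using Henstock_Kurzweil_Integration.integral_reflect_real[of 0 "- s" h] by simp
      have "integral {-T..0} ?d = integral {0..T} (\<lambda>t. ?d (- t))" by (rule refl[symmetric])
      also have "\<dots> \<le> (Le.C3 + (c2 + c2 / B) / c3) * \<Gamma> + c2 * exp (- (B * T))"
      proof (rule Le.defect_integral_bound[OF T _ c3, simplified])
        show "integral {0..S} (\<lambda>t. wa (- t) * amgm_gap \<iota> (m' (- t))) \<le> \<Gamma>" for S
          using refl[of S ?g] sub by simp
        fix t assume t: "0 \<le> t" "K \<le> m' (- t)"
        have "\<epsilon> * (g2 * (c1 * exp (- (\<kappa> * \<epsilon>)) * exp (- (B * t)))) \<le> \<Gamma>"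
        proof (rule big[OF t(2)])
          \<comment> \<open>In the original variable the interval still extends to the right, hence
            towards the origin, and it may cross it. Beyond 0 the bound for \<open>wa\<close> loses
            at most the factor \<open>exp (- (\<kappa> * \<epsilon>))\<close>.\<close>
          fix s assume s: "- t \<le> s" "s \<le> - t + \<epsilon>"
          show "c1 * exp (- (\<kappa> * \<epsilon>)) * exp (- (B * t)) \<le> wa s"
          proof (cases "s \<le> 0")
            case True
            have "c1 * exp (- (\<kappa> * \<epsilon>)) * exp (- (B * t)) \<le> c1 * 1 * exp (B * s)"
              using s c1_pos \<kappa>_pos eps B_pos mult_left_mono[of "- t" s B] by (intro mult_mono) auto
            then show ?thesis using wa_ge_left[OF True] by simp
          next
            case False
            have "c1 * exp (- (\<kappa> * \<epsilon>)) * exp (- (B * t)) \<le> c1 * exp (- (\<kappa> * s)) * 1"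
              using s t c1_pos \<kappa>_pos eps B_pos by (intro mult_mono) auto
            then show ?thesis using wa_ge_right[of s] False by simp
          qed
        qed (use c1_pos in simp)
        then show "c3 * exp (- (B * t)) \<le> \<Gamma>" by (simp add: c3_def mult_ac)
      qed
      also have "Le.C3 + (c2 + c2 / B) / c3 = C4f B" by (simp add: C4f_def C3f_def lamf_def Le.C3_def Le.lam_def)
      finally show ?thesis .
    qed
    have "integral {-T..T} ?d = integral {-T..0} ?d + integral {0..T} ?d"
      by (rule Henstock_Kurzweil_Integration.integral_combine[symmetric])
        (use T in \<open>auto intro!: integrable_continuous_interval R.defect_cont\<close>)
    then show "integral {-T..T} ?d \<le> (C4f \<kappa> + C4f B) * \<Gamma> + c2 * (exp (- (\<kappa> * T)) + exp (- (B * T)))"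
      using left right by (simp add: algebra_simps)
  qed
qed

end

section \<open>Integrals and monotone transport on the real line\<close>

lemma integral_interval_eq_LINT:
  fixes g :: "real \<Rightarrow> real"
  assumes "continuous_on {a..b} g"
  shows "integral {a..b} g = (\<integral>x. indicator {a..b} x * g x \<partial>lborel)"
    "integrable lborel (\<lambda>x. indicator {a..b} x * g x)"
proof -
  have "set_integrable lborel {a..b} g" using assms by (rule borel_integrable_atLeastAtMost')
  then show "integral {a..b} g = (\<integral>x. indicator {a..b} x * g x \<partial>lborel)"
    "integrable lborel (\<lambda>x. indicator {a..b} x * g x)"
    using set_borel_integral_eq_integral(2)[of "{a..b}" g]
    by (simp_all add: set_integrable_def set_lebesgue_integral_def)
qed

lemma integral_symmetric_interval_tendsto:
  fixes g :: "real \<Rightarrow> real"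
  assumes g: "integrable lborel g" "continuous_on UNIV g"
  shows "((\<lambda>T. integral {-T..T} g) \<longlongrightarrow> (\<integral>x. g x \<partial>lborel)) at_top"
proof (rule tendsto_at_topI_sequentially)
  fix X :: "nat \<Rightarrow> real" assume X: "filterlim X at_top sequentially"
  have "(\<lambda>n. \<integral>x. indicator {-X n..X n} x * g x \<partial>lborel) \<longlonglongrightarrow> (\<integral>x. g x \<partial>lborel)"
  proof (rule integral_dominated_convergence[where w = "\<lambda>x. norm (g x)"])
    show "AE x in lborel. (\<lambda>n. indicator {-X n..X n} x * g x) \<longlonglongrightarrow> g x"
    proof (rule AE_I2)
      fix x
      have "eventually (\<lambda>n. \<bar>x\<bar> \<le> X n) sequentially"
        using X unfolding filterlim_at_top by blast
      then have "eventually (\<lambda>n. indicator {-X n..X n} x * g x = g x) sequentially"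
        by eventually_elim (auto simp: indicator_def abs_le_iff)
      then show "(\<lambda>n. indicator {-X n..X n} x * g x) \<longlonglongrightarrow> g x"
        by (rule tendsto_eventually)
    qed
    show "AE x in lborel. norm (indicator {-X n..X n} x * g x) \<le> norm (g x)" for n
      by (auto simp: indicator_def)
  qed (use g in \<open>auto intro: borel_measurable_integrable\<close>)
  then show "(\<lambda>n. integral {-X n..X n} g) \<longlonglongrightarrow> (\<integral>x. g x \<partial>lborel)"
    using g(2) by (simp add: integral_interval_eq_LINT(1) continuous_on_subset)
qed

lemma integral_interval_le_LINT:
  fixes g :: "real \<Rightarrow> real"
  assumes "integrable lborel g" "continuous_on UNIV g" "\<And>x. 0 \<le> g x"
  shows "integral {a..b} g \<le> (\<integral>x. g x \<partial>lborel)"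
proof -
  have c: "continuous_on {a..b} g" using assms(2) by (rule continuous_on_subset) auto
  show ?thesis unfolding integral_interval_eq_LINT(1)[OF c]
    by (intro integral_mono integral_interval_eq_LINT(2)[OF c] assms) (auto simp: indicator_def assms)
qed

text \<open>Monotone convergence over \<open>{-n..n}\<close>: bounds uniform in \<open>T\<close>
  become statements about the Lebesgue integral.\<close>

lemma integrable_if_interval_integrals_bounded:
  fixes g :: "real \<Rightarrow> real"
  assumes c: "continuous_on UNIV g" and nn: "\<And>x. 0 \<le> g x"
    and le: "\<And>T. 0 \<le> T \<Longrightarrow> integral {-T..T} g \<le> C"
  shows "integrable lborel g" "(\<integral>x. g x \<partial>lborel) \<le> C"
proof -
  have m: "g \<in> borel_measurable lborel" using c by (simp add: borel_measurable_continuous_onI)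
  have cI: "continuous_on {a..b} g" for a b using c by (rule continuous_on_subset) auto
  have "(\<lambda>n. \<integral>\<^sup>+x. ennreal (indicator {-real n..real n} x * g x) \<partial>lborel) \<longlonglongrightarrow> (\<integral>\<^sup>+x. ennreal (g x) \<partial>lborel)"
  proof (rule nn_integral_LIMSEQ)
    show "incseq (\<lambda>n x. ennreal (indicator {-real n..real n} x * g x))"
      by (auto simp: incseq_def le_fun_def indicator_def nn)
    fix x
    obtain n0 where n0: "\<bar>x\<bar> \<le> real n0" using real_arch_simple by blast
    have "eventually (\<lambda>n. ennreal (indicator {-real n..real n} x * g x) = ennreal (g x)) sequentially"
      using eventually_ge_at_top[of n0] by eventually_elim (use n0 in \<open>auto simp: indicator_def abs_le_iff\<close>)
    then show "(\<lambda>n. ennreal (indicator {-real n..real n} x * g x)) \<longlonglongrightarrow> ennreal (g x)"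
      by (rule tendsto_eventually)
  qed (use m in auto)
  moreover have "(\<integral>\<^sup>+x. ennreal (indicator {-real n..real n} x * g x) \<partial>lborel) \<le> ennreal C" for n
    using integral_interval_eq_LINT[OF cI] le[of "real n"]
    by (subst nn_integral_eq_integral) (auto simp: nn intro: ennreal_leI)
  ultimately have *: "(\<integral>\<^sup>+x. ennreal (g x) \<partial>lborel) \<le> ennreal C"
    using LIMSEQ_le_const2[of _ _ "ennreal C"] by blast
  then show i: "integrable lborel g"
    by (intro integrableI_nonneg) (use m nn in \<open>auto intro: le_less_trans\<close>)
  have C0: "0 \<le> C" using le[of 0] by simp
  show "(\<integral>x. g x \<partial>lborel) \<le> C"
    using * C0 nn by (simp add: nn_integral_eq_integral[OF i])
qed

lemma integrable_if_exponential_bounds: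
  fixes g :: "real \<Rightarrow> real"
  assumes c: "continuous_on UNIV g" and nn: "\<And>x. 0 \<le> g x" and pos: "0 < a" "0 < b"
    and r: "\<And>t. 0 \<le> t \<Longrightarrow> g t \<le> C * exp (- (a * t))" and l: "\<And>t. t \<le> 0 \<Longrightarrow> g t \<le> C * exp (b * t)"
  shows "integrable lborel g"
proof (rule integrable_if_interval_integrals_bounded(1)[OF c nn])
  have C0: "0 \<le> C" using nn[of 0] r[of 0] by simp
  fix T :: real assume T: "0 \<le> T"
  have cI: "continuous_on {a..b} g" for a b using c by (rule continuous_on_subset) auto
  have "integral {0..T} g \<le> - (C / a) * exp (- (a * T)) - (- (C / a) * exp (- (a * 0)))"
  proof (rule integral_le_by_antiderivative[OF T cI])
    fix x :: real assume "0 \<le> x"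
    then show "g x \<le> C * exp (- (a * x))" by (rule r)
    show "((\<lambda>T. - (C / a) * exp (- (a * T))) has_real_derivative C * exp (- (a * x))) (at x)"
      using pos by (auto intro!: derivative_eq_intros)
  qed
  also have "\<dots> \<le> C / a" using C0 pos by simp
  finally have 1: "integral {0..T} g \<le> C / a" .
  have "integral {-T..0} g \<le> C / b * exp (b * 0) - C / b * exp (b * (- T))"
  proof (rule integral_le_by_antiderivative[OF _ cI])
    fix x :: real assume "x \<le> 0"
    then show "g x \<le> C * exp (b * x)" by (rule l)
    show "((\<lambda>T. C / b * exp (b * T)) has_real_derivative C * exp (b * x)) (at x)"
      using pos by (auto intro!: derivative_eq_intros)
  qed (use T in simp)
  also have "\<dots> \<le> C / b" using C0 pos by simp
  finally have 2: "integral {-T..0} g \<le> C / b" .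
  have "integral {-T..T} g = integral {-T..0} g + integral {0..T} g"
    by (rule Henstock_Kurzweil_Integration.integral_combine[symmetric])
      (use T cI in \<open>auto intro!: integrable_continuous_interval\<close>)
  then show "integral {-T..T} g \<le> C / a + C / b" using 1 2 by simp
qed

lemma LINT_pos:
  fixes g :: "real \<Rightarrow> real"
  assumes "integrable lborel g" "\<And>t. 0 < g t"
  shows "0 < (\<integral>t. g t \<partial>lborel)"
proof (rule ccontr)
  assume "\<not> ?thesis"
  moreover have "0 \<le> (\<integral>t. g t \<partial>lborel)" using assms by (intro integral_nonneg_AE) (auto simp: less_imp_le)
  ultimately have "(\<integral>t. g t \<partial>lborel) = 0" by simp
  then have "AE t in lborel. g t = 0"
    using integral_nonneg_eq_0_iff_AE[OF assms(1)] assms(2) by (auto simp: less_imp_le)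
  then have "AE t in (lborel :: real measure). False"
    by eventually_elim (use assms(2) in \<open>auto simp: less_le\<close>)
  then show False by (subst (asm) AE_iff_measurable[of UNIV]) auto
qed

lemma exp_neg_mult_tendsto_0:
  fixes c :: real
  assumes "0 < c"
  shows "((\<lambda>t. exp (- (c * t))) \<longlongrightarrow> 0) at_top"
proof (rule filterlim_compose[OF exp_at_bot])
  show "filterlim (\<lambda>t. - (c * t)) at_bot at_top"
    using assms by (simp add: filterlim_uminus_at_bot filterlim_tendsto_pos_mult_at_top[OF tendsto_const] filterlim_ident)
qed

lemma cumulative:
  fixes g :: "real \<Rightarrow> real"
  assumes g: "integrable lborel g" "continuous_on UNIV g"
  defines "G \<equiv> \<lambda>t. (\<integral>x. indicator {..t} x *\<^sub>R g x \<partial>lborel)"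
  shows "(G has_real_derivative g t) (at t)" "(G \<longlongrightarrow> 0) at_bot"
    "(G \<longlongrightarrow> (\<integral>x. g x \<partial>lborel)) at_top"
proof -
  have gi: "integrable lborel (\<lambda>x. indicator A x *\<^sub>R g x)" if "A \<in> sets borel" for A
    using integrable_mult_indicator[OF _ g(1)] that by simp
  have G_diff: "G t - G s = integral {s..t} g" if "s \<le> t" for s t
  proof -
    have c: "continuous_on {s..t} g" using g(2) by (rule continuous_on_subset) auto
    have "G t - G s = (\<integral>x. indicator {..t} x *\<^sub>R g x - indicator {..s} x *\<^sub>R g x \<partial>lborel)"
      unfolding G_def by (rule Bochner_Integration.integral_diff[symmetric]) (rule gi, simp)+
    also have "\<dots> = (\<integral>x. indicator {s..t} x * g x \<partial>lborel)"
    proof (rule integral_cong_AE)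
      show "AE x in lborel. indicator {..t} x *\<^sub>R g x - indicator {..s} x *\<^sub>R g x = indicator {s..t} x * g x"
        using AE_lborel_singleton[of s] by eventually_elim (use that in \<open>auto simp: indicator_def\<close>)
    qed (use borel_measurable_integrable[OF g(1)] in measurable)
    finally show ?thesis by (simp add: integral_interval_eq_LINT(1)[OF c])
  qed
  show "(G has_real_derivative g t) (at t)"
  proof -
    have "((\<lambda>x. integral {t - 1..x} g) has_real_derivative g t) (at t within {t - 1..t + 1})"
      by (rule integral_has_real_derivative) (auto intro: continuous_on_subset[OF g(2)])
    then have "((\<lambda>x. integral {t - 1..x} g) has_real_derivative g t) (at t)"
      by (simp add: at_within_Icc_at)
    then have "((\<lambda>x. G (t - 1) + integral {t - 1..x} g) has_real_derivative g t) (at t)"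
      by (auto intro!: derivative_eq_intros)
    then show ?thesis
    proof (rule has_field_derivative_transform_within_open[where S = "{t - 1<..<t + 1}"])
      fix x assume "x \<in> {t - 1<..<t + 1}"
      then show "G (t - 1) + integral {t - 1..x} g = G x" using G_diff[of "t - 1" x] by simp
    qed auto
  qed
  show "(G \<longlongrightarrow> (\<integral>x. g x \<partial>lborel)) at_top"
    unfolding G_def by (rule tendsto_integral_at_top) (use g in auto)
  show "(G \<longlongrightarrow> 0) at_bot"
  proof (rule tendsto_at_botI_sequentially)
    fix X :: "nat \<Rightarrow> real" assume X: "filterlim X at_bot sequentially"
    have "(\<lambda>n. \<integral>x. indicator {..X n} x *\<^sub>R g x \<partial>lborel) \<longlonglongrightarrow> (\<integral>x. 0 \<partial>(lborel :: real measure))"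
    proof (rule integral_dominated_convergence[where w = "\<lambda>x. norm (g x)"])
      show "AE x in lborel. (\<lambda>n. indicator {..X n} x *\<^sub>R g x) \<longlonglongrightarrow> 0"
      proof (rule AE_I2)
        fix x
        have "eventually (\<lambda>n. X n < x) sequentially" using X unfolding filterlim_at_bot_dense by blast
        then have "eventually (\<lambda>n. indicator {..X n} x *\<^sub>R g x = 0) sequentially"
          by eventually_elim (auto simp: indicator_def)
        then show "(\<lambda>n. indicator {..X n} x *\<^sub>R g x) \<longlonglongrightarrow> 0" by (rule tendsto_eventually)
      qed
      show "AE x in lborel. norm (indicator {..X n} x *\<^sub>R g x) \<le> norm (g x)" for n
        by (auto simp: indicator_def)
    qed (use g borel_measurable_integrable[OF g(1)] in \<open>auto\<close>)
    then show "(\<lambda>n. G (X n)) \<longlonglongrightarrow> 0" by (simp add: G_def)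
  qed
qed

lemma strict_mono_limits_strict:
  fixes G :: "real \<Rightarrow> real"
  assumes sm: "strict_mono G" and "(G \<longlongrightarrow> l) at_bot" "(G \<longlongrightarrow> h) at_top"
  shows "l < G t" "G t < h"
proof -
  have "l \<le> G (t - 1)"
    by (rule tendsto_upperbound[OF assms(2)])
      (auto intro!: eventually_at_bot_linorderI[of "t - 1"] strict_mono_leD[OF sm])
  then show "l < G t" using strict_monoD[OF sm, of "t - 1" t] by simp
  have "G (t + 1) \<le> h"
    by (rule tendsto_lowerbound[OF assms(3)])
      (auto intro!: eventually_at_top_linorderI[of "t + 1"] strict_mono_leD[OF sm])
  then show "G t < h" using strict_monoD[OF sm, of t "t + 1"] by simp
qed

lemma IVT_limits:
  fixes G :: "real \<Rightarrow> real"
  assumes c: "continuous_on UNIV G" and "(G \<longlongrightarrow> l) at_bot" "(G \<longlongrightarrow> h) at_top" "l < y" "y < h"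
  shows "\<exists>t. G t = y"
proof -
  have "eventually (\<lambda>t. G t < y) at_bot" using assms(2,4) by (rule order_tendstoD)
  then obtain a where a: "\<And>t. t \<le> a \<Longrightarrow> G t < y" unfolding eventually_at_bot_linorder by blast
  have "eventually (\<lambda>t. y < G t) at_top" using assms(3,5) by (rule order_tendstoD)
  then obtain b where b: "\<And>t. b \<le> t \<Longrightarrow> y < G t" unfolding eventually_at_top_linorder by blast
  show ?thesis
    using IVT'[of G "min a b" y "max a b"] a[of "min a b"] b[of "max a b"]
      continuous_on_subset[OF c] by fastforce
qed

text \<open>\<open>m\<close> is \<open>H\<close> followed by the inverse of \<open>G\<close>. The
  common limits at both ends make it defined everywhere and onto; its derivative comes from the
  inverse function rule.\<close>

lemma monotone_transport_exists:
  fixes g h G H :: "real \<Rightarrow> real"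
  assumes G: "\<And>t. (G has_real_derivative g t) (at t)" "\<And>t. 0 < g t" "(G \<longlongrightarrow> l) at_bot" "(G \<longlongrightarrow> M) at_top"
    and H: "\<And>t. (H has_real_derivative h t) (at t)" "\<And>t. 0 < h t" "(H \<longlongrightarrow> l) at_bot" "(H \<longlongrightarrow> M) at_top"
  obtains m where "\<And>t. (m has_real_derivative h t / g (m t)) (at t)" "\<And>t. G (m t) = H t" "bij m" "strict_mono m"
proof -
  have smG: "strict_mono G"
    by (rule strict_monoI) (rule DERIV_pos_imp_increasing, assumption, use G(1,2) in blast)
  have smH: "strict_mono H"
    by (rule strict_monoI) (rule DERIV_pos_imp_increasing, assumption, use H(1,2) in blast)
  have cG: "isCont G t" for t using DERIV_isCont[OF G(1)] .
  have cH: "isCont H t" for t using DERIV_isCont[OF H(1)] .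
  have injG: "inj G" using smG by (rule strict_mono_imp_inj_on)
  define J where "J = inv G"
  have JG: "J (G z) = z" for z using injG by (simp add: J_def)
  have surjG: "\<exists>t. G t = y" if "l < y" "y < M" for y
    using IVT_limits[OF _ G(3,4) that] cG by (simp add: continuous_at_imp_continuous_on)
  have surjH: "\<exists>t. H t = y" if "l < y" "y < M" for y
    using IVT_limits[OF _ H(3,4) that] cH by (simp add: continuous_at_imp_continuous_on)
  have GJ: "G (J y) = y" if "l < y" "y < M" for y using surjG[OF that] JG by metis
  have Hr: "l < H t" "H t < M" for t using strict_mono_limits_strict[OF smH H(3,4)] by auto
  have Gr: "l < G t" "G t < M" for t using strict_mono_limits_strict[OF smG G(3,4)] by auto
  define m where "m t = J (H t)" for t
  have Gm: "G (m t) = H t" for t using GJ Hr by (simp add: m_def)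
  have J_der: "(J has_real_derivative inverse (g (J y))) (at y)" if y: "l < y" "y < M" for y
  proof (rule DERIV_inverse_function[OF _ _ y])
    show "(G has_real_derivative g (J y)) (at (J y))" "g (J y) \<noteq> 0"
      using G(1) G(2)[of "J y"] by auto
    show "isCont J y"
      using isCont_inverse_function[of 1 "J y" J G] JG cG GJ[OF y] by simp
  qed (use GJ in auto)
  have "(m has_real_derivative h t / g (m t)) (at t)" for t
    unfolding m_def[abs_def]
    using DERIV_chain2[OF J_der[OF Hr[of t]] H(1)] by (simp add: divide_inverse mult.commute)
  moreover have sm: "strict_mono m"
  proof (rule strict_monoI)
    fix s t :: real assume "s < t"
    then have "G (m s) < G (m t)" unfolding Gm by (rule strict_monoD[OF smH])
    then show "m s < m t" using smG by (simp add: strict_mono_less)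
  qed
  moreover have "bij m"
  proof (rule bijI)
    show "inj m" using sm by (rule strict_mono_imp_inj_on)
    show "surj m"
    proof (rule surjI)
      fix y
      obtain t where "H t = G y" using surjH[OF Gr] by blast
      then have "m t = y" by (simp add: m_def JG)
      then show "m (SOME t. m t = y) = y" by (rule someI)
    qed
  qed
  ultimately show thesis using that Gm by blast
qed

lemma lborel_change_of_variables:
  fixes m m' g :: "real \<Rightarrow> real"
  assumes der: "\<And>t. (m has_real_derivative m' t) (at t)" and nn: "\<And>t. 0 \<le> m' t" and bij: "bij m"
    and [measurable]: "m' \<in> borel_measurable borel" "g \<in> borel_measurable borel"
  shows "integrable lborel (\<lambda>t. m' t * g (m t)) \<longleftrightarrow> integrable lborel g"
    "(\<integral>t. m' t * g (m t) \<partial>lborel) = (\<integral>t. g t \<partial>lborel)"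
proof -
  have "continuous_on UNIV m" using der DERIV_isCont continuous_at_imp_continuous_on by blast
  then have [measurable]: "m \<in> borel_measurable borel" by (rule borel_measurable_continuous_onI)
  have *: "(\<lambda>x. m' x * g (m x)) absolutely_integrable_on UNIV \<and> integral UNIV (\<lambda>x. m' x * g (m x)) = b
     \<longleftrightarrow> g absolutely_integrable_on UNIV \<and> integral UNIV g = b" for b
    using has_absolute_integral_change_of_variables_1'[of UNIV m m' g b] der nn bij
    by (simp add: bij_def)
  have ai: "h absolutely_integrable_on UNIV \<longleftrightarrow> integrable lborel h"
    if "h \<in> borel_measurable borel" for h :: "real \<Rightarrow> real"
    using that by (simp add: set_integrable_def integrable_completion)
  show iff: "integrable lborel (\<lambda>t. m' t * g (m t)) \<longleftrightarrow> integrable lborel g"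
    using * by (subst (1 2) ai[symmetric]) (measurable, blast)
  show "(\<integral>t. m' t * g (m t) \<partial>lborel) = (\<integral>t. g t \<partial>lborel)"
  proof (cases "integrable lborel g")
    case True
    then have "g absolutely_integrable_on UNIV" by (subst ai) measurable
    then have "integral UNIV (\<lambda>x. m' x * g (m x)) = integral UNIV g" using * by blast
    then show ?thesis using True iff by (simp add: integral_lborel)
  next
    \<comment> \<open>Neither side is integrable, and both Bochner integrals have the default value
      0.\<close>
    case False
    then show ?thesis using iff by (simp add: not_integrable_integral_eq)
  qed
qed

section \<open>The deficit of a monotone profile\<close>

context bliss
begin

text \<open>Decay rate of the mass density \<open>wh\<close> at infinity:
  \<open>B - q * k * \<sigma> = - \<delta>\<close>.\<close>

definition \<delta> :: real where "\<delta> = B / (p - 1)"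

lemma \<delta>_pos: "0 < \<delta>" using B_pos p1_pos by (simp add: \<delta>_def)

lemma wh_le_right: "0 \<le> t \<Longrightarrow> wh t \<le> 1 * exp (- (\<delta> * t))"
proof -
  assume t: "0 \<le> t"
  have "B - q * k * \<sigma> = - \<delta>" unfolding qk\<sigma>(1) \<delta>_def using p1_pos
    by (simp add: divide_simps) (simp add: algebra_simps)
  then have "(B - q * k * \<sigma>) * t = - \<delta> * t" by (rule arg_cong)
  then have e: "B * t + - (q * k) * (\<sigma> * t) = - (\<delta> * t)" by (simp add: algebra_simps)
  have "wh t \<le> exp (B * t) * exp (\<sigma> * t) powr (- (q * k))"
    unfolding wh_eq using L_bounds_right[OF t] L_pos[of t] qk_gt
    by (intro mult_left_mono powr_mono2') auto
  also have "\<dots> = exp (B * t + - (q * k) * (\<sigma> * t))"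
    by (simp only: exp_add) (simp add: powr_def)
  finally show ?thesis unfolding e by simp
qed

lemma wh_le_left: "wh t \<le> 1 * exp (B * t)"
proof -
  have "L t powr (- (q * k)) \<le> 1 powr (- (q * k))"
    using L_bounds_left[of t] qk_gt by (intro powr_mono2') auto
  then show ?thesis unfolding wh_eq by simp
qed

lemma wh_integrable: "integrable lborel wh"
  by (rule integrable_if_exponential_bounds[OF wh_cont less_imp_le[OF wh_pos] \<delta>_pos B_pos wh_le_right wh_le_left])

lemma wb_integrable: "integrable lborel wb"
  by (rule integrable_if_exponential_bounds[OF wb_cont less_imp_le[OF wb_pos] \<kappa>_pos B_pos wb_le_right wb_le_left])

definition DU :: real where "DU = (\<integral>t. wb t \<partial>lborel)"
definition QU :: real where "QU = (\<integral>t. wh t \<partial>lborel)"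

lemma DU_pos: "0 < DU" and QU_pos: "0 < QU"
  unfolding DU_def QU_def using LINT_pos wb_integrable wh_integrable wb_pos wh_pos by auto

text \<open>The normalisation that exposes
  \<open>q * (1 - \<iota>) * v powr (q * (1 - \<iota>) - 1)\<close> in \<open>cross_term\<close>,
  the derivative of \<open>v powr (q * (1 - \<iota>))\<close>.\<close>

definition A1 :: real where "A1 = \<kappa> powr (p - 1) / (q * (1 - \<iota>))"

lemma A1_pos: "0 < A1" using \<kappa>_pos q_pos \<iota>_less1 by (simp add: A1_def)

lemma \<iota>_eqs: "B * \<iota> * p = B - \<gamma>" "q * k * \<iota> = 1" "q * (1 - \<iota>) - 1 = (p - 1) * q / p" "\<sigma> * (p - 1) = B - \<gamma>"
proof -
  show "B * \<iota> * p = B - \<gamma>" using B_pos p_pos by (simp add: \<iota>_def)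
  show "q * k * \<iota> = 1" using B_pos p_pos \<gamma>_less by (simp add: qk(2) \<iota>_def)
  have "q * \<iota> = (B - \<gamma>) / \<gamma>" using B_pos p_pos by (simp add: q_def \<iota>_def)
  then have "q * (1 - \<iota>) - 1 = q - B / \<gamma>" using \<gamma>_pos by (simp add: algebra_simps diff_divide_distrib)
  also have "\<dots> = (p - 1) * q / p" using p_pos \<gamma>_pos by (simp add: q_def field_simps)
  finally show "q * (1 - \<iota>) - 1 = (p - 1) * q / p" .
  show "\<sigma> * (p - 1) = B - \<gamma>" using p1_pos by (simp add: \<sigma>_def)
qed

text \<open>\<open>eq\<close> says that the mass density of \<open>v\<close> at \<open>s\<close>,
  times the derivative \<open>x\<close> of the transport, is the mass density of \<open>U\<close> at
  \<open>t\<close>. In logarithms this is one linear relation, and both claims become linear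
  identities between exponents.\<close>

lemma transport_identity:
  assumes v: "0 < v" and x: "0 < x" and eq: "v powr q * exp (B * s) * x = wh t"
  shows "f t powr (p - 1) * exp (\<gamma> * t * (p - 1) / p) * (exp (\<gamma> * s / p) * x powr (1 / p))
      = \<kappa> powr (p - 1) * v powr (q * (1 - \<iota>) - 1) * exp (B * (\<iota> * t + (1 - \<iota>) * s)) * x"
    and "v powr (q * (1 - \<iota>)) * exp (B * (\<iota> * t + (1 - \<iota>) * s)) = wa t * x powr (\<iota> - 1)"
proof -
  define lv lx lf lk lL where "lv = ln v" "lx = ln x" "lf = ln (f t)" "lk = ln \<kappa>" "lL = ln (L t)"
  note defs = this
  have "ln (v powr q * exp (B * s) * x) = q * lv + B * s + lx"
    using v x by (simp add: ln_mult ln_powr defs)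
  moreover have "ln (wh t) = B * t - q * k * lL"
    using L_pos[of t] by (simp add: wh_eq ln_mult ln_powr defs)
  ultimately have m: "q * lv + B * s + lx = B * t - q * k * lL" using eq by simp
  have "ln (wb t) = p * lf + \<gamma> * t"
    using f_pos[of t] by (simp add: wb_def ln_mult ln_powr defs)
  moreover have "ln (wb t) = p * lk + (B + \<sigma>) * t - q * k * lL"
    by (simp add: wb_eq_exp \<beta>_def defs)
  \<comment> \<open>Equating the two forms of \<open>ln (wb t)\<close> and inserting
    \<open>m\<close> eliminates \<open>ln (L t)\<close>: \<open>f t\<close> is expressed through
    \<open>v\<close>, \<open>s\<close>, \<open>x\<close> and \<open>t\<close>.\<close>
  ultimately have lf: "p * lf = p * lk + \<sigma> * t + (q * lv + B * s + lx) - \<gamma> * t"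
    unfolding m by (simp add: algebra_simps)
  have "p * ((p - 1) * lf + \<gamma> * t * (p - 1) / p + \<gamma> * s / p + lx / p)
     = (p - 1) * (p * lf) + \<gamma> * t * (p - 1) + \<gamma> * s + lx"
    using p_pos by (simp add: field_simps)
  also have "\<dots> = p * (p - 1) * lk + (\<sigma> * (p - 1)) * t + (p - 1) * q * lv + ((p - 1) * B + \<gamma>) * s + p * lx"
    unfolding lf by (simp add: algebra_simps)
  also have "\<dots> = p * (p - 1) * lk + (B * \<iota> * p) * t + (p - 1) * q * lv + (p * B - B * \<iota> * p) * s + p * lx"
    unfolding \<iota>_eqs by (simp add: algebra_simps)
  also have "\<dots> = p * ((p - 1) * lk + (p - 1) * q / p * lv + B * (\<iota> * t + (1 - \<iota>) * s) + lx)"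
    using p_pos by (simp add: field_simps)
  also have "\<dots> = p * ((p - 1) * lk + (q * (1 - \<iota>) - 1) * lv + B * (\<iota> * t + (1 - \<iota>) * s) + lx)"
    unfolding \<iota>_eqs(3) ..
  finally have "(p - 1) * lf + \<gamma> * t * (p - 1) / p + \<gamma> * s / p + lx / p =
     (p - 1) * lk + (q * (1 - \<iota>) - 1) * lv + B * (\<iota> * t + (1 - \<iota>) * s) + lx"
    using p_pos by simp
  then have "exp ((p - 1) * lf + \<gamma> * t * (p - 1) / p + \<gamma> * s / p + lx / p) =
     exp ((p - 1) * lk + (q * (1 - \<iota>) - 1) * lv + B * (\<iota> * t + (1 - \<iota>) * s) + lx)" by (rule arg_cong)
  then show "f t powr (p - 1) * exp (\<gamma> * t * (p - 1) / p) * (exp (\<gamma> * s / p) * x powr (1 / p))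
      = \<kappa> powr (p - 1) * v powr (q * (1 - \<iota>) - 1) * exp (B * (\<iota> * t + (1 - \<iota>) * s)) * x"
    unfolding exp_add using v x f_pos[of t] \<kappa>_pos by (simp add: powr_def defs)
  have "q * (1 - \<iota>) * lv + B * (\<iota> * t + (1 - \<iota>) * s) = (1 - \<iota>) * (q * lv + B * s + lx) + B * \<iota> * t + (\<iota> - 1) * lx"
    by (simp add: algebra_simps)
  also have "\<dots> = B * t + (q * k * \<iota> - q * k) * lL + (\<iota> - 1) * lx"
    unfolding m by (simp add: algebra_simps)
  also have "\<dots> = B * t + (1 - q * k) * lL + (\<iota> - 1) * lx" unfolding \<iota>_eqs(2) ..
  finally have "exp (q * (1 - \<iota>) * lv + B * (\<iota> * t + (1 - \<iota>) * s)) = exp (B * t + (1 - q * k) * lL + (\<iota> - 1) * lx)"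
    by (rule arg_cong)
  then show "v powr (q * (1 - \<iota>)) * exp (B * (\<iota> * t + (1 - \<iota>) * s)) = wa t * x powr (\<iota> - 1)"
    unfolding exp_add using v x L_pos[of t] by (simp add: powr_def defs wa_def)
qed

definition Rf :: "real \<Rightarrow> real" where "Rf t = f t * exp (\<gamma> * t / p)"

lemma Rf_pos: "0 < Rf t" using f_pos by (simp add: Rf_def)

lemma Rf_powr: "Rf t powr p = wb t" "wb t powr (1 / p) = Rf t"
proof -
  show 1: "Rf t powr p = wb t"
    using f_pos[of t] p_pos by (simp add: Rf_def wb_def powr_mult) (simp add: powr_def)
  show "wb t powr (1 / p) = Rf t"
    using Rf_pos[of t] p_pos by (simp add: 1[symmetric] powr_powr)
qed

lemma Rf_cont: "continuous_on S Rf"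
  unfolding Rf_def using p_pos by (intro continuous_intros) auto

text \<open>The left-hand side is the cross term of the tangent inequality at \<open>Rf t\<close>; up to an exact
  derivative it is bounded below by the weighted arithmetic-geometric mean inequality.\<close>
lemma cross_term:
  assumes v: "0 < v" and x: "0 < x" and eq: "v powr q * exp (B * s) * x = wh t"
  shows "Rf t powr (p - 1) * (F * exp (\<gamma> * s / p) * x powr (1 / p))
    = A1 * (q * (1 - \<iota>) * v powr (q * (1 - \<iota>) - 1) * (F * x) * exp (B * (\<iota> * t + (1 - \<iota>) * s)))"
    (is ?A)
    and "v powr (q * (1 - \<iota>)) * (exp (B * (\<iota> * t + (1 - \<iota>) * s)) * (B * (\<iota> + (1 - \<iota>) * x)))
      = B * wa t * (1 + amgm_gap \<iota> x)" (is ?B)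
proof -
  have "Rf t powr (p - 1) = f t powr (p - 1) * exp (\<gamma> * t * (p - 1) / p)"
    using f_pos[of t] by (simp add: Rf_def powr_mult) (simp add: powr_def mult_ac)
  then have "Rf t powr (p - 1) * (F * exp (\<gamma> * s / p) * x powr (1 / p)) =
     F * (f t powr (p - 1) * exp (\<gamma> * t * (p - 1) / p) * (exp (\<gamma> * s / p) * x powr (1 / p)))"
    by (simp only: mult_ac)
  also have "\<dots> = F * (\<kappa> powr (p - 1) * v powr (q * (1 - \<iota>) - 1) * exp (B * (\<iota> * t + (1 - \<iota>) * s)) * x)"
    using transport_identity(1)[OF assms] by simp
  also have "\<kappa> powr (p - 1) = A1 * (q * (1 - \<iota>))" using q_pos \<iota>_less1 by (simp add: A1_def)
  finally show ?A by (simp only: mult_ac)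
  have "x powr \<iota> = x powr (\<iota> - 1) * x" using x by (simp add: powr_diff)
  then have "x powr (\<iota> - 1) * (\<iota> + (1 - \<iota>) * x) = 1 + amgm_gap \<iota> x"
    by (simp add: amgm_gap_def algebra_simps)
  moreover have "v powr (q * (1 - \<iota>)) * (exp (B * (\<iota> * t + (1 - \<iota>) * s)) * (B * (\<iota> + (1 - \<iota>) * x)))
     = B * (v powr (q * (1 - \<iota>)) * exp (B * (\<iota> * t + (1 - \<iota>) * s))) * (\<iota> + (1 - \<iota>) * x)"
    by (simp only: mult_ac)
  ultimately show ?B unfolding transport_identity(2)[OF assms] by (simp only: mult_ac)
qed

end

text \<open>\<open>u_mass\<close> gives \<open>u\<close> the total mass of the extremal, so that a
  transport map exists. \<open>tail\<close> serves the boundary term at infinity: it passes the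
  Harnack bound for \<open>wh\<close> on to the mass density of \<open>u\<close>.\<close>

locale bliss_profile = bliss p \<gamma> B for p \<gamma> B :: real +
  fixes u F :: "real \<Rightarrow> real" and \<epsilon> R :: real
  assumes u_pos: "\<And>t. 0 < u t" and u_der: "\<And>t. (u has_real_derivative - F t) (at t)"
    and F_cont: "continuous_on UNIV F" and F_nn: "\<And>t. 0 \<le> F t"
    and u_int: "integrable lborel (\<lambda>t. u t powr q * exp (B * t))"
    and u_mass: "(\<integral>t. u t powr q * exp (B * t) \<partial>lborel) = QU"
    and F_int: "integrable lborel (\<lambda>t. F t powr p * exp (\<gamma> * t))"
    and \<epsilon>_pos: "0 < \<epsilon>" and tail: "\<And>t. R \<le> t \<Longrightarrow> u t = \<epsilon> * U t"
begin

definition w :: "real \<Rightarrow> real" where "w t = u t powr q * exp (B * t)"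

definition D :: real where "D = (\<integral>t. F t powr p * exp (\<gamma> * t) \<partial>lborel)"

lemma u_cont: "continuous_on S u"
  by (meson u_der DERIV_isCont continuous_at_imp_continuous_on)

lemma w_pos: "0 < w t" using u_pos[of t] by (simp add: w_def)

lemma w_cont: "continuous_on S w"
  unfolding w_def using u_pos by (intro continuous_intros u_cont) (auto simp: less_imp_neq[symmetric])

lemma u_antimono: "s \<le> t \<Longrightarrow> u t \<le> u s"
  by (rule DERIV_nonpos_imp_nonincreasing[of s t u]) (use u_der F_nn in \<open>auto intro!: exI[of _ "- F _"]\<close>)

lemma F_powr_cont: "continuous_on UNIV (\<lambda>t. F t powr p * exp (\<gamma> * t))"
  using p_pos F_nn by (intro continuous_intros F_cont continuous_on_powr') auto

lemma w_tail_ratio: "R \<le> s \<Longrightarrow> s \<le> t \<Longrightarrow> t \<le> s + 1 \<Longrightarrow> w s \<le> exp \<Lambda> * w t"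
proof -
  assume st: "R \<le> s" "s \<le> t" "t \<le> s + 1"
  have eq: "w z = \<epsilon> powr q * wh z" if "R \<le> z" for z
    using tail[OF that] \<epsilon>_pos U_pos[of z] by (simp add: w_def wh_def powr_mult)
  have "wh s \<le> exp (\<Lambda> * (t - s)) * wh t" using wh_le st by auto
  also have "\<dots> \<le> exp \<Lambda> * wh t"
  proof -
    have "\<Lambda> * (t - s) \<le> \<Lambda> * 1" using st \<Lambda>_pos by (intro mult_left_mono) auto
    then show ?thesis using wh_pos[of t] by simp
  qed
  finally have "\<epsilon> powr q * wh s \<le> \<epsilon> powr q * (exp \<Lambda> * wh t)" by (intro mult_left_mono) auto
  then show ?thesis using st by (simp add: eq mult_ac)
qed

text \<open>The tangent inequality with remainder is integrated over \<open>{-T..T}\<close>. The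
  cross term is traded for the derivative of \<open>V\<close> and the energy density of
  \<open>U\<close> for that of \<open>wa\<close>; apart from boundary terms, the gap and the
  remainder are left. Then \<open>T\<close> tends to infinity.\<close>

lemma deficit:
  obtains m m' where "\<And>t. (m has_real_derivative m' t) (at t)" "continuous_on UNIV m'" "\<And>t. 0 < m' t"
    "bij m" "mono (\<lambda>t. exp (B * m t) * m' t / wh t)"
    "\<And>T. 0 \<le> T \<Longrightarrow> p * A1 * B * integral {-T..T} (\<lambda>t. wa t * amgm_gap \<iota> (m' t))
      + 2 powr (1 - p) * integral {-T..T} (\<lambda>t. \<bar>F (m t) * exp (\<gamma> * m t / p) * m' t powr (1 / p) - Rf t\<bar> powr p)
      \<le> D - DU"
proof -
  obtain G where G: "\<And>t. (G has_real_derivative w t) (at t)" "(G \<longlongrightarrow> 0) at_bot" "(G \<longlongrightarrow> QU) at_top"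
    using cumulative[OF u_int w_cont[unfolded w_def]] unfolding u_mass w_def by blast
  obtain H where H: "\<And>t. (H has_real_derivative wh t) (at t)" "(H \<longlongrightarrow> 0) at_bot" "(H \<longlongrightarrow> QU) at_top"
    using cumulative[OF wh_integrable wh_cont] unfolding QU_def by blast
  obtain m where m: "\<And>t. (m has_real_derivative wh t / w (m t)) (at t)" "\<And>t. G (m t) = H t"
    "bij m" "strict_mono m"
    using monotone_transport_exists[OF G(1) w_pos G(2,3) H(1) wh_pos H(2,3)] by metis
  define m' where "m' t = wh t / w (m t)" for t
  have m_der: "(m has_real_derivative m' t) (at t)" for t using m(1) by (simp add: m'_def)
  have m_cont: "continuous_on S m" for S
    by (meson m_der DERIV_isCont continuous_at_imp_continuous_on)
  have wm_cont: "continuous_on S (\<lambda>t. w (m t))" for S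
    using continuous_on_compose2[OF w_cont[of UNIV] m_cont] by auto
  have m'_pos: "0 < m' t" for t using wh_pos w_pos by (simp add: m'_def)
  have m'_cont: "continuous_on S m'" for S
    unfolding m'_def using w_pos by (intro continuous_intros wm_cont) (auto simp: less_imp_neq[symmetric])
  have eq: "u (m t) powr q * exp (B * m t) * m' t = wh t" for t
    using u_pos[of "m t"] by (simp add: m'_def w_def)
  \<comment> \<open>The transport relation turns this function into
    \<open>u (m t) powr (- q)\<close>, so the monotonicity of \<open>u\<close> enters here.\<close>
  have mono: "mono (\<lambda>t. exp (B * m t) * m' t / wh t)"
  proof (rule monoI)
    fix s t :: real assume st: "s \<le> t"
    have "exp (B * m t) * m' t / wh t = u (m t) powr (- q)" for t
      using eq[of t] u_pos[of "m t"] wh_pos[of t] by (simp add: powr_minus field_simps)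
    moreover have "u (m s) powr (- q) \<le> u (m t) powr (- q)"
      using u_antimono[of "m s" "m t"] strict_mono_leD[OF m(4) st] u_pos q_pos by (intro powr_mono2') auto
    ultimately show "exp (B * m s) * m' s / wh s \<le> exp (B * m t) * m' t / wh t" by simp
  qed
  define P where "P t = F (m t) * exp (\<gamma> * m t / p) * m' t powr (1 / p)" for t
  \<comment> \<open>The exponent interpolates between \<open>t\<close> and \<open>m t\<close>, so
    its derivative is \<open>B\<close> times the arithmetic mean
    \<open>\<iota> + (1 - \<iota>) * m' t\<close>. Differentiating \<open>V\<close> therefore yields
    this mean and the cross term together.\<close>
  define E where "E t = exp (B * (\<iota> * t + (1 - \<iota>) * m t))" for t
  define V where "V t = u (m t) powr (q * (1 - \<iota>)) * E t" for t
  define V' where "V' t = - (q * (1 - \<iota>) * u (m t) powr (q * (1 - \<iota>) - 1) * (F (m t) * m' t) * E t)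
     + u (m t) powr (q * (1 - \<iota>)) * (E t * (B * (\<iota> + (1 - \<iota>) * m' t)))" for t
  have E_der: "(E has_real_derivative E t * (B * (\<iota> + (1 - \<iota>) * m' t))) (at t)" for t
    unfolding E_def[abs_def] by (auto intro!: derivative_eq_intros m_der)
  have um_der: "((\<lambda>t. u (m t)) has_real_derivative - (F (m t) * m' t)) (at t)" for t
    using DERIV_chain2[OF u_der m_der] by simp
  have V_der: "(V has_real_derivative V' t) (at t)" for t
    unfolding V_def[abs_def] V'_def
    by (rule derivative_eq_intros E_der DERIV_fun_powr[OF um_der] u_pos refl)+ simp
  \<comment> \<open>The same computation for \<open>u = U\<close> and the identity transport, where
    the gap is 0 and \<open>V\<close> becomes \<open>wa\<close>.\<close>
  have VU_der: "(wa has_real_derivative - (wb t / A1) + B * wa t) (at t)" for t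
  proof -
    have U_eq: "U s powr q * exp (B * s) * 1 = wh s" for s by (simp add: wh_def)
    have wa_eq: "wa s = U s powr (q * (1 - \<iota>)) * exp (B * s)" for s
      using transport_identity(2)[OF U_pos zero_less_one U_eq, of s] by (simp add: algebra_simps)
    have "wa = (\<lambda>s. U s powr (q * (1 - \<iota>)) * exp (B * s))" by (rule ext) (rule wa_eq)
    moreover have "((\<lambda>s. U s powr (q * (1 - \<iota>)) * exp (B * s)) has_real_derivative
       q * (1 - \<iota>) * U t powr (q * (1 - \<iota>) - 1) * - f t * exp (B * t)
        + U t powr (q * (1 - \<iota>)) * (exp (B * t) * B)) (at t)"
      by (rule derivative_eq_intros DERIV_fun_powr[OF U_der] U_pos refl)+ (simp add: mult_ac)
    moreover have "wb t = A1 * (q * (1 - \<iota>) * U t powr (q * (1 - \<iota>) - 1) * f t * exp (B * t))"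
    proof -
      have "wb t = Rf t powr (p - 1) * (f t * exp (\<gamma> * t / p) * 1 powr (1 / p))"
        using Rf_pos[of t] by (simp add: Rf_powr(1)[symmetric] powr_diff Rf_def[symmetric])
      also have "\<dots> = A1 * (q * (1 - \<iota>) * U t powr (q * (1 - \<iota>) - 1) * f t * exp (B * t))"
        using cross_term(1)[OF U_pos zero_less_one U_eq, of t "f t"] by (simp add: algebra_simps)
      finally show ?thesis .
    qed
    ultimately show ?thesis using A1_pos by (simp add: wa_eq[of t] mult_ac)
  qed
  have P_nn: "0 \<le> P t" for t using F_nn by (simp add: P_def)
  have P_powr: "P t powr p = m' t * (F (m t) powr p * exp (\<gamma> * m t))" for t
  proof -
    have "P t powr p = F (m t) powr p * exp (\<gamma> * m t / p) powr p * (m' t powr (1 / p)) powr p"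
      using F_nn m'_pos[of t] by (simp add: P_def powr_mult)
    also have "exp (\<gamma> * m t / p) powr p = exp (\<gamma> * m t)" using p_pos by (simp add: powr_def)
    also have "(m' t powr (1 / p)) powr p = m' t" using p_pos m'_pos[of t] by (simp add: powr_powr)
    finally show ?thesis by (simp add: mult_ac)
  qed
  have Fm_cont: "continuous_on S (\<lambda>t. F (m t))" for S
    using continuous_on_compose2[OF F_cont m_cont] by auto
  have P_cont: "continuous_on S P" for S
    unfolding P_def using m'_pos p_pos by (intro continuous_intros Fm_cont m_cont m'_cont) (auto simp: less_imp_neq[symmetric])
  have Pp_cont: "continuous_on S (\<lambda>t. P t powr p)" for S
    using p_pos P_nn by (intro continuous_on_powr' P_cont continuous_intros) auto
  have PR_cont: "continuous_on S (\<lambda>t. \<bar>P t - Rf t\<bar> powr p)" for S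
    using p_pos by (intro continuous_on_powr' P_cont Rf_cont continuous_intros) auto
  have g_cont: "continuous_on S (\<lambda>t. wa t * amgm_gap \<iota> (m' t))" for S
    by (intro continuous_intros amgm_gap_continuous_on m'_cont m'_pos)
  have g_nn: "0 \<le> wa t * amgm_gap \<iota> (m' t)" for t
    using wa_pos[of t] amgm_gap_nonneg[OF \<iota>_pos \<iota>_less1 m'_pos] by simp
  define A2 where "A2 = p * A1 * B"
  have A2_pos: "0 < A2" using p_pos A1_pos B_pos by (simp add: A2_def)
  define lhs where "lhs T = A2 * integral {-T..T} (\<lambda>t. wa t * amgm_gap \<iota> (m' t))
      + 2 powr (1 - p) * integral {-T..T} (\<lambda>t. \<bar>P t - Rf t\<bar> powr p)" for T
  \<comment> \<open>Both integrands are nonnegative, so the bound at \<open>T\<close> is inherited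
    from larger \<open>S\<close>, whose boundary terms tend to 0.\<close>
  have lhs_mono: "lhs S \<le> lhs T" if "0 \<le> S" "S \<le> T" for S T
    unfolding lhs_def using that A2_pos
    by (intro add_mono mult_left_mono integral_subset_le integrable_continuous_interval g_cont PR_cont)
      (auto simp: g_nn)
  have step: "lhs T \<le> D - integral {-T..T} wb + p * A1 * (V T + wa (- T))" if T: "0 \<le> T" for T
  proof -
    let ?h = "\<lambda>t. A2 * (wa t * amgm_gap \<iota> (m' t)) + 2 powr (1 - p) * \<bar>P t - Rf t\<bar> powr p - P t powr p + wb t"
    have "integral {-T..T} ?h \<le> p * A1 * (V T - wa T) - p * A1 * (V (- T) - wa (- T))"
    proof (rule integral_le_by_antiderivative)
      show "continuous_on {-T..T} ?h"
        by (intro continuous_on_add continuous_on_diff continuous_on_mult_left g_cont PR_cont Pp_cont wb_cont)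
      fix t
      show "((\<lambda>t. p * A1 * (V t - wa t)) has_real_derivative p * A1 * (V' t - (- (wb t / A1) + B * wa t))) (at t)"
        by (rule derivative_eq_intros V_der VU_der refl)+ simp
      have cr: "Rf t powr (p - 1) * P t = A1 * (- V' t + B * wa t * (1 + amgm_gap \<iota> (m' t)))"
        unfolding V'_def E_def P_def cross_term(1)[OF u_pos[of "m t"] m'_pos[of t] eq[of t], of "F (m t)"]
          cross_term(2)[OF u_pos[of "m t"] m'_pos[of t] eq[of t]] by simp
      have rr: "Rf t powr (p - 1) * Rf t = wb t"
        using Rf_pos[of t] by (simp add: Rf_powr(1)[symmetric] powr_diff)
      have "wb t + p * (Rf t powr (p - 1) * P t - Rf t powr (p - 1) * Rf t) + 2 powr (1 - p) * \<bar>P t - Rf t\<bar> powr p \<le> P t powr p"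
        using powr_uniformly_convex[OF p2 less_imp_le[OF Rf_pos[of t]] P_nn[of t]]
        by (simp add: Rf_powr right_diff_distrib mult.assoc)
      then have "wb t + p * (A1 * (- V' t + B * wa t * (1 + amgm_gap \<iota> (m' t))) - wb t) + 2 powr (1 - p) * \<bar>P t - Rf t\<bar> powr p \<le> P t powr p"
        unfolding cr rr .
      moreover have "p * A1 * (V' t - (- (wb t / A1) + B * wa t)) = p * (A1 * V' t) + p * wb t - p * (A1 * (B * wa t))"
        using A1_pos by (simp add: algebra_simps)
      moreover have "p * (A1 * (- V' t + B * wa t * (1 + amgm_gap \<iota> (m' t))) - wb t)
        = - (p * (A1 * V' t)) + p * (A1 * (B * wa t)) + A2 * (wa t * amgm_gap \<iota> (m' t)) - p * wb t"
        by (simp add: A2_def algebra_simps)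
      ultimately show "?h t \<le> p * A1 * (V' t - (- (wb t / A1) + B * wa t))" by linarith
    qed (use T in simp)
    moreover have "integral {-T..T} ?h = lhs T - integral {-T..T} (\<lambda>t. P t powr p) + integral {-T..T} wb"
    proof -
      have i1: "(\<lambda>t. A2 * (wa t * amgm_gap \<iota> (m' t))) integrable_on {-T..T}"
        and i2: "(\<lambda>t. 2 powr (1 - p) * \<bar>P t - Rf t\<bar> powr p) integrable_on {-T..T}"
        and i3: "(\<lambda>t. P t powr p) integrable_on {-T..T}" and i4: "wb integrable_on {-T..T}"
        by (intro integrable_continuous_interval continuous_on_mult_left g_cont PR_cont Pp_cont wb_cont)+
      note ints = i1 i2 i3 i4
      have "integral {-T..T} ?h = integral {-T..T} (\<lambda>t. A2 * (wa t * amgm_gap \<iota> (m' t)) + 2 powr (1 - p) * \<bar>P t - Rf t\<bar> powr p - P t powr p)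
         + integral {-T..T} wb"
        by (intro Henstock_Kurzweil_Integration.integral_add integrable_diff integrable_add ints)
      also have "integral {-T..T} (\<lambda>t. A2 * (wa t * amgm_gap \<iota> (m' t)) + 2 powr (1 - p) * \<bar>P t - Rf t\<bar> powr p - P t powr p)
         = integral {-T..T} (\<lambda>t. A2 * (wa t * amgm_gap \<iota> (m' t)) + 2 powr (1 - p) * \<bar>P t - Rf t\<bar> powr p) - integral {-T..T} (\<lambda>t. P t powr p)"
        by (intro Henstock_Kurzweil_Integration.integral_diff integrable_add ints)
      also have "integral {-T..T} (\<lambda>t. A2 * (wa t * amgm_gap \<iota> (m' t)) + 2 powr (1 - p) * \<bar>P t - Rf t\<bar> powr p) = lhs T"
        unfolding lhs_def by (subst Henstock_Kurzweil_Integration.integral_add[OF i1 i2]) simp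
      finally show ?thesis .
    qed
    moreover have "integral {-T..T} (\<lambda>t. P t powr p) \<le> D"
    proof -
      have cv: "integrable lborel (\<lambda>t. m' t * (F (m t) powr p * exp (\<gamma> * m t)))"
        "(\<integral>t. m' t * (F (m t) powr p * exp (\<gamma> * m t)) \<partial>lborel) = D"
        using lborel_change_of_variables[OF m_der less_imp_le[OF m'_pos] m(3)
          borel_measurable_continuous_onI[OF m'_cont] borel_measurable_continuous_onI[OF F_powr_cont]] F_int
        by (auto simp: D_def)
      show ?thesis
        using integral_interval_le_LINT[OF cv(1)] Pp_cont[of UNIV] cv(2) m'_pos
        by (simp add: P_powr less_imp_le)
    qed
    \<comment> \<open>At the left end \<open>V\<close> enters with the favourable sign, so there
      only \<open>wa (- T)\<close> has to vanish.\<close>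
    moreover have "p * A1 * (V T - wa T) - p * A1 * (V (- T) - wa (- T)) \<le> p * A1 * (V T + wa (- T))"
    proof -
      have "0 \<le> V (- T)" "0 \<le> wa T" using wa_pos[of T] by (auto simp: V_def E_def)
      then have "0 \<le> p * A1 * (V (- T) + wa T)" using p_pos A1_pos by auto
      then show ?thesis by (simp add: algebra_simps)
    qed
    ultimately show ?thesis by linarith
  qed
  \<comment> \<open>\<open>V t\<close> is
    \<open>w (m t) powr (1 - \<iota>) * exp (B * \<iota> * t)\<close>. By the tail condition
    \<open>w (m t)\<close> is at most a multiple of the mass of \<open>u\<close> beyond
    \<open>m t\<close>, which equals that of \<open>U\<close> beyond \<open>t\<close> and is
    \<open>O(exp (- (\<delta> * t)))\<close>. The total exponent is negative because
    \<open>\<iota> * p < 1\<close>.\<close>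
  have V_lim: "(V \<longlongrightarrow> 0) at_top"
  proof (rule tendsto_sandwich)
    show "eventually (\<lambda>t. 0 \<le> V t) at_top" by (simp add: V_def E_def)
    obtain t0 where t0: "m t0 = R" using m(3) by (metis bij_pointE)
    have smG: "strict_mono G"
      by (rule strict_monoI) (rule DERIV_pos_imp_increasing, assumption, use G(1) w_pos in blast)
    define C where "C = (exp \<Lambda> / \<delta>) powr (1 - \<iota>)"
    show "eventually (\<lambda>t. V t \<le> C * exp ((B * \<iota> - \<delta> * (1 - \<iota>)) * t)) at_top"
    proof (rule eventually_at_top_linorderI[of "max 0 t0"])
      fix t assume "max 0 t0 \<le> t"
      then have t: "0 \<le> t" "R \<le> m t" using strict_mono_leD[OF m(4), of t0 t] t0 by auto
      have "w (m t) \<le> exp \<Lambda> * (QU - H t)"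
      proof -
        obtain s where s: "m t < s" "s < m t + 1" "G (m t + 1) - G (m t) = (m t + 1 - m t) * w s"
          using MVT2[of "m t" "m t + 1" G w] G(1) by auto
        have "w (m t) \<le> exp \<Lambda> * w s" using w_tail_ratio[OF t(2), of s] s by auto
        also have "w s = G (m t + 1) - H t" using s(3) m(2)[of t] by simp
        also have "G (m t + 1) - H t \<le> QU - H t"
          using strict_mono_limits_strict(2)[OF smG G(2,3), of "m t + 1"] by simp
        finally show ?thesis by simp
      qed
      also have "QU - H t \<le> exp (- (\<delta> * t)) / \<delta>"
      proof -
        have "((\<lambda>s. H s + exp (- (\<delta> * s)) / \<delta>) \<longlongrightarrow> QU + 0) at_top"
        proof (intro tendsto_add H(3))
          have "((\<lambda>s. exp (- (\<delta> * s))) \<longlongrightarrow> 0) at_top"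
            using \<delta>_pos by (rule exp_neg_mult_tendsto_0)
          then show "((\<lambda>s. exp (- (\<delta> * s)) / \<delta>) \<longlongrightarrow> 0) at_top"
            using tendsto_divide[OF _ tendsto_const, of _ 0 at_top \<delta>] \<delta>_pos by force
        qed
        moreover have "H s + exp (- (\<delta> * s)) / \<delta> \<le> H t + exp (- (\<delta> * t)) / \<delta>" if "t \<le> s" for s
        proof (rule DERIV_nonpos_imp_nonincreasing[OF that, of "\<lambda>s. H s + exp (- (\<delta> * s)) / \<delta>"])
          fix x assume x: "t \<le> x"
          have "((\<lambda>s. H s + exp (- (\<delta> * s)) / \<delta>) has_real_derivative wh x - exp (- (\<delta> * x))) (at x)"
            using \<delta>_pos by (auto intro!: derivative_eq_intros H(1))
          moreover have "wh x - exp (- (\<delta> * x)) \<le> 0" using wh_le_right[of x] x t by simp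
          ultimately show "\<exists>y. ((\<lambda>s. H s + exp (- (\<delta> * s)) / \<delta>) has_real_derivative y) (at x) \<and> y \<le> 0" by blast
        qed
        ultimately have "QU + 0 \<le> H t + exp (- (\<delta> * t)) / \<delta>"
          by (intro tendsto_upperbound) (auto intro: eventually_at_top_linorderI[of t])
        then show ?thesis by simp
      qed
      finally have "w (m t) \<le> exp \<Lambda> * (exp (- (\<delta> * t)) / \<delta>)" by simp
      then have "w (m t) \<le> exp \<Lambda> / \<delta> * exp (- (\<delta> * t))" by simp
      then have "w (m t) powr (1 - \<iota>) \<le> (exp \<Lambda> / \<delta> * exp (- (\<delta> * t))) powr (1 - \<iota>)"
        using \<iota>_less1 w_pos[of "m t"] by (intro powr_mono2) auto
      also have "\<dots> = C * exp (- (\<delta> * (1 - \<iota>) * t))"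
        using \<delta>_pos unfolding C_def by (subst powr_mult) (simp_all add: powr_def mult_ac)
      finally have "w (m t) powr (1 - \<iota>) * exp (B * \<iota> * t) \<le> C * exp (- (\<delta> * (1 - \<iota>) * t)) * exp (B * \<iota> * t)"
        by (intro mult_right_mono) auto
      also have "\<dots> = C * exp ((B * \<iota> - \<delta> * (1 - \<iota>)) * t)"
        by (simp add: mult.assoc exp_add[symmetric] left_diff_distrib)
      also have "w (m t) powr (1 - \<iota>) * exp (B * \<iota> * t) = V t"
      proof -
        have "w (m t) powr (1 - \<iota>) = u (m t) powr (q * (1 - \<iota>)) * exp (B * m t) powr (1 - \<iota>)"
          using u_pos by (simp add: w_def powr_mult powr_powr)
        moreover have "exp (B * m t) powr (1 - \<iota>) * exp (B * \<iota> * t) = E t"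
          unfolding E_def powr_def by (simp add: exp_add[symmetric] algebra_simps)
        ultimately show ?thesis unfolding V_def by (simp add: mult.assoc)
      qed
      finally show "V t \<le> C * exp ((B * \<iota> - \<delta> * (1 - \<iota>)) * t)" .
    qed
    have neg: "B * \<iota> - \<delta> * (1 - \<iota>) < 0"
    proof -
      have "B * \<iota> - \<delta> * (1 - \<iota>) = B * (\<iota> * p - 1) / (p - 1)"
        unfolding \<delta>_def using p1_pos by (simp add: divide_simps) (simp add: algebra_simps)
      moreover have "\<iota> * p < 1" using \<iota>_less p_pos by (simp add: field_simps)
      ultimately show ?thesis using B_pos p1_pos by (simp add: divide_neg_pos mult_pos_neg)
    qed
    have "filterlim (\<lambda>t. (B * \<iota> - \<delta> * (1 - \<iota>)) * t) at_bot at_top"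
      using neg by (rule filterlim_tendsto_neg_mult_at_bot[OF tendsto_const _ filterlim_ident])
    then have "((\<lambda>t. exp ((B * \<iota> - \<delta> * (1 - \<iota>)) * t)) \<longlongrightarrow> 0) at_top"
      by (rule filterlim_compose[OF exp_at_bot])
    from tendsto_mult[OF tendsto_const this, of C]
    show "((\<lambda>t. C * exp ((B * \<iota> - \<delta> * (1 - \<iota>)) * t)) \<longlongrightarrow> 0) at_top" by simp
  qed simp
  have wa_lim: "((\<lambda>T. wa (- T)) \<longlongrightarrow> 0) at_top"
  proof (rule tendsto_sandwich)
    show "eventually (\<lambda>T. 0 \<le> wa (- T)) at_top" using wa_pos by (simp add: less_imp_le)
    have "wa (- T) \<le> exp (- (B * T))" for T
    proof -
      have "L (- T) powr (1 - q * k) \<le> 1 powr (1 - q * k)"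
        using L_bounds_left(1)[of "- T"] qk_gt by (intro powr_mono2') auto
      then show ?thesis by (simp add: wa_def)
    qed
    then show "eventually (\<lambda>T. wa (- T) \<le> exp (- (B * T))) at_top" by simp
    show "((\<lambda>T. exp (- (B * T))) \<longlongrightarrow> 0) at_top"
      using B_pos by (rule exp_neg_mult_tendsto_0)
  qed simp
  have "lhs T \<le> D - DU" if T: "0 \<le> T" for T
  proof (rule tendsto_lowerbound)
    show "((\<lambda>S. D - integral {-S..S} wb + p * A1 * (V S + wa (- S))) \<longlongrightarrow> D - DU) at_top"
      unfolding DU_def
      by (rule tendsto_eq_intros integral_symmetric_interval_tendsto wb_integrable wb_cont V_lim wa_lim refl | simp)+
    show "eventually (\<lambda>S. lhs T \<le> D - integral {-S..S} wb + p * A1 * (V S + wa (- S))) at_top"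
    proof (rule eventually_at_top_linorderI[of T])
      fix S assume "T \<le> S"
      then show "lhs T \<le> D - integral {-S..S} wb + p * A1 * (V S + wa (- S))"
        using lhs_mono[of T S] step[of S] T by linarith
    qed
  qed simp
  then show thesis
    using that[OF m_der m'_cont m'_pos m(3) mono] by (simp add: lhs_def P_def A2_def)
qed

end

context bliss
begin

text \<open>Pulled back by \<open>m\<close>, the energy distance compares \<open>P t\<close> with
  \<open>Rf (mb t) * m' t powr (1 / p)\<close>. With \<open>Rf t\<close> inserted in between, the
  first difference is the remainder in the deficit and the second is bounded by the Hellinger
  integrand. The factor \<open>exp (\<gamma> * \<theta> / p)\<close> keeps the energy of the
  translate equal to \<open>DU\<close>.\<close>

theorem profile_stability:
  obtains C where "0 < C"
    "\<And>u F \<epsilon> R. bliss_profile p \<gamma> B u F \<epsilon> R \<Longrightarrow>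
      \<exists>\<theta>. integrable lborel (\<lambda>t. \<bar>F t - exp (\<gamma> * \<theta> / p) * f (t + \<theta>)\<bar> powr p * exp (\<gamma> * t)) \<and>
        (\<integral>t. \<bar>F t - exp (\<gamma> * \<theta> / p) * f (t + \<theta>)\<bar> powr p * exp (\<gamma> * t) \<partial>lborel)
          \<le> C * ((\<integral>t. F t powr p * exp (\<gamma> * t) \<partial>lborel) - DU)"
proof -
  obtain CH where CH: "0 < CH"
    "\<And>m m' \<Gamma> T. m 0 = 0 \<Longrightarrow> (\<And>t. (m has_real_derivative m' t) (at t)) \<Longrightarrow>
      continuous_on UNIV m' \<Longrightarrow> (\<And>t. 0 < m' t) \<Longrightarrow>
      mono (\<lambda>t. exp (B * m t) * m' t / wh t) \<Longrightarrow>
      (\<And>T. 0 \<le> T \<Longrightarrow> integral {-T..T} (\<lambda>t. wa t * amgm_gap \<iota> (m' t)) \<le> \<Gamma>) \<Longrightarrow> 0 \<le> T \<Longrightarrow>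
      integral {-T..T} (\<lambda>t. wb t - sqrt (wb t * wb (m t) * m' t))
        \<le> CH * \<Gamma> + c2 * (exp (- (\<kappa> * T)) + exp (- (B * T)))"
    using Hellinger_bound by blast
  define A2 where "A2 = p * A1 * B"
  have A2: "0 < A2" using p_pos A1_pos B_pos by (simp add: A2_def)
  \<comment> \<open>The two summands come from the remainder of uniform convexity and from the
    Hellinger bound, the outer factor from the triangle inequality for \<open>p\<close>-th
    powers.\<close>
  define C where "C = 2 powr (p - 1) * (2 powr (p - 1) + 2 * CH / A2)"
  show thesis
  proof
    show "0 < C" using A2 CH(1) unfolding C_def by (intro mult_pos_pos add_pos_pos divide_pos_pos) auto
    fix u F \<epsilon> R
    assume "bliss_profile p \<gamma> B u F \<epsilon> R"
    then interpret bliss_profile p \<gamma> B u F \<epsilon> R .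
    obtain m m' where m: "\<And>t. (m has_real_derivative m' t) (at t)" and m'_cont: "continuous_on UNIV m'"
      and m'_pos: "\<And>t. 0 < m' t" and bij: "bij m" and mono: "mono (\<lambda>t. exp (B * m t) * m' t / wh t)"
      and def: "\<And>T. 0 \<le> T \<Longrightarrow> p * A1 * B * integral {-T..T} (\<lambda>t. wa t * amgm_gap \<iota> (m' t))
      + 2 powr (1 - p) * integral {-T..T} (\<lambda>t. \<bar>F (m t) * exp (\<gamma> * m t / p) * m' t powr (1 / p) - Rf t\<bar> powr p)
      \<le> D - DU"
      by (rule deficit) (rule that)
    define P where "P t = F (m t) * exp (\<gamma> * m t / p) * m' t powr (1 / p)" for t
    \<comment> \<open>This translation makes \<open>mb\<close> fix 0, as the Hellinger bound
      requires.\<close>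
    define \<theta> where "\<theta> = - m 0"
    define mb where "mb t = m t + \<theta>" for t
    have mb: "(mb has_real_derivative m' t) (at t)" for t
      unfolding mb_def[abs_def] by (auto intro!: derivative_eq_intros m)
    have mb0: "mb 0 = 0" by (simp add: mb_def \<theta>_def)
    have mb_bij: "bij mb"
    proof -
      have "bij ((\<lambda>x. x + \<theta>) \<circ> m)" by (intro bij_comp bij bij_plus_right)
      then show ?thesis by (simp add: mb_def[abs_def] comp_def)
    qed
    have m_cont: "continuous_on S m" and mb_cont: "continuous_on S mb" for S
      by (meson m mb DERIV_isCont continuous_at_imp_continuous_on)+
    have m'c: "continuous_on S m'" for S using continuous_on_subset[OF m'_cont] by auto
    have mb_mono: "mono (\<lambda>t. exp (B * mb t) * m' t / wh t)"
    proof (rule monoI)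
      fix s t :: real assume "s \<le> t"
      then have "exp (B * \<theta>) * (exp (B * m s) * m' s / wh s) \<le> exp (B * \<theta>) * (exp (B * m t) * m' t / wh t)"
        by (intro mult_left_mono monoD[OF mono]) auto
      then show "exp (B * mb s) * m' s / wh s \<le> exp (B * mb t) * m' t / wh t"
        by (simp add: mb_def distrib_left exp_add mult_ac)
    qed
    have Fm_cont: "continuous_on S (\<lambda>t. F (m t))" for S
      using continuous_on_compose2[OF F_cont m_cont] by auto
    have wbm_cont: "continuous_on S (\<lambda>t. wb (mb t))" for S
      using continuous_on_compose2[OF wb_cont[of UNIV] mb_cont] by auto
    have P_cont: "continuous_on S P" for S
      unfolding P_def using m'_pos p_pos
      by (intro continuous_intros Fm_cont m_cont m'c) (auto simp: less_imp_neq[symmetric])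
    have PR_cont: "continuous_on S (\<lambda>t. \<bar>P t - Rf t\<bar> powr p)" for S
      using p_pos by (intro continuous_on_powr' P_cont Rf_cont continuous_intros) auto
    have g_cont: "continuous_on S (\<lambda>t. wa t * amgm_gap \<iota> (m' t))" for S
      by (intro continuous_intros amgm_gap_continuous_on m'c m'_pos)
    have g_nn: "0 \<le> wa t * amgm_gap \<iota> (m' t)" for t
      using wa_pos[of t] amgm_gap_nonneg[OF \<iota>_pos \<iota>_less1 m'_pos] by simp
    define \<Delta> where "\<Delta> = D - DU"
    let ?Ig = "\<lambda>T. integral {-T..T} (\<lambda>t. wa t * amgm_gap \<iota> (m' t))"
    let ?IP = "\<lambda>T. integral {-T..T} (\<lambda>t. \<bar>P t - Rf t\<bar> powr p)"
    have Ig_nn: "0 \<le> ?Ig T" and IP_nn: "0 \<le> ?IP T" for T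
      by (auto intro!: Henstock_Kurzweil_Integration.integral_nonneg integrable_continuous_interval g_cont PR_cont g_nn)
    have def': "A2 * ?Ig T + 2 powr (1 - p) * ?IP T \<le> \<Delta>" if "0 \<le> T" for T
      using def[OF that] by (simp add: A2_def P_def \<Delta>_def)
    have Ig: "?Ig T \<le> \<Delta> / A2" if "0 \<le> T" for T
    proof -
      have "0 \<le> 2 powr (1 - p) * ?IP T" using IP_nn by simp
      then have "A2 * ?Ig T \<le> \<Delta>" using def'[OF that] by linarith
      then show ?thesis using A2 by (simp add: field_simps)
    qed
    have IP: "?IP T \<le> 2 powr (p - 1) * \<Delta>" if "0 \<le> T" for T
    proof -
      have "0 \<le> A2 * ?Ig T" using Ig_nn A2 by simp
      then have "2 powr (1 - p) * ?IP T \<le> \<Delta>" using def'[OF that] by linarith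
      then have "2 powr (p - 1) * (2 powr (1 - p) * ?IP T) \<le> 2 powr (p - 1) * \<Delta>"
        by (intro mult_left_mono) auto
      then show ?thesis by (simp add: mult.assoc[symmetric] powr_add[symmetric])
    qed
    define df where "df t = wb t - sqrt (wb t * wb (mb t) * m' t)" for t
    have df_cont: "continuous_on S df" for S
      unfolding df_def by (intro continuous_intros wbm_cont m'c)
    have Idf: "integral {-T..T} df \<le> CH * (\<Delta> / A2) + c2 * (exp (- (\<kappa> * T)) + exp (- (B * T)))" if "0 \<le> T" for T
      unfolding df_def by (rule CH(2)[OF mb0 mb m'_cont m'_pos mb_mono Ig that])
    have mbw: "integrable lborel (\<lambda>t. m' t * wb (mb t))" "(\<integral>t. m' t * wb (mb t) \<partial>lborel) = DU"
      using lborel_change_of_variables[OF mb less_imp_le[OF m'_pos] mb_bij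
        borel_measurable_continuous_onI[OF m'_cont] borel_measurable_continuous_onI[OF wb_cont]]
        wb_integrable by (auto simp: DU_def)
    have mw_cont: "continuous_on S (\<lambda>t. m' t * wb (mb t))" for S
      by (intro continuous_intros wbm_cont m'c)
    have Imw: "integral {-T..T} (\<lambda>t. m' t * wb (mb t)) \<le> DU" for T
      using integral_interval_le_LINT[OF mbw(1) mw_cont] m'_pos wb_pos mbw(2) by (simp add: less_imp_le)
    define g where "g t = \<bar>F t - exp (\<gamma> * \<theta> / p) * f (t + \<theta>)\<bar> powr p * exp (\<gamma> * t)" for t
    have f\<theta>_cont: "continuous_on S (\<lambda>t. f (t + \<theta>))" for S
      by (rule continuous_on_compose2[OF f_cont[of UNIV]]) (auto intro!: continuous_intros)
    have gc: "continuous_on UNIV g"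
      unfolding g_def using p_pos by (intro continuous_intros continuous_on_powr' F_cont f\<theta>_cont) auto
    define X where "X t = m' t * g (m t)" for t
    have X_nn: "0 \<le> X t" for t using m'_pos[of t] by (simp add: X_def g_def)
    have X_cont: "continuous_on S X" for S
      unfolding X_def using continuous_on_compose2[OF gc m_cont] by (intro continuous_intros m'c) auto
    have X_le: "X t \<le> 2 powr (p - 1) * (\<bar>P t - Rf t\<bar> powr p + (2 * df t + m' t * wb (mb t) - wb t))" for t
    proof -
      have "P t - Rf (mb t) * m' t powr (1 / p)
          = (F (m t) - exp (\<gamma> * \<theta> / p) * f (m t + \<theta>)) * (exp (\<gamma> * m t / p) * m' t powr (1 / p))"
      proof -
        have "exp (\<gamma> * mb t / p) = exp (\<gamma> * \<theta> / p) * exp (\<gamma> * m t / p)"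
          by (simp add: mb_def distrib_left add_divide_distrib flip: exp_add)
        then show ?thesis by (simp add: P_def Rf_def mb_def algebra_simps)
      qed
      then have "\<bar>P t - Rf (mb t) * m' t powr (1 / p)\<bar> powr p
          = \<bar>F (m t) - exp (\<gamma> * \<theta> / p) * f (m t + \<theta>)\<bar> powr p * (exp (\<gamma> * m t / p) powr p * (m' t powr (1 / p)) powr p)"
        by (simp add: abs_mult powr_mult)
      also have "exp (\<gamma> * m t / p) powr p = exp (\<gamma> * m t)" using p_pos by (simp add: powr_def)
      also have "(m' t powr (1 / p)) powr p = m' t" using p_pos m'_pos[of t] by (simp add: powr_powr)
      finally have X_eq: "X t = \<bar>P t - Rf (mb t) * m' t powr (1 / p)\<bar> powr p"
        by (simp add: X_def g_def mult_ac)
      also have "\<dots> \<le> 2 powr (p - 1) * (\<bar>P t - Rf t\<bar> powr p + \<bar>Rf t - Rf (mb t) * m' t powr (1 / p)\<bar> powr p)"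
        using norm_diff_powr_le[of p "P t" "Rf (mb t) * m' t powr (1 / p)" "Rf t"] p2 by simp
      also have "\<bar>Rf t - Rf (mb t) * m' t powr (1 / p)\<bar> powr p \<le> (sqrt (wb t) - sqrt (m' t * wb (mb t)))\<^sup>2"
      proof -
        have "Rf (mb t) * m' t powr (1 / p) = (m' t * wb (mb t)) powr (1 / p)"
          using m'_pos[of t] wb_pos[of "mb t"] by (simp add: powr_mult Rf_powr)
        then show ?thesis
          using root_diff_powr_le_Hellinger[OF p2, of "wb t" "m' t * wb (mb t)"] m'_pos[of t] wb_pos[of t] wb_pos[of "mb t"]
          by (simp add: Rf_powr less_imp_le)
      qed
      \<comment> \<open>The squared Hellinger integrand is twice the defect plus the difference of
        two densities of the same total mass \<open>DU\<close>; that difference contributes nothing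
        as \<open>T\<close> tends to infinity.\<close>
      also have "(sqrt (wb t) - sqrt (m' t * wb (mb t)))\<^sup>2 = 2 * df t + m' t * wb (mb t) - wb t"
      proof -
        have "0 \<le> wb t" "0 \<le> m' t * wb (mb t)"
          using m'_pos[of t] wb_pos[of t] wb_pos[of "mb t"] by (auto simp: less_imp_le)
        then have "(sqrt (wb t) - sqrt (m' t * wb (mb t)))\<^sup>2 = wb t + m' t * wb (mb t) - 2 * sqrt (wb t * (m' t * wb (mb t)))"
          unfolding power2_diff real_sqrt_mult[of "wb t" "m' t * wb (mb t)"] by simp
        then show ?thesis by (simp add: df_def mult_ac)
      qed
      finally show ?thesis by simp
    qed
    have step: "integral {-T..T} X \<le> 2 powr (p - 1) * (2 powr (p - 1) * \<Delta> + 2 * (CH * (\<Delta> / A2)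
        + c2 * (exp (- (\<kappa> * T)) + exp (- (B * T)))) + DU - integral {-T..T} wb)" (is "_ \<le> ?rhs T") if T: "0 \<le> T" for T
    proof -
      let ?Y = "\<lambda>t. \<bar>P t - Rf t\<bar> powr p + (2 * df t + m' t * wb (mb t) - wb t)"
      have Yc: "continuous_on {-T..T} ?Y"
        by (intro continuous_on_add continuous_on_diff continuous_on_mult_left PR_cont df_cont mw_cont wb_cont)
      have "integral {-T..T} X \<le> integral {-T..T} (\<lambda>t. 2 powr (p - 1) * ?Y t)"
        by (intro integral_le integrable_continuous_interval continuous_on_mult_left Yc X_cont X_le)
      also have "\<dots> = 2 powr (p - 1) * integral {-T..T} ?Y" by simp
      also have "integral {-T..T} ?Y = ?IP T + (2 * integral {-T..T} df
          + integral {-T..T} (\<lambda>t. m' t * wb (mb t)) - integral {-T..T} wb)"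
      proof -
        have i: "(\<lambda>t. \<bar>P t - Rf t\<bar> powr p) integrable_on {-T..T}" "(\<lambda>t. 2 * df t) integrable_on {-T..T}"
          "(\<lambda>t. m' t * wb (mb t)) integrable_on {-T..T}" "wb integrable_on {-T..T}"
          by (intro integrable_continuous_interval continuous_on_mult_left PR_cont df_cont mw_cont wb_cont)+
        then show ?thesis
          by (simp add: Henstock_Kurzweil_Integration.integral_add Henstock_Kurzweil_Integration.integral_diff
              integrable_add integrable_diff)
      qed
      also have "2 powr (p - 1) * (?IP T + (2 * integral {-T..T} df
          + integral {-T..T} (\<lambda>t. m' t * wb (mb t)) - integral {-T..T} wb)) \<le> ?rhs T"
        using IP[OF T] Idf[OF T] Imw[of T] by (intro mult_left_mono) auto
      finally show ?thesis .
    qed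
    have lim: "((\<lambda>T. 2 powr (p - 1) * (2 powr (p - 1) * \<Delta> + 2 * (CH * (\<Delta> / A2)
        + c2 * (exp (- (\<kappa> * T)) + exp (- (B * T)))) + DU - integral {-T..T} wb)) \<longlongrightarrow> C * \<Delta>) at_top"
    proof -
      have "((\<lambda>T. 2 powr (p - 1) * (2 powr (p - 1) * \<Delta> + 2 * (CH * (\<Delta> / A2)
        + c2 * (exp (- (\<kappa> * T)) + exp (- (B * T)))) + DU - integral {-T..T} wb)) \<longlongrightarrow>
        2 powr (p - 1) * (2 powr (p - 1) * \<Delta> + 2 * (CH * (\<Delta> / A2) + c2 * (0 + 0)) + DU - DU)) at_top"
        unfolding DU_def
        by (intro tendsto_intros exp_neg_mult_tendsto_0 \<kappa>_pos B_pos integral_symmetric_interval_tendsto wb_integrable wb_cont)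
      then show ?thesis by (simp add: C_def algebra_simps)
    qed
    have IX: "integral {-T..T} X \<le> C * \<Delta>" if T: "0 \<le> T" for T
    proof (rule tendsto_lowerbound[OF lim])
      show "eventually (\<lambda>S. integral {-T..T} X \<le> 2 powr (p - 1) * (2 powr (p - 1) * \<Delta> + 2 * (CH * (\<Delta> / A2)
        + c2 * (exp (- (\<kappa> * S)) + exp (- (B * S)))) + DU - integral {-S..S} wb)) at_top"
      proof (rule eventually_at_top_linorderI[of T])
        fix S assume "T \<le> S"
        then have "integral {-T..T} X \<le> integral {-S..S} X"
          by (intro integral_subset_le integrable_continuous_interval X_cont) (auto simp: X_nn)
        then show "integral {-T..T} X \<le> 2 powr (p - 1) * (2 powr (p - 1) * \<Delta> + 2 * (CH * (\<Delta> / A2)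
        + c2 * (exp (- (\<kappa> * S)) + exp (- (B * S)))) + DU - integral {-S..S} wb)"
          using step[of S] T \<open>T \<le> S\<close> by linarith
      qed
    qed simp
    have "integrable lborel X" "(\<integral>t. X t \<partial>lborel) \<le> C * \<Delta>"
      using integrable_if_interval_integrals_bounded[OF X_cont X_nn IX] by auto
    then have "integrable lborel g" "(\<integral>t. g t \<partial>lborel) \<le> C * \<Delta>"
      using lborel_change_of_variables[OF m less_imp_le[OF m'_pos] bij
        borel_measurable_continuous_onI[OF m'_cont] borel_measurable_continuous_onI[OF gc]]
      by (auto simp: X_def[abs_def])
    then show "\<exists>\<theta>. integrable lborel (\<lambda>t. \<bar>F t - exp (\<gamma> * \<theta> / p) * f (t + \<theta>)\<bar> powr p * exp (\<gamma> * t)) \<and>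
        (\<integral>t. \<bar>F t - exp (\<gamma> * \<theta> / p) * f (t + \<theta>)\<bar> powr p * exp (\<gamma> * t) \<partial>lborel)
          \<le> C * ((\<integral>t. F t powr p * exp (\<gamma> * t) \<partial>lborel) - DU)"
      unfolding g_def \<Delta>_def D_def by blast
  qed
qed

end

section \<open>Density and tail integrals\<close>

text \<open>Young's inequality with cruder constants, by comparing \<open>y\<close> with
  \<open>x powr (p - 1)\<close>.\<close>

lemma young_powr_le:
  fixes x y p :: real
  assumes "0 \<le> x" "0 \<le> y" "1 < p"
  shows "x * y \<le> x powr p + y powr (p / (p - 1))"
proof (cases "y \<le> x powr (p - 1)")
  case True
  then have "x * y \<le> x * x powr (p - 1)" using assms by (intro mult_left_mono)
  also have "\<dots> = x powr p" using assms by (cases "x = 0") (auto simp: powr_diff)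
  finally show ?thesis by (smt (verit) powr_ge_zero)
next
  case False
  then have "(x powr (p - 1)) powr (1 / (p - 1)) \<le> y powr (1 / (p - 1))"
    using assms by (intro powr_mono2) auto
  then have "x \<le> y powr (1 / (p - 1))" using assms by (simp add: powr_powr)
  then have "x * y \<le> y powr (1 / (p - 1)) * y" using assms by (intro mult_right_mono)
  also have "\<dots> = y powr (p / (p - 1))"
  proof (cases "y = 0")
    case False
    then have "y powr (1 / (p - 1)) * y = y powr (1 / (p - 1) + 1)" using assms by (simp add: powr_add)
    also have "1 / (p - 1) + 1 = p / (p - 1)" using assms by (simp add: field_simps)
    finally show ?thesis .
  qed auto
  finally show ?thesis by (smt (verit) powr_ge_zero)
qed

lemma integrable_if_abs_le:
  fixes f g :: "'b \<Rightarrow> real"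
  assumes "integrable M g" "f \<in> borel_measurable M" "\<And>t. \<bar>f t\<bar> \<le> g t"
  shows "integrable M f"
  by (rule Bochner_Integration.integrable_bound[OF assms(1,2)])
    (use assms(3) in \<open>auto intro: order_trans[OF _ abs_ge_self]\<close>)

text \<open>\<open>F\<close> is cut off in height and support, approximated almost everywhere by
  continuous functions, and these are clamped to a common height and compact support, so that
  dominated convergence gives the weighted norm.\<close>

lemma weighted_Lp_density:
  fixes F :: "real \<Rightarrow> real" and p \<gamma> e :: real
  assumes p: "1 \<le> p" and [measurable]: "F \<in> borel_measurable borel" and nn: "\<And>t. 0 \<le> F t"
    and int: "integrable lborel (\<lambda>t. F t powr p * exp (\<gamma> * t))" and e: "0 < e"
  obtains G R where "continuous_on UNIV G" "\<And>t. 0 \<le> G t" "\<And>t. R < \<bar>t\<bar> \<Longrightarrow> G t = 0"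
    "integrable lborel (\<lambda>t. \<bar>F t - G t\<bar> powr p * exp (\<gamma> * t))"
    "(\<integral>t. \<bar>F t - G t\<bar> powr p * exp (\<gamma> * t) \<partial>lborel) < e"
proof -
  define F1 where "F1 n t = min (F t) (real n) * indicator {-real n..real n} t" for n t
  have F1_nn: "0 \<le> F1 n t" "F1 n t \<le> F t" "F1 n t \<le> real n" for n t
    using nn[of t] by (auto simp: F1_def indicator_def)
  have [measurable]: "F1 n \<in> borel_measurable borel" for n unfolding F1_def[abs_def] by measurable
  define e' where "e' = e / (2 * 2 powr (p - 1))"
  have e': "0 < e'" using e by (simp add: e'_def)
  have lim1: "(\<lambda>n. \<integral>t. \<bar>F t - F1 n t\<bar> powr p * exp (\<gamma> * t) \<partial>lborel) \<longlonglongrightarrow> (\<integral>t. 0 \<partial>(lborel :: real measure))"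
    and int1: "integrable lborel (\<lambda>t. \<bar>F t - F1 n t\<bar> powr p * exp (\<gamma> * t))" for n
  proof -
    have conv: "AE t in lborel. (\<lambda>n. \<bar>F t - F1 n t\<bar> powr p * exp (\<gamma> * t)) \<longlonglongrightarrow> 0"
    proof (rule AE_I2)
      fix t
      obtain n0 where n0: "max (F t) \<bar>t\<bar> \<le> real n0" using real_arch_simple by blast
      have "eventually (\<lambda>n. \<bar>F t - F1 n t\<bar> powr p * exp (\<gamma> * t) = 0) sequentially"
        using eventually_ge_at_top[of n0]
      proof eventually_elim
        case (elim n)
        then have "max (F t) \<bar>t\<bar> \<le> real n" using n0 by linarith
        then show ?case by (auto simp: F1_def indicator_def)
      qed
      then show "(\<lambda>n. \<bar>F t - F1 n t\<bar> powr p * exp (\<gamma> * t)) \<longlonglongrightarrow> 0" by (rule tendsto_eventually)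
    qed
    have dom: "AE t in lborel. norm (\<bar>F t - F1 n t\<bar> powr p * exp (\<gamma> * t)) \<le> F t powr p * exp (\<gamma> * t)" for n
      using F1_nn p by (auto simp: powr_mono2)
    show "(\<lambda>n. \<integral>t. \<bar>F t - F1 n t\<bar> powr p * exp (\<gamma> * t) \<partial>lborel) \<longlonglongrightarrow> (\<integral>t. 0 \<partial>(lborel :: real measure))"
      by (rule integral_dominated_convergence[OF _ _ int conv dom]) measurable
    show "integrable lborel (\<lambda>t. \<bar>F t - F1 n t\<bar> powr p * exp (\<gamma> * t))"
      by (rule integrable_if_abs_le[OF int]) (use F1_nn p in \<open>auto simp: powr_mono2\<close>)
  qed
  have "eventually (\<lambda>n. (\<integral>t. \<bar>F t - F1 n t\<bar> powr p * exp (\<gamma> * t) \<partial>lborel) < e') sequentially"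
    using lim1 e' by (intro order_tendstoD(2)) auto
  then obtain n where n: "(\<integral>t. \<bar>F t - F1 n t\<bar> powr p * exp (\<gamma> * t) \<partial>lborel) < e'"
    unfolding eventually_sequentially by blast
  have "F1 n measurable_on UNIV"
    by (subst measurable_on_iff_borel_measurable) (auto intro: borel_measurable_if_D measurable_completion simp: lebesgue_on_UNIV_eq)
  then obtain N g where N: "negligible N" and g: "\<And>i. continuous_on UNIV (g i)"
    "\<And>t. t \<notin> N \<Longrightarrow> (\<lambda>i. g i t) \<longlonglongrightarrow> F1 n t"
    unfolding measurable_on_def by auto
  define chi where "chi t = max 0 (min 1 (real n + 1 - \<bar>t\<bar>))" for t :: real
  define G where "G i t = chi t * max 0 (min (real n) (g i t))" for i t
  have chi: "0 \<le> chi t" "chi t \<le> 1" "real n + 1 < \<bar>t\<bar> \<Longrightarrow> chi t = 0" "\<bar>t\<bar> \<le> real n \<Longrightarrow> chi t = 1" for t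
    by (auto simp: chi_def)
  have Gc: "continuous_on UNIV (G i)" for i
    unfolding G_def chi_def by (intro continuous_intros g)
  have G_nn: "0 \<le> G i t" for i t using chi by (simp add: G_def)
  have G_le: "G i t \<le> real n" for i t
  proof -
    have "G i t \<le> 1 * real n" unfolding G_def using chi by (intro mult_mono) auto
    then show ?thesis by simp
  qed
  have G_z: "real n + 1 < \<bar>t\<bar> \<Longrightarrow> G i t = 0" for i t using chi by (simp add: G_def)
  have [measurable]: "G i \<in> borel_measurable borel" for i using Gc by (rule borel_measurable_continuous_onI)
  have F1_z: "real n + 1 < \<bar>t\<bar> \<Longrightarrow> F1 n t = 0" for t by (auto simp: F1_def indicator_def)
  define J where "J t = indicator {-(real n + 1)..real n + 1} t * (real n powr p * exp (\<gamma> * t))" for t :: real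
  have J_int: "integrable lborel J"
    unfolding J_def by (rule integral_interval_eq_LINT(2)) (intro continuous_intros)
  have dom: "norm (\<bar>F1 n t - G i t\<bar> powr p * exp (\<gamma> * t)) \<le> J t" for i t
  proof (cases "real n + 1 < \<bar>t\<bar>")
    case True
    then show ?thesis using G_z F1_z p by (simp add: J_def)
  next
    case False
    have "\<bar>F1 n t - G i t\<bar> \<le> real n" using G_nn[of i t] G_le[of i t] F1_nn[of n t] by linarith
    then show ?thesis using False p by (auto simp: J_def indicator_def powr_mono2)
  qed
  have N0: "AE t in lborel. t \<notin> N"
    using AE_not_in[of N lebesgue] N by (simp add: negligible_iff_null_sets AE_completion_iff)
  have "(\<lambda>i. \<integral>t. \<bar>F1 n t - G i t\<bar> powr p * exp (\<gamma> * t) \<partial>lborel) \<longlonglongrightarrow> (\<integral>t. 0 \<partial>(lborel :: real measure))"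
  proof (rule integral_dominated_convergence[OF _ _ J_int])
    show "AE t in lborel. (\<lambda>i. \<bar>F1 n t - G i t\<bar> powr p * exp (\<gamma> * t)) \<longlonglongrightarrow> 0"
      using N0
    proof eventually_elim
      case (elim t)
      have "(\<lambda>i. G i t) \<longlonglongrightarrow> chi t * max 0 (min (real n) (F1 n t))"
        unfolding G_def using elim by (intro tendsto_intros g)
      also have "chi t * max 0 (min (real n) (F1 n t)) = F1 n t"
        using F1_nn[of n t] chi(4)[of t] by (cases "\<bar>t\<bar> \<le> real n") (auto simp: F1_def indicator_def)
      finally have "(\<lambda>i. \<bar>F1 n t - G i t\<bar> powr p * exp (\<gamma> * t)) \<longlonglongrightarrow> \<bar>F1 n t - F1 n t\<bar> powr p * exp (\<gamma> * t)"
        using p by (intro tendsto_intros tendsto_powr') auto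
      then show ?case using p by simp
    qed
  qed (use dom in auto)
  then have "eventually (\<lambda>i. (\<integral>t. \<bar>F1 n t - G i t\<bar> powr p * exp (\<gamma> * t) \<partial>lborel) < e') sequentially"
    using e' by (intro order_tendstoD(2)) auto
  then obtain i where i: "(\<integral>t. \<bar>F1 n t - G i t\<bar> powr p * exp (\<gamma> * t) \<partial>lborel) < e'"
    unfolding eventually_sequentially by blast
  have int2: "integrable lborel (\<lambda>t. \<bar>F1 n t - G i t\<bar> powr p * exp (\<gamma> * t))"
    by (rule integrable_if_abs_le[OF J_int]) (use dom in auto)
  let ?S = "\<lambda>t. 2 powr (p - 1) * (\<bar>F t - F1 n t\<bar> powr p * exp (\<gamma> * t) + \<bar>F1 n t - G i t\<bar> powr p * exp (\<gamma> * t))"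
  have le: "\<bar>F t - G i t\<bar> powr p * exp (\<gamma> * t) \<le> ?S t" for t
    using mult_right_mono[OF norm_diff_powr_le[OF p, of "F t" "G i t" "F1 n t"], of "exp (\<gamma> * t)"]
    by (simp add: algebra_simps)
  have intS: "integrable lborel ?S" using int1 int2 by auto
  have int3: "integrable lborel (\<lambda>t. \<bar>F t - G i t\<bar> powr p * exp (\<gamma> * t))"
    by (rule integrable_if_abs_le[OF intS]) (use le in auto)
  have "(\<integral>t. \<bar>F t - G i t\<bar> powr p * exp (\<gamma> * t) \<partial>lborel) \<le> (\<integral>t. ?S t \<partial>lborel)"
    by (intro integral_mono int3 intS le)
  also have "\<dots> = 2 powr (p - 1) * ((\<integral>t. \<bar>F t - F1 n t\<bar> powr p * exp (\<gamma> * t) \<partial>lborel) + (\<integral>t. \<bar>F1 n t - G i t\<bar> powr p * exp (\<gamma> * t) \<partial>lborel))"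
    using int1 int2 by simp
  also have "\<dots> < 2 powr (p - 1) * (e' + e')" using n i by (intro mult_strict_left_mono add_strict_mono) auto
  also have "\<dots> = e" by (simp add: e'_def)
  finally show thesis using that[OF Gc G_nn G_z int3] by blast
qed

lemma exp_abs_integrable: "0 < (a::real) \<Longrightarrow> integrable lborel (\<lambda>s::real. exp (- (a * \<bar>s\<bar>)))"
  by (rule integrable_if_exponential_bounds[of _ a a 1]) (auto intro!: continuous_intros)

text \<open>The primitive of \<open>- F\<close> that vanishes at infinity: it recovers
  \<open>u\<close> from \<open>F = - u'\<close>.\<close>

definition tail_integral :: "(real \<Rightarrow> real) \<Rightarrow> real \<Rightarrow> real" where
  "tail_integral F t = (\<integral>s. indicator {t..} s * F s \<partial>lborel)"

lemma tail_integral_deriv: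
  assumes F: "integrable lborel F" "continuous_on UNIV F"
  shows "(tail_integral F has_real_derivative - F t) (at t)"
proof -
  have [measurable]: "F \<in> borel_measurable borel" using F(2) by (rule borel_measurable_continuous_onI)
  have "tail_integral F = (\<lambda>t. (\<integral>s. F s \<partial>lborel) - (\<integral>s. indicator {..t} s *\<^sub>R F s \<partial>lborel))"
  proof
    fix t
    have "(\<integral>s. F s \<partial>lborel) - (\<integral>s. indicator {..t} s *\<^sub>R F s \<partial>lborel) = (\<integral>s. F s - indicator {..t} s *\<^sub>R F s \<partial>lborel)"
      by (rule Bochner_Integration.integral_diff[symmetric]) (use F integrable_mult_indicator[OF _ F(1)] in auto)
    also have "\<dots> = tail_integral F t" unfolding tail_integral_def
    proof (rule integral_cong_AE)
      show "AE s in lborel. F s - indicator {..t} s *\<^sub>R F s = indicator {t..} s * F s"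
        using AE_lborel_singleton[of t] by eventually_elim (auto simp: indicator_def)
    qed measurable
    finally show "tail_integral F t = (\<integral>s. F s \<partial>lborel) - (\<integral>s. indicator {..t} s *\<^sub>R F s \<partial>lborel)" by simp
  qed
  then show ?thesis using DERIV_diff[OF DERIV_const cumulative(1)[OF F]] by simp
qed

context bliss
begin

text \<open>The energy quotient at \<open>U\<close>. That no profile has a smaller one comes out of
  the stability estimates.\<close>

definition SB :: real where "SB = DU / QU powr (p / q)"

lemma SB_pos: "0 < SB" using DU_pos QU_pos by (simp add: SB_def)

lemma pq: "0 < p / q" "p / q < 1"
  using p_pos q_pos \<gamma>_pos \<gamma>_less B_pos by (auto simp: q_def field_simps)

lemma tail_exp_integrable: "integrable lborel (\<lambda>s. indicator {t..} s * exp (- (\<kappa> * s)))"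
proof (rule integrable_if_abs_le[OF integrable_mult_right[OF exp_abs_integrable[OF \<kappa>_pos], of "exp (2 * \<kappa> * \<bar>t\<bar>)"]])
  fix s
  show "\<bar>indicator {t..} s * exp (- (\<kappa> * s))\<bar> \<le> exp (2 * \<kappa> * \<bar>t\<bar>) * exp (- (\<kappa> * \<bar>s\<bar>))"
  proof (cases "t \<le> s")
    case True
    then have "\<bar>s\<bar> \<le> 2 * \<bar>t\<bar> + s" by linarith
    then have "\<kappa> * \<bar>s\<bar> \<le> \<kappa> * (2 * \<bar>t\<bar> + s)" using \<kappa>_pos by (intro mult_left_mono) auto
    then show ?thesis using True by (simp add: algebra_simps flip: exp_add)
  qed auto
qed measurable

text \<open>Young's inequality with the weight distributed so that one term is the energy density
  and the other, \<open>exp (- (\<kappa> * s))\<close>, is integrable at infinity. The free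
  \<open>\<mu>\<close> takes the place of Hoelder's inequality.\<close>

lemma abs_le_weighted:
  "\<mu> > 0 \<Longrightarrow> \<bar>x\<bar> \<le> \<mu> powr (- p) * (\<bar>x\<bar> powr p * exp (\<gamma> * s)) + \<mu> powr (p / (p - 1)) * exp (- (\<kappa> * s))"
proof -
  assume \<mu>: "\<mu> > 0"
  have "\<bar>x\<bar> = (\<bar>x\<bar> * exp (\<gamma> * s / p) / \<mu>) * (\<mu> * exp (- (\<gamma> * s / p)))"
    using \<mu> by (simp add: exp_minus)
  also have "\<dots> \<le> (\<bar>x\<bar> * exp (\<gamma> * s / p) / \<mu>) powr p + (\<mu> * exp (- (\<gamma> * s / p))) powr (p / (p - 1))"
    using \<mu> p2 by (intro young_powr_le) auto
  also have "(\<bar>x\<bar> * exp (\<gamma> * s / p) / \<mu>) powr p = \<mu> powr (- p) * (\<bar>x\<bar> powr p * exp (\<gamma> * s))"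
  proof -
    have "exp (\<gamma> * s / p) powr p = exp (\<gamma> * s)" using p_pos by (simp add: powr_def)
    then show ?thesis using \<mu> by (simp add: powr_divide powr_mult powr_minus_divide)
  qed
  also have "(\<mu> * exp (- (\<gamma> * s / p))) powr (p / (p - 1)) = \<mu> powr (p / (p - 1)) * exp (- (\<kappa> * s))"
  proof -
    have "exp (- (\<gamma> * s / p)) powr (p / (p - 1)) = exp (- (\<kappa> * s))"
      using p_pos p1_pos by (simp add: powr_def \<kappa>_def mult_ac)
    then show ?thesis using \<mu> by (simp add: powr_mult)
  qed
  finally show ?thesis .
qed

context
  fixes F :: "real \<Rightarrow> real"
  assumes [measurable]: "F \<in> borel_measurable borel"
    and F_int: "integrable lborel (\<lambda>s. \<bar>F s\<bar> powr p * exp (\<gamma> * s))"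
begin

lemma tail_integrable: "integrable lborel (\<lambda>s. indicator {t..} s * F s)"
proof (rule integrable_if_abs_le)
  show "integrable lborel (\<lambda>s. \<bar>F s\<bar> powr p * exp (\<gamma> * s) + indicator {t..} s * exp (- (\<kappa> * s)))"
    by (intro Bochner_Integration.integrable_add F_int tail_exp_integrable)
  show "\<bar>indicator {t..} s * F s\<bar> \<le> \<bar>F s\<bar> powr p * exp (\<gamma> * s) + indicator {t..} s * exp (- (\<kappa> * s))" for s
    using abs_le_weighted[of 1 "F s" s] by (auto simp: indicator_def)
qed measurable

lemma tail_integral_bound:
  assumes "\<mu> > 0"
  shows "\<bar>tail_integral F t\<bar> \<le> \<mu> powr (- p) * (\<integral>s. \<bar>F s\<bar> powr p * exp (\<gamma> * s) \<partial>lborel)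
     + \<mu> powr (p / (p - 1)) * (\<integral>s. indicator {t..} s * exp (- (\<kappa> * s)) \<partial>lborel)"
proof -
  have "\<bar>tail_integral F t\<bar> \<le> (\<integral>s. \<bar>indicator {t..} s * F s\<bar> \<partial>lborel)"
    unfolding tail_integral_def using integral_norm_bound[of lborel "\<lambda>s. indicator {t..} s * F s"] by simp
  also have "\<dots> \<le> (\<integral>s. \<mu> powr (- p) * (\<bar>F s\<bar> powr p * exp (\<gamma> * s)) + \<mu> powr (p / (p - 1)) * (indicator {t..} s * exp (- (\<kappa> * s))) \<partial>lborel)"
  proof (rule integral_mono)
    show "integrable lborel (\<lambda>s. \<bar>indicator {t..} s * F s\<bar>)" using tail_integrable by (rule integrable_abs)
    show "integrable lborel (\<lambda>s. \<mu> powr (- p) * (\<bar>F s\<bar> powr p * exp (\<gamma> * s)) + \<mu> powr (p / (p - 1)) * (indicator {t..} s * exp (- (\<kappa> * s))))"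
      by (intro Bochner_Integration.integrable_add integrable_mult_right F_int tail_exp_integrable)
    show "\<bar>indicator {t..} s * F s\<bar> \<le> \<mu> powr (- p) * (\<bar>F s\<bar> powr p * exp (\<gamma> * s)) + \<mu> powr (p / (p - 1)) * (indicator {t..} s * exp (- (\<kappa> * s)))" for s
      using abs_le_weighted[OF assms, of "F s" s] by (auto simp: indicator_def)
  qed
  also have "\<dots> = \<mu> powr (- p) * (\<integral>s. \<bar>F s\<bar> powr p * exp (\<gamma> * s) \<partial>lborel)
     + \<mu> powr (p / (p - 1)) * (\<integral>s. indicator {t..} s * exp (- (\<kappa> * s)) \<partial>lborel)"
    by (subst Bochner_Integration.integral_add) (auto intro!: integrable_mult_right F_int tail_exp_integrable)
  finally show ?thesis .
qed

end

lemma tail_integral_diff: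
  assumes [measurable]: "F \<in> borel_measurable borel" "G \<in> borel_measurable borel"
    and "integrable lborel (\<lambda>s. \<bar>F s\<bar> powr p * exp (\<gamma> * s))" "integrable lborel (\<lambda>s. \<bar>G s\<bar> powr p * exp (\<gamma> * s))"
  shows "tail_integral (\<lambda>s. F s - G s) t = tail_integral F t - tail_integral G t"
  unfolding tail_integral_def right_diff_distrib
  by (rule Bochner_Integration.integral_diff; rule tail_integrable) (use assms in auto)

lemma tail_integral_tendsto:
  fixes F :: "real \<Rightarrow> real" and Fn :: "nat \<Rightarrow> real \<Rightarrow> real"
  assumes [measurable]: "F \<in> borel_measurable borel" "\<And>n. Fn n \<in> borel_measurable borel"
    and F: "integrable lborel (\<lambda>s. \<bar>F s\<bar> powr p * exp (\<gamma> * s))"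
    and Fn: "\<And>n. integrable lborel (\<lambda>s. \<bar>Fn n s\<bar> powr p * exp (\<gamma> * s))"
    and d: "\<And>n. integrable lborel (\<lambda>s. \<bar>Fn n s - F s\<bar> powr p * exp (\<gamma> * s))"
    and r: "\<And>n. 0 < r n" "\<And>n. (\<integral>s. \<bar>Fn n s - F s\<bar> powr p * exp (\<gamma> * s) \<partial>lborel) \<le> r n" "r \<longlonglongrightarrow> 0"
  shows "(\<lambda>n. tail_integral (Fn n) t) \<longlonglongrightarrow> tail_integral F t"
proof -
  define K where "K = (\<integral>s. indicator {t..} s * exp (- (\<kappa> * s)) \<partial>lborel)"
  have bd: "\<bar>tail_integral (Fn n) t - tail_integral F t\<bar> \<le> r n powr (1/2) + r n powr (1 / (2 * p) * (p / (p - 1))) * K" for n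
  proof -
    \<comment> \<open>With \<open>\<mu> = r n powr (1 / (2 * p))\<close> the first term is at most
      \<open>r n powr (1/2)\<close> and the second keeps a positive power of \<open>r n\<close>, so
      both tend to 0.\<close>
    have "\<bar>tail_integral (\<lambda>s. Fn n s - F s) t\<bar> \<le> (r n powr (1 / (2 * p))) powr (- p) * (\<integral>s. \<bar>Fn n s - F s\<bar> powr p * exp (\<gamma> * s) \<partial>lborel)
      + (r n powr (1 / (2 * p))) powr (p / (p - 1)) * K"
      unfolding K_def by (rule tail_integral_bound) (use d r(1)[of n] in auto)
    also have "(r n powr (1 / (2 * p))) powr (- p) * (\<integral>s. \<bar>Fn n s - F s\<bar> powr p * exp (\<gamma> * s) \<partial>lborel) \<le> r n powr (- (1/2)) * r n"
      using r(2)[of n] p_pos by (simp add: powr_powr mult_left_mono)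
    also have "r n powr (- (1/2)) * r n = r n powr (- (1/2) + 1)" 
      unfolding powr_add using r(1)[of n] by simp
    also have "tail_integral (\<lambda>s. Fn n s - F s) t = tail_integral (Fn n) t - tail_integral F t"
      by (rule tail_integral_diff) (use F Fn in auto)
    finally show ?thesis by (simp add: powr_powr)
  qed
  have lim: "(\<lambda>n. r n powr (1/2) + r n powr (1 / (2 * p) * (p / (p - 1))) * K) \<longlonglongrightarrow> 0 powr (1/2) + 0 powr (1 / (2 * p) * (p / (p - 1))) * K"
    using r p_pos p1_pos by (intro tendsto_intros tendsto_powr' r) (auto simp: less_imp_le)
  have "(\<lambda>n. tail_integral (Fn n) t - tail_integral F t) \<longlonglongrightarrow> 0"
  proof (rule Lim_null_comparison)
    show "eventually (\<lambda>n. norm (tail_integral (Fn n) t - tail_integral F t)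
        \<le> r n powr (1/2) + r n powr (1 / (2 * p) * (p / (p - 1))) * K) sequentially"
      using bd unfolding real_norm_def by (rule always_eventually[OF allI])
    show "(\<lambda>n. r n powr (1/2) + r n powr (1 / (2 * p) * (p / (p - 1))) * K) \<longlonglongrightarrow> 0"
      using lim by simp
  qed
  then show ?thesis by (rule LIM_zero_cancel)
qed

lemma f_integrable: "integrable lborel f"
proof (rule integrable_if_exponential_bounds[OF f_cont less_imp_le[OF f_pos] \<kappa>_pos \<sigma>_pos])
  fix t :: real
  have k1: "- k - 1 \<le> 0" using k_pos by simp
  show "f t \<le> \<kappa> * exp (- (\<kappa> * t))" if "0 \<le> t"
  proof -
    have "f t \<le> \<kappa> * exp (\<sigma> * t) * exp (\<sigma> * t) powr (- k - 1)"
      unfolding f_def using L_bounds_right[OF that] \<kappa>_pos k1 by (intro mult_left_mono powr_mono2') auto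
    also have "\<dots> = \<kappa> * exp (\<sigma> * t + (- k - 1) * (\<sigma> * t))" by (simp only: exp_add) (simp add: powr_def)
    also have "\<sigma> * t + (- k - 1) * (\<sigma> * t) = - (\<kappa> * t)" unfolding k\<sigma>[symmetric] by (simp add: algebra_simps)
    finally show ?thesis .
  qed
  show "f t \<le> \<kappa> * exp (\<sigma> * t)"
  proof -
    have "L t powr (- k - 1) \<le> 1 powr (- k - 1)"
      using L_bounds_left[of t] k1 by (intro powr_mono2') auto
    then show ?thesis unfolding f_def using \<kappa>_pos by (simp add: mult_left_le)
  qed
qed

lemma tail_f: "tail_integral f t = U t"
proof -
  have "filterlim (\<lambda>t. exp (\<sigma> * t)) at_top at_top"
    by (rule filterlim_compose[OF exp_at_top])
      (use \<sigma>_pos in \<open>simp add: filterlim_tendsto_pos_mult_at_top[OF tendsto_const] filterlim_ident\<close>)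
  then have "filterlim L at_top at_top"
    unfolding L_def by (rule filterlim_tendsto_add_at_top[OF tendsto_const])
  then have "(U \<longlongrightarrow> 0) at_top"
    unfolding U_def using k_pos by (intro tendsto_neg_powr) auto
  then have lim: "((\<lambda>t. - U t) \<longlongrightarrow> - 0) at_top" by (rule tendsto_minus)
  have "(\<integral>\<^sup>+s. ennreal (f s) * indicator {t..} s \<partial>lborel) = ennreal (- 0 - (- U t))"
    by (rule nn_integral_FTC_atLeast[OF borel_measurable_continuous_onI[OF f_cont] _ less_imp_le[OF f_pos] lim])
      (use DERIV_minus[OF U_der] in auto)
  moreover have "(\<integral>\<^sup>+s. ennreal (f s) * indicator {t..} s \<partial>lborel) = (\<integral>\<^sup>+s. ennreal (indicator {t..} s * f s) \<partial>lborel)"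
    by (intro nn_integral_cong) (auto simp: indicator_def)
  ultimately have "(\<integral>\<^sup>+s. ennreal (indicator {t..} s * f s) \<partial>lborel) = ennreal (U t)" by simp
  then show ?thesis unfolding tail_integral_def
    by (intro integral_eq_nn_integral[THEN trans])
      (use borel_measurable_continuous_onI[OF f_cont] f_pos U_pos[of t] in \<open>auto simp: less_imp_le\<close>)
qed

end

text \<open>Convexity at \<open>a + b = l * (a / l) + (1 - l) * (b / (1 - l))\<close>. For
  \<open>l\<close> close to 1 the coefficient of \<open>a powr p\<close> is close to 1, at the price
  of a large one for \<open>b powr p\<close>.\<close>

lemma powr_add_le_split:
  fixes a b l p :: real
  assumes "0 \<le> a" "0 \<le> b" "0 < l" "l < 1" "1 \<le> p"
  shows "(a + b) powr p \<le> l powr (1 - p) * a powr p + (1 - l) powr (1 - p) * b powr p"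
proof -
  define M where "M = a + b"
  have t1: "M powr p + p * M powr (p - 1) * (a / l - M) \<le> (a / l) powr p"
    using assms by (intro powr_ge_tangent) (auto simp: M_def)
  have t2: "M powr p + p * M powr (p - 1) * (b / (1 - l) - M) \<le> (b / (1 - l)) powr p"
    using assms by (intro powr_ge_tangent) (auto simp: M_def)
  have "l * (M powr p + p * M powr (p - 1) * (a / l - M)) + (1 - l) * (M powr p + p * M powr (p - 1) * (b / (1 - l) - M))
     \<le> l * (a / l) powr p + (1 - l) * (b / (1 - l)) powr p"
    using t1 t2 assms by (intro add_mono mult_left_mono) auto
  moreover have "l * (M powr p + p * M powr (p - 1) * (a / l - M)) + (1 - l) * (M powr p + p * M powr (p - 1) * (b / (1 - l) - M)) = M powr p"
  proof -
    have "l * (a / l - M) = a - l * M" "(1 - l) * (b / (1 - l) - M) = b - (1 - l) * M"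
      using assms by (simp_all add: right_diff_distrib)
    then have "l * (p * M powr (p - 1) * (a / l - M)) + (1 - l) * (p * M powr (p - 1) * (b / (1 - l) - M))
       = p * M powr (p - 1) * ((a - l * M) + (b - (1 - l) * M))"
      by (simp only: mult.left_commute[of l] mult.left_commute[of "1 - l"] distrib_left)
    also have "(a - l * M) + (b - (1 - l) * M) = 0" by (simp add: M_def algebra_simps)
    finally show ?thesis by (simp add: distrib_left) (simp add: algebra_simps)
  qed
  moreover have "l * (a / l) powr p = l powr (1 - p) * a powr p"
    using assms by (simp add: powr_divide powr_diff)
  moreover have "(1 - l) * (b / (1 - l)) powr p = (1 - l) powr (1 - p) * b powr p"
    using assms by (simp add: powr_divide powr_diff)
  ultimately show ?thesis by (simp add: M_def)
qed

section \<open>Stability on the line: from regular profiles to arbitrary finite energy\<close>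

context bliss
begin

abbreviation energy :: "(real \<Rightarrow> real) \<Rightarrow> real" where
  "energy F \<equiv> (\<integral>t. \<bar>F t\<bar> powr p * exp (\<gamma> * t) \<partial>lborel)"

abbreviation finite_energy :: "(real \<Rightarrow> real) \<Rightarrow> bool" where
  "finite_energy F \<equiv> integrable lborel (\<lambda>t. \<bar>F t\<bar> powr p * exp (\<gamma> * t))"

abbreviation mass :: "(real \<Rightarrow> real) \<Rightarrow> real" where
  "mass F \<equiv> (\<integral>t. \<bar>tail_integral F t\<bar> powr q * exp (B * t) \<partial>lborel)"

abbreviation finite_mass :: "(real \<Rightarrow> real) \<Rightarrow> bool" where
  "finite_mass F \<equiv> integrable lborel (\<lambda>t. \<bar>tail_integral F t\<bar> powr q * exp (B * t))"

lemma f_energy: "finite_energy f" "energy f = DU"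
  using wb_integrable f_pos by (simp_all add: wb_def[abs_def] DU_def less_imp_le)

lemma f_shift_meas [measurable]: "(\<lambda>t. f (t + \<theta>)) \<in> borel_measurable borel"
  by (rule borel_measurable_continuous_onI) (auto intro!: continuous_on_compose2[OF f_cont[of UNIV]] continuous_intros)

lemma energy_triangle:
  assumes [measurable]: "F \<in> borel_measurable borel" "G \<in> borel_measurable borel" "H \<in> borel_measurable borel"
    and FG: "finite_energy (\<lambda>t. F t - G t)" and GH: "finite_energy (\<lambda>t. G t - H t)"
  shows "finite_energy (\<lambda>t. F t - H t)"
    "energy (\<lambda>t. F t - H t) \<le> 2 powr (p - 1) * (energy (\<lambda>t. F t - G t) + energy (\<lambda>t. G t - H t))"
proof -
  let ?S = "\<lambda>t. 2 powr (p - 1) * (\<bar>F t - G t\<bar> powr p * exp (\<gamma> * t) + \<bar>G t - H t\<bar> powr p * exp (\<gamma> * t))"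
  have le: "\<bar>F t - H t\<bar> powr p * exp (\<gamma> * t) \<le> ?S t" for t
    using mult_right_mono[OF norm_diff_powr_le[of p "F t" "H t" "G t"], of "exp (\<gamma> * t)"] p2
    by (simp add: algebra_simps)
  have intS: "integrable lborel ?S" using FG GH by auto
  show i: "finite_energy (\<lambda>t. F t - H t)"
    by (rule integrable_if_abs_le[OF intS]) (use le in auto)
  have "energy (\<lambda>t. F t - H t) \<le> (\<integral>t. ?S t \<partial>lborel)" by (intro integral_mono i intS le)
  also have "\<dots> = 2 powr (p - 1) * (energy (\<lambda>t. F t - G t) + energy (\<lambda>t. G t - H t))" using FG GH by simp
  finally show "energy (\<lambda>t. F t - H t) \<le> 2 powr (p - 1) * (energy (\<lambda>t. F t - G t) + energy (\<lambda>t. G t - H t))" .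
qed

lemma tail_integral_mono:
  assumes [measurable]: "F \<in> borel_measurable borel" "G \<in> borel_measurable borel"
    and "finite_energy F" "finite_energy G" "\<And>t. F t \<le> G t"
  shows "tail_integral F t \<le> tail_integral G t"
  unfolding tail_integral_def
  by (intro integral_mono tail_integrable) (use assms in \<open>auto simp: indicator_def\<close>)

lemma tail_integral_nonneg: "(\<And>t. 0 \<le> F t) \<Longrightarrow> 0 \<le> tail_integral F t"
  unfolding tail_integral_def by (intro integral_nonneg_AE) auto

text \<open>Adding \<open>\<epsilon> * f\<close> makes \<open>u\<close> positive everywhere and an
  exact multiple of \<open>U\<close> beyond the support of \<open>G\<close>, as
  \<open>bliss_profile\<close> demands. The mass is normalised by a division, and the estimate
  scales back because both sides are homogeneous of degree \<open>p\<close>.\<close>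

theorem compact_stability:
  obtains C where "0 < C"
    "\<And>G R \<epsilon>. continuous_on UNIV G \<Longrightarrow> (\<And>t. 0 \<le> G t) \<Longrightarrow> (\<And>t. R < \<bar>t\<bar> \<Longrightarrow> G t = 0) \<Longrightarrow> 0 < \<epsilon> \<Longrightarrow>
      finite_energy (\<lambda>t. G t + \<epsilon> * f t) \<and> finite_mass (\<lambda>t. G t + \<epsilon> * f t) \<and>
      (\<exists>c \<theta>. finite_energy (\<lambda>t. G t + \<epsilon> * f t - c * f (t + \<theta>)) \<and>
        energy (\<lambda>t. G t + \<epsilon> * f t - c * f (t + \<theta>))
          \<le> C * (energy (\<lambda>t. G t + \<epsilon> * f t) - SB * mass (\<lambda>t. G t + \<epsilon> * f t) powr (p / q)))"
proof -
  obtain C where C: "0 < C"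
    "\<And>u F \<epsilon> R. bliss_profile p \<gamma> B u F \<epsilon> R \<Longrightarrow>
      \<exists>\<theta>. integrable lborel (\<lambda>t. \<bar>F t - exp (\<gamma> * \<theta> / p) * f (t + \<theta>)\<bar> powr p * exp (\<gamma> * t)) \<and>
        (\<integral>t. \<bar>F t - exp (\<gamma> * \<theta> / p) * f (t + \<theta>)\<bar> powr p * exp (\<gamma> * t) \<partial>lborel)
          \<le> C * ((\<integral>t. F t powr p * exp (\<gamma> * t) \<partial>lborel) - DU)"
    using profile_stability by blast
  show thesis
  proof (rule that[OF C(1)])
    fix G :: "real \<Rightarrow> real" and R \<epsilon> :: real
    assume G: "continuous_on UNIV G" "\<And>t. 0 \<le> G t" "\<And>t. R < \<bar>t\<bar> \<Longrightarrow> G t = 0" and eps: "0 < \<epsilon>"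
    define F where "F t = G t + \<epsilon> * f t" for t
    have F_pos: "0 < F t" for t using G(2)[of t] f_pos[of t] eps by (simp add: F_def add_nonneg_pos)
    have Fc: "continuous_on UNIV F" unfolding F_def by (intro continuous_intros G)
    have [measurable]: "F \<in> borel_measurable borel" using Fc by (rule borel_measurable_continuous_onI)
    have [measurable]: "f \<in> borel_measurable borel" using f_cont by (rule borel_measurable_continuous_onI)
    have [measurable]: "G \<in> borel_measurable borel" using G(1) by (rule borel_measurable_continuous_onI)
    \<comment> \<open>\<open>G / f\<close> is continuous and vanishes off a compact interval.
      Through \<open>F \<le> (K + \<epsilon>) * f\<close> the integrability claims are inherited
      from the extremal.\<close>
    obtain K where K: "0 \<le> K" "\<And>t. G t \<le> K * f t"
    proof -
      have "compact ((\<lambda>t. G t / f t) ` {-R..R})"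
        by (intro compact_continuous_image continuous_intros continuous_on_subset[OF G(1)])
          (use f_pos in \<open>auto simp: less_imp_neq[symmetric]\<close>)
      then have "bounded ((\<lambda>t. G t / f t) ` {-R..R})" by (rule compact_imp_bounded)
      then obtain K where "\<forall>x\<in>(\<lambda>t. G t / f t) ` {-R..R}. norm x \<le> K"
        unfolding bounded_iff ..
      then have K: "\<bar>G t / f t\<bar> \<le> K" if "t \<in> {-R..R}" for t using that by simp
      have "G t \<le> max K 0 * f t" for t
      proof (cases "t \<in> {-R..R}")
        case True
        then have "G t / f t \<le> max K 0" using K[OF True] by linarith
        then show ?thesis using f_pos[of t] by (simp add: pos_divide_le_eq)
      next
        case False
        then have "G t = 0" using G(3)[of t] by auto
        then show ?thesis using f_pos[of t] by simp
      qed
      then show thesis using that[of "max K 0"] by auto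
    qed
    have F_le: "F t \<le> (K + \<epsilon>) * f t" for t using K(2)[of t] by (simp add: F_def distrib_right)
    have Kf: "finite_energy (\<lambda>t. (K + \<epsilon>) * f t)"
    proof -
      have "(\<lambda>t. \<bar>(K + \<epsilon>) * f t\<bar> powr p * exp (\<gamma> * t)) = (\<lambda>t. (K + \<epsilon>) powr p * (\<bar>f t\<bar> powr p * exp (\<gamma> * t)))"
        using K eps by (auto simp: abs_mult powr_mult)
      then show ?thesis using f_energy(1) by simp
    qed
    have F_en: "finite_energy F"
      by (rule integrable_if_abs_le[OF Kf])
        (use F_le F_pos p_pos in \<open>auto intro!: powr_mono2 abs_leI intro: order_trans[OF _ abs_ge_self] simp: less_imp_le abs_of_pos\<close>)
    have F_int: "integrable lborel F"
      by (rule integrable_if_abs_le[OF integrable_mult_right[OF f_integrable]])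
        (use F_le F_pos in \<open>auto simp: abs_of_pos\<close>)
    define u where "u = tail_integral F"
    have tail_cf: "tail_integral (\<lambda>t. c * f t) t = c * U t" for c t
      unfolding tail_f[symmetric] tail_integral_def by (simp add: mult.left_commute)
    have epsf: "finite_energy (\<lambda>t. \<epsilon> * f t)"
      by (rule integrable_if_abs_le[OF Kf])
        (use K eps f_pos p_pos in \<open>auto intro!: powr_mono2 mult_right_mono simp: less_imp_le abs_mult\<close>)
    have u_ge: "\<epsilon> * U t \<le> u t" for t
      unfolding u_def tail_cf[symmetric] by (intro tail_integral_mono epsf F_en) (auto simp: F_def G)
    have u_le: "u t \<le> (K + \<epsilon>) * U t" for t
      unfolding u_def tail_cf[symmetric] by (intro tail_integral_mono Kf F_en F_le) auto
    have u_pos: "0 < u t" for t using u_ge[of t] U_pos[of t] eps by (smt (verit) mult_pos_pos)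
    have u_der: "(u has_real_derivative - F t) (at t)" for t
      unfolding u_def by (rule tail_integral_deriv[OF F_int Fc])
    have u_meas [measurable]: "u \<in> borel_measurable borel"
      by (rule borel_measurable_continuous_onI) (meson u_der DERIV_isCont continuous_at_imp_continuous_on)
    have u_tail: "u t = \<epsilon> * U t" if "max R 0 + 1 \<le> t" for t
      unfolding u_def tail_cf[symmetric] tail_integral_def
      by (rule Bochner_Integration.integral_cong) (use that G(3) in \<open>auto simp: indicator_def F_def\<close>)
    define Q where "Q = (\<integral>t. u t powr q * exp (B * t) \<partial>lborel)"
    have u_int: "integrable lborel (\<lambda>t. u t powr q * exp (B * t))"
    proof (rule integrable_if_abs_le[OF integrable_mult_right[OF wh_integrable, of "(K + \<epsilon>) powr q"]])
      fix t
      have "u t powr q \<le> ((K + \<epsilon>) * U t) powr q"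
        using u_le[of t] u_pos[of t] q_pos by (intro powr_mono2) auto
      also have "\<dots> = (K + \<epsilon>) powr q * U t powr q" by (rule powr_mult)
      finally show "\<bar>u t powr q * exp (B * t)\<bar> \<le> (K + \<epsilon>) powr q * wh t" by (simp add: wh_def)
    qed measurable
    have Q_pos: "0 < Q" unfolding Q_def using u_pos by (intro LINT_pos[OF u_int]) (simp add: less_imp_neq[symmetric])
    \<comment> \<open>Chosen so that \<open>u / c\<close> has mass \<open>QU\<close>; then
      \<open>c powr p * DU\<close> is exactly \<open>SB * Q powr (p / q)\<close>.\<close>
    define c where "c = (Q / QU) powr (1 / q)"
    have c_pos: "0 < c" using Q_pos QU_pos by (simp add: c_def)
    have c_q: "c powr q = Q / QU" using q_pos Q_pos QU_pos by (simp add: c_def powr_powr)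
    have c_p: "c powr p * DU = SB * Q powr (p / q)"
      using Q_pos QU_pos by (simp add: c_def powr_powr SB_def powr_divide)
    have Fp: "(F t / c) powr p * exp (\<gamma> * t) = inverse (c powr p) * (\<bar>F t\<bar> powr p * exp (\<gamma> * t))" for t
      using c_pos F_pos[of t] by (simp add: powr_divide inverse_eq_divide abs_of_pos)
    interpret P: bliss_profile p \<gamma> B "\<lambda>t. u t / c" "\<lambda>t. F t / c" "\<epsilon> / c" "max R 0 + 1"
    proof unfold_locales
      fix t
      show "0 < u t / c" "0 \<le> F t / c" using u_pos[of t] F_pos[of t] c_pos by auto
      show "((\<lambda>t. u t / c) has_real_derivative - (F t / c)) (at t)"
        using DERIV_cdivide[OF u_der, of c t] by simp
      show "max R 0 + 1 \<le> t \<Longrightarrow> u t / c = \<epsilon> / c * U t" using u_tail[of t] by simp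
    next
      have e: "(u t / c) powr q * exp (B * t) = inverse (c powr q) * (u t powr q * exp (B * t))" for t
        using c_pos u_pos[of t] by (simp add: powr_divide inverse_eq_divide)
      show "integrable lborel (\<lambda>t. (u t / c) powr q * exp (B * t))"
        unfolding e by (intro integrable_mult_right u_int)
      show "(\<integral>t. (u t / c) powr q * exp (B * t) \<partial>lborel) = QU"
        unfolding e using Q_pos QU_pos by (simp add: Q_def[symmetric] c_q)
      show "integrable lborel (\<lambda>t. (F t / c) powr p * exp (\<gamma> * t))"
        unfolding Fp by (intro integrable_mult_right F_en)
      show "continuous_on UNIV (\<lambda>t. F t / c)" using c_pos by (intro continuous_intros Fc) auto
      show "0 < \<epsilon> / c" using eps c_pos by simp
    qed
    obtain \<theta> where th: "integrable lborel (\<lambda>t. \<bar>F t / c - exp (\<gamma> * \<theta> / p) * f (t + \<theta>)\<bar> powr p * exp (\<gamma> * t))"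
      "(\<integral>t. \<bar>F t / c - exp (\<gamma> * \<theta> / p) * f (t + \<theta>)\<bar> powr p * exp (\<gamma> * t) \<partial>lborel)
          \<le> C * ((\<integral>t. (F t / c) powr p * exp (\<gamma> * t) \<partial>lborel) - DU)"
      using C(2)[OF P.bliss_profile_axioms] by blast
    define c' where "c' = c * exp (\<gamma> * \<theta> / p)"
    have e2: "\<bar>F t - c' * f (t + \<theta>)\<bar> powr p * exp (\<gamma> * t)
        = c powr p * (\<bar>F t / c - exp (\<gamma> * \<theta> / p) * f (t + \<theta>)\<bar> powr p * exp (\<gamma> * t))" for t
    proof -
      have "F t - c' * f (t + \<theta>) = c * (F t / c - exp (\<gamma> * \<theta> / p) * f (t + \<theta>))"
        using c_pos by (simp add: c'_def right_diff_distrib)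
      then show ?thesis using c_pos by (simp add: abs_mult powr_mult)
    qed
    have i1: "finite_energy (\<lambda>t. F t - c' * f (t + \<theta>))"
      unfolding e2 by (intro integrable_mult_right th)
    have "energy (\<lambda>t. F t - c' * f (t + \<theta>)) \<le> c powr p * (C * ((\<integral>t. (F t / c) powr p * exp (\<gamma> * t) \<partial>lborel) - DU))"
      unfolding e2 integral_mult_right_zero using th(2) by (intro mult_left_mono) auto
    also have "\<dots> = C * (energy F - SB * Q powr (p / q))"
      unfolding Fp integral_mult_right_zero c_p[symmetric] using c_pos by (simp add: field_simps)
    also have "Q = mass F" using u_pos by (simp add: Q_def u_def[symmetric] abs_of_pos)
    finally have "energy (\<lambda>t. F t - c' * f (t + \<theta>)) \<le> C * (energy F - SB * mass F powr (p / q))" .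
    moreover have "finite_mass F" using u_int u_pos by (simp add: u_def[symmetric] abs_of_pos)
    ultimately show "finite_energy (\<lambda>t. G t + \<epsilon> * f t) \<and> finite_mass (\<lambda>t. G t + \<epsilon> * f t) \<and>
      (\<exists>c \<theta>. finite_energy (\<lambda>t. G t + \<epsilon> * f t - c * f (t + \<theta>)) \<and>
        energy (\<lambda>t. G t + \<epsilon> * f t - c * f (t + \<theta>))
          \<le> C * (energy (\<lambda>t. G t + \<epsilon> * f t) - SB * mass (\<lambda>t. G t + \<epsilon> * f t) powr (p / q)))"
      using F_en i1 unfolding F_def by blast
  qed
qed

end

lemma tail_integral_measurable:
  assumes [measurable]: "H \<in> borel_measurable borel"
  shows "tail_integral H \<in> borel_measurable borel"
proof -
  have "tail_integral H = (\<lambda>t. \<integral>s. (if t \<le> s then H s else 0) \<partial>lborel)"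
    unfolding tail_integral_def by (intro ext Bochner_Integration.integral_cong) (auto simp: indicator_def)
  then show ?thesis by simp
qed

context bliss
begin

text \<open>Both limits go the right way: the energies of the approximants have upper limit at most
  that of \<open>F\<close>, their masses have lower limit at least that of \<open>F\<close> by
  Fatou. For given \<open>e\<close> the parameters \<open>c\<close> and \<open>\<theta>\<close> are
  those of one sufficiently good approximant.\<close>

theorem nonneg_stability:
  obtains C where "0 < C"
    "\<And>F e. F \<in> borel_measurable borel \<Longrightarrow> (\<And>t. 0 \<le> F t) \<Longrightarrow> finite_energy F \<Longrightarrow> finite_mass F"
    "\<And>F e. F \<in> borel_measurable borel \<Longrightarrow> (\<And>t. 0 \<le> F t) \<Longrightarrow> finite_energy F \<Longrightarrow> 0 < e \<Longrightarrow>
      \<exists>c \<theta>. finite_energy (\<lambda>t. F t - c * f (t + \<theta>)) \<and>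
        energy (\<lambda>t. F t - c * f (t + \<theta>)) \<le> C * (energy F - SB * mass F powr (p / q)) + e"
proof -
  obtain C where C: "0 < C"
    "\<And>G R \<epsilon>. continuous_on UNIV G \<Longrightarrow> (\<And>t. 0 \<le> G t) \<Longrightarrow> (\<And>t. R < \<bar>t\<bar> \<Longrightarrow> G t = 0) \<Longrightarrow> 0 < \<epsilon> \<Longrightarrow>
      finite_energy (\<lambda>t. G t + \<epsilon> * f t) \<and> finite_mass (\<lambda>t. G t + \<epsilon> * f t) \<and>
      (\<exists>c \<theta>. finite_energy (\<lambda>t. G t + \<epsilon> * f t - c * f (t + \<theta>)) \<and>
        energy (\<lambda>t. G t + \<epsilon> * f t - c * f (t + \<theta>))
          \<le> C * (energy (\<lambda>t. G t + \<epsilon> * f t) - SB * mass (\<lambda>t. G t + \<epsilon> * f t) powr (p / q)))"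
    using compact_stability by blast
  have [measurable]: "f \<in> borel_measurable borel" using f_cont by (rule borel_measurable_continuous_onI)
  have main: "finite_mass F \<and> (\<forall>e>0. \<exists>c \<theta>. finite_energy (\<lambda>t. F t - c * f (t + \<theta>)) \<and>
        energy (\<lambda>t. F t - c * f (t + \<theta>)) \<le> 2 powr (p - 1) * C * (energy F - SB * mass F powr (p / q)) + e)"
    if Fm [measurable]: "F \<in> borel_measurable borel" and F_nn: "\<And>t. 0 \<le> F t" and F_en: "finite_energy F" for F
  proof -
    have approx: "\<exists>G. G \<in> borel_measurable borel \<and> (\<forall>t. 0 \<le> G t) \<and> finite_energy G \<and> finite_mass G \<and>
        finite_energy (\<lambda>t. G t - F t) \<and> energy (\<lambda>t. G t - F t) \<le> r \<and>
        (\<exists>c \<theta>. finite_energy (\<lambda>t. G t - c * f (t + \<theta>)) \<and>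
          energy (\<lambda>t. G t - c * f (t + \<theta>)) \<le> C * (energy G - SB * mass G powr (p / q)))" if r: "0 < r" for r
    proof -
      define r' where "r' = r / (2 * 2 powr (p - 1))"
      have r': "0 < r'" using r by (simp add: r'_def)
      have intF: "integrable lborel (\<lambda>t. F t powr p * exp (\<gamma> * t))" using F_en F_nn by simp
      have p1: "1 \<le> p" using p2 by simp
      obtain G R where G: "continuous_on UNIV G" "\<And>t. 0 \<le> G t" "\<And>t. R < \<bar>t\<bar> \<Longrightarrow> G t = 0"
        "finite_energy (\<lambda>t. F t - G t)" "energy (\<lambda>t. F t - G t) < r'"
        using weighted_Lp_density[OF p1 Fm F_nn intF r'] by blast
      have [measurable]: "G \<in> borel_measurable borel" using G(1) by (rule borel_measurable_continuous_onI)
      define \<epsilon> where "\<epsilon> = (r' / DU) powr (1 / p)"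
      have eps: "0 < \<epsilon>" using r' DU_pos by (simp add: \<epsilon>_def)
      have eps_p: "\<epsilon> powr p * DU = r'" using r' DU_pos p_pos by (simp add: \<epsilon>_def powr_powr)
      define H where "H t = G t + \<epsilon> * f t" for t
      have [measurable]: "H \<in> borel_measurable borel" unfolding H_def[abs_def] by measurable
      have H_nn: "0 \<le> H t" for t using G(2)[of t] eps f_pos[of t] by (simp add: H_def)
      have GH_eq: "\<bar>H t - G t\<bar> powr p * exp (\<gamma> * t) = \<epsilon> powr p * (\<bar>f t\<bar> powr p * exp (\<gamma> * t))" for t
        using eps by (simp add: H_def abs_mult powr_mult)
      have GH: "finite_energy (\<lambda>t. H t - G t)" "energy (\<lambda>t. H t - G t) = r'"
        unfolding GH_eq integral_mult_right_zero f_energy(2)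
        by (rule integrable_mult_right[OF f_energy(1)], rule eps_p)
      have GF: "finite_energy (\<lambda>t. G t - F t)" "energy (\<lambda>t. G t - F t) < r'"
        unfolding abs_minus_commute[of "G _"] by (rule G)+
      have HF: "finite_energy (\<lambda>t. H t - F t)" "energy (\<lambda>t. H t - F t) \<le> 2 powr (p - 1) * (energy (\<lambda>t. H t - G t) + energy (\<lambda>t. G t - F t))"
        by (rule energy_triangle[OF _ _ _ GH(1) GF(1)]; measurable)+
      have "energy (\<lambda>t. H t - F t) \<le> 2 powr (p - 1) * (r' + r')"
        using GH(2) GF(2) by (intro order_trans[OF HF(2)] mult_left_mono) auto
      also have "\<dots> = r" by (simp add: r'_def)
      finally have "energy (\<lambda>t. H t - F t) \<le> r" .
      moreover have "finite_energy H \<and> finite_mass H \<and>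
        (\<exists>c \<theta>. finite_energy (\<lambda>t. H t - c * f (t + \<theta>)) \<and>
          energy (\<lambda>t. H t - c * f (t + \<theta>)) \<le> C * (energy H - SB * mass H powr (p / q)))"
        using C(2)[OF G(1,2,3) eps] unfolding H_def by blast
      ultimately show ?thesis using H_nn HF(1) by (intro exI[of _ H]) auto
    qed
    define r where "r n = 1 / real (Suc n)" for n
    have r: "0 < r n" "r \<longlonglongrightarrow> 0" for n
      unfolding r_def[abs_def] using LIMSEQ_Suc[OF lim_1_over_n[where 'a = real]] by auto
    define good where "good n G \<longleftrightarrow> G \<in> borel_measurable borel \<and> (\<forall>t. 0 \<le> G t) \<and> finite_energy G \<and> finite_mass G \<and>
        finite_energy (\<lambda>t. G t - F t) \<and> energy (\<lambda>t. G t - F t) \<le> r n \<and>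
        (\<exists>c \<theta>. finite_energy (\<lambda>t. G t - c * f (t + \<theta>)) \<and>
          energy (\<lambda>t. G t - c * f (t + \<theta>)) \<le> C * (energy G - SB * mass G powr (p / q)))" for n G
    have "\<forall>n. \<exists>G. good n G" unfolding good_def using approx r(1) by blast
    then obtain Fn where "\<forall>n. good n (Fn n)" by (rule choice[THEN exE])
    then have good: "good n (Fn n)" for n ..
    have Fn: "\<And>n. Fn n \<in> borel_measurable borel" "\<And>n t. 0 \<le> Fn n t"
      "\<And>n. finite_energy (Fn n)" "\<And>n. finite_mass (Fn n)"
      "\<And>n. finite_energy (\<lambda>t. Fn n t - F t)" "\<And>n. energy (\<lambda>t. Fn n t - F t) \<le> r n"
      "\<And>n. \<exists>c \<theta>. finite_energy (\<lambda>t. Fn n t - c * f (t + \<theta>)) \<and>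
          energy (\<lambda>t. Fn n t - c * f (t + \<theta>)) \<le> C * (energy (Fn n) - SB * mass (Fn n) powr (p / q))"
      using good unfolding good_def by blast+
    note [measurable] = Fn(1)
    define D Dn Qn where "D = energy F" and "Dn n = energy (Fn n)" and "Qn n = mass (Fn n)" for n
    have Qn_nn: "0 \<le> Qn n" for n unfolding Qn_def by (intro integral_nonneg_AE) auto
    have D_nn: "0 \<le> D" unfolding D_def by (intro integral_nonneg_AE) auto
    \<comment> \<open>The left-hand side of the stability estimate is nonnegative, so the sharp
      inequality holds for the approximants. It bounds their masses and thereby makes the mass of
      \<open>F\<close> finite.\<close>
    have Qn_le: "SB * Qn n powr (p / q) \<le> Dn n" for n
    proof -
      obtain c \<theta> where "energy (\<lambda>t. Fn n t - c * f (t + \<theta>)) \<le> C * (Dn n - SB * Qn n powr (p / q))"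
        using Fn(7)[of n] by (auto simp: Dn_def Qn_def)
      moreover have "0 \<le> energy (\<lambda>t. Fn n t - c * f (t + \<theta>))" by (intro integral_nonneg_AE) auto
      ultimately have "0 \<le> C * (Dn n - SB * Qn n powr (p / q))" by linarith
      then show ?thesis using C(1) by (simp add: zero_le_mult_iff)
    qed
    \<comment> \<open>First \<open>l\<close> is taken close to 1 in terms of \<open>\<eta>\<close>,
      then \<open>n\<close> large in terms of \<open>l\<close>.\<close>
    have Dn_ev: "eventually (\<lambda>n. Dn n < D + \<eta>) sequentially" if eta: "0 < \<eta>" for \<eta>
    proof -
      have "((\<lambda>l. l powr (1 - p) * D) \<longlongrightarrow> 1 powr (1 - p) * D) (at_left 1)"
        by (intro tendsto_intros) auto
      then have "eventually (\<lambda>l. l powr (1 - p) * D < D + \<eta>) (at_left (1::real))"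
        using eta by (intro order_tendstoD(2)) auto
      then have "eventually (\<lambda>l. l powr (1 - p) * D < D + \<eta> \<and> 0 < l \<and> l < 1) (at_left (1::real))"
        using eventually_at_left_real[OF zero_less_one] by eventually_elim auto
      then obtain l :: real where l: "l powr (1 - p) * D < D + \<eta>" "0 < l" "l < 1"
        by (metis (mono_tags, lifting) eventually_happens' trivial_limit_at_left_real)
      have "(\<lambda>n. l powr (1 - p) * D + (1 - l) powr (1 - p) * r n) \<longlonglongrightarrow> l powr (1 - p) * D + (1 - l) powr (1 - p) * 0"
        by (intro tendsto_intros r)
      then have "eventually (\<lambda>n. l powr (1 - p) * D + (1 - l) powr (1 - p) * r n < D + \<eta>) sequentially"
        using l(1) by (intro order_tendstoD(2)) auto
      then show ?thesis
      proof eventually_elim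
        case (elim n)
        let ?S = "\<lambda>t. l powr (1 - p) * (\<bar>F t\<bar> powr p * exp (\<gamma> * t)) + (1 - l) powr (1 - p) * (\<bar>Fn n t - F t\<bar> powr p * exp (\<gamma> * t))"
        have "Dn n \<le> (\<integral>t. ?S t \<partial>lborel)" unfolding Dn_def
        proof (rule integral_mono)
          show "finite_energy (Fn n)" by fact
          show "integrable lborel ?S" using F_en Fn(5) by auto
          fix t
          have "\<bar>Fn n t\<bar> powr p \<le> (\<bar>F t\<bar> + \<bar>Fn n t - F t\<bar>) powr p"
            using p_pos by (intro powr_mono2) auto
          also have "\<dots> \<le> l powr (1 - p) * \<bar>F t\<bar> powr p + (1 - l) powr (1 - p) * \<bar>Fn n t - F t\<bar> powr p"
            using l p2 by (intro powr_add_le_split) auto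
          finally show "\<bar>Fn n t\<bar> powr p * exp (\<gamma> * t) \<le> ?S t"
            by (metis (no_types, lifting) distrib_right exp_ge_zero mult.assoc mult_right_mono)
        qed
        also have "\<dots> = l powr (1 - p) * D + (1 - l) powr (1 - p) * energy (\<lambda>t. Fn n t - F t)"
          using F_en Fn(5) by (simp add: D_def)
        also have "\<dots> \<le> l powr (1 - p) * D + (1 - l) powr (1 - p) * r n"
          using Fn(6)[of n] by (intro add_left_mono mult_left_mono) auto
        finally show ?case using elim by linarith
      qed
    qed
    have tl: "(\<lambda>n. tail_integral (Fn n) t) \<longlonglongrightarrow> tail_integral F t" for t
      by (rule tail_integral_tendsto[OF _ _ F_en Fn(3) Fn(5) r(1) Fn(6) r(2)]) measurable
    note [measurable] = tail_integral_measurable[OF Fm] tail_integral_measurable[OF Fn(1)]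
    define I where "I = (\<integral>\<^sup>+t. ennreal (\<bar>tail_integral F t\<bar> powr q * exp (B * t)) \<partial>lborel)"
    have I_le: "I \<le> liminf (\<lambda>n. ennreal (Qn n))"
    proof -
      have "I = (\<integral>\<^sup>+t. liminf (\<lambda>n. ennreal (\<bar>tail_integral (Fn n) t\<bar> powr q * exp (B * t))) \<partial>lborel)"
        unfolding I_def
      proof (intro nn_integral_cong)
        fix t
        have "(\<lambda>n. \<bar>tail_integral (Fn n) t\<bar> powr q * exp (B * t)) \<longlonglongrightarrow> \<bar>tail_integral F t\<bar> powr q * exp (B * t)"
          using q_pos by (intro tendsto_intros tendsto_powr' tl) auto
        then have "(\<lambda>n. ennreal (\<bar>tail_integral (Fn n) t\<bar> powr q * exp (B * t))) \<longlonglongrightarrow> ennreal (\<bar>tail_integral F t\<bar> powr q * exp (B * t))"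
          by (rule tendsto_ennrealI)
        then show "ennreal (\<bar>tail_integral F t\<bar> powr q * exp (B * t)) = liminf (\<lambda>n. ennreal (\<bar>tail_integral (Fn n) t\<bar> powr q * exp (B * t)))"
          by (rule lim_imp_Liminf[OF trivial_limit_sequentially, symmetric])
      qed
      also have "\<dots> \<le> liminf (\<lambda>n. \<integral>\<^sup>+t. ennreal (\<bar>tail_integral (Fn n) t\<bar> powr q * exp (B * t)) \<partial>lborel)"
        by (rule nn_integral_liminf) measurable
      also have "(\<lambda>n. \<integral>\<^sup>+t. ennreal (\<bar>tail_integral (Fn n) t\<bar> powr q * exp (B * t)) \<partial>lborel) = (\<lambda>n. ennreal (Qn n))"
        unfolding Qn_def by (intro ext nn_integral_eq_integral Fn(4)) auto
      finally show ?thesis .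
    qed
    have fm: "finite_mass F"
    proof -
      have "liminf (\<lambda>n. ennreal (Qn n)) \<le> ennreal (((D + 1) / SB) powr (q / p))"
      proof (rule Liminf_le)
        show "eventually (\<lambda>n. ennreal (Qn n) \<le> ennreal (((D + 1) / SB) powr (q / p))) sequentially"
          using Dn_ev[OF zero_less_one]
        proof eventually_elim
          case (elim n)
          then have "Qn n powr (p / q) \<le> (D + 1) / SB"
            using Qn_le[of n] SB_pos by (simp add: field_simps)
          then have "(Qn n powr (p / q)) powr (q / p) \<le> ((D + 1) / SB) powr (q / p)"
            using p_pos q_pos by (intro powr_mono2) auto
          then show ?case using p_pos q_pos Qn_nn[of n] by (intro ennreal_leI) (simp add: powr_powr)
        qed
      qed simp
      then have "I < \<infinity>" using I_le by (metis ennreal_less_top infinity_ennreal_def le_less_trans)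
      then show ?thesis unfolding I_def by (intro integrableI_nonneg) auto
    qed
    define Q where "Q = mass F"
    have I_eq: "I = ennreal Q" unfolding I_def Q_def by (intro nn_integral_eq_integral fm) auto
    have Q_nn: "0 \<le> Q" unfolding Q_def by (intro integral_nonneg_AE) auto
    have Qn_ev: "eventually (\<lambda>n. SB * Q powr (p / q) \<le> SB * Qn n powr (p / q) + \<eta>) sequentially" if eta: "0 < \<eta>" for \<eta>
    proof (cases "Q = 0")
      case True
      then show ?thesis using eta SB_pos by (intro always_eventually allI) (simp add: add_nonneg_nonneg less_imp_le)
    next
      case False
      then have Q: "0 < Q" using Q_nn by simp
      have "((\<lambda>y. SB * y powr (p / q)) \<longlongrightarrow> SB * Q powr (p / q)) (at_left Q)"
        using Q by (intro tendsto_intros) auto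
      then have "eventually (\<lambda>y. SB * Q powr (p / q) - \<eta> < SB * y powr (p / q)) (at_left Q)"
        using eta by (intro order_tendstoD(1)) auto
      then have "eventually (\<lambda>y. SB * Q powr (p / q) - \<eta> < SB * y powr (p / q) \<and> 0 < y \<and> y < Q) (at_left Q)"
        using eventually_at_left_real[OF Q] by eventually_elim auto
      then obtain y where y: "SB * Q powr (p / q) - \<eta> < SB * y powr (p / q)" "0 < y" "y < Q"
        by (metis (mono_tags, lifting) eventually_happens' trivial_limit_at_left_real)
      have "ennreal y < liminf (\<lambda>n. ennreal (Qn n))"
        using I_le y unfolding I_eq by (metis ennreal_less_iff less_imp_le less_le_trans)
      then have "eventually (\<lambda>n. ennreal y < ennreal (Qn n)) sequentially" by (rule less_LiminfD)
      then show ?thesis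
      proof eventually_elim
        case (elim n)
        then have "y < Qn n" using y by (simp add: ennreal_less_iff)
        then have "SB * y powr (p / q) \<le> SB * Qn n powr (p / q)"
          using SB_pos y pq by (intro mult_left_mono powr_mono2) auto
        then show ?case using y by linarith
      qed
    qed
    have "\<exists>c \<theta>. finite_energy (\<lambda>t. F t - c * f (t + \<theta>)) \<and>
        energy (\<lambda>t. F t - c * f (t + \<theta>)) \<le> 2 powr (p - 1) * C * (D - SB * Q powr (p / q)) + e" if e: "0 < e" for e
    proof -
      \<comment> \<open>Energy and mass of the approximant cost \<open>C * \<eta>\<close> each, its
        distance to \<open>F\<close> costs \<open>\<eta>\<close>, and the triangle inequality
        multiplies all by \<open>2 powr (p - 1)\<close>.\<close>
      define \<eta> where "\<eta> = e / (2 powr (p - 1) * (2 * C + 1))"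
      have eta: "0 < \<eta>" using e C(1) by (simp add: \<eta>_def)
      have "eventually (\<lambda>n. r n < \<eta>) sequentially" using r(2) eta by (rule order_tendstoD(2))
      then have "eventually (\<lambda>n. r n < \<eta> \<and> Dn n < D + \<eta> \<and> SB * Q powr (p / q) \<le> SB * Qn n powr (p / q) + \<eta>) sequentially"
        using Dn_ev[OF eta] Qn_ev[OF eta] by eventually_elim auto
      then obtain n where n: "r n < \<eta>" "Dn n < D + \<eta>" "SB * Q powr (p / q) \<le> SB * Qn n powr (p / q) + \<eta>"
        unfolding eventually_sequentially by blast
      obtain c \<theta> where ct: "finite_energy (\<lambda>t. Fn n t - c * f (t + \<theta>))"
        "energy (\<lambda>t. Fn n t - c * f (t + \<theta>)) \<le> C * (Dn n - SB * Qn n powr (p / q))"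
        using Fn(7)[of n] by (auto simp: Dn_def Qn_def)
      have FFn: "finite_energy (\<lambda>t. F t - Fn n t)" "energy (\<lambda>t. F t - Fn n t) \<le> \<eta>"
        unfolding abs_minus_commute[of "F _"] using Fn(5,6)[of n] n(1) by linarith+
      have tr: "finite_energy (\<lambda>t. F t - c * f (t + \<theta>))"
        "energy (\<lambda>t. F t - c * f (t + \<theta>)) \<le> 2 powr (p - 1) * (energy (\<lambda>t. F t - Fn n t) + energy (\<lambda>t. Fn n t - c * f (t + \<theta>)))"
        by (rule energy_triangle[OF _ _ _ FFn(1) ct(1)]; measurable)+
      have "C * (Dn n - SB * Qn n powr (p / q)) \<le> C * (D - SB * Q powr (p / q) + 2 * \<eta>)"
        using n C(1) by (intro mult_left_mono) auto
      then have "energy (\<lambda>t. F t - Fn n t) + energy (\<lambda>t. Fn n t - c * f (t + \<theta>)) \<le> C * (D - SB * Q powr (p / q)) + (2 * C + 1) * \<eta>"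
        using ct(2) FFn(2) by (simp add: algebra_simps)
      then have "2 powr (p - 1) * (energy (\<lambda>t. F t - Fn n t) + energy (\<lambda>t. Fn n t - c * f (t + \<theta>)))
         \<le> 2 powr (p - 1) * (C * (D - SB * Q powr (p / q)) + (2 * C + 1) * \<eta>)" by (intro mult_left_mono) auto
      also have "\<dots> = 2 powr (p - 1) * C * (D - SB * Q powr (p / q)) + e"
      proof -
        have "2 powr (p - 1) * (2 * C + 1) * \<eta> = e"
          unfolding \<eta>_def using C(1) by (intro nonzero_mult_div_cancel_left[THEN trans, OF _ refl] | simp)+
        then show ?thesis by (simp only: distrib_left[of "2 powr (p - 1)" "C * _"] mult.assoc)
      qed
      finally show ?thesis using tr by (intro exI[of _ c] exI[of _ \<theta>]) linarith
    qed
    then show ?thesis using fm unfolding D_def Q_def by blast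
  qed
  show thesis
  proof (rule that[of "2 powr (p - 1) * C"])
    show "0 < 2 powr (p - 1) * C" using C(1) by simp
  qed (use main in blast)+
qed

end

context bliss
begin

text \<open>The positive part \<open>P\<close> and the negative part \<open>N\<close> of
  \<open>F\<close> have disjoint supports, so energies add, whereas masses are subadditive. If
  \<open>N\<close> has the smaller mass, the deficit bounds both the energy of \<open>N\<close> and
  the deficit of \<open>P\<close>, and an extremal near \<open>P\<close> is also near
  \<open>F\<close>.\<close>

theorem stability:
  obtains C where "0 < C"
    "\<And>F. F \<in> borel_measurable borel \<Longrightarrow> finite_energy F \<Longrightarrow> finite_mass F"
    "\<And>F e. F \<in> borel_measurable borel \<Longrightarrow> finite_energy F \<Longrightarrow> 0 < e \<Longrightarrow>
      \<exists>c \<theta>. finite_energy (\<lambda>t. F t - c * f (t + \<theta>)) \<and>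
        energy (\<lambda>t. F t - c * f (t + \<theta>)) \<le> C * (energy F - SB * mass F powr (p / q)) + e"
proof -
  obtain C where C: "0 < C"
    "\<And>F e. F \<in> borel_measurable borel \<Longrightarrow> (\<And>t. 0 \<le> F t) \<Longrightarrow> finite_energy F \<Longrightarrow> finite_mass F"
    "\<And>F e. F \<in> borel_measurable borel \<Longrightarrow> (\<And>t. 0 \<le> F t) \<Longrightarrow> finite_energy F \<Longrightarrow> 0 < e \<Longrightarrow>
      \<exists>c \<theta>. finite_energy (\<lambda>t. F t - c * f (t + \<theta>)) \<and>
        energy (\<lambda>t. F t - c * f (t + \<theta>)) \<le> C * (energy F - SB * mass F powr (p / q)) + e"
    using nonneg_stability by blast
  \<comment> \<open>The sharp inequality for nonnegative \<open>F\<close>: the energy distance is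
    nonnegative and \<open>e\<close> is arbitrary.\<close>
  have bliss_ineq: "SB * mass F powr (p / q) \<le> energy F"
    if F: "F \<in> borel_measurable borel" "\<And>t. 0 \<le> F t" "finite_energy F" for F
  proof -
    have "0 \<le> C * (energy F - SB * mass F powr (p / q)) + e" if "0 < e" for e
    proof -
      obtain c \<theta> where "energy (\<lambda>t. F t - c * f (t + \<theta>)) \<le> C * (energy F - SB * mass F powr (p / q)) + e"
        using C(3)[OF F \<open>0 < e\<close>] by blast
      moreover have "0 \<le> energy (\<lambda>t. F t - c * f (t + \<theta>))" by (intro integral_nonneg_AE) auto
      ultimately show ?thesis by linarith
    qed
    then have "0 \<le> C * (energy F - SB * mass F powr (p / q))"
      using field_le_epsilon by blast
    then show ?thesis using C(1) by (simp add: zero_le_mult_iff)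
  qed
  define C' where "C' = 2 powr (p - 1) * (C + 1 / (1 - p / q))"
  have C': "0 < C'" unfolding C'_def using C(1) pq by (intro mult_pos_pos add_pos_pos divide_pos_pos) auto
  have split: "finite_mass F \<and> (mass (\<lambda>t. max (- F t) 0) \<le> mass (\<lambda>t. max (F t) 0) \<longrightarrow>
      (\<forall>e>0. \<exists>c \<theta>. finite_energy (\<lambda>t. F t - c * f (t + \<theta>)) \<and>
        energy (\<lambda>t. F t - c * f (t + \<theta>)) \<le> C' * (energy F - SB * mass F powr (p / q)) + e))"
    if [measurable]: "F \<in> borel_measurable borel" and F_en: "finite_energy F" for F
  proof -
    define P N where "P t = max (F t) 0" and "N t = max (- F t) 0" for t
    have [measurable]: "P \<in> borel_measurable borel" "N \<in> borel_measurable borel"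
      unfolding P_def[abs_def] N_def[abs_def] by measurable
    have nn: "0 \<le> P t" "0 \<le> N t" for t by (auto simp: P_def N_def)
    have F_eq: "F = (\<lambda>t. P t - N t)" by (auto simp: P_def N_def)
    have pw: "\<bar>F t\<bar> powr p * exp (\<gamma> * t) = \<bar>P t\<bar> powr p * exp (\<gamma> * t) + \<bar>N t\<bar> powr p * exp (\<gamma> * t)" for t
      by (cases "0 \<le> F t") (auto simp: P_def N_def)
    have P_en: "finite_energy P" and N_en: "finite_energy N"
      by (rule integrable_if_abs_le[OF F_en]; simp add: pw)+
    have en: "energy F = energy P + energy N" unfolding pw using P_en N_en by simp
    have tl: "tail_integral F t = tail_integral P t - tail_integral N t" for t
      by (subst F_eq) (rule tail_integral_diff[OF _ _ P_en N_en]; measurable)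
    \<comment> \<open>The difference of two nonnegative tails is at most the larger one in absolute
      value.\<close>
    have mle: "\<bar>tail_integral F t\<bar> powr q * exp (B * t)
        \<le> \<bar>tail_integral P t\<bar> powr q * exp (B * t) + \<bar>tail_integral N t\<bar> powr q * exp (B * t)" for t
    proof -
      have x: "0 \<le> tail_integral P t" "0 \<le> tail_integral N t" using nn by (auto intro: tail_integral_nonneg)
      have "\<bar>tail_integral F t\<bar> powr q \<le> max (tail_integral P t) (tail_integral N t) powr q"
        unfolding tl using x q_pos by (intro powr_mono2) auto
      also have "\<dots> \<le> tail_integral P t powr q + tail_integral N t powr q" by (simp add: max_def)
      finally show ?thesis
        using x mult_right_mono[of _ _ "exp (B * t)"] by (simp add: distrib_right[symmetric])
    qed
    have fm: "finite_mass P" "finite_mass N" using C(2) nn P_en N_en by auto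
    note [measurable] = tail_integral_measurable[OF \<open>F \<in> borel_measurable borel\<close>]
    have S_int: "integrable lborel (\<lambda>t. \<bar>tail_integral P t\<bar> powr q * exp (B * t) + \<bar>tail_integral N t\<bar> powr q * exp (B * t))"
      using fm by auto
    have F_fm: "finite_mass F"
      by (rule integrable_if_abs_le[OF S_int]) (use mle in auto)
    have m_le: "mass F \<le> mass P + mass N"
      using integral_mono[OF F_fm S_int mle] fm by simp
    have m_nn: "0 \<le> mass H" for H by (intro integral_nonneg_AE) auto
    have en_nn: "0 \<le> energy H" for H by (intro integral_nonneg_AE) auto
    have "\<exists>c \<theta>. finite_energy (\<lambda>t. F t - c * f (t + \<theta>)) \<and>
        energy (\<lambda>t. F t - c * f (t + \<theta>)) \<le> C' * (energy F - SB * mass F powr (p / q)) + e"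
      if le: "mass N \<le> mass P" and e: "0 < e" for e
    proof -
      define \<Delta> where "\<Delta> = energy F - SB * mass F powr (p / q)"
      have "mass F powr (p / q) \<le> (mass P + mass N) powr (p / q)"
        using m_le m_nn pq by (intro powr_mono2) auto
      also have "\<dots> \<le> mass P powr (p / q) + p / q * mass N powr (p / q)"
        using le m_nn pq by (intro powr_add_concave_le) auto
      finally have "SB * mass F powr (p / q) \<le> SB * (mass P powr (p / q) + p / q * mass N powr (p / q))"
        using SB_pos by (intro mult_left_mono) auto
      moreover have "p / q * (SB * mass N powr (p / q)) \<le> p / q * energy N"
        using bliss_ineq[of N] nn N_en pq by (intro mult_left_mono) auto
      ultimately have 1: "(energy P - SB * mass P powr (p / q)) + (1 - p / q) * energy N \<le> \<Delta>"
        unfolding \<Delta>_def en by (simp add: algebra_simps)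
      have P0: "0 \<le> energy P - SB * mass P powr (p / q)" using bliss_ineq[of P] nn P_en by auto
      have N0: "0 \<le> (1 - p / q) * energy N" using pq en_nn by (intro mult_nonneg_nonneg) auto
      have Pd: "energy P - SB * mass P powr (p / q) \<le> \<Delta>" using 1 N0 by linarith
      have Nd: "energy N \<le> 1 / (1 - p / q) * \<Delta>"
      proof -
        have "(1 - p / q) * energy N \<le> \<Delta>" using 1 P0 by linarith
        then show ?thesis using pq by (simp add: pos_le_divide_eq mult.commute)
      qed
      define e' where "e' = e / 2 powr (p - 1)"
      have e': "0 < e'" using e by (simp add: e'_def)
      obtain c \<theta> where ct: "finite_energy (\<lambda>t. P t - c * f (t + \<theta>))"
        "energy (\<lambda>t. P t - c * f (t + \<theta>)) \<le> C * (energy P - SB * mass P powr (p / q)) + e'"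
        using C(3)[of P e'] nn P_en e' by auto
      have FP: "finite_energy (\<lambda>t. F t - P t)" "energy (\<lambda>t. F t - P t) = energy N"
      proof -
        have "\<bar>F t - P t\<bar> = \<bar>N t\<bar>" for t by (auto simp: P_def N_def)
        then show "finite_energy (\<lambda>t. F t - P t)" "energy (\<lambda>t. F t - P t) = energy N" using N_en by auto
      qed
      have tr: "finite_energy (\<lambda>t. F t - c * f (t + \<theta>))"
        "energy (\<lambda>t. F t - c * f (t + \<theta>)) \<le> 2 powr (p - 1) * (energy (\<lambda>t. F t - P t) + energy (\<lambda>t. P t - c * f (t + \<theta>)))"
        by (rule energy_triangle[OF _ _ _ FP(1) ct(1)]; measurable)+
      have "C * (energy P - SB * mass P powr (p / q)) \<le> C * \<Delta>" using Pd C(1) by (intro mult_left_mono) auto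
      then have "energy (\<lambda>t. F t - P t) + energy (\<lambda>t. P t - c * f (t + \<theta>)) \<le> (C + 1 / (1 - p / q)) * \<Delta> + e'"
        unfolding FP(2) distrib_right using ct(2) Nd by linarith
      then have "2 powr (p - 1) * (energy (\<lambda>t. F t - P t) + energy (\<lambda>t. P t - c * f (t + \<theta>))) \<le> 2 powr (p - 1) * ((C + 1 / (1 - p / q)) * \<Delta> + e')"
        by (intro mult_left_mono) auto
      also have "\<dots> = C' * \<Delta> + e" by (simp add: C'_def e'_def distrib_left)
      finally show ?thesis using tr unfolding \<Delta>_def by (intro exI[of _ c] exI[of _ \<theta>]) linarith
    qed
    then show ?thesis using F_fm unfolding P_def N_def by blast
  qed
  show thesis
  proof (rule that[OF C'])
    fix F :: "real \<Rightarrow> real" and e :: real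
    assume F: "F \<in> borel_measurable borel" "finite_energy F"
    show "finite_mass F" using split[OF F] by blast
    assume e: "0 < e"
    show "\<exists>c \<theta>. finite_energy (\<lambda>t. F t - c * f (t + \<theta>)) \<and>
        energy (\<lambda>t. F t - c * f (t + \<theta>)) \<le> C' * (energy F - SB * mass F powr (p / q)) + e"
    proof (cases "mass (\<lambda>t. max (- F t) 0) \<le> mass (\<lambda>t. max (F t) 0)")
      case True
      then show ?thesis using split[OF F] e by blast
    next
      \<comment> \<open>Now \<open>N\<close> has the larger mass. Passing to \<open>- F\<close>
        exchanges the two parts, and the sign is put back into \<open>c\<close>.\<close>
      case False
      have tm: "tail_integral (\<lambda>t. - F t) t = - tail_integral F t" for t
        unfolding tail_integral_def by simp
      have "(\<lambda>t. - F t) \<in> borel_measurable borel" "finite_energy (\<lambda>t. - F t)" using F by auto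
      from split[OF this] False e
      obtain c \<theta> where ct: "finite_energy (\<lambda>t. - F t - c * f (t + \<theta>))"
        "energy (\<lambda>t. - F t - c * f (t + \<theta>)) \<le> C' * (energy F - SB * mass F powr (p / q)) + e"
        by (auto simp: tm)
      have "\<bar>- F t - c * f (t + \<theta>)\<bar> = \<bar>F t - (- c) * f (t + \<theta>)\<bar>" for t by (simp add: abs_minus_commute[of _ "- _"] abs_if)
      then show ?thesis using ct by (intro exI[of _ "- c"] exI[of _ \<theta>]) simp
    qed
  qed
qed

end

section \<open>Radial integration and rays\<close>

text \<open>The surface area of the unit sphere.\<close>

definition sphere_const :: "'a::euclidean_space itself \<Rightarrow> real" where
  "sphere_const TYPE('a) = real DIM('a) * unit_ball_vol (real DIM('a))"

lemma sphere_const_pos: "0 < sphere_const TYPE('a::euclidean_space)"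
  by (simp add: sphere_const_def)

text \<open>Polar coordinates for radial functions, from the volumes of balls alone: two measures on
  the line are compared on half lines. The sign in \<open>- ln (norm x)\<close> makes the half lines
  \<open>{s<..}\<close> correspond to balls, up to the origin, and these have finite volume.\<close>

lemma nn_integral_radial:
  fixes g :: "real \<Rightarrow> ennreal"
  assumes [measurable]: "g \<in> borel_measurable borel"
  shows "(\<integral>\<^sup>+x. g (ln (norm (x::'a::euclidean_space))) \<partial>lborel)
    = (\<integral>\<^sup>+t. ennreal (sphere_const TYPE('a) * exp (real DIM('a) * t)) * g t \<partial>lborel)"
proof -
  define N where "N = real DIM('a)"
  define c where "c = sphere_const TYPE('a)"
  have N: "0 < N" by (simp add: N_def)
  have c: "0 < c" unfolding c_def by (rule sphere_const_pos)
  define M1 where "M1 = distr (lborel :: 'a measure) borel (\<lambda>x. - ln (norm x))"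
  define M2 where "M2 = density lborel (\<lambda>s. ennreal (c * exp (- (N * s))))"
  have e1: "emeasure M1 {s<..} = ennreal (unit_ball_vol N * exp (- (N * s)))" for s
  proof -
    have [measurable]: "(\<lambda>x::'a. - ln (norm x)) \<in> borel_measurable borel" by measurable
    have "emeasure M1 {s<..} = emeasure lborel ((\<lambda>x::'a. - ln (norm x)) -` {s<..} \<inter> space lborel)"
      unfolding M1_def by (rule emeasure_distr) auto
    also have "\<dots> = emeasure lborel (ball (0::'a) (exp (- s)))"
    proof (rule emeasure_eq_AE)
      show "AE x::'a in lborel. (x \<in> (\<lambda>x. - ln (norm x)) -` {s<..} \<inter> space lborel) = (x \<in> ball 0 (exp (- s)))"
        using AE_lborel_singleton[of 0]
      proof eventually_elim
        case (elim x)
        then have "0 < norm x" by simp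
        then have "ln (norm x) < - s \<longleftrightarrow> norm x < exp (- s)" by (metis exp_less_mono exp_ln ln_exp ln_less_cancel_iff exp_gt_zero)
        then show ?case by auto
      qed
    qed (use measurable_sets[of "\<lambda>x::'a. - ln (norm x)" borel borel "{s<..}"] in auto)
    also have "\<dots> = ennreal (unit_ball_vol N * exp (- s) ^ DIM('a))"
      by (simp add: emeasure_ball N_def)
    also have "exp (- s) ^ DIM('a) = exp (- (N * s))"
      by (simp add: N_def exp_of_nat_mult[symmetric])
    finally show ?thesis .
  qed
  have e2: "emeasure M2 {s<..} = ennreal (unit_ball_vol N * exp (- (N * s)))" for s
  proof -
    have "emeasure M2 {s<..} = (\<integral>\<^sup>+x. ennreal (c * exp (- (N * x))) * indicator {s<..} x \<partial>lborel)"
      unfolding M2_def by (rule emeasure_density) auto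
    also have "\<dots> = (\<integral>\<^sup>+x. ennreal (c * exp (- (N * x))) * indicator {s..} x \<partial>lborel)"
      by (rule nn_integral_cong_AE) (use AE_lborel_singleton[of s] in eventually_elim, auto simp: indicator_def)
    also have "\<dots> = ennreal (0 - (- (c / N) * exp (- (N * s))))"
    proof (rule nn_integral_FTC_atLeast)
      show "((\<lambda>x. - (c / N) * exp (- (N * x))) \<longlongrightarrow> 0) at_top"
      proof -
        have "((\<lambda>x. exp (- (N * x))) \<longlongrightarrow> 0) at_top" using N by (rule exp_neg_mult_tendsto_0)
        from tendsto_mult[OF tendsto_const[of "- (c / N)"] this] show ?thesis by simp
      qed
      show "((\<lambda>x. - (c / N) * exp (- (N * x))) has_real_derivative c * exp (- (N * x))) (at x)" for x
        using N by (auto intro!: derivative_eq_intros)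
    qed (use c in auto)
    also have "0 - (- (c / N) * exp (- (N * s))) = unit_ball_vol N * exp (- (N * s))"
      using N by (simp add: c_def sphere_const_def N_def)
    finally show ?thesis .
  qed
  have M: "M1 = M2"
    by (rule measure_eqI_lessThan) (auto simp: M1_def[THEN arg_cong[of _ _ sets]] M2_def[THEN arg_cong[of _ _ sets]] e1 e2)
  have "(\<integral>\<^sup>+x. g (ln (norm (x::'a))) \<partial>lborel) = (\<integral>\<^sup>+s. g (- s) \<partial>M1)"
    unfolding M1_def by (subst nn_integral_distr) auto
  also have "\<dots> = (\<integral>\<^sup>+s. ennreal (c * exp (- (N * s))) * g (- s) \<partial>lborel)"
    unfolding M M2_def by (subst nn_integral_density) auto
  also have "\<dots> = (\<integral>\<^sup>+t. ennreal (c * exp (N * t)) * g t \<partial>lborel)"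
    by (subst nn_integral_real_affine[of _ "-1" 0]) auto
  finally show ?thesis by (simp add: c_def N_def)
qed

lemma distr_ln_norm:
  "distr (lborel :: 'a::euclidean_space measure) borel (\<lambda>x. ln (norm x))
    = density lborel (\<lambda>t. ennreal (sphere_const TYPE('a) * exp (real DIM('a) * t)))" (is "?M = ?D")
proof (rule measure_eqI)
  fix A assume "A \<in> sets ?M"
  then have [measurable]: "A \<in> sets borel" by simp
  have "emeasure ?M A = (\<integral>\<^sup>+t. indicator A t \<partial>?M)" by simp
  also have "\<dots> = (\<integral>\<^sup>+x. indicator A (ln (norm (x::'a))) \<partial>lborel)"
    by (rule nn_integral_distr) auto
  also have "\<dots> = emeasure ?D A"
    by (subst nn_integral_radial) (auto simp: emeasure_density)
  finally show "emeasure ?M A = emeasure ?D A" .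
qed simp

lemma integral_radial:
  fixes g :: "real \<Rightarrow> real"
  assumes [measurable]: "g \<in> borel_measurable borel"
  shows "(\<integral>x. g (ln (norm (x::'a::euclidean_space))) \<partial>lborel)
      = sphere_const TYPE('a) * (\<integral>t. g t * exp (real DIM('a) * t) \<partial>lborel)"
    "integrable lborel (\<lambda>x::'a. g (ln (norm x))) \<longleftrightarrow> integrable lborel (\<lambda>t. g t * exp (real DIM('a) * t))"
proof -
  have c: "0 < sphere_const TYPE('a)" by (rule sphere_const_pos)
  have "(\<integral>x. g (ln (norm (x::'a))) \<partial>lborel) = (\<integral>t. g t \<partial>distr (lborel :: 'a measure) borel (\<lambda>x. ln (norm x)))"
    by (subst integral_distr) auto
  also have "\<dots> = (\<integral>t. (sphere_const TYPE('a) * exp (real DIM('a) * t)) *\<^sub>R g t \<partial>lborel)"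
    unfolding distr_ln_norm using c by (subst integral_density) (auto simp: less_imp_le)
  also have "\<dots> = sphere_const TYPE('a) * (\<integral>t. g t * exp (real DIM('a) * t) \<partial>lborel)"
    by (subst integral_mult_right_zero[symmetric]) (simp add: mult_ac)
  finally show "(\<integral>x. g (ln (norm (x::'a))) \<partial>lborel) = sphere_const TYPE('a) * (\<integral>t. g t * exp (real DIM('a) * t) \<partial>lborel)" .
  have "integrable lborel (\<lambda>x::'a. g (ln (norm x))) \<longleftrightarrow> integrable (distr (lborel :: 'a measure) borel (\<lambda>x. ln (norm x))) g"
    by (subst integrable_distr_eq) auto
  also have "\<dots> \<longleftrightarrow> integrable lborel (\<lambda>t. (sphere_const TYPE('a) * exp (real DIM('a) * t)) *\<^sub>R g t)"
    unfolding distr_ln_norm using c by (subst integrable_density) (auto simp: less_imp_le)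
  also have "\<dots> \<longleftrightarrow> integrable lborel (\<lambda>t. sphere_const TYPE('a) * (g t * exp (real DIM('a) * t)))"
    by (simp add: mult_ac)
  also have "\<dots> \<longleftrightarrow> integrable lborel (\<lambda>t. g t * exp (real DIM('a) * t))" using c by simp
  finally show "integrable lborel (\<lambda>x::'a. g (ln (norm x))) \<longleftrightarrow> integrable lborel (\<lambda>t. g t * exp (real DIM('a) * t))" .
qed

lemma nn_integral_lborel_scale:
  fixes g :: "'a::euclidean_space \<Rightarrow> ennreal"
  assumes [measurable]: "g \<in> borel_measurable borel" and c: "0 < c"
  shows "(\<integral>\<^sup>+x. g x \<partial>lborel) = ennreal (c ^ DIM('a)) * (\<integral>\<^sup>+x. g (c *\<^sub>R x) \<partial>lborel)"
proof -
  have "(\<integral>\<^sup>+x. g x \<partial>lborel) = (\<integral>\<^sup>+x. g x \<partial>density (distr lborel borel (\<lambda>x::'a. 0 + c *\<^sub>R x)) (\<lambda>_. \<bar>c\<bar> ^ DIM('a)))"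
    using c by (subst lborel_affine[of c 0]) auto
  also have "\<dots> = (\<integral>\<^sup>+x. ennreal (c ^ DIM('a)) * g x \<partial>distr lborel borel (\<lambda>x::'a. 0 + c *\<^sub>R x))"
    using c by (subst nn_integral_density) auto
  also have "\<dots> = ennreal (c ^ DIM('a)) * (\<integral>\<^sup>+x. g (c *\<^sub>R x) \<partial>lborel)"
    by (subst nn_integral_distr) (auto simp: nn_integral_cmult)
  finally show ?thesis .
qed

lemma AE_lborel_scale:
  assumes "AE x::'a::euclidean_space in lborel. P x" and c: "0 < c"
  shows "AE x in lborel. P (c *\<^sub>R x)"
proof -
  obtain N where N: "{x. \<not> P x} \<subseteq> N" "N \<in> sets borel" "emeasure lborel N = 0"
    using assms(1) by (auto elim!: AE_E)
  note [measurable] = N(2)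
  have "ennreal (c ^ DIM('a)) * (\<integral>\<^sup>+x. indicator N (c *\<^sub>R x :: 'a) \<partial>lborel) = 0"
    using nn_integral_lborel_scale[of "indicator N", OF _ c] N by simp
  then have "(\<integral>\<^sup>+x. indicator N (c *\<^sub>R x :: 'a) \<partial>lborel) = 0" using c by simp
  then have "AE x::'a in lborel. indicator N (c *\<^sub>R x) = (0::ennreal)"
    by (subst (asm) nn_integral_0_iff_AE) auto
  then show ?thesis by eventually_elim (use N(1) in \<open>auto simp: indicator_def split: if_splits\<close>)
qed

text \<open>Every dilate of a null set is null; Fubini in \<open>x\<close> and \<open>\<tau>\<close>
  exchanges the two quantifiers.\<close>

lemma AE_along_rays:
  assumes "AE x::'a::euclidean_space in lborel. P x"
  shows "AE x::'a in lborel. AE \<tau>::real in lborel. P (exp \<tau> *\<^sub>R x)"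
proof -
  obtain N where N: "{x. \<not> P x} \<subseteq> N" "N \<in> sets borel" "emeasure lborel N = 0"
    using assms by (auto elim!: AE_E)
  note [measurable] = N(2)
  have notN: "AE x in lborel. x \<notin> N" by (rule AE_not_in) (use N in auto)
  have "AE \<tau>::real in lborel. AE x::'a in lborel. exp \<tau> *\<^sub>R x \<notin> N"
    by (rule AE_I2) (rule AE_lborel_scale[OF notN], simp)
  moreover have "{z \<in> space (lborel \<Otimes>\<^sub>M lborel). exp (snd z :: real) *\<^sub>R (fst z :: 'a) \<notin> N} \<in> sets (lborel \<Otimes>\<^sub>M lborel)"
    by measurable
  ultimately have "AE x::'a in lborel. AE \<tau>::real in lborel. exp \<tau> *\<^sub>R x \<notin> N"
    by (subst lborel_pair.AE_commute)
  then show ?thesis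
    by eventually_elim (use N(1) in \<open>auto elim!: eventually_mono\<close>)
qed

lemma AE_lborel_ex:
  assumes "AE x::'a::euclidean_space in lborel. P x"
  shows "\<exists>x. P x"
proof (rule ccontr)
  assume "\<not> ?thesis"
  then have "AE x::'a in lborel. False" using assms by simp
  then show False by (subst (asm) AE_iff_measurable[of UNIV]) auto
qed

text \<open>Fubini in the other direction provides one dilation factor that works for almost every
  \<open>x\<close>; scaling back by its inverse removes it.\<close>

lemma AE_if_along_rays:
  assumes [measurable]: "Measurable.pred borel P"
    and "AE x::'a::euclidean_space in lborel. AE \<tau>::real in lborel. P (exp \<tau> *\<^sub>R x)"
  shows "AE x in lborel. P x"
proof -
  have "{z \<in> space (lborel \<Otimes>\<^sub>M lborel). P (exp (snd z :: real) *\<^sub>R (fst z :: 'a))} \<in> sets (lborel \<Otimes>\<^sub>M lborel)"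
    by measurable
  from lborel_pair.AE_commute[OF this] assms(2)
  have "AE \<tau>::real in lborel. AE x::'a in lborel. P (exp \<tau> *\<^sub>R x)" by simp
  then obtain \<tau> :: real where "AE x::'a in lborel. P (exp \<tau> *\<^sub>R x)"
    using AE_lborel_ex by blast
  from AE_lborel_scale[OF this, of "exp (- \<tau>)"] show ?thesis
    by (simp add: exp_minus)
qed

lemma AE_lborel_translate:
  fixes P :: "real \<Rightarrow> bool"
  assumes "AE x in lborel. P x"
  shows "AE x in lborel. P (x + s)"
proof -
  obtain N where N: "{x. \<not> P x} \<subseteq> N" "N \<in> sets borel" "emeasure lborel N = 0"
    using assms(1) by (auto elim!: AE_E)
  note [measurable] = N(2)
  have "(\<integral>\<^sup>+x. indicator N (x + s) \<partial>lborel) = 0"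
    using nn_integral_real_affine[of "indicator N" 1 s] N by (simp add: add.commute)
  then have "AE x in lborel. indicator N (x + s) = (0::ennreal)"
    by (subst (asm) nn_integral_0_iff_AE) auto
  then show ?thesis by eventually_elim (use N(1) in \<open>auto simp: indicator_def split: if_splits\<close>)
qed

lemma AE_real_in_interval:
  fixes P :: "real \<Rightarrow> bool"
  assumes "AE x in lborel. P x" "a < b"
  obtains x where "a < x" "x < b" "P x"
proof (rule ccontr)
  assume "\<not> thesis"
  then have "{a<..<b} \<subseteq> {x. \<not> P x}" using that by auto
  moreover obtain N where N: "{x. \<not> P x} \<subseteq> N" "N \<in> sets borel" "emeasure lborel N = 0"
    using assms(1) by (auto elim!: AE_E)
  ultimately have "emeasure lborel {a<..<b} \<le> emeasure lborel N" by (intro emeasure_mono) auto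
  then show False using N(3) assms(2) by simp
qed

text \<open>By continuity in the end point all tails vanish. The positive and negative parts of
  \<open>d\<close> are then densities of measures that agree on half lines, hence equal almost
  everywhere.\<close>

lemma AE_zero_if_tail_integrals_zero:
  fixes d :: "real \<Rightarrow> real"
  assumes [measurable]: "d \<in> borel_measurable borel"
    and good: "AE \<tau> in lborel. integrable lborel (\<lambda>s. indicator {\<tau>..} s * d s) \<and> tail_integral d \<tau> = 0"
  shows "AE s in lborel. d s = 0"
proof -
  \<comment> \<open>A tail inherits integrability from any longer tail, and a good end point exists
    just to the left of \<open>\<tau>\<close>.\<close>
  have int: "integrable lborel (\<lambda>s. indicator {\<tau>..} s * d s)" for \<tau>
  proof -
    obtain x where x: "x < \<tau>" "integrable lborel (\<lambda>s. indicator {x..} s * d s)"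
      using AE_real_in_interval[OF good, of "\<tau> - 1" \<tau>] by auto
    show ?thesis
      by (rule Bochner_Integration.integrable_bound[OF x(2)]) (use x(1) in \<open>auto simp: indicator_def\<close>)
  qed
  have zero: "tail_integral d x = 0" for x
  proof -
    have "\<exists>\<tau>. x - 1 / real (Suc n) < \<tau> \<and> \<tau> < x \<and> tail_integral d \<tau> = 0" for n
    proof -
      have "x - 1 / real (Suc n) < x" by simp
      from AE_real_in_interval[OF good this] show ?thesis by blast
    qed
    then obtain \<tau> where \<tau>: "\<And>n. x - 1 / real (Suc n) < \<tau> n" "\<And>n. \<tau> n < x" "\<And>n. tail_integral d (\<tau> n) = 0"
      by metis
    have lim: "\<tau> \<longlonglongrightarrow> x"
    proof (rule tendsto_sandwich)
      show "eventually (\<lambda>n. x - 1 / real (Suc n) \<le> \<tau> n) sequentially" using \<tau>(1) by (intro always_eventually allI less_imp_le)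
      show "eventually (\<lambda>n. \<tau> n \<le> x) sequentially" using \<tau>(2) by (intro always_eventually allI less_imp_le)
      have "(\<lambda>n. x - 1 / real (Suc n)) \<longlonglongrightarrow> x - 0"
        by (intro tendsto_intros LIMSEQ_Suc[OF lim_1_over_n])
      then show "(\<lambda>n. x - 1 / real (Suc n)) \<longlonglongrightarrow> x" by simp
    qed simp
    have "(\<lambda>n. tail_integral d (\<tau> n)) \<longlonglongrightarrow> tail_integral d x"
      unfolding tail_integral_def
    proof (rule integral_dominated_convergence[where w = "\<lambda>s. \<bar>indicator {x - 1..} s * d s\<bar>"])
      show "integrable lborel (\<lambda>s. \<bar>indicator {x - 1..} s * d s\<bar>)" using int by (rule integrable_abs)
      show "AE s in lborel. (\<lambda>n. indicator {\<tau> n..} s * d s) \<longlonglongrightarrow> indicator {x..} s * d s"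
      proof (rule AE_I2)
        fix s
        have "eventually (\<lambda>n. indicator {\<tau> n..} s * d s = indicator {x..} s * d s) sequentially"
        proof (cases "x \<le> s")
          case True
          then have "\<tau> n \<le> s" for n using \<tau>(2)[of n] by linarith
          then show ?thesis using True by simp
        next
          case False
          then have "eventually (\<lambda>n. s < \<tau> n) sequentially" using lim by (intro order_tendstoD(1)) auto
          then show ?thesis by eventually_elim (use False in \<open>auto simp: indicator_def\<close>)
        qed
        then show "(\<lambda>n. indicator {\<tau> n..} s * d s) \<longlonglongrightarrow> indicator {x..} s * d s" by (rule tendsto_eventually)
      qed
      show "AE s in lborel. norm (indicator {\<tau> n..} s * d s) \<le> \<bar>indicator {x - 1..} s * d s\<bar>" for n
      proof (rule AE_I2)
        fix s
        have "1 / real (Suc n) \<le> 1" by simp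
        then have "x - 1 \<le> \<tau> n" using \<tau>(1)[of n] by linarith
        then show "norm (indicator {\<tau> n..} s * d s) \<le> \<bar>indicator {x - 1..} s * d s\<bar>"
          by (auto simp: indicator_def)
      qed
    qed auto
    then show ?thesis using \<tau>(3) by (simp add: LIMSEQ_const_iff)
  qed
  define P N where "P s = max (d s) 0" and "N s = max (- d s) 0" for s
  have [measurable]: "P \<in> borel_measurable borel" "N \<in> borel_measurable borel"
    unfolding P_def[abs_def] N_def[abs_def] by measurable
  have iP: "integrable lborel (\<lambda>s. indicator {x..} s * P s)" and iN: "integrable lborel (\<lambda>s. indicator {x..} s * N s)" for x
    by (rule Bochner_Integration.integrable_bound[OF int[of x]]; auto simp: P_def N_def indicator_def)+
  have em: "emeasure (density lborel (\<lambda>s. ennreal (H s))) {x<..} = ennreal (\<integral>s. indicator {x..} s * H s \<partial>lborel)"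
    if [measurable]: "H \<in> borel_measurable borel" and "\<And>s. 0 \<le> H s" "integrable lborel (\<lambda>s. indicator {x..} s * H s)" for H :: "real \<Rightarrow> real" and x
  proof -
    have "emeasure (density lborel (\<lambda>s. ennreal (H s))) {x<..} = (\<integral>\<^sup>+s. ennreal (H s) * indicator {x<..} s \<partial>lborel)"
      by (rule emeasure_density) auto
    also have "\<dots> = (\<integral>\<^sup>+s. ennreal (indicator {x..} s * H s) \<partial>lborel)"
      by (rule nn_integral_cong_AE) (use AE_lborel_singleton[of x] in eventually_elim, auto simp: indicator_def)
    also have "\<dots> = ennreal (\<integral>s. indicator {x..} s * H s \<partial>lborel)"
      by (rule nn_integral_eq_integral) (use that in auto)
    finally show ?thesis .
  qed
  have "density lborel (\<lambda>s. ennreal (P s)) = density lborel (\<lambda>s. ennreal (N s))"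
  proof (rule measure_eqI_lessThan)
    fix x
    have eP: "emeasure (density lborel (\<lambda>s. ennreal (P s))) {x<..} = ennreal (\<integral>s. indicator {x..} s * P s \<partial>lborel)"
      by (rule em[OF _ _ iP]) (auto simp: P_def)
    have eN: "emeasure (density lborel (\<lambda>s. ennreal (N s))) {x<..} = ennreal (\<integral>s. indicator {x..} s * N s \<partial>lborel)"
      by (rule em[OF _ _ iN]) (auto simp: N_def)
    have "(\<integral>s. indicator {x..} s * P s \<partial>lborel) - (\<integral>s. indicator {x..} s * N s \<partial>lborel) = (\<integral>s. indicator {x..} s * P s - indicator {x..} s * N s \<partial>lborel)"
      using iP iN by simp
    also have "\<dots> = tail_integral d x" unfolding tail_integral_def
      by (intro Bochner_Integration.integral_cong) (auto simp: P_def N_def indicator_def)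
    finally have "(\<integral>s. indicator {x..} s * P s \<partial>lborel) = (\<integral>s. indicator {x..} s * N s \<partial>lborel)" using zero by simp
    then show "emeasure (density lborel (\<lambda>s. ennreal (P s))) {x<..} = emeasure (density lborel (\<lambda>s. ennreal (N s))) {x<..}"
      unfolding eP eN by simp
    show "emeasure (density lborel (\<lambda>s. ennreal (P s))) {x<..} < \<infinity>" unfolding eP by simp
  qed auto
  then have "AE s in lborel. ennreal (P s) = ennreal (N s)"
    by (intro sigma_finite_measure.density_unique[OF lborel.sigma_finite_measure_axioms]) auto
  then show ?thesis
  proof eventually_elim
    case (elim s)
    then have "P s = N s" by (simp add: P_def N_def)
    then show ?case by (auto simp: P_def N_def max_def split: if_splits)
  qed
qed

section \<open>Radial elements of the completion\<close>

lemma test_fun_has_derivative: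
  assumes "test_fun \<phi>"
  shows "(\<phi> has_derivative (\<lambda>v. grad \<phi> x \<bullet> v)) (at x)"
proof -
  have d: "\<phi> differentiable (at x)"
    using assms unfolding test_fun_def smooth_def by (metis empty_set empty_subsetI foldr.simps(1) id_apply)
  then have D: "(\<phi> has_derivative frechet_derivative \<phi> (at x)) (at x)" by (simp add: frechet_derivative_works)
  have lin: "linear (frechet_derivative \<phi> (at x))" using d by (rule linear_frechet_derivative)
  have "frechet_derivative \<phi> (at x) v = grad \<phi> x \<bullet> v" for v
  proof -
    have "frechet_derivative \<phi> (at x) v = frechet_derivative \<phi> (at x) (\<Sum>b\<in>Basis. (v \<bullet> b) *\<^sub>R b)"
      by (simp add: euclidean_representation)
    also have "\<dots> = (\<Sum>b\<in>Basis. (v \<bullet> b) * frechet_derivative \<phi> (at x) b)"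
      using lin by (simp add: linear_sum linear_cmul)
    also have "\<dots> = grad \<phi> x \<bullet> v"
      unfolding grad_def inner_sum_left by (intro sum.cong refl) (simp add: inner_commute mult.commute)
    finally show ?thesis .
  qed
  then have "frechet_derivative \<phi> (at x) = (\<lambda>v. grad \<phi> x \<bullet> v)" by (rule ext)
  with D show ?thesis by simp
qed

lemma grad_eqI:
  assumes "(\<phi> has_derivative (\<lambda>v. g \<bullet> v)) (at x)"
  shows "grad \<phi> x = g"
proof -
  have "frechet_derivative \<phi> (at x) = (\<lambda>v. g \<bullet> v)" using assms by (rule frechet_derivative_at[symmetric])
  then show ?thesis by (simp add: grad_def euclidean_representation)
qed

lemma test_fun_grad_continuous:
  assumes "test_fun \<phi>"
  shows "continuous_on UNIV (grad \<phi>)"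
proof -
  have "continuous_on UNIV (\<lambda>x. frechet_derivative \<phi> (at x) b)" if b: "b \<in> Basis" for b
  proof -
    have "foldr pderiv_dir [b] \<phi> differentiable (at x)" for x
    proof -
      have "set [b] \<subseteq> Basis" using b by simp
      then show ?thesis using assms unfolding test_fun_def smooth_def by blast
    qed
    then have "(\<lambda>x. frechet_derivative \<phi> (at x) b) differentiable (at x)" for x
      by (simp add: pderiv_dir_def[abs_def])
    then show ?thesis
      by (simp add: continuous_at_imp_continuous_on differentiable_imp_continuous_within)
  qed
  then show ?thesis unfolding grad_def by (intro continuous_intros) auto
qed

lemma test_fun_support:
  fixes \<phi> :: "'a::euclidean_space \<Rightarrow> real"
  assumes "test_fun \<phi>"
  obtains R where "0 < R" "\<And>x. R < norm x \<Longrightarrow> \<phi> x = 0" "\<And>x. R < norm x \<Longrightarrow> grad \<phi> x = 0"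
proof -
  have "bounded (closure {x. \<phi> x \<noteq> 0})"
    using assms by (simp add: test_fun_def compact_imp_bounded)
  then obtain R where R: "0 < R" "\<forall>x\<in>closure {x. \<phi> x \<noteq> 0}. norm x \<le> R"
    unfolding bounded_pos by blast
  have z: "\<phi> x = 0" if "R < norm x" for x
  proof (rule ccontr)
    assume "\<phi> x \<noteq> 0"
    then have "x \<in> closure {x. \<phi> x \<noteq> 0}" using closure_subset[of "{x. \<phi> x \<noteq> 0}"] by blast
    then show False using R(2) that by fastforce
  qed
  have "grad \<phi> x = 0" if x: "R < norm x" for x
  proof (rule grad_eqI)
    have "open {y::'a. R < norm y}" by (intro open_Collect_less continuous_intros)
    moreover have "((\<lambda>_. 0) has_derivative (\<lambda>_. 0)) (at x)" by simp
    ultimately show "(\<phi> has_derivative (\<lambda>v. 0 \<bullet> v)) (at x)"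
      using has_derivative_transform_within_open[of "\<lambda>_. 0" "\<lambda>_. 0" x UNIV "{y. R < norm y}" \<phi>] x z by simp
  qed
  with R(1) z show thesis by (rule that)
qed

text \<open>If \<open>G\<close> is the gradient of \<open>\<phi>\<close>, this is minus the
  derivative of \<open>\<phi> (exp s *\<^sub>R y)\<close> at \<open>s = 0\<close>: the derivative in
  the logarithm of the radius, with the sign of \<open>F = - u'\<close>.\<close>

abbreviation radial_part :: "('a::euclidean_space \<Rightarrow> 'a) \<Rightarrow> 'a \<Rightarrow> real" where
  "radial_part G y \<equiv> - (G y \<bullet> y)"

text \<open>Fundamental theorem of calculus along \<open>exp s *\<^sub>R x\<close>; the far end
  contributes 0 by compact support.\<close>

lemma test_fun_ray:
  fixes \<phi> :: "'a::euclidean_space \<Rightarrow> real"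
  assumes \<phi>: "test_fun \<phi>" and x: "x \<noteq> 0"
  shows "integrable lborel (\<lambda>s. indicator {0..} s * radial_part (grad \<phi>) (exp s *\<^sub>R x))"
    "(\<integral>s. indicator {0..} s * radial_part (grad \<phi>) (exp s *\<^sub>R x) \<partial>lborel) = \<phi> x"
proof -
  obtain R where R: "0 < R" "\<And>x. R < norm x \<Longrightarrow> \<phi> x = 0" "\<And>x. R < norm x \<Longrightarrow> grad \<phi> x = 0"
    using test_fun_support[OF \<phi>] by blast
  define S where "S = max 0 (ln ((R + 1) / norm x))"
  have S0: "0 \<le> S" by (simp add: S_def)
  have far: "R < norm (exp s *\<^sub>R x)" if "S \<le> s" for s
  proof -
    have "(R + 1) / norm x = exp (ln ((R + 1) / norm x))" using x R by simp
    also have "\<dots> \<le> exp s" using that by (simp add: S_def)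
    finally have "R + 1 \<le> exp s * norm x" using x by (simp add: pos_divide_le_eq)
    then show ?thesis by simp
  qed
  define h where "h s = radial_part (grad \<phi>) (exp s *\<^sub>R x)" for s
  have hc: "continuous_on A h" for A
  proof -
    have "continuous_on A (\<lambda>s. grad \<phi> (exp s *\<^sub>R x))"
      by (rule continuous_on_compose2[OF test_fun_grad_continuous[OF \<phi>]]) (auto intro!: continuous_intros)
    then show ?thesis unfolding h_def by (intro continuous_intros)
  qed
  have eq: "indicator {0..} s * h s = indicator {0..S} s * h s" for s
    using R(3)[OF far, of s] by (cases "S \<le> s") (auto simp: indicator_def h_def)
  have der: "((\<lambda>s. - \<phi> (exp s *\<^sub>R x)) has_real_derivative h s) (at s)" for s
  proof -
    have 1: "((\<lambda>s. exp s *\<^sub>R x) has_derivative (\<lambda>t. (exp s * t) *\<^sub>R x)) (at s)"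
      by (auto intro!: derivative_eq_intros)
    have "((\<lambda>s. \<phi> (exp s *\<^sub>R x)) has_derivative (\<lambda>t. grad \<phi> (exp s *\<^sub>R x) \<bullet> ((exp s * t) *\<^sub>R x))) (at s)"
      by (rule has_derivative_compose[OF 1 test_fun_has_derivative[OF \<phi>]])
    then have "((\<lambda>s. - \<phi> (exp s *\<^sub>R x)) has_derivative (\<lambda>t. - (grad \<phi> (exp s *\<^sub>R x) \<bullet> ((exp s * t) *\<^sub>R x)))) (at s)"
      by (rule has_derivative_minus)
    moreover have "(\<lambda>t. - (grad \<phi> (exp s *\<^sub>R x) \<bullet> ((exp s * t) *\<^sub>R x))) = (*) (h s)"
      by (auto simp: h_def mult_ac)
    ultimately show ?thesis by (simp add: has_field_derivative_def)
  qed
  show "integrable lborel (\<lambda>s. indicator {0..} s * radial_part (grad \<phi>) (exp s *\<^sub>R x))"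
    unfolding h_def[symmetric] eq by (rule integral_interval_eq_LINT(2)[OF hc])
  have "(h has_integral (- \<phi> (exp S *\<^sub>R x)) - (- \<phi> (exp 0 *\<^sub>R x))) {0..S}"
    using S0 der by (intro fundamental_theorem_of_calculus)
      (auto simp: has_real_derivative_iff_has_vector_derivative[symmetric] intro: DERIV_subset)
  then have hI: "integral {0..S} h = - \<phi> (exp S *\<^sub>R x) - (- \<phi> (exp 0 *\<^sub>R x))" by (rule integral_unique)
  have "(\<integral>s. indicator {0..} s * h s \<partial>lborel) = integral {0..S} h"
    unfolding eq by (rule integral_interval_eq_LINT(1)[OF hc, symmetric])
  also note hI
  also have "- \<phi> (exp S *\<^sub>R x) - (- \<phi> (exp 0 *\<^sub>R x)) = \<phi> x" using R(2)[OF far, of S] by simp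
  finally show "(\<integral>s. indicator {0..} s * radial_part (grad \<phi>) (exp s *\<^sub>R x) \<partial>lborel) = \<phi> x"
    by (simp add: h_def)
qed

text \<open>The power \<open>- DIM('a)\<close> of the norm is the dilation-invariant weight. After
  Fubini and scaling, each \<open>y\<close> is weighted by the measure of the
  \<open>s \<ge> 0\<close> that carry it back into the annulus: at most \<open>2 * j\<close>, and 0
  unless \<open>- j \<le> ln (norm y)\<close>.\<close>

lemma nn_integral_rays_le:
  fixes h :: "'a::euclidean_space \<Rightarrow> ennreal"
  assumes [measurable]: "h \<in> borel_measurable borel" and j: "0 \<le> j"
  shows "(\<integral>\<^sup>+x. (\<integral>\<^sup>+s. indicator {0..} s * h (exp s *\<^sub>R x) \<partial>lborel)
        * ennreal (norm x powr (- real DIM('a)) * indicator {-j..j} (ln (norm x))) \<partial>lborel)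
    \<le> (\<integral>\<^sup>+y. h y * ennreal (norm y powr (- real DIM('a)) * (2 * j * indicator {-j..} (ln (norm y)))) \<partial>lborel)"
proof -
  let ?N = "real DIM('a)"
  let ?w = "\<lambda>x::'a. norm x powr (- ?N)"
  have "(\<integral>\<^sup>+x. (\<integral>\<^sup>+s. indicator {0..} s * h (exp s *\<^sub>R x) \<partial>lborel) * ennreal (?w x * indicator {-j..j} (ln (norm x))) \<partial>lborel)
     = (\<integral>\<^sup>+x. \<integral>\<^sup>+s. indicator {0..} s * h (exp s *\<^sub>R x) * ennreal (?w x * indicator {-j..j} (ln (norm x))) \<partial>lborel \<partial>lborel)"
    by (intro nn_integral_cong nn_integral_multc[symmetric]) measurable
  also have "\<dots> = (\<integral>\<^sup>+s. \<integral>\<^sup>+x. indicator {0..} s * h (exp s *\<^sub>R x) * ennreal (?w x * indicator {-j..j} (ln (norm x))) \<partial>lborel \<partial>lborel)"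
    by (rule lborel_pair.Fubini'[symmetric]) measurable
  also have "\<dots> = (\<integral>\<^sup>+s. \<integral>\<^sup>+y. h y * (ennreal (?w y) * (indicator {0..} s * indicator {-j..j} (ln (norm y) - s))) \<partial>lborel \<partial>lborel)"
  proof (rule nn_integral_cong)
    fix s :: real
    define k where "k y = indicator {0..} s * h (exp s *\<^sub>R y) * ennreal (?w y * indicator {-j..j} (ln (norm y)))" for y
    have [measurable]: "k \<in> borel_measurable borel" unfolding k_def[abs_def] by measurable
    have "(\<integral>\<^sup>+x. k x \<partial>lborel) = ennreal (exp (- s) ^ DIM('a)) * (\<integral>\<^sup>+y. k (exp (- s) *\<^sub>R y) \<partial>lborel)"
      by (rule nn_integral_lborel_scale) auto
    also have "\<dots> = (\<integral>\<^sup>+y. ennreal (exp (- s) ^ DIM('a)) * k (exp (- s) *\<^sub>R y) \<partial>lborel)"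
      by (rule nn_integral_cmult[symmetric]) measurable
    also have "\<dots> = (\<integral>\<^sup>+y. h y * (ennreal (?w y) * (indicator {0..} s * indicator {-j..j} (ln (norm y) - s))) \<partial>lborel)"
    proof (rule nn_integral_cong_AE)
      show "AE y in lborel. ennreal (exp (- s) ^ DIM('a)) * k (exp (- s) *\<^sub>R y)
          = h y * (ennreal (?w y) * (indicator {0..} s * indicator {-j..j} (ln (norm y) - s)))"
        using AE_lborel_singleton[of 0]
      proof eventually_elim
      case (elim y)
      have y: "0 < norm y" using elim by simp
      have p: "exp (- s) ^ DIM('a) * (exp (- s) * norm y) powr (- ?N) = ?w y"
      proof -
        have "exp (- s) ^ DIM('a) = exp (- s) powr ?N" by (simp add: powr_realpow)
        then show ?thesis by (simp add: powr_mult powr_minus)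
      qed
      have l: "ln (exp (- s) * norm y) = ln (norm y) - s" using y by (simp add: ln_mult)
      have "exp s *\<^sub>R (exp (- s) *\<^sub>R y) = y" by (simp add: exp_minus)
      then have "ennreal (exp (- s) ^ DIM('a)) * k (exp (- s) *\<^sub>R y)
        = indicator {0..} s * h y * ennreal (exp (- s) ^ DIM('a) * ((exp (- s) * norm y) powr (- ?N) * indicator {-j..j} (ln (exp (- s) * norm y))))"
        unfolding k_def by (subst ennreal_mult''[of _ "exp (- s) ^ DIM('a)"]) (simp_all add: mult_ac)
      also have "exp (- s) ^ DIM('a) * ((exp (- s) * norm y) powr (- ?N) * indicator {-j..j} (ln (exp (- s) * norm y)))
         = ?w y * indicator {-j..j} (ln (norm y) - s)" unfolding l p[symmetric] by (simp only: mult.assoc)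
      also have "indicator {0..} s * h y * ennreal (?w y * indicator {-j..j} (ln (norm y) - s))
         = h y * (ennreal (?w y) * (indicator {0..} s * indicator {-j..j} (ln (norm y) - s)))"
        by (auto simp: indicator_def)
      finally show ?case .
      qed
    qed
    finally show "(\<integral>\<^sup>+x. indicator {0..} s * h (exp s *\<^sub>R x) * ennreal (?w x * indicator {-j..j} (ln (norm x))) \<partial>lborel)
       = (\<integral>\<^sup>+y. h y * (ennreal (?w y) * (indicator {0..} s * indicator {-j..j} (ln (norm y) - s))) \<partial>lborel)"
      by (simp add: k_def)
  qed
  also have "\<dots> = (\<integral>\<^sup>+y. \<integral>\<^sup>+s. h y * (ennreal (?w y) * (indicator {0..} s * indicator {-j..j} (ln (norm y) - s))) \<partial>lborel \<partial>lborel)"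
  proof (rule lborel_pair.Fubini')
    have "(\<lambda>z::'a \<times> real. indicator {-j..j} (ln (norm (fst z)) - snd z) :: ennreal) \<in> borel_measurable (lborel \<Otimes>\<^sub>M lborel)"
      by measurable
    then show "(\<lambda>(y::'a, s::real). h y * (ennreal (?w y) * (indicator {0..} s * indicator {-j..j} (ln (norm y) - s)))) \<in> borel_measurable (lborel \<Otimes>\<^sub>M lborel)"
      by (simp add: case_prod_beta')
  qed
  also have "\<dots> \<le> (\<integral>\<^sup>+y. h y * ennreal (?w y * (2 * j * indicator {-j..} (ln (norm y)))) \<partial>lborel)"
  proof (rule nn_integral_mono)
    fix y :: 'a
    let ?t = "ln (norm y)"
    have "(\<integral>\<^sup>+s. indicator {0..} s * indicator {-j..j} (?t - s) \<partial>lborel) \<le> (\<integral>\<^sup>+s. indicator {-j..} ?t * indicator {?t - j..?t + j} s \<partial>lborel)"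
      by (intro nn_integral_mono) (auto simp: indicator_def)
    also have "\<dots> = indicator {-j..} ?t * ennreal (2 * j)"
      using j by (simp add: nn_integral_cmult)
    finally have le: "(\<integral>\<^sup>+s. indicator {0..} s * indicator {-j..j} (?t - s) \<partial>lborel) \<le> indicator {-j..} ?t * ennreal (2 * j)" .
    have "(\<integral>\<^sup>+s. h y * (ennreal (?w y) * (indicator {0..} s * indicator {-j..j} (?t - s))) \<partial>lborel)
       = h y * (ennreal (?w y) * (\<integral>\<^sup>+s. indicator {0..} s * indicator {-j..j} (?t - s) \<partial>lborel))"
      by (simp add: nn_integral_cmult)
    also have "\<dots> \<le> h y * (ennreal (?w y) * (indicator {-j..} ?t * ennreal (2 * j)))"
      by (intro mult_left_mono le) auto
    also have "\<dots> = h y * ennreal (?w y * (2 * j * indicator {-j..} ?t))"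
      using j by (auto simp: indicator_def ennreal_mult'')
    finally show "(\<integral>\<^sup>+s. h y * (ennreal (?w y) * (indicator {0..} s * indicator {-j..j} (?t - s))) \<partial>lborel)
       \<le> h y * ennreal (?w y * (2 * j * indicator {-j..} ?t))" .
  qed
  finally show ?thesis .
qed

text \<open>The powers of \<open>r\<close> are distributed so that the first term is the energy
  density and the second, whose exponent is below \<open>- N\<close> when
  \<open>0 < N - p + \<alpha>\<close>, is integrable away from the origin.\<close>

lemma weighted_young_le:
  fixes p \<alpha> N r d \<mu> :: real
  assumes p: "1 < p" and r: "0 < r" and d: "0 \<le> d" and \<mu>: "0 < \<mu>"
  shows "d * r * r powr (- N) \<le> \<mu> powr (- p) * (r powr \<alpha> * d powr p)
    + \<mu> powr (p / (p - 1)) * r powr (- ((N - p + \<alpha>) / (p - 1)) - N)"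
proof -
  have "d * r * r powr (- N) = (d * r powr (\<alpha> / p) / \<mu>) * (\<mu> * r powr (1 - N - \<alpha> / p))"
  proof -
    have "r powr (\<alpha> / p) * r powr (1 - N - \<alpha> / p) = r powr (1 - N)" by (simp add: powr_add[symmetric])
    also have "\<dots> = r * r powr (- N)" using r by (simp add: powr_diff powr_minus_divide)
    finally show ?thesis using \<mu> by (simp add: mult_ac)
  qed
  also have "\<dots> \<le> (d * r powr (\<alpha> / p) / \<mu>) powr p + (\<mu> * r powr (1 - N - \<alpha> / p)) powr (p / (p - 1))"
    using assms by (intro young_powr_le) auto
  also have "(d * r powr (\<alpha> / p) / \<mu>) powr p = \<mu> powr (- p) * (r powr \<alpha> * d powr p)"
    using assms by (simp add: powr_divide powr_mult powr_powr powr_minus_divide)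
  also have "(\<mu> * r powr (1 - N - \<alpha> / p)) powr (p / (p - 1)) = \<mu> powr (p / (p - 1)) * r powr (- ((N - p + \<alpha>) / (p - 1)) - N)"
  proof -
    have "(1 - N - \<alpha> / p) * (p / (p - 1)) = - ((N - p + \<alpha>) / (p - 1)) - N"
      using p by (simp add: divide_simps) (simp add: algebra_simps)
    then show ?thesis using \<mu> by (simp add: powr_mult powr_powr)
  qed
  finally show ?thesis .
qed

text \<open>The ray integrals of the error in the radial derivative tend to 0 in the mean over every
  annulus. By Fatou their lower limit is 0 for almost every \<open>x\<close>, so along indices
  depending on \<open>x\<close> the identity for test functions passes to the limit.\<close>

theorem in_D_ray:
  fixes u :: "'a::euclidean_space \<Rightarrow> real"
  assumes D: "in_D p \<alpha> u G" and p: "1 < p" and \<alpha>: "p - real DIM('a) < \<alpha>"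
  shows "AE x in lborel. integrable lborel (\<lambda>s. indicator {0..} s * radial_part G (exp s *\<^sub>R x)) \<and>
    u x = (\<integral>s. indicator {0..} s * radial_part G (exp s *\<^sub>R x) \<partial>lborel)"
proof -
  define N where "N = real DIM('a)"
  define \<kappa> where "\<kappa> = (N - p + \<alpha>) / (p - 1)"
  have \<kappa>: "0 < \<kappa>" using p \<alpha> by (simp add: \<kappa>_def N_def)
  obtain \<phi> where um: "u \<in> borel_measurable borel" and Gm: "G \<in> borel_measurable borel" and
    \<phi>: "\<And>k. test_fun (\<phi> k)" "AE x in lborel. (\<lambda>k. \<phi> k x) \<longlonglongrightarrow> u x"
      "(\<lambda>k. \<integral>\<^sup>+ x. ennreal (norm x powr \<alpha> * norm (grad (\<phi> k) x - G x) powr p) \<partial>lborel) \<longlonglongrightarrow> 0"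
    using D unfolding in_D_def by auto
  note [measurable] = um Gm
  have gm [measurable]: "grad (\<phi> k) \<in> borel_measurable borel" for k
    using test_fun_grad_continuous[OF \<phi>(1)] by (rule borel_measurable_continuous_onI)
  define a where "a k = (\<integral>\<^sup>+ x. ennreal (norm x powr \<alpha> * norm (grad (\<phi> k) x - G x) powr p) \<partial>lborel)" for k
  define h where "h k y = ennreal \<bar>radial_part (grad (\<phi> k)) y - radial_part G y\<bar>" for k y
  have [measurable]: "h k \<in> borel_measurable borel" for k unfolding h_def[abs_def] by measurable
  define X where "X k x = (\<integral>\<^sup>+s. indicator {0..} s * h k (exp s *\<^sub>R x) \<partial>lborel)" for k x
  have [measurable]: "X k \<in> borel_measurable borel" for k unfolding X_def[abs_def] by measurable
  define w where "w j x = norm x powr (- N) * indicator {-real j..real j} (ln (norm x))" for j and x :: 'a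
  have [measurable]: "w j \<in> borel_measurable borel" for j unfolding w_def[abs_def] by measurable
  have lim0: "AE x in lborel. liminf (\<lambda>k. X k x * ennreal (w j x)) = 0" for j
  proof -
    define Kf where "Kf y = norm y powr (- \<kappa> - N) * indicator {-real j..} (ln (norm y))" for y :: 'a
    have [measurable]: "Kf \<in> borel_measurable borel" unfolding Kf_def[abs_def] by measurable
    define K where "K = (\<integral>\<^sup>+y. ennreal (Kf y) \<partial>(lborel :: 'a measure))"
    have "K = (\<integral>\<^sup>+y. ennreal (exp ((- \<kappa> - N) * ln (norm (y::'a))) * indicator {-real j..} (ln (norm y))) \<partial>lborel)"
      unfolding K_def
      by (rule nn_integral_cong_AE) (use AE_lborel_singleton[of 0] in eventually_elim, auto simp: Kf_def powr_def)
    also have "\<dots> = (\<integral>\<^sup>+t. ennreal (sphere_const TYPE('a) * exp (N * t)) * ennreal (exp ((- \<kappa> - N) * t) * indicator {-real j..} t) \<partial>lborel)"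
      unfolding N_def by (subst nn_integral_radial[symmetric]) auto
    also have "\<dots> = (\<integral>\<^sup>+t. ennreal (sphere_const TYPE('a) * exp (- (\<kappa> * t))) * indicator {-real j..} t \<partial>lborel)"
    proof (rule nn_integral_cong)
      fix t :: real
      have "exp (N * t) * exp ((- \<kappa> - N) * t) = exp (- (\<kappa> * t))" by (simp add: exp_add[symmetric] algebra_simps)
      then show "ennreal (sphere_const TYPE('a) * exp (N * t)) * ennreal (exp ((- \<kappa> - N) * t) * indicator {-real j..} t)
        = ennreal (sphere_const TYPE('a) * exp (- (\<kappa> * t))) * indicator {-real j..} t"
        using sphere_const_pos[where 'a = 'a] by (auto simp: indicator_def ennreal_mult'[symmetric] mult.assoc less_imp_le)
    qed
    also have "\<dots> = ennreal (0 - (- (sphere_const TYPE('a) / \<kappa>) * exp (- (\<kappa> * (- real j)))))"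
    proof (rule nn_integral_FTC_atLeast)
      have "((\<lambda>x. exp (- (\<kappa> * x))) \<longlongrightarrow> 0) at_top" using \<kappa> by (rule exp_neg_mult_tendsto_0)
      from tendsto_mult[OF tendsto_const[of "- (sphere_const TYPE('a) / \<kappa>)"] this]
      show "((\<lambda>x. - (sphere_const TYPE('a) / \<kappa>) * exp (- (\<kappa> * x))) \<longlongrightarrow> 0) at_top" by simp
      show "((\<lambda>x. - (sphere_const TYPE('a) / \<kappa>) * exp (- (\<kappa> * x))) has_real_derivative sphere_const TYPE('a) * exp (- (\<kappa> * x))) (at x)" for x
        using \<kappa> by (auto intro!: derivative_eq_intros)
    qed (use sphere_const_pos[where 'a = 'a] in \<open>auto simp: less_imp_le\<close>)
    finally have "K < \<infinity>" by simp
    then obtain Kr where Kr: "0 \<le> Kr" "K = ennreal Kr" by (cases K) auto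
    \<comment> \<open>The 1 keeps \<open>J\<close> positive for \<open>j = 0\<close>, so that
      dividing by it is safe.\<close>
    define J where "J = real j + 1"
    have J: "0 < J" "real j \<le> J" by (auto simp: J_def)
    have bound: "(\<integral>\<^sup>+x. X k x * ennreal (w j x) \<partial>lborel) \<le> ennreal (2 * J) * (ennreal (\<mu> powr (- p)) * a k + ennreal (\<mu> powr (p / (p - 1))) * K)"
      if \<mu>: "0 < \<mu>" for k \<mu>
    proof -
      have "(\<integral>\<^sup>+x. X k x * ennreal (w j x) \<partial>lborel)
        \<le> (\<integral>\<^sup>+y. h k y * ennreal (norm y powr (- real DIM('a)) * (2 * real j * indicator {-real j..} (ln (norm y)))) \<partial>lborel)"
        unfolding X_def w_def N_def by (rule nn_integral_rays_le) auto
      also have "\<dots> \<le> (\<integral>\<^sup>+y. ennreal (2 * J) * (ennreal (\<mu> powr (- p)) * ennreal (norm y powr \<alpha> * norm (grad (\<phi> k) y - G y) powr p)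
          + ennreal (\<mu> powr (p / (p - 1))) * ennreal (Kf y)) \<partial>lborel)"
      proof (rule nn_integral_mono_AE)
        show "AE y in lborel. h k y * ennreal (norm y powr (- real DIM('a)) * (2 * real j * indicator {-real j..} (ln (norm y))))
          \<le> ennreal (2 * J) * (ennreal (\<mu> powr (- p)) * ennreal (norm y powr \<alpha> * norm (grad (\<phi> k) y - G y) powr p)
          + ennreal (\<mu> powr (p / (p - 1))) * ennreal (Kf y))"
          using AE_lborel_singleton[of 0]
        proof eventually_elim
          case (elim y)
          define r where "r = norm y"
          define d where "d = norm (grad (\<phi> k) y - G y)"
          have r: "0 < r" using elim by (simp add: r_def)
          show ?case
          proof (cases "- real j \<le> ln (norm y)")
            case True
            have "\<bar>radial_part (grad (\<phi> k)) y - radial_part G y\<bar> = \<bar>(grad (\<phi> k) y - G y) \<bullet> y\<bar>"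
              by (simp add: inner_diff_left abs_minus_commute)
            also have "\<dots> \<le> d * r" unfolding d_def r_def by (rule Cauchy_Schwarz_ineq2)
            finally have hd: "\<bar>radial_part (grad (\<phi> k)) y - radial_part G y\<bar> \<le> d * r" .
            have "h k y * ennreal (norm y powr (- real DIM('a)) * (2 * real j * indicator {-real j..} (ln (norm y))))
               = ennreal (\<bar>radial_part (grad (\<phi> k)) y - radial_part G y\<bar> * (r powr (- N) * (2 * real j)))"
              using True by (simp add: h_def r_def N_def ennreal_mult'')
            also have "\<dots> \<le> ennreal ((d * r) * (r powr (- N) * (2 * J)))"
              using hd J by (intro ennreal_leI mult_mono) (auto intro: order_trans[OF abs_ge_zero])
            also have "(d * r) * (r powr (- N) * (2 * J)) = 2 * J * (d * r * r powr (- N))" by simp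
            also have "ennreal (2 * J * (d * r * r powr (- N))) \<le> ennreal (2 * J * (\<mu> powr (- p) * (r powr \<alpha> * d powr p)
                + \<mu> powr (p / (p - 1)) * r powr (- \<kappa> - N)))"
              using weighted_young_le[OF p r _ \<mu>, of d N \<alpha>] J unfolding \<kappa>_def
              by (intro ennreal_leI mult_left_mono) (auto simp: d_def)
            also have "\<dots> = ennreal (2 * J) * (ennreal (\<mu> powr (- p)) * ennreal (r powr \<alpha> * d powr p)
                + ennreal (\<mu> powr (p / (p - 1))) * ennreal (r powr (- \<kappa> - N)))"
              using J by (simp add: ennreal_mult' ennreal_plus)
            finally show ?thesis using True by (simp add: Kf_def r_def d_def)
          qed simp
        qed
      qed
      also have "\<dots> = ennreal (2 * J) * (ennreal (\<mu> powr (- p)) * a k + ennreal (\<mu> powr (p / (p - 1))) * K)"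
        unfolding a_def K_def by (simp add: nn_integral_cmult nn_integral_add)
      finally show ?thesis .
    qed
    have ev: "eventually (\<lambda>k. (\<integral>\<^sup>+x. X k x * ennreal (w j x) \<partial>lborel) \<le> ennreal e) sequentially" if e: "0 < e" for e
    proof -
      \<comment> \<open>\<open>\<mu>\<close> makes the contribution of \<open>Kr\<close> at most
        \<open>e / 2\<close>, after which \<open>\<delta>\<close> does the same for the energy term.
        \<open>Kr + 1\<close> avoids a zero denominator.\<close>
      define \<mu> where "\<mu> = (e / (4 * J * (Kr + 1))) powr ((p - 1) / p)"
      have \<mu>: "0 < \<mu>" using e J Kr by (simp add: \<mu>_def)
      have \<mu>K: "2 * J * (\<mu> powr (p / (p - 1)) * Kr) \<le> e / 2"
      proof -
        have "\<mu> powr (p / (p - 1)) = e / (4 * J * (Kr + 1))" using e J Kr p by (simp add: \<mu>_def powr_powr)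
        then have "\<mu> powr (p / (p - 1)) * (Kr + 1) = e / (4 * J)" using Kr by simp
        moreover have "2 * J * (\<mu> powr (p / (p - 1)) * Kr) \<le> 2 * J * (\<mu> powr (p / (p - 1)) * (Kr + 1))"
          using J by (intro mult_left_mono) auto
        ultimately show ?thesis using J by simp
      qed
      define \<delta> where "\<delta> = e / (4 * J) * \<mu> powr p"
      have \<delta>: "0 < \<delta>" using e J \<mu> by (simp add: \<delta>_def)
      have "eventually (\<lambda>k. a k < ennreal \<delta>) sequentially"
        using \<phi>(3) \<delta> unfolding a_def by (intro order_tendstoD(2)) auto
      then show ?thesis
      proof eventually_elim
        case (elim k)
        have "ennreal (2 * J) * (ennreal (\<mu> powr (- p)) * a k + ennreal (\<mu> powr (p / (p - 1))) * K)
           \<le> ennreal (2 * J) * (ennreal (\<mu> powr (- p)) * ennreal \<delta> + ennreal (\<mu> powr (p / (p - 1))) * K)"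
          using elim by (intro mult_left_mono add_right_mono) auto
        also have "\<dots> = ennreal (2 * J * (\<mu> powr (- p) * \<delta> + \<mu> powr (p / (p - 1)) * Kr))"
          using J Kr \<delta> by (simp add: ennreal_mult' ennreal_plus)
        also have "2 * J * (\<mu> powr (- p) * \<delta> + \<mu> powr (p / (p - 1)) * Kr) \<le> e"
        proof -
          have "2 * J * (\<mu> powr (- p) * \<delta>) = e / 2" using J \<mu> by (simp add: \<delta>_def powr_minus field_simps)
          then show ?thesis using \<mu>K by (simp add: distrib_left)
        qed
        finally show ?case using bound[OF \<mu>, of k] by (meson ennreal_leI order_trans)
      qed
    qed
    have le: "(\<integral>\<^sup>+x. liminf (\<lambda>k. X k x * ennreal (w j x)) \<partial>lborel) \<le> ennreal e" if "0 < e" for e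
    proof -
      have "(\<integral>\<^sup>+x. liminf (\<lambda>k. X k x * ennreal (w j x)) \<partial>lborel) \<le> liminf (\<lambda>k. \<integral>\<^sup>+x. X k x * ennreal (w j x) \<partial>lborel)"
        by (rule nn_integral_liminf) measurable
      also have "\<dots> \<le> ennreal e" using ev[OF that] by (intro Liminf_le) auto
      finally show ?thesis .
    qed
    have "(\<integral>\<^sup>+x. liminf (\<lambda>k. X k x * ennreal (w j x)) \<partial>lborel) \<le> 0"
      by (rule ennreal_le_epsilon) (unfold add_0, rule le)
    then have "(\<integral>\<^sup>+x. liminf (\<lambda>k. X k x * ennreal (w j x)) \<partial>lborel) = 0" by simp
    then show ?thesis by (subst (asm) nn_integral_0_iff_AE) auto
  qed
  have "AE x in lborel. \<forall>j. liminf (\<lambda>k. X k x * ennreal (w j x)) = 0"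
    using lim0 by (simp add: AE_all_countable)
  then show ?thesis using \<phi>(2) AE_lborel_singleton[of 0]
  proof eventually_elim
    case (elim x)
    let ?r = "\<lambda>H s. indicator {0..} s * radial_part H (exp s *\<^sub>R x) :: real"
    obtain j where j: "\<bar>ln (norm x)\<bar> \<le> real j" using real_arch_simple by blast
    define v where "v = norm x powr (- N)"
    have v: "0 < v" using elim(3) by (simp add: v_def)
    have wv: "w j x = v" using j by (auto simp: w_def v_def indicator_def abs_le_iff)
    have freq: "frequently (\<lambda>k. X k x * ennreal v < ennreal e) sequentially" if e: "0 < e" for e
    proof (rule ccontr)
      assume "\<not> ?thesis"
      then have "eventually (\<lambda>k. ennreal e \<le> X k x * ennreal v) sequentially"
        by (simp add: frequently_def not_less)
      then have "ennreal e \<le> liminf (\<lambda>k. X k x * ennreal v)" by (rule Liminf_bounded)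
      then show False using elim(1) e unfolding wv[symmetric] by simp
    qed
    have rm: "?r H \<in> borel_measurable borel" if [measurable]: "H \<in> borel_measurable borel" for H by measurable
    have Xd: "X k x = (\<integral>\<^sup>+s. ennreal (norm (?r (grad (\<phi> k)) s - ?r G s)) \<partial>lborel)" for k
      unfolding X_def h_def by (intro nn_integral_cong) (auto simp: indicator_def)
    \<comment> \<open>One index with a finite ray integral is enough to make
      \<open>radial_part G\<close> integrable along this ray.\<close>
    obtain k0 where k0: "X k0 x * ennreal v < ennreal 1"
      using frequently_ex[OF freq[OF zero_less_one]] by blast
    have "X k0 x < \<infinity>"
    proof (rule ccontr)
      assume "\<not> X k0 x < \<infinity>"
      then have "X k0 x = top" by (cases "X k0 x") auto
      then have "X k0 x * ennreal v = top" using v by (simp add: ennreal_top_mult)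
      then show False using k0 by simp
    qed
    then have "integrable lborel (\<lambda>s. ?r (grad (\<phi> k0)) s - ?r G s)"
      unfolding Xd by (intro integrableI_bounded) (use rm[OF gm] rm[OF Gm] in auto)
    from Bochner_Integration.integrable_diff[OF test_fun_ray(1)[OF \<phi>(1)[of k0] elim(3)] this]
    have rG: "integrable lborel (?r G)" by (simp only: diff_diff_eq2 add_diff_cancel_left')
    define I where "I = (\<integral>s. ?r G s \<partial>lborel)"
    have dist: "ennreal \<bar>\<phi> k x - I\<bar> \<le> X k x" for k
    proof -
      have d: "integrable lborel (\<lambda>s. ?r (grad (\<phi> k)) s - ?r G s)"
        by (intro Bochner_Integration.integrable_diff rG test_fun_ray(1)[OF \<phi>(1) elim(3)])
      have "\<phi> k x - I = (\<integral>s. ?r (grad (\<phi> k)) s - ?r G s \<partial>lborel)"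
        unfolding I_def test_fun_ray(2)[OF \<phi>(1) elim(3), symmetric]
        by (intro Bochner_Integration.integral_diff[symmetric] rG test_fun_ray(1)[OF \<phi>(1) elim(3)])
      then show ?thesis unfolding Xd using integral_norm_bound_ennreal[OF d] by simp
    qed
    have small: "\<bar>u x - I\<bar> \<le> e + e / v" if e: "0 < e" for e
    proof -
      have "eventually (\<lambda>k. \<bar>\<phi> k x - u x\<bar> < e) sequentially"
        using tendstoD[OF elim(2) e] by (simp add: dist_real_def)
      then have "frequently (\<lambda>k. X k x * ennreal v < ennreal e \<and> \<bar>\<phi> k x - u x\<bar> < e) sequentially"
        using frequently_eventually_frequently[OF freq[OF e]] by blast
      then obtain k where k: "X k x * ennreal v < ennreal e" "\<bar>\<phi> k x - u x\<bar> < e"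
        using frequently_ex by blast
      have "ennreal (\<bar>\<phi> k x - I\<bar> * v) = ennreal \<bar>\<phi> k x - I\<bar> * ennreal v" using v by (simp add: ennreal_mult')
      also have "\<dots> \<le> X k x * ennreal v" by (intro mult_right_mono dist) auto
      also have "\<dots> < ennreal e" by (rule k(1))
      finally have "\<bar>\<phi> k x - I\<bar> * v < e" using v by (simp add: ennreal_less_iff)
      then have "\<bar>\<phi> k x - I\<bar> < e / v" using v by (simp add: pos_less_divide_eq)
      then show ?thesis using k(2) by linarith
    qed
    have "\<bar>u x - I\<bar> \<le> 0"
    proof (rule field_le_epsilon)
      fix e :: real assume e: "0 < e"
      have "e / (1 + 1 / v) + e / (1 + 1 / v) / v = e"
      proof -
        have "e / (1 + 1 / v) + e / (1 + 1 / v) / v = e / (1 + 1 / v) * (1 + 1 / v)" by (simp add: distrib_left)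
        also have "\<dots> = e" using v by (simp add: add_pos_pos less_imp_neq[symmetric])
        finally show ?thesis .
      qed
      then show "\<bar>u x - I\<bar> \<le> 0 + e" using small[of "e / (1 + 1 / v)"] e v by (simp add: add_pos_pos)
    qed
    then show ?case using rG by (simp add: I_def)
  qed
qed

lemma tail_integral_shift:
  fixes H :: "real \<Rightarrow> real"
  shows "integrable lborel (\<lambda>\<sigma>. indicator {\<tau> + s..} \<sigma> * H \<sigma>) \<longleftrightarrow> integrable lborel (\<lambda>\<sigma>. indicator {\<tau>..} \<sigma> * H (\<sigma> + s))"
    "tail_integral H (\<tau> + s) = tail_integral (\<lambda>\<sigma>. H (\<sigma> + s)) \<tau>"
proof -
  let ?f = "\<lambda>\<sigma>. indicator {\<tau> + s..} \<sigma> * H \<sigma>"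
  have e: "?f (s + 1 * \<sigma>) = indicator {\<tau>..} \<sigma> * H (\<sigma> + s)" for \<sigma>
    by (auto simp: indicator_def add.commute)
  show "integrable lborel ?f \<longleftrightarrow> integrable lborel (\<lambda>\<sigma>. indicator {\<tau>..} \<sigma> * H (\<sigma> + s))"
    using lborel_integrable_real_affine_iff[of 1 ?f s] unfolding e by simp
  show "tail_integral H (\<tau> + s) = tail_integral (\<lambda>\<sigma>. H (\<sigma> + s)) \<tau>"
    using lborel_integral_real_affine[of 1 ?f s] unfolding e tail_integral_def by simp
qed

text \<open>Along almost every ray \<open>u\<close> is the tail integral of its radial derivative.  Since \<open>u\<close> is
  radial, comparing with one fixed good ray shows that this derivative is radial as well.\<close>
theorem in_D_radial:
  fixes u :: "'a::euclidean_space \<Rightarrow> real"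
  assumes D: "in_D p \<alpha> u G" and p: "1 < p" and \<alpha>: "p - real DIM('a) < \<alpha>" and rad: "radial u"
  obtains F where "F \<in> borel_measurable borel" "AE y in lborel. radial_part G y = F (ln (norm y))"
    "AE y in lborel. u y = tail_integral F (ln (norm y))"
proof -
  have [measurable]: "u \<in> borel_measurable borel" "G \<in> borel_measurable borel"
    using D unfolding in_D_def by auto
  define h where "h x s = radial_part G (exp s *\<^sub>R x)" for x s
  have [measurable]: "h x \<in> borel_measurable borel" for x unfolding h_def[abs_def] by measurable
  define good where "good x \<longleftrightarrow> (AE \<tau> in lborel. integrable lborel (\<lambda>\<sigma>. indicator {\<tau>..} \<sigma> * h x \<sigma>) \<and>
      u (exp \<tau> *\<^sub>R x) = tail_integral (h x) \<tau>)" for x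
  have AE_good: "AE x in lborel. good x"
    using AE_along_rays[OF in_D_ray[OF D p \<alpha>]]
  proof eventually_elim
    case (elim x)
    then show ?case unfolding good_def
    proof eventually_elim
      case (elim \<tau>)
      have e: "radial_part G (exp s *\<^sub>R exp \<tau> *\<^sub>R x) = h x (s + \<tau>)" for s
        by (simp add: h_def exp_add)
      have "integrable lborel (\<lambda>\<sigma>. indicator {0 + \<tau>..} \<sigma> * h x \<sigma>)"
        using elim unfolding e by (subst tail_integral_shift(1)) auto
      moreover have "u (exp \<tau> *\<^sub>R x) = tail_integral (h x) (0 + \<tau>)"
        using elim unfolding e tail_integral_shift(2) by (simp add: tail_integral_def)
      ultimately show ?case by simp
    qed
  qed
  then have "AE x in lborel. good x \<and> x \<noteq> 0" using AE_lborel_singleton[of 0] by eventually_elim simp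
  then obtain x0 where x0: "good x0" "x0 \<noteq> 0" using AE_lborel_ex by blast
  define F where "F t = h x0 (t - ln (norm x0))" for t
  have F_meas [measurable]: "F \<in> borel_measurable borel" unfolding F_def[abs_def] by measurable
  have ln_exp_norm: "ln (norm (exp \<tau> *\<^sub>R x)) = \<tau> + ln (norm x)" if "x \<noteq> 0" for \<tau> and x :: 'a
    using that by (simp add: ln_mult)
  have key: "AE \<sigma> in lborel. h x \<sigma> = F (\<sigma> + ln (norm x))" if x: "good x" "x \<noteq> 0" for x
  proof -
    \<comment> \<open>The shift that matches the radii on the ray of \<open>x0\<close> with those on
      the ray of \<open>x\<close>. Radiality of \<open>u\<close> equates the tails of both radial
      derivatives, and tails determine a function almost everywhere.\<close>
    define s where "s = ln (norm x) - ln (norm x0)"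
    have Fs: "F (\<sigma> + ln (norm x)) = h x0 (\<sigma> + s)" for \<sigma> by (simp add: F_def s_def algebra_simps)
    have "AE \<tau> in lborel. integrable lborel (\<lambda>\<sigma>. indicator {\<tau> + s..} \<sigma> * h x0 \<sigma>) \<and>
      u (exp (\<tau> + s) *\<^sub>R x0) = tail_integral (h x0) (\<tau> + s)"
      using AE_lborel_translate[OF x0(1)[unfolded good_def], of s] .
    then have "AE \<tau> in lborel. integrable lborel (\<lambda>\<sigma>. indicator {\<tau>..} \<sigma> * (h x \<sigma> - h x0 (\<sigma> + s))) \<and>
        tail_integral (\<lambda>\<sigma>. h x \<sigma> - h x0 (\<sigma> + s)) \<tau> = 0"
      using x(1)[unfolded good_def]
    proof eventually_elim
      case (elim \<tau>)
      have "norm (exp \<tau> *\<^sub>R x) = norm (exp (\<tau> + s) *\<^sub>R x0)"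
      proof -
        have "exp s = norm x / norm x0" using x(2) x0(2) by (simp add: s_def exp_diff)
        then show ?thesis using x0(2) by (simp add: exp_add)
      qed
      then have ueq: "u (exp \<tau> *\<^sub>R x) = u (exp (\<tau> + s) *\<^sub>R x0)" using rad unfolding radial_def by blast
      have i1: "integrable lborel (\<lambda>\<sigma>. indicator {\<tau>..} \<sigma> * h x \<sigma>)" using elim by blast
      have i2: "integrable lborel (\<lambda>\<sigma>. indicator {\<tau>..} \<sigma> * h x0 (\<sigma> + s))"
        using elim tail_integral_shift(1) by blast
      have "tail_integral (\<lambda>\<sigma>. h x \<sigma> - h x0 (\<sigma> + s)) \<tau> = tail_integral (h x) \<tau> - tail_integral (\<lambda>\<sigma>. h x0 (\<sigma> + s)) \<tau>"
        unfolding tail_integral_def right_diff_distrib by (rule Bochner_Integration.integral_diff[OF i1 i2])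
      also have "\<dots> = 0" using elim ueq by (simp add: tail_integral_shift(2))
      finally show ?case using Bochner_Integration.integrable_diff[OF i1 i2] by (simp add: right_diff_distrib)
    qed
    from AE_zero_if_tail_integrals_zero[OF _ this]
    show ?thesis unfolding Fs by (auto elim: eventually_mono)
  qed
  have AE1: "AE x in lborel. AE \<tau> in lborel. radial_part G (exp \<tau> *\<^sub>R x) = F (ln (norm (exp \<tau> *\<^sub>R x)))"
    using AE_good AE_lborel_singleton[of 0]
  proof eventually_elim
    case (elim x)
    then show ?case using key[of x] by (simp add: h_def ln_exp_norm del: norm_scaleR)
  qed
  have AE2: "AE x in lborel. AE \<tau> in lborel. u (exp \<tau> *\<^sub>R x) = tail_integral F (ln (norm (exp \<tau> *\<^sub>R x)))"
    using AE_good AE_lborel_singleton[of 0]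
  proof eventually_elim
    case (elim x)
    have "tail_integral (h x) \<tau> = tail_integral F (\<tau> + ln (norm x))" for \<tau>
      unfolding tail_integral_shift(2) unfolding tail_integral_def
      by (rule integral_cong_AE) (use key[OF elim] in \<open>auto elim: eventually_mono\<close>)
    then show ?case using elim(1)[unfolded good_def] elim(2)
      by (simp add: ln_exp_norm del: norm_scaleR)
  qed
  note [measurable] = tail_integral_measurable[OF F_meas]
  have "AE y in lborel. radial_part G y = F (ln (norm y))"
    by (rule AE_if_along_rays[OF _ AE1]) measurable
  moreover have "AE y in lborel. u y = tail_integral F (ln (norm y))"
    by (rule AE_if_along_rays[OF _ AE2]) measurable
  ultimately show thesis using that F_meas by blast
qed

section \<open>Smooth truncations of the extremal\<close>

definition smooth_real :: "(real \<Rightarrow> real) \<Rightarrow> bool" where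
  "smooth_real h \<longleftrightarrow> (\<exists>d. d 0 = h \<and> (\<forall>n x. (d n has_real_derivative d (Suc n) x) (at x)))"

lemma smooth_real_deriv:
  assumes "smooth_real h"
  obtains h' where "\<And>x. (h has_real_derivative h' x) (at x)" "smooth_real h'"
proof -
  obtain d where d: "d 0 = h" "\<And>n x. (d n has_real_derivative d (Suc n) x) (at x)"
    using assms unfolding smooth_real_def by blast
  have "smooth_real (d 1)" unfolding smooth_real_def
    by (rule exI[of _ "\<lambda>n. d (Suc n)"]) (use d in auto)
  moreover have "(h has_real_derivative d 1 x) (at x)" for x using d(2)[of 0 x] d(1) by simp
  ultimately show thesis using that by blast
qed

lemma smooth_real_antideriv:
  assumes "\<And>x. (H has_real_derivative h x) (at x)" "smooth_real h"
  shows "smooth_real H"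
proof -
  obtain d where d: "d 0 = h" "\<And>n x. (d n has_real_derivative d (Suc n) x) (at x)"
    using assms(2) unfolding smooth_real_def by blast
  show ?thesis unfolding smooth_real_def
    by (rule exI[of _ "\<lambda>n. case n of 0 \<Rightarrow> H | Suc m \<Rightarrow> d m"]) (use d assms(1) in \<open>auto split: nat.split\<close>)
qed

text \<open>A derivative is chosen inside the class and iterated; the iterates are the sequence that
  \<open>smooth_real\<close> asks for.\<close>

lemma smooth_real_coinduct:
  assumes "Q h" and step: "\<And>g. Q g \<Longrightarrow> \<exists>g'. Q g' \<and> (\<forall>x. (g has_real_derivative g' x) (at x))"
  shows "smooth_real h"
proof -
  obtain D where D: "\<And>g. Q g \<Longrightarrow> Q (D g) \<and> (\<forall>x. (g has_real_derivative D g x) (at x))"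
    using step by metis
  have Q: "Q ((D ^^ n) h)" for n by (induction n) (use assms(1) D in auto)
  show ?thesis unfolding smooth_real_def
    by (rule exI[of _ "\<lambda>n. (D ^^ n) h"]) (use Q D in auto)
qed

text \<open>Unlike the functions \<open>h (x \<bullet> x)\<close> alone, this class is closed under partial derivatives.\<close>
inductive smooth_alg :: "('a::euclidean_space \<Rightarrow> real) \<Rightarrow> bool" where
  const: "smooth_alg (\<lambda>_. c)"
| coord: "smooth_alg (\<lambda>x. x \<bullet> b)"
| comp: "smooth_real h \<Longrightarrow> smooth_alg (\<lambda>x. h (x \<bullet> x))"
| add: "smooth_alg f \<Longrightarrow> smooth_alg g \<Longrightarrow> smooth_alg (\<lambda>x. f x + g x)"
| mult: "smooth_alg f \<Longrightarrow> smooth_alg g \<Longrightarrow> smooth_alg (\<lambda>x. f x * g x)"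

lemma smooth_alg_deriv:
  assumes "smooth_alg f"
  shows "\<exists>D. (\<forall>x. (f has_derivative D x) (at x)) \<and> (\<forall>b. smooth_alg (\<lambda>x. D x b))"
  using assms
proof induction
  case (const c)
  show ?case by (rule exI[of _ "\<lambda>x v. 0"]) (auto intro: smooth_alg.const)
next
  case (coord b)
  show ?case
    by (rule exI[of _ "\<lambda>x v. v \<bullet> b"]) (auto intro!: derivative_eq_intros smooth_alg.const)
next
  case (comp h)
  obtain h' where h': "\<And>x. (h has_real_derivative h' x) (at x)" "smooth_real h'"
    using smooth_real_deriv[OF comp] by blast
  have "((\<lambda>x. h (x \<bullet> x)) has_derivative (\<lambda>v. h' (x \<bullet> x) * (2 * (x \<bullet> v)))) (at x)" for x :: 'a
  proof -
    have 1: "((\<lambda>x. x \<bullet> x) has_derivative (\<lambda>v. 2 * (x \<bullet> v))) (at x)"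
      by (auto intro!: derivative_eq_intros simp: inner_commute)
    show ?thesis
      using has_derivative_compose[OF 1 h'(1)[unfolded has_field_derivative_def, of "x \<bullet> x"]] by simp
  qed
  moreover have "smooth_alg (\<lambda>x::'a. h' (x \<bullet> x) * (2 * (x \<bullet> b)))" for b
    by (intro smooth_alg.intros h')
  ultimately show ?case by (intro exI[of _ "\<lambda>x v. h' (x \<bullet> x) * (2 * (x \<bullet> v))"]) auto
next
  case (add f g)
  then obtain D E where "\<forall>x. (f has_derivative D x) (at x)" "\<forall>b. smooth_alg (\<lambda>x. D x b)"
    "\<forall>x. (g has_derivative E x) (at x)" "\<forall>b. smooth_alg (\<lambda>x. E x b)" by blast
  then show ?case
    by (intro exI[of _ "\<lambda>x v. D x v + E x v"]) (auto intro!: has_derivative_add smooth_alg.add)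
next
  case (mult f g)
  then obtain D E where "\<forall>x. (f has_derivative D x) (at x)" "\<forall>b. smooth_alg (\<lambda>x. D x b)"
    "\<forall>x. (g has_derivative E x) (at x)" "\<forall>b. smooth_alg (\<lambda>x. E x b)" by blast
  then show ?case using mult.hyps
    by (intro exI[of _ "\<lambda>x v. f x * E x v + D x v * g x"]) (auto intro!: has_derivative_mult smooth_alg.intros)
qed

lemma smooth_alg_pderiv:
  assumes "smooth_alg f"
  shows "smooth_alg (pderiv_dir b f)" "f differentiable (at x)"
proof -
  obtain D where D: "\<forall>x. (f has_derivative D x) (at x)" "\<forall>b. smooth_alg (\<lambda>x. D x b)"
    using smooth_alg_deriv[OF assms] by blast
  have "frechet_derivative f (at x) = D x" for x
    using frechet_derivative_at D(1) by metis
  then have "pderiv_dir b f = (\<lambda>x. D x b)" by (simp add: pderiv_dir_def fun_eq_iff)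
  then show "smooth_alg (pderiv_dir b f)" using D(2) by simp
  show "f differentiable (at x)" using D(1) unfolding differentiable_def by blast
qed

lemma smooth_alg_imp_smooth:
  assumes "smooth_alg f"
  shows "smooth f"
proof -
  have "smooth_alg (foldr pderiv_dir bs f)" for bs
    by (induction bs) (use assms in \<open>auto intro: smooth_alg_pderiv(1)\<close>)
  then show ?thesis unfolding smooth_def using smooth_alg_pderiv(2) by blast
qed

text \<open>\<open>k = 0\<close> is the classical flat function; the powers of
  \<open>inverse x\<close> make the family closed under differentiation up to linear
  combinations.\<close>

definition exp_bump :: "nat \<Rightarrow> real \<Rightarrow> real" where
  "exp_bump k x = (if 0 < x then inverse x ^ k * exp (- inverse x) else 0)"

lemma exp_bump_nonneg: "0 \<le> exp_bump k x"
  by (simp add: exp_bump_def)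

lemma exp_bump_0_le: "exp_bump 0 x \<le> 1"
  by (simp add: exp_bump_def)

lemma exp_bump_deriv:
  "(exp_bump k has_real_derivative exp_bump (k + 2) x - real k * exp_bump (k + 1) x) (at x)"
proof (cases x "0::real" rule: linorder_cases)
  case greater
  have "((\<lambda>x. inverse x ^ k * exp (- inverse x)) has_real_derivative
     inverse x ^ k * (exp (- inverse x) * inverse x ^ 2) - real k * (inverse x ^ k * inverse x) * exp (- inverse x)) (at x)"
  proof -
    have 1: "((\<lambda>x. inverse x ^ k) has_real_derivative - (real k * (inverse x ^ k * inverse x))) (at x)"
    proof (cases k)
      case (Suc n)
      have "((\<lambda>x. inverse x ^ Suc n) has_real_derivative real (Suc n) * (- (inverse x ^ Suc (Suc 0)) * inverse x ^ n)) (at x)"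
        using DERIV_power_Suc[OF DERIV_inverse[of x], of n] greater by (simp add: mult_ac)
      then show ?thesis by (simp add: Suc mult_ac)
    qed simp
    have 2: "((\<lambda>x. exp (- inverse x)) has_real_derivative exp (- inverse x) * inverse x ^ 2) (at x)"
      using greater by (auto intro!: derivative_eq_intros simp: power2_eq_square)
    from DERIV_mult[OF 1 2] show ?thesis by (simp add: mult_ac)
  qed
  moreover have "inverse x ^ k * (exp (- inverse x) * inverse x ^ 2) - real k * (inverse x ^ k * inverse x) * exp (- inverse x)
     = exp_bump (k + 2) x - real k * exp_bump (k + 1) x"
    using greater by (simp add: exp_bump_def power_add power2_eq_square)
  ultimately have "((\<lambda>x. inverse x ^ k * exp (- inverse x)) has_real_derivative exp_bump (k + 2) x - real k * exp_bump (k + 1) x) (at x)"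
    by simp
  then show ?thesis
    by (rule has_field_derivative_transform_within_open[where S = "{0<..}"]) (use greater in \<open>auto simp: exp_bump_def\<close>)
next
  case less
  have "((\<lambda>_. 0::real) has_real_derivative 0) (at x)" by simp
  then have "(exp_bump k has_real_derivative 0) (at x)"
    by (rule has_field_derivative_transform_within_open[where S = "{..<0}"]) (use less in \<open>auto simp: exp_bump_def\<close>)
  then show ?thesis using less by (simp add: exp_bump_def)
next
  \<comment> \<open>From the right the difference quotient is \<open>y ^ (k + 1) / exp y\<close>
    with \<open>y = inverse h\<close>, which tends to 0.\<close>
  case equal
  have "((\<lambda>h. (exp_bump k (0 + h) - exp_bump k 0) / h) \<longlongrightarrow> 0) (at 0)"
  proof (rule filterlim_split_at)
    show "((\<lambda>h. (exp_bump k (0 + h) - exp_bump k 0) / h) \<longlongrightarrow> 0) (at_left 0)"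
    proof (rule tendsto_eventually)
      show "eventually (\<lambda>h. (exp_bump k (0 + h) - exp_bump k 0) / h = 0) (at_left 0)"
        using eventually_at_left_real[of "-1" 0] by (auto simp: exp_bump_def elim!: eventually_mono)
    qed
    have "((\<lambda>y::real. y ^ (k + 1) / exp y) \<longlongrightarrow> 0) at_top" by (rule tendsto_power_div_exp_0)
    then have "((\<lambda>h::real. inverse h ^ (k + 1) / exp (inverse h)) \<longlongrightarrow> 0) (at_right 0)"
      by (rule filterlim_compose[OF _ filterlim_inverse_at_top_right])
    then show "((\<lambda>h. (exp_bump k (0 + h) - exp_bump k 0) / h) \<longlongrightarrow> 0) (at_right 0)"
    proof (rule Lim_transform_eventually)
      show "eventually (\<lambda>h. inverse h ^ (k + 1) / exp (inverse h) = (exp_bump k (0 + h) - exp_bump k 0) / h) (at_right (0::real))"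
        using eventually_at_right_less[of "0::real"]
        by eventually_elim (simp add: exp_bump_def exp_minus divide_inverse mult_ac)
    qed
  qed
  then have "(exp_bump k has_real_derivative 0) (at 0)" by (simp add: DERIV_def)
  then show ?thesis using equal by (simp add: exp_bump_def)
qed

lemma exp_bump_cont: "continuous_on S (exp_bump n)"
  by (meson exp_bump_deriv DERIV_isCont continuous_at_imp_continuous_on)

text \<open>Contains the radial derivative of the truncated extremal and is closed under
  differentiation on the positive half line; the singularity of the powers at 0 is removed later by
  the cutoff.\<close>

inductive half_line_alg :: "(real \<Rightarrow> real) \<Rightarrow> bool" where
  const: "half_line_alg (\<lambda>_. c)"
| bump: "half_line_alg (\<lambda>x. exp_bump k (a * x + b))"
| powr: "half_line_alg (\<lambda>x. x powr a)"
| powr2: "half_line_alg (\<lambda>x. (1 + x powr a) powr b)"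
| add: "half_line_alg f \<Longrightarrow> half_line_alg g \<Longrightarrow> half_line_alg (\<lambda>x. f x + g x)"
| mult: "half_line_alg f \<Longrightarrow> half_line_alg g \<Longrightarrow> half_line_alg (\<lambda>x. f x * g x)"

lemma half_line_alg_deriv:
  assumes "half_line_alg f"
  shows "\<exists>f'. half_line_alg f' \<and> (\<forall>x>0. (f has_real_derivative f' x) (at x))"
  using assms
proof induction
  case (const c)
  show ?case by (rule exI[of _ "\<lambda>_. 0"]) (auto intro: half_line_alg.const)
next
  case (bump k a b)
  have "((\<lambda>x. exp_bump k (a * x + b)) has_real_derivative
      a * (exp_bump (k + 2) (a * x + b) + (- real k) * exp_bump (k + 1) (a * x + b))) (at x)" for x
  proof -
    have "((\<lambda>x. a * x + b) has_real_derivative a) (at x)" by (auto intro!: derivative_eq_intros)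
    from DERIV_chain2[OF exp_bump_deriv this] show ?thesis by (simp add: mult.commute)
  qed
  moreover have "half_line_alg (\<lambda>x. a * (exp_bump (k + 2) (a * x + b) + (- real k) * exp_bump (k + 1) (a * x + b)))"
    by (intro half_line_alg.intros)
  ultimately show ?case by blast
next
  case (powr a)
  have "((\<lambda>x. x powr a) has_real_derivative a * x powr (a - 1)) (at x)" if "0 < x" for x
    using that by (rule has_real_derivative_powr)
  moreover have "half_line_alg (\<lambda>x. a * x powr (a - 1))" by (intro half_line_alg.intros)
  ultimately show ?case by blast
next
  case (powr2 a b)
  have "((\<lambda>x. (1 + x powr a) powr b) has_real_derivative b * (1 + x powr a) powr (b - 1) * (a * x powr (a - 1))) (at x)" if "0 < x" for x
  proof -
    have 1: "((\<lambda>x. 1 + x powr a) has_real_derivative a * x powr (a - 1)) (at x)"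
      using that by (auto intro!: derivative_eq_intros has_real_derivative_powr)
    show ?thesis using DERIV_fun_powr[OF 1, of b] by (simp add: add_pos_nonneg)
  qed
  moreover have "half_line_alg (\<lambda>x. b * (1 + x powr a) powr (b - 1) * (a * x powr (a - 1)))"
    by (intro half_line_alg.intros)
  ultimately show ?case by blast
next
  case (add f g)
  then obtain f' g' where "half_line_alg f'" "\<forall>x>0. (f has_real_derivative f' x) (at x)"
    "half_line_alg g'" "\<forall>x>0. (g has_real_derivative g' x) (at x)" by blast
  then show ?case by (intro exI[of _ "\<lambda>x. f' x + g' x"]) (auto intro!: half_line_alg.add DERIV_add)
next
  case (mult f g)
  then obtain f' g' where "half_line_alg f'" "\<forall>x>0. (f has_real_derivative f' x) (at x)"
    "half_line_alg g'" "\<forall>x>0. (g has_real_derivative g' x) (at x)" by blast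
  then show ?case using mult.hyps
    by (intro exI[of _ "\<lambda>x. f' x * g x + g' x * f x"]) (auto intro!: half_line_alg.intros DERIV_mult)
qed

text \<open>Vanishing near 0 passes to the derivative, so the extensions by 0 form a class to which
  the coinduction applies.\<close>

lemma smooth_real_if_half_line_alg:
  assumes f: "half_line_alg g" and \<delta>: "0 < \<delta>" and z: "\<And>x. 0 < x \<Longrightarrow> x < \<delta> \<Longrightarrow> g x = 0"
  shows "smooth_real (\<lambda>x. if 0 < x then g x else 0)"
proof (rule smooth_real_coinduct)
  let ?Q = "\<lambda>h. \<exists>g. half_line_alg g \<and> (\<forall>x. 0 < x \<longrightarrow> x < \<delta> \<longrightarrow> g x = 0) \<and> h = (\<lambda>x. if 0 < x then g x else 0)"
  show "?Q (\<lambda>x. if 0 < x then g x else 0)" using f z by blast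
  fix h assume "?Q h"
  then obtain g where g: "half_line_alg g" "\<And>x. 0 < x \<Longrightarrow> x < \<delta> \<Longrightarrow> g x = 0" "h = (\<lambda>x. if 0 < x then g x else 0)"
    by blast
  obtain g' where g': "half_line_alg g'" "\<And>x. 0 < x \<Longrightarrow> (g has_real_derivative g' x) (at x)"
    using half_line_alg_deriv[OF g(1)] by blast
  have zero: "(k has_real_derivative 0) (at x)" if "x \<in> S" "open S" "\<And>y. y \<in> S \<Longrightarrow> k y = 0" for k :: "real \<Rightarrow> real" and x S
    by (rule has_field_derivative_transform_within_open[of "\<lambda>_. 0", OF _ that(2,1)]) (use that(3) in auto)
  have g'z: "g' x = 0" if "0 < x" "x < \<delta>" for x
    by (rule DERIV_unique[OF g'(2)[OF that(1)] zero[of x "{0<..<\<delta>}"]]) (use that g(2) in auto)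
  have "(h has_real_derivative (if 0 < x then g' x else 0)) (at x)" for x
  proof (cases "0 < x")
    case True
    have "(h has_real_derivative g' x) (at x)"
      by (rule has_field_derivative_transform_within_open[OF g'(2)[OF True], of "{0<..}"]) (use True g(3) in auto)
    then show ?thesis using True by simp
  next
    case False
    have "(h has_real_derivative 0) (at x)"
      by (rule zero[of x "{..<\<delta>}"]) (use False \<delta> g in auto)
    then show ?thesis using False by simp
  qed
  then show "\<exists>h'. ?Q h' \<and> (\<forall>x. (h has_real_derivative h' x) (at x))" using g'(1) g'z by blast
qed

section \<open>The functionals of radial functions as integrals over the line\<close>

lemma norm_powr_eq_exp: "x \<noteq> 0 \<Longrightarrow> norm x powr a = exp (a * ln (norm x))"
  by (simp add: powr_def)

lemma weighted_Lq_radial: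
  fixes u :: "'a::euclidean_space \<Rightarrow> real"
  assumes [measurable]: "u \<in> borel_measurable borel" "T \<in> borel_measurable borel"
    and u: "AE x in lborel. u x = T (ln (norm x))"
  shows "weighted_Lq \<beta> q u = sphere_const TYPE('a) * (\<integral>t. \<bar>T t\<bar> powr q * exp ((real DIM('a) + \<beta>) * t) \<partial>lborel)"
proof -
  have "weighted_Lq \<beta> q u = (\<integral>x. exp (\<beta> * ln (norm (x::'a))) * \<bar>T (ln (norm x))\<bar> powr q \<partial>lborel)"
    unfolding weighted_Lq_def
  proof (rule integral_cong_AE)
    show "AE x in lborel. norm x powr \<beta> * \<bar>u x\<bar> powr q = exp (\<beta> * ln (norm x)) * \<bar>T (ln (norm x))\<bar> powr q"
      using u AE_lborel_singleton[of 0] by eventually_elim (simp add: norm_powr_eq_exp)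
  qed measurable
  also have "\<dots> = sphere_const TYPE('a) * (\<integral>t. (exp (\<beta> * t) * \<bar>T t\<bar> powr q) * exp (real DIM('a) * t) \<partial>lborel)"
    by (rule integral_radial) measurable
  also have "(\<lambda>t. (exp (\<beta> * t) * \<bar>T t\<bar> powr q) * exp (real DIM('a) * t)) = (\<lambda>t. \<bar>T t\<bar> powr q * exp ((real DIM('a) + \<beta>) * t))"
  proof
    fix t
    have "exp (\<beta> * t) * exp (real DIM('a) * t) = exp ((real DIM('a) + \<beta>) * t)"
      by (simp add: exp_add[symmetric] algebra_simps)
    then show "(exp (\<beta> * t) * \<bar>T t\<bar> powr q) * exp (real DIM('a) * t) = \<bar>T t\<bar> powr q * exp ((real DIM('a) + \<beta>) * t)"
      by (simp add: mult_ac)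
  qed
  finally show ?thesis .
qed

text \<open>\<open>F\<close> is a derivative in \<open>ln (norm x)\<close>, so the gradient carries
  an extra \<open>1 / norm x\<close>, which lowers the exponent of the weight by
  \<open>p\<close>.\<close>

lemma Dnorm_p_radial:
  fixes G :: "'a::euclidean_space \<Rightarrow> 'a"
  assumes [measurable]: "G \<in> borel_measurable borel" "F \<in> borel_measurable borel"
    and G: "AE x in lborel. norm (G x) = \<bar>F (ln (norm x))\<bar> / norm x"
  shows "Dnorm_p p \<alpha> G = sphere_const TYPE('a) * (\<integral>t. \<bar>F t\<bar> powr p * exp ((real DIM('a) - p + \<alpha>) * t) \<partial>lborel)"
    "integrable lborel (\<lambda>x. norm x powr \<alpha> * norm (G x) powr p)
      \<longleftrightarrow> integrable lborel (\<lambda>t. \<bar>F t\<bar> powr p * exp ((real DIM('a) - p + \<alpha>) * t))"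
proof -
  let ?g = "\<lambda>t. exp ((\<alpha> - p) * t) * \<bar>F t\<bar> powr p"
  have ae: "AE x in lborel. norm x powr \<alpha> * norm (G x) powr p = ?g (ln (norm x))"
    using G AE_lborel_singleton[of 0]
  proof eventually_elim
    case (elim x)
    have "norm x powr \<alpha> * norm (G x) powr p = \<bar>F (ln (norm x))\<bar> powr p * norm x powr (\<alpha> - p)"
      using elim by (simp add: powr_divide powr_diff)
    then show ?case using elim by (simp add: norm_powr_eq_exp mult.commute)
  qed
  have e: "?g t * exp (real DIM('a) * t) = \<bar>F t\<bar> powr p * exp ((real DIM('a) - p + \<alpha>) * t)" for t
  proof -
    have "exp ((\<alpha> - p) * t) * exp (real DIM('a) * t) = exp ((real DIM('a) - p + \<alpha>) * t)"
      by (simp add: exp_add[symmetric] algebra_simps)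
    then show ?thesis by (simp add: mult_ac)
  qed
  have "Dnorm_p p \<alpha> G = (\<integral>x. ?g (ln (norm (x::'a))) \<partial>lborel)"
    unfolding Dnorm_p_def by (rule integral_cong_AE[OF _ _ ae]) measurable
  also have "\<dots> = sphere_const TYPE('a) * (\<integral>t. ?g t * exp (real DIM('a) * t) \<partial>lborel)"
    by (rule integral_radial(1)) measurable
  finally show "Dnorm_p p \<alpha> G = sphere_const TYPE('a) * (\<integral>t. \<bar>F t\<bar> powr p * exp ((real DIM('a) - p + \<alpha>) * t) \<partial>lborel)"
    unfolding e .
  have "integrable lborel (\<lambda>x. norm x powr \<alpha> * norm (G x) powr p) \<longleftrightarrow> integrable lborel (\<lambda>x::'a. ?g (ln (norm x)))"
    by (rule integrable_cong_AE[OF _ _ ae]) measurable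
  also have "\<dots> \<longleftrightarrow> integrable lborel (\<lambda>t. ?g t * exp (real DIM('a) * t))"
    by (rule integral_radial(2)) measurable
  finally show "integrable lborel (\<lambda>x. norm x powr \<alpha> * norm (G x) powr p)
      \<longleftrightarrow> integrable lborel (\<lambda>t. \<bar>F t\<bar> powr p * exp ((real DIM('a) - p + \<alpha>) * t))" unfolding e .
qed

lemma in_D_test_fun:
  fixes \<phi> :: "'a::euclidean_space \<Rightarrow> real"
  assumes "test_fun \<phi>"
  shows "in_D p \<alpha> \<phi> (grad \<phi>)"
proof -
  have "continuous_on UNIV \<phi>"
    using test_fun_has_derivative[OF assms] has_derivative_continuous continuous_at_imp_continuous_on by blast
  then show ?thesis unfolding in_D_def
    using borel_measurable_continuous_onI[OF test_fun_grad_continuous[OF assms]] assms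
    by (auto intro!: borel_measurable_continuous_onI exI[of _ "\<lambda>_. \<phi>"])
qed

text \<open>Multiplying out also covers a vanishing denominator: the quotient is then 0 by
  convention, but the product on the left is 0 as well.\<close>

lemma S_rad_le_quotient:
  fixes u :: "'a::euclidean_space \<Rightarrow> real"
  assumes "in_D p \<alpha> u G" "radial u" "Dnorm_p p \<alpha> G \<noteq> 0"
  shows "S_rad TYPE('a) p \<alpha> \<beta> * weighted_Lq \<beta> (crit_exp DIM('a) p \<alpha> \<beta>) u powr (p / crit_exp DIM('a) p \<alpha> \<beta>) \<le> Dnorm_p p \<alpha> G"
proof -
  let ?q = "crit_exp DIM('a) p \<alpha> \<beta>"
  have Dnn: "0 \<le> Dnorm_p p \<alpha> H" for H :: "'a \<Rightarrow> 'a"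
    unfolding Dnorm_p_def by (intro integral_nonneg_AE) auto
  have "S_rad TYPE('a) p \<alpha> \<beta> \<le> Dnorm_p p \<alpha> G / weighted_Lq \<beta> ?q u powr (p / ?q)"
    unfolding S_rad_def
    by (rule cInf_lower) (use assms Dnn in \<open>auto intro!: bdd_belowI[of _ 0]\<close>)
  then show ?thesis using Dnn[of G]
    by (cases "weighted_Lq \<beta> ?q u powr (p / ?q) = 0") (auto simp: pos_le_divide_eq less_le)
qed

context bliss
begin

text \<open>Supported in \<open>{1 / j..j}\<close> and increasing to 1 as \<open>j \<rightarrow> \<infinity>\<close>.\<close>
definition cutoff :: "real \<Rightarrow> real \<Rightarrow> real" where
  "cutoff j r = exp_bump 0 (j * r - 1) * exp_bump 0 (j\<^sup>2 - j * r)"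

lemma cutoff_bounds: "0 \<le> cutoff j r" "cutoff j r \<le> 1"
  using exp_bump_nonneg exp_bump_0_le by (auto simp: cutoff_def intro!: mult_le_one)

lemma cutoff_zero: "0 < j \<Longrightarrow> r \<le> 1 / j \<Longrightarrow> cutoff j r = 0" "0 < j \<Longrightarrow> j \<le> r \<Longrightarrow> cutoff j r = 0"
  by (auto simp: cutoff_def exp_bump_def field_simps power2_eq_square)

lemma cutoff_tendsto: "0 < r \<Longrightarrow> (\<lambda>n. cutoff (real (Suc n)) r) \<longlonglongrightarrow> 1"
proof -
  assume r: "0 < r"
  have b: "(exp_bump 0 \<longlongrightarrow> 1) at_top"
  proof -
    have "((\<lambda>x::real. exp (- inverse x)) \<longlongrightarrow> exp (- 0)) at_top"
      by (intro tendsto_intros tendsto_inverse_0_at_top filterlim_ident)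
    moreover have "eventually (\<lambda>x. exp (- inverse x) = exp_bump 0 x) at_top"
      using eventually_gt_at_top[of 0] by eventually_elim (simp add: exp_bump_def)
    ultimately have "(exp_bump 0 \<longlongrightarrow> exp (- 0)) at_top" by (rule Lim_transform_eventually)
    then show ?thesis by simp
  qed
  have s: "filterlim (\<lambda>n. real (Suc n)) at_top sequentially"
    by (rule filterlim_compose[OF filterlim_real_sequentially filterlim_Suc])
  have 1: "filterlim (\<lambda>n. real (Suc n) * r - 1) at_top sequentially"
  proof -
    have "filterlim (\<lambda>n. - 1 + r * real (Suc n)) at_top sequentially"
      by (intro filterlim_tendsto_add_at_top[OF tendsto_const] filterlim_tendsto_pos_mult_at_top[OF tendsto_const r s])
    then show ?thesis by (simp add: algebra_simps)
  qed
  have 2: "filterlim (\<lambda>n. (real (Suc n))\<^sup>2 - real (Suc n) * r) at_top sequentially"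
  proof -
    have "filterlim (\<lambda>n. real (Suc n) * (- r + real (Suc n))) at_top sequentially"
      by (intro filterlim_at_top_mult_at_top[OF s] filterlim_tendsto_add_at_top[OF tendsto_const s])
    then show ?thesis by (simp add: power2_eq_square algebra_simps)
  qed
  have "(\<lambda>n. exp_bump 0 (real (Suc n) * r - 1) * exp_bump 0 ((real (Suc n))\<^sup>2 - real (Suc n) * r)) \<longlonglongrightarrow> 1 * 1"
    by (intro tendsto_mult filterlim_compose[OF b] 1 2)
  then show ?thesis by (simp add: cutoff_def)
qed

text \<open>The cutoff acts on \<open>exp (2 * t)\<close>, the square of the radius, because the
  test function will depend on \<open>x \<bullet> x\<close>.\<close>

definition truncated :: "real \<Rightarrow> real \<Rightarrow> real" where
  "truncated j t = cutoff j (exp (2 * t)) * f t"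

lemma truncated_bounds: "0 \<le> truncated j t" "truncated j t \<le> f t"
  using cutoff_bounds f_pos[of t] by (auto simp: truncated_def mult_left_le_one_le less_imp_le)

lemma truncated_cont: "continuous_on S (truncated j)"
proof -
  have c: "continuous_on S (\<lambda>t. exp_bump 0 (h t))" if "continuous_on S h" for h :: "real \<Rightarrow> real"
    using continuous_on_compose2[OF exp_bump_cont[of UNIV] that] by auto
  show ?thesis unfolding truncated_def cutoff_def by (intro continuous_intros c)
qed

text \<open>The profile \<open>truncated j\<close> is realised by the smooth function \<open>x \<mapsto> H (x \<bullet> x)\<close> with
  \<open>- H' r = cutoff j r * f (ln (sqrt r)) / (2 * r)\<close>.\<close>
lemma truncated_test_fun:
  assumes j: "0 < j"
  obtains \<phi> :: "'a::euclidean_space \<Rightarrow> real" where "test_fun \<phi>" "radial \<phi>"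
    "\<And>x. x \<noteq> 0 \<Longrightarrow> norm (grad \<phi> x) = \<bar>truncated j (ln (norm x))\<bar> / norm x"
    "\<And>x. x \<noteq> 0 \<Longrightarrow> \<phi> x = tail_integral (truncated j) (ln (norm x))"
proof -
  define g where "g r = (exp_bump 0 (j * r + (- 1)) * exp_bump 0 ((- j) * r + j\<^sup>2))
      * (\<kappa> / 2 * (r powr (\<sigma> / 2 - 1) * (1 + r powr (\<sigma> / 2)) powr (- k - 1)))" for r
  define K where "K r = (if 0 < r then g r else 0)" for r
  have g_cut: "g r = cutoff j r * (\<kappa> / 2 * (r powr (\<sigma> / 2 - 1) * (1 + r powr (\<sigma> / 2)) powr (- k - 1)))" for r
    by (simp add: g_def cutoff_def algebra_simps)
  have g_alg: "half_line_alg g"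
    unfolding g_def[abs_def] by (intro half_line_alg.intros)
  have g_zero: "g r = 0" if "0 < r" "r < 1 / j" for r
    using cutoff_zero(1)[OF j, of r] that by (simp add: g_cut)
  have sm: "smooth_real (\<lambda>r. - K r)"
  proof -
    have "smooth_real (\<lambda>r. if 0 < r then (- 1) * g r else 0)"
      by (rule smooth_real_if_half_line_alg[OF half_line_alg.mult[OF half_line_alg.const g_alg], of "1 / j"])
        (use j g_zero in auto)
    moreover have "(\<lambda>r. if 0 < r then (- 1) * g r else 0) = (\<lambda>r. - K r)" by (auto simp: K_def)
    ultimately show ?thesis by simp
  qed
  have Kc: "continuous_on S K" for S
  proof -
    obtain h' where "\<And>x. ((\<lambda>r. - K r) has_real_derivative h' x) (at x)" using smooth_real_deriv[OF sm] by blast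
    then have "continuous_on S (\<lambda>r. - K r)" by (meson DERIV_isCont continuous_at_imp_continuous_on)
    then have "continuous_on S (\<lambda>r. - (- K r))" by (rule continuous_on_minus)
    then show ?thesis by simp
  qed
  have K_far: "K r = 0" if "j \<le> r" for r using cutoff_zero(2)[OF j that] by (simp add: K_def g_cut)
  have K_eq: "K = (\<lambda>r. indicator {0..j} r * K r)"
  proof
    fix r
    have "r < 0 \<Longrightarrow> K r = 0" by (simp add: K_def)
    then show "K r = indicator {0..j} r * K r" using K_far[of r] by (force simp: indicator_def)
  qed
  have K_int: "integrable lborel K"
    by (subst K_eq) (rule integral_interval_eq_LINT(2)[OF Kc])
  define H where "H = tail_integral K"
  have H_der: "(H has_real_derivative - K r) (at r)" for r
    unfolding H_def by (rule tail_integral_deriv[OF K_int Kc])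
  have H_sm: "smooth_real H" by (rule smooth_real_antideriv[OF H_der sm])
  have H_far: "H r = 0" if "j \<le> r" for r
  proof -
    have "(\<lambda>s. indicator {r..} s * K s) = (\<lambda>s. 0)" using K_far that by (auto simp: fun_eq_iff indicator_def)
    then show ?thesis by (simp add: H_def tail_integral_def)
  qed
  define \<phi> where "\<phi> x = H (x \<bullet> x)" for x :: 'a
  have test: "test_fun \<phi>"
    unfolding test_fun_def
  proof
    show "smooth \<phi>" unfolding \<phi>_def[abs_def] by (intro smooth_alg_imp_smooth smooth_alg.comp H_sm)
    have "{x. \<phi> x \<noteq> 0} \<subseteq> cball 0 (sqrt j)"
    proof
      fix x assume "x \<in> {x. \<phi> x \<noteq> 0}"
      then have "x \<bullet> x < j" using H_far[of "x \<bullet> x"] by (force simp: \<phi>_def)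
      then show "x \<in> cball 0 (sqrt j)" by (simp add: norm_eq_sqrt_inner)
    qed
    then have "bounded {x. \<phi> x \<noteq> 0}" using bounded_cball bounded_subset by blast
    then show "compact (closure {x. \<phi> x \<noteq> 0})" by (simp add: compact_closure)
  qed
  have grad_\<phi>: "grad \<phi> x = (- (2 * K (x \<bullet> x))) *\<^sub>R x" for x
  proof (rule grad_eqI)
    have 1: "((\<lambda>x. x \<bullet> x) has_derivative (\<lambda>v. 2 * (x \<bullet> v))) (at x)"
      by (auto intro!: derivative_eq_intros simp: inner_commute)
    show "(\<phi> has_derivative (\<lambda>v. ((- (2 * K (x \<bullet> x))) *\<^sub>R x) \<bullet> v)) (at x)"
      unfolding \<phi>_def[abs_def]
      using has_derivative_compose[OF 1 H_der[unfolded has_field_derivative_def, of "x \<bullet> x"]] by (simp add: mult_ac)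
  qed
  \<comment> \<open>With \<open>x \<bullet> x = exp (2 * t)\<close> the powers in \<open>g\<close>
    combine to those of \<open>exp (\<sigma> * t)\<close> in \<open>f\<close>; the factor
    \<open>2 * (x \<bullet> x)\<close> is the chain rule for the logarithm of the radius.\<close>
  have KT: "2 * (x \<bullet> x) * K (x \<bullet> x) = truncated j (ln (norm x))" if x: "x \<noteq> 0" for x :: 'a
  proof -
    define t where "t = ln (norm x)"
    have xx: "x \<bullet> x = exp (2 * t)" using x by (simp add: t_def exp_double power2_norm_eq_inner)
    have "exp (2 * t) powr (\<sigma> / 2 - 1) * exp (2 * t) = exp (2 * t) powr (\<sigma> / 2)" by (simp add: powr_diff)
    also have "\<dots> = exp (\<sigma> * t)" by (simp add: powr_def)
    finally have e: "exp (2 * t) powr (\<sigma> / 2 - 1) * exp (2 * t) = exp (\<sigma> * t)" "exp (2 * t) powr (\<sigma> / 2) = exp (\<sigma> * t)"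
      by (simp_all add: powr_def)
    have "2 * exp (2 * t) * K (exp (2 * t)) = cutoff j (exp (2 * t)) * (\<kappa> * (exp (2 * t) powr (\<sigma> / 2 - 1) * exp (2 * t)) * (1 + exp (2 * t) powr (\<sigma> / 2)) powr (- k - 1))"
      by (simp add: K_def g_cut)
    also have "\<dots> = truncated j t" unfolding e by (simp add: truncated_def f_def L_def)
    finally show ?thesis by (simp add: xx t_def[symmetric])
  qed
  have radpart: "radial_part (grad \<phi>) x = truncated j (ln (norm x))" if "x \<noteq> 0" for x
    using KT[OF that] by (simp add: grad_\<phi> mult_ac)
  have gn: "norm (grad \<phi> x) = \<bar>truncated j (ln (norm x))\<bar> / norm x" if x: "x \<noteq> 0" for x
  proof -
    have "norm (grad \<phi> x) * norm x = \<bar>2 * (x \<bullet> x) * K (x \<bullet> x)\<bar>"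
      by (simp add: grad_\<phi> abs_mult power2_norm_eq_inner[symmetric] power2_eq_square)
    then show ?thesis using x by (simp add: KT[OF x] eq_divide_eq)
  qed
  have \<phi>_tail: "\<phi> x = tail_integral (truncated j) (ln (norm x))" if x: "x \<noteq> 0" for x
  proof -
    have "radial_part (grad \<phi>) (exp s *\<^sub>R x) = truncated j (s + ln (norm x))" for s
      using radpart[of "exp s *\<^sub>R x"] x by (simp add: ln_mult)
    then have "\<phi> x = (\<integral>s. indicator {0..} s * truncated j (s + ln (norm x)) \<partial>lborel)"
      using test_fun_ray(2)[OF test x] by simp
    also have "\<dots> = tail_integral (truncated j) (0 + ln (norm x))"
      unfolding tail_integral_shift(2) by (simp add: tail_integral_def)
    finally show ?thesis by simp
  qed
  have "radial \<phi>" unfolding radial_def \<phi>_def by (metis power2_norm_eq_inner)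
  from that[OF test this gn \<phi>_tail] show thesis .
qed

lemma truncated_energy: "energy (truncated j) \<le> DU" "finite_energy (truncated j)"
proof -
  have le: "\<bar>truncated j t\<bar> powr p * exp (\<gamma> * t) \<le> \<bar>f t\<bar> powr p * exp (\<gamma> * t)" for t
    using truncated_bounds[of j t] p_pos by (intro mult_right_mono powr_mono2) auto
  have [measurable]: "truncated j \<in> borel_measurable borel" using truncated_cont by (rule borel_measurable_continuous_onI)
  show i: "finite_energy (truncated j)"
    by (rule integrable_if_abs_le[OF f_energy(1)]) (use le in auto)
  show "energy (truncated j) \<le> DU" unfolding f_energy(2)[symmetric] by (intro integral_mono i f_energy le)
qed

text \<open>Dominated convergence twice: the truncations lie below \<open>f\<close>, hence their
  tails lie below \<open>U\<close>.\<close>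

lemma truncated_mass_tendsto: "(\<lambda>n. mass (truncated (real (Suc n)))) \<longlonglongrightarrow> QU"
proof -
  have tm [measurable]: "truncated j \<in> borel_measurable borel" for j
    using truncated_cont by (rule borel_measurable_continuous_onI)
  have [measurable]: "f \<in> borel_measurable borel" using f_cont by (rule borel_measurable_continuous_onI)
  note [measurable] = tail_integral_measurable[OF tm]
  have tl: "(\<lambda>n. tail_integral (truncated (real (Suc n))) t) \<longlonglongrightarrow> U t" for t
    unfolding tail_f[symmetric] tail_integral_def
  proof (rule integral_dominated_convergence[where w = f])
    show "integrable lborel f" by (rule f_integrable)
    show "AE s in lborel. (\<lambda>n. indicator {t..} s * truncated (real (Suc n)) s) \<longlonglongrightarrow> indicator {t..} s * f s"
    proof (rule AE_I2)
      fix s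
      have "(\<lambda>n. indicator {t..} s * (cutoff (real (Suc n)) (exp (2 * s)) * f s)) \<longlonglongrightarrow> indicator {t..} s * (1 * f s)"
        by (intro tendsto_intros cutoff_tendsto) simp
      then show "(\<lambda>n. indicator {t..} s * truncated (real (Suc n)) s) \<longlonglongrightarrow> indicator {t..} s * f s"
        by (simp add: truncated_def)
    qed
    show "AE s in lborel. norm (indicator {t..} s * truncated (real (Suc n)) s) \<le> f s" for n
      using truncated_bounds f_pos by (auto simp: indicator_def less_imp_le abs_of_nonneg)
  qed measurable
  have bd: "0 \<le> tail_integral (truncated j) t" "tail_integral (truncated j) t \<le> U t" for j t
    unfolding tail_f[symmetric]
    by (auto intro!: tail_integral_nonneg tail_integral_mono truncated_bounds truncated_energy f_energy)
  have "(\<lambda>n. mass (truncated (real (Suc n)))) \<longlonglongrightarrow> (\<integral>t. \<bar>U t\<bar> powr q * exp (B * t) \<partial>lborel)"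
  proof (rule integral_dominated_convergence[OF _ _ wh_integrable])
    show "AE t in lborel. (\<lambda>n. \<bar>tail_integral (truncated (real (Suc n))) t\<bar> powr q * exp (B * t)) \<longlonglongrightarrow> \<bar>U t\<bar> powr q * exp (B * t)"
      using q_pos by (intro AE_I2 tendsto_intros tendsto_powr' tl) auto
    show "AE t in lborel. norm (\<bar>tail_integral (truncated (real (Suc n))) t\<bar> powr q * exp (B * t)) \<le> wh t" for n
      using bd q_pos by (auto simp: wh_def intro!: powr_mono2 AE_I2)
    show "(\<lambda>t. \<bar>U t\<bar> powr q * exp (B * t)) \<in> borel_measurable lborel"
      using borel_measurable_continuous_onI[OF U_cont[of UNIV]] by measurable
  qed measurable
  also have "(\<integral>t. \<bar>U t\<bar> powr q * exp (B * t) \<partial>lborel) = QU"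
    using U_pos by (simp add: QU_def wh_def[abs_def] less_imp_le)
  finally show ?thesis .
qed

end

section \<open>Stability of the radial inequality\<close>

text \<open>\<open>G\<close> is within finite energy of some \<open>grad (\<phi> k)\<close>, which
  is bounded with bounded support; the weight is integrable near 0 since \<open>\<alpha>\<close>
  exceeds \<open>- DIM('a)\<close>.\<close>

lemma in_D_integrable:
  fixes u :: "'a::euclidean_space \<Rightarrow> real"
  assumes D: "in_D p \<alpha> u G" and p: "1 < p" and \<alpha>: "p - real DIM('a) < \<alpha>"
  shows "integrable lborel (\<lambda>x. norm x powr \<alpha> * norm (G x) powr p)"
proof -
  obtain \<phi> where Gm: "G \<in> borel_measurable borel" and \<phi>: "\<And>k. test_fun (\<phi> k)"
      "(\<lambda>k. \<integral>\<^sup>+ x. ennreal (norm x powr \<alpha> * norm (grad (\<phi> k) x - G x) powr p) \<partial>lborel) \<longlonglongrightarrow> 0"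
    using D unfolding in_D_def by auto
  note [measurable] = Gm
  have "eventually (\<lambda>k. (\<integral>\<^sup>+ x. ennreal (norm x powr \<alpha> * norm (grad (\<phi> k) x - G x) powr p) \<partial>lborel) < 1) sequentially"
    using \<phi>(2) by (rule order_tendstoD) simp
  then obtain k where k: "(\<integral>\<^sup>+ x. ennreal (norm x powr \<alpha> * norm (grad (\<phi> k) x - G x) powr p) \<partial>lborel) < 1"
    unfolding eventually_sequentially by blast
  have gc: "continuous_on UNIV (grad (\<phi> k))" by (rule test_fun_grad_continuous[OF \<phi>(1)])
  have [measurable]: "grad (\<phi> k) \<in> borel_measurable borel" using gc by (rule borel_measurable_continuous_onI)
  have 1: "integrable lborel (\<lambda>x. norm x powr \<alpha> * norm (grad (\<phi> k) x - G x) powr p)"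
    by (rule integrableI_nonneg) (use k in \<open>auto intro: less_trans\<close>)
  obtain R where R: "0 < R" "\<And>x. R < norm x \<Longrightarrow> grad (\<phi> k) x = 0" using test_fun_support[OF \<phi>(1)] by metis
  have "bounded (grad (\<phi> k) ` cball 0 R)"
    by (intro compact_imp_bounded compact_continuous_image continuous_on_subset[OF gc]) auto
  then obtain M where M: "\<forall>y\<in>grad (\<phi> k) ` cball 0 R. norm y \<le> M" unfolding bounded_iff ..
  define r where "r = ln R"
  define a where "a = real DIM('a) + \<alpha>"
  have a: "0 < a" using p \<alpha> by (simp add: a_def)
  have "integrable lborel (\<lambda>t. indicator {..r} t * exp (a * t))"
  proof (rule integrable_if_abs_le[OF integrable_mult_right[OF exp_abs_integrable[OF a], of "exp (2 * a * \<bar>r\<bar>)"]])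
    fix t
    show "\<bar>indicator {..r} t * exp (a * t)\<bar> \<le> exp (2 * a * \<bar>r\<bar>) * exp (- (a * \<bar>t\<bar>))"
    proof (cases "t \<le> r")
      case True
      then have "t + \<bar>t\<bar> \<le> 2 * \<bar>r\<bar>" by linarith
      then have "a * (t + \<bar>t\<bar>) \<le> a * (2 * \<bar>r\<bar>)" using a by (intro mult_left_mono) auto
      then show ?thesis using True by (simp add: algebra_simps flip: exp_add)
    qed auto
  qed measurable
  moreover have "indicator {..r} t * exp (a * t) = (indicator {..r} t * exp (\<alpha> * t)) * exp (real DIM('a) * t)" for t
    by (simp add: a_def exp_add[symmetric] algebra_simps)
  ultimately have "integrable lborel (\<lambda>t. (indicator {..r} t * exp (\<alpha> * t)) * exp (real DIM('a) * t))" by simp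
  then have loc: "integrable lborel (\<lambda>x::'a. indicator {..r} (ln (norm x)) * exp (\<alpha> * ln (norm x)))"
    by (subst integral_radial(2)[where g = "\<lambda>t. indicator {..r} t * exp (\<alpha> * t)"]) auto
  have 2: "integrable lborel (\<lambda>x. norm x powr \<alpha> * norm (grad (\<phi> k) x) powr p)"
  proof (rule Bochner_Integration.integrable_bound[OF integrable_mult_right[OF loc, of "\<bar>M\<bar> powr p"]])
    show "AE x in lborel. norm (norm x powr \<alpha> * norm (grad (\<phi> k) x) powr p)
        \<le> norm (\<bar>M\<bar> powr p * (indicator {..r} (ln (norm x)) * exp (\<alpha> * ln (norm x))))"
      using AE_lborel_singleton[of 0]
    proof eventually_elim
      case (elim x)
      show ?case
      proof (cases "norm x \<le> R")
        case True
        then have "norm (grad (\<phi> k) x) powr p \<le> \<bar>M\<bar> powr p"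
          using M p by (intro powr_mono2) (auto intro: order_trans[OF _ abs_ge_self])
        moreover have "ln (norm x) \<le> r" using True elim unfolding r_def by (intro ln_mono) auto
        ultimately show ?thesis
          using elim by (simp add: norm_powr_eq_exp mult.commute mult_left_mono)
      next
        case False
        then show ?thesis using R(2)[of x] p by simp
      qed
    qed
  qed measurable
  show ?thesis
  proof (rule integrable_if_abs_le[OF integrable_mult_right[OF Bochner_Integration.integrable_add[OF 1 2], of "2 powr (p - 1)"]])
    fix x
    have "norm (G x - 0) powr p \<le> 2 powr (p - 1) * (norm (G x - grad (\<phi> k) x) powr p + norm (grad (\<phi> k) x - 0) powr p)"
      using p by (intro norm_diff_powr_le) auto
    then have "norm x powr \<alpha> * norm (G x) powr p \<le> norm x powr \<alpha> * (2 powr (p - 1) * (norm (grad (\<phi> k) x - G x) powr p + norm (grad (\<phi> k) x) powr p))"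
      by (intro mult_left_mono) (auto simp: norm_minus_commute)
    then show "\<bar>norm x powr \<alpha> * norm (G x) powr p\<bar> \<le> 2 powr (p - 1) * (norm x powr \<alpha> * norm (grad (\<phi> k) x - G x) powr p + norm x powr \<alpha> * norm (grad (\<phi> k) x) powr p)"
      by (simp add: distrib_left mult_ac)
  qed measurable
qed

lemma C_const_pos:
  assumes "1 < p" "0 < real N - p + \<alpha>" "0 < real N + \<beta>"
  shows "0 < C_const N p \<alpha> \<beta>"
  using assms by (simp add: C_const_def)

context
  fixes p \<alpha> \<beta> :: real
  assumes p2: "2 \<le> p" and \<alpha>: "p - real DIM('a::euclidean_space) < \<alpha>" and \<alpha>\<beta>: "\<alpha> < p + \<beta>"
begin

interpretation b: bliss p "real DIM('a) - p + \<alpha>" "real DIM('a) + \<beta>"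
  by unfold_locales (use p2 \<alpha> \<alpha>\<beta> in auto)

lemma crit_exp_eq: "crit_exp DIM('a) p \<alpha> \<beta> = b.q"
  by (simp add: crit_exp_def b.q_def)

text \<open>The truncations of \<open>U\<close> compete in the infimum. An upper bound is the useful
  direction, since a smaller \<open>S_rad\<close> only enlarges the deficit.\<close>

lemma S_rad_le:
  "S_rad TYPE('a) p \<alpha> \<beta> * (sphere_const TYPE('a) * b.QU) powr (p / b.q) \<le> sphere_const TYPE('a) * b.DU"
proof -
  have step: "S_rad TYPE('a) p \<alpha> \<beta> * (sphere_const TYPE('a) * b.mass (b.truncated j)) powr (p / b.q) \<le> sphere_const TYPE('a) * b.DU" if j: "0 < j" for j
  proof -
    have tm [measurable]: "b.truncated j \<in> borel_measurable borel"
      using b.truncated_cont by (rule borel_measurable_continuous_onI)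
    obtain \<phi> :: "'a \<Rightarrow> real" where \<phi>: "test_fun \<phi>" "radial \<phi>"
      "\<And>x. x \<noteq> 0 \<Longrightarrow> norm (grad \<phi> x) = \<bar>b.truncated j (ln (norm x))\<bar> / norm x"
      "\<And>x. x \<noteq> 0 \<Longrightarrow> \<phi> x = tail_integral (b.truncated j) (ln (norm x))"
      using b.truncated_test_fun[OF j] by blast
    have inD: "in_D p \<alpha> \<phi> (grad \<phi>)" by (rule in_D_test_fun[OF \<phi>(1)])
    then have [measurable]: "\<phi> \<in> borel_measurable borel" "grad \<phi> \<in> borel_measurable borel" unfolding in_D_def by auto
    have Dn: "Dnorm_p p \<alpha> (grad \<phi>) = sphere_const TYPE('a) * b.energy (b.truncated j)"
      by (rule Dnorm_p_radial) (use AE_lborel_singleton[of 0] \<phi>(3) in \<open>auto elim!: eventually_mono\<close>)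
    have Lq: "weighted_Lq \<beta> b.q \<phi> = sphere_const TYPE('a) * b.mass (b.truncated j)"
      by (rule weighted_Lq_radial) (use AE_lborel_singleton[of 0] \<phi>(4) tail_integral_measurable[OF tm] in \<open>auto elim!: eventually_mono\<close>)
    have le: "sphere_const TYPE('a) * b.energy (b.truncated j) \<le> sphere_const TYPE('a) * b.DU"
      using b.truncated_energy(1) sphere_const_pos[where 'a = 'a] by (intro mult_left_mono) auto
    show ?thesis
    proof (cases "Dnorm_p p \<alpha> (grad \<phi>) = 0")
      case False
      then show ?thesis
        using S_rad_le_quotient[OF inD \<phi>(2) False, of \<beta>] le unfolding crit_exp_eq Dn Lq by linarith
    next
      \<comment> \<open>A truncation of zero energy does not compete in the infimum, but it vanishes
        almost everywhere, so its mass is 0 and the claim is trivial.\<close>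
      case True
      then have "b.energy (b.truncated j) = 0" unfolding Dn using sphere_const_pos[where 'a = 'a] by simp
      then have "AE t in lborel. \<bar>b.truncated j t\<bar> powr p * exp ((real DIM('a) - p + \<alpha>) * t) = 0"
        using integral_nonneg_eq_0_iff_AE[OF b.truncated_energy(2)] by simp
      then have "AE t in lborel. b.truncated j t = 0" by eventually_elim simp
      then have "tail_integral (b.truncated j) t = tail_integral (\<lambda>_. 0) t" for t
        unfolding tail_integral_def by (intro integral_cong_AE) (auto elim!: eventually_mono)
      then have "b.mass (b.truncated j) = 0" by (simp add: tail_integral_def)
      then show ?thesis using b.DU_pos sphere_const_pos[where 'a = 'a] by (simp add: less_imp_le)
    qed
  qed
  have lim: "(\<lambda>n. S_rad TYPE('a) p \<alpha> \<beta> * (sphere_const TYPE('a) * b.mass (b.truncated (real (Suc n)))) powr (p / b.q))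
      \<longlonglongrightarrow> S_rad TYPE('a) p \<alpha> \<beta> * (sphere_const TYPE('a) * b.QU) powr (p / b.q)"
    using b.QU_pos sphere_const_pos[where 'a = 'a] by (intro tendsto_intros b.truncated_mass_tendsto) auto
  show ?thesis by (rule LIMSEQ_le_const2[OF lim]) (use step in auto)
qed

text \<open>By homogeneity the bound at mass \<open>QU\<close> scales to every mass.\<close>

lemma S_rad_mass_le:
  assumes Q: "0 \<le> Q"
  shows "S_rad TYPE('a) p \<alpha> \<beta> * (sphere_const TYPE('a) * Q) powr (p / b.q) \<le> sphere_const TYPE('a) * (b.SB * Q powr (p / b.q))"
proof -
  have c: "0 < sphere_const TYPE('a)" by (rule sphere_const_pos)
  have "(sphere_const TYPE('a) * Q) powr (p / b.q) = (sphere_const TYPE('a) * b.QU) powr (p / b.q) * (Q / b.QU) powr (p / b.q)"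
    using c Q b.QU_pos by (simp add: powr_mult powr_divide)
  then have "S_rad TYPE('a) p \<alpha> \<beta> * (sphere_const TYPE('a) * Q) powr (p / b.q) = (S_rad TYPE('a) p \<alpha> \<beta> * (sphere_const TYPE('a) * b.QU) powr (p / b.q)) * (Q / b.QU) powr (p / b.q)"
    by simp
  also have "\<dots> \<le> (sphere_const TYPE('a) * b.DU) * (Q / b.QU) powr (p / b.q)"
    by (intro mult_right_mono S_rad_le) auto
  also have "\<dots> = sphere_const TYPE('a) * (b.SB * Q powr (p / b.q))"
    using Q b.QU_pos by (simp add: b.SB_def powr_divide)
  finally show ?thesis .
qed

text \<open>With \<open>lam = exp \<theta>\<close> the dilation becomes the translation by
  \<open>\<theta>\<close> in \<open>ln (norm x)\<close>. The origin is excluded because the extremal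
  may fail to be differentiable there.\<close>

lemma grad_U_ext:
  fixes x :: 'a
  assumes x: "x \<noteq> 0"
  shows "grad (U_ext p \<alpha> \<beta> (exp \<theta>)) x =
    (- (C_const DIM('a) p \<alpha> \<beta> * exp (\<theta> * ((real DIM('a) - p + \<alpha>) / p)) * b.f (ln (norm x) + \<theta>) / (norm x)\<^sup>2)) *\<^sub>R x"
proof (rule grad_eqI)
  define A where "A = C_const DIM('a) p \<alpha> \<beta> * exp (\<theta> * ((real DIM('a) - p + \<alpha>) / p))"
  have U_eq: "A * b.U (ln (norm y) + \<theta>) = U_ext p \<alpha> \<beta> (exp \<theta>) y" if "y \<noteq> 0" for y :: 'a
  proof -
    have s: "(p + \<beta> - \<alpha>) / (p - 1) = b.\<sigma>" by (simp add: b.\<sigma>_def)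
    have k: "(real DIM('a) - p + \<alpha>) / (p + \<beta> - \<alpha>) = b.k" by (simp add: b.k_def)
    have "exp \<theta> powr b.\<sigma> * norm y powr b.\<sigma> = exp (b.\<sigma> * (ln (norm y) + \<theta>))"
      using that by (simp add: powr_def exp_add[symmetric] algebra_simps)
    then have "1 + exp \<theta> powr b.\<sigma> * norm y powr b.\<sigma> = b.L (ln (norm y) + \<theta>)" by (simp add: b.L_def)
    then show ?thesis unfolding U_ext_def s k A_def b.U_def
      by (simp add: powr_minus divide_inverse powr_def[of "exp \<theta>"] mult_ac)
  qed
  have "((\<lambda>y. ln (norm y) + \<theta>) has_derivative (\<lambda>v. (v \<bullet> sgn x) * inverse (norm x))) (at x)"
    using x by (auto intro!: derivative_eq_intros has_derivative_norm simp: divide_inverse)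
  from has_derivative_compose[OF this b.U_der[unfolded has_field_derivative_def, of "ln (norm x) + \<theta>"]]
  have "((\<lambda>y. A * b.U (ln (norm y) + \<theta>)) has_derivative (\<lambda>v. A * (- b.f (ln (norm x) + \<theta>) * ((v \<bullet> sgn x) * inverse (norm x))))) (at x)"
    by (rule has_derivative_mult_right)
  moreover have "A * (- b.f (ln (norm x) + \<theta>) * ((v \<bullet> sgn x) * inverse (norm x))) = ((- (A * b.f (ln (norm x) + \<theta>) / (norm x)\<^sup>2)) *\<^sub>R x) \<bullet> v" for v
    using x by (simp add: sgn_div_norm power2_eq_square field_simps inner_commute)
  ultimately have "((\<lambda>y. A * b.U (ln (norm y) + \<theta>)) has_derivative (\<lambda>v. ((- (A * b.f (ln (norm x) + \<theta>) / (norm x)\<^sup>2)) *\<^sub>R x) \<bullet> v)) (at x)"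
    by simp
  then have "(U_ext p \<alpha> \<beta> (exp \<theta>) has_derivative (\<lambda>v. ((- (A * b.f (ln (norm x) + \<theta>) / (norm x)\<^sup>2)) *\<^sub>R x) \<bullet> v)) (at x)"
    by (rule has_derivative_transform_within_open[where s = "- {0}"]) (use x U_eq in auto)
  then show "(U_ext p \<alpha> \<beta> (exp \<theta>) has_derivative (\<lambda>v. ((- (C_const DIM('a) p \<alpha> \<beta> * exp (\<theta> * ((real DIM('a) - p + \<alpha>) / p)) * b.f (ln (norm x) + \<theta>) / (norm x)\<^sup>2)) *\<^sub>R x) \<bullet> v)) (at x)"
    by (simp add: A_def)
qed

lemma dist_M_powr_le:
  fixes G :: "'a \<Rightarrow> 'a"
  assumes "0 < lam"
  shows "dist_M p \<alpha> \<beta> G powr p \<le> Dnorm_p p \<alpha> (\<lambda>x. G x - c *\<^sub>R grad (U_ext p \<alpha> \<beta> lam) x)"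
proof -
  have nn: "0 \<le> Dnorm_p p \<alpha> H" for H :: "'a \<Rightarrow> 'a"
    unfolding Dnorm_p_def by (intro integral_nonneg_AE) auto
  have "dist_M p \<alpha> \<beta> G \<le> Dnorm_p p \<alpha> (\<lambda>x. G x - c *\<^sub>R grad (U_ext p \<alpha> \<beta> lam) x) powr (1 / p)"
    unfolding dist_M_def by (rule cInf_lower) (use assms in \<open>auto intro!: bdd_belowI[of _ 0]\<close>)
  moreover have "0 \<le> dist_M p \<alpha> \<beta> G"
    unfolding dist_M_def by (rule cInf_greatest) (use zero_less_one in blast, auto)
  ultimately have "dist_M p \<alpha> \<beta> G powr p \<le> (Dnorm_p p \<alpha> (\<lambda>x. G x - c *\<^sub>R grad (U_ext p \<alpha> \<beta> lam) x) powr (1 / p)) powr p"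
    using p2 by (intro powr_mono2) auto
  then show ?thesis using nn p2 by (simp add: powr_powr)
qed

text \<open>\<open>G\<close> is split orthogonally into \<open>Gb\<close> along \<open>x\<close>,
  governed by the estimate on the line, and a remainder of energy \<open>D2\<close>. The deficit
  dominates the one-dimensional deficit plus \<open>D2\<close>, and the distance is bounded by the
  same two quantities.\<close>

lemma radial_stability:
  "\<exists>B1 > 0. \<forall>(u :: 'a \<Rightarrow> real) G. in_D p \<alpha> u G \<and> radial u \<longrightarrow>
     Dnorm_p p \<alpha> G - S_rad TYPE('a) p \<alpha> \<beta> *
        (weighted_Lq \<beta> (crit_exp DIM('a) p \<alpha> \<beta>) u) powr (p / crit_exp DIM('a) p \<alpha> \<beta>)
     \<ge> B1 * (dist_M p \<alpha> \<beta> G) powr p"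
proof -
  obtain C where C: "0 < C"
    "\<And>F. F \<in> borel_measurable borel \<Longrightarrow> b.finite_energy F \<Longrightarrow> b.finite_mass F"
    "\<And>F e. F \<in> borel_measurable borel \<Longrightarrow> b.finite_energy F \<Longrightarrow> 0 < e \<Longrightarrow>
      \<exists>c \<theta>. b.finite_energy (\<lambda>t. F t - c * b.f (t + \<theta>)) \<and>
        b.energy (\<lambda>t. F t - c * b.f (t + \<theta>)) \<le> C * (b.energy F - b.SB * b.mass F powr (p / b.q)) + e"
    using b.stability by blast
  have cpos: "0 < sphere_const TYPE('a)" by (rule sphere_const_pos)
  have p1: "1 < p" using p2 by simp
  define C' where "C' = 2 powr (p - 1) * (1 + C)"
  have C': "0 < C'" using C(1) by (simp add: C'_def)
  have main: "dist_M p \<alpha> \<beta> G powr p \<le> C' * (Dnorm_p p \<alpha> G - S_rad TYPE('a) p \<alpha> \<beta> * weighted_Lq \<beta> b.q u powr (p / b.q))"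
    if D: "in_D p \<alpha> u G" and rad: "radial u" for u :: "'a \<Rightarrow> real" and G
  proof -
    have [measurable]: "u \<in> borel_measurable borel" "G \<in> borel_measurable borel" using D unfolding in_D_def by auto
    obtain F where F_meas [measurable]: "F \<in> borel_measurable borel" and RG: "AE y in lborel. radial_part G y = F (ln (norm y))"
      and uF: "AE y in lborel. u y = tail_integral F (ln (norm y))"
      using in_D_radial[OF D p1 \<alpha> rad] by blast
    note [measurable] = tail_integral_measurable[OF F_meas]
    \<comment> \<open>Almost everywhere the projection of \<open>G\<close> onto the direction of
      \<open>y\<close>, written with the function \<open>F\<close> of the radius alone.\<close>
    define Gb where "Gb y = (- (F (ln (norm y)) / (norm y)\<^sup>2)) *\<^sub>R y" for y :: 'a
    have [measurable]: "Gb \<in> borel_measurable borel" unfolding Gb_def[abs_def] by measurable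
    have Gb_norm: "norm (Gb y) = \<bar>F (ln (norm y))\<bar> / norm y" if "y \<noteq> 0" for y
      using that by (simp add: Gb_def power2_eq_square)
    have G_int: "integrable lborel (\<lambda>x. norm x powr \<alpha> * norm (G x) powr p)" by (rule in_D_integrable[OF D p1 \<alpha>])
    have split: "AE y in lborel. norm y powr \<alpha> * norm (Gb y) powr p + norm y powr \<alpha> * norm (G y - Gb y) powr p \<le> norm y powr \<alpha> * norm (G y) powr p"
      using RG AE_lborel_singleton[of 0]
    proof eventually_elim
      case (elim y)
      have "Gb y \<bullet> y = - F (ln (norm y))" using elim by (simp add: Gb_def power2_norm_eq_inner)
      then have "(G y - Gb y) \<bullet> y = 0" using elim by (simp add: inner_diff_left)
      then have "Gb y \<bullet> (G y - Gb y) = 0" by (simp add: Gb_def inner_commute)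
      from norm_powr_orthogonal[OF this p2]
      have "norm (Gb y) powr p + norm (G y - Gb y) powr p \<le> norm (G y) powr p" by simp
      then show ?case by (metis distrib_left mult_left_mono powr_ge_zero)
    qed
    have Gb_int: "integrable lborel (\<lambda>x. norm x powr \<alpha> * norm (Gb x) powr p)"
      by (rule Bochner_Integration.integrable_bound[OF G_int])
        (measurable, use split in eventually_elim, simp add: order_trans[rotated])
    have Gd_int: "integrable lborel (\<lambda>x. norm x powr \<alpha> * norm (G x - Gb x) powr p)"
      by (rule Bochner_Integration.integrable_bound[OF G_int])
        (measurable, use split in eventually_elim, simp add: order_trans[rotated])
    define D2 where "D2 = Dnorm_p p \<alpha> (\<lambda>x. G x - Gb x)"
    have D2_nn: "0 \<le> D2" unfolding D2_def Dnorm_p_def by (intro integral_nonneg_AE) auto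
    have Gb_ae: "AE x in lborel. norm (Gb x) = \<bar>F (ln (norm x))\<bar> / norm x"
      using AE_lborel_singleton[of 0] by eventually_elim (rule Gb_norm)
    have Gb_Dn: "Dnorm_p p \<alpha> Gb = sphere_const TYPE('a) * b.energy F" by (rule Dnorm_p_radial(1)[OF _ _ Gb_ae]) measurable
    have F_en: "b.finite_energy F" using Gb_int by (subst (asm) Dnorm_p_radial(2)[OF _ _ Gb_ae]) measurable
    have Dsplit: "sphere_const TYPE('a) * b.energy F + D2 \<le> Dnorm_p p \<alpha> G"
    proof -
      have "Dnorm_p p \<alpha> Gb + D2 = (\<integral>x. norm x powr \<alpha> * norm (Gb x) powr p + norm x powr \<alpha> * norm (G x - Gb x) powr p \<partial>lborel)"
        unfolding D2_def Dnorm_p_def by (rule Bochner_Integration.integral_add[symmetric, OF Gb_int Gd_int])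
      also have "\<dots> \<le> Dnorm_p p \<alpha> G" unfolding Dnorm_p_def
        by (rule integral_mono_AE[OF _ G_int split]) (intro Bochner_Integration.integrable_add Gb_int Gd_int)
      finally show ?thesis unfolding Gb_Dn .
    qed
    define Q where "Q = b.mass F"
    have Q_nn: "0 \<le> Q" unfolding Q_def by (intro integral_nonneg_AE) auto
    have Lq: "weighted_Lq \<beta> b.q u = sphere_const TYPE('a) * Q" unfolding Q_def by (rule weighted_Lq_radial[OF _ _ uF]) measurable
    define d where "d = b.energy F - b.SB * Q powr (p / b.q)"
    have deficit: "sphere_const TYPE('a) * d + D2 \<le> Dnorm_p p \<alpha> G - S_rad TYPE('a) p \<alpha> \<beta> * weighted_Lq \<beta> b.q u powr (p / b.q)"
      using S_rad_mass_le[OF Q_nn] Dsplit unfolding Lq d_def by (simp add: right_diff_distrib)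
    \<comment> \<open>The second conjunct gives \<open>0 \<le> C * d\<close> once \<open>e\<close>
      tends to 0; this sign is used when the constants are merged into \<open>C'\<close>.\<close>
    have near: "dist_M p \<alpha> \<beta> G powr p \<le> 2 powr (p - 1) * (D2 + sphere_const TYPE('a) * (C * d + e)) \<and> 0 \<le> C * d + e" if e: "0 < e" for e
    proof -
      obtain c \<theta> where ct: "b.finite_energy (\<lambda>t. F t - c * b.f (t + \<theta>))"
        "b.energy (\<lambda>t. F t - c * b.f (t + \<theta>)) \<le> C * d + e"
        using C(3)[OF F_meas F_en e] unfolding d_def Q_def by blast
      define A where "A = C_const DIM('a) p \<alpha> \<beta> * exp (\<theta> * ((real DIM('a) - p + \<alpha>) / p))"
      have A: "0 < A" unfolding A_def using C_const_pos[of p "DIM('a)" \<alpha> \<beta>] b.\<gamma>_pos b.B_pos p1 by simp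
      define V where "V x = (c / A) *\<^sub>R grad (U_ext p \<alpha> \<beta> (exp \<theta>)) x" for x :: 'a
      \<comment> \<open>At the origin \<open>grad\<close> may be an unspecified value; isolating it
        makes the measurability of \<open>V\<close> evident.\<close>
      define v0 where "v0 = V 0"
      have V_eq: "V x = (if x = 0 then v0 else (- (c * b.f (ln (norm x) + \<theta>) / (norm x)\<^sup>2)) *\<^sub>R x)" for x
      proof (cases "x = 0")
        case False
        then show ?thesis unfolding V_def grad_U_ext[OF False] A_def[symmetric] using A by simp
      qed (simp add: v0_def)
      have [measurable]: "V \<in> borel_measurable borel" unfolding V_eq[abs_def] by measurable
      define h where "h t = F t - c * b.f (t + \<theta>)" for t
      have [measurable]: "h \<in> borel_measurable borel" unfolding h_def[abs_def] by measurable
      have GV_ae: "AE x in lborel. norm (Gb x - V x) = \<bar>h (ln (norm x))\<bar> / norm x"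
        using AE_lborel_singleton[of 0]
      proof eventually_elim
        case (elim x)
        have "Gb x - V x = (- (h (ln (norm x)) / (norm x)\<^sup>2)) *\<^sub>R x"
          using elim by (simp add: V_eq[of x] Gb_def h_def scaleR_diff_left[symmetric] diff_divide_distrib)
        then show ?case using elim by (simp add: power2_eq_square)
      qed
      have GV_Dn: "Dnorm_p p \<alpha> (\<lambda>x. Gb x - V x) = sphere_const TYPE('a) * b.energy h"
        by (rule Dnorm_p_radial(1)[OF _ _ GV_ae]) measurable
      have GV_int: "integrable lborel (\<lambda>x. norm x powr \<alpha> * norm (Gb x - V x) powr p)"
        using ct(1) unfolding h_def[symmetric] by (subst Dnorm_p_radial(2)[OF _ _ GV_ae]) measurable
      let ?S = "\<lambda>x. 2 powr (p - 1) * (norm x powr \<alpha> * norm (G x - Gb x) powr p + norm x powr \<alpha> * norm (Gb x - V x) powr p)"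
      have S_int: "integrable lborel ?S" by (intro integrable_mult_right Bochner_Integration.integrable_add Gd_int GV_int)
      have le: "norm x powr \<alpha> * norm (G x - V x) powr p \<le> ?S x" for x
      proof -
        have "norm x powr \<alpha> * norm (G x - V x) powr p \<le> norm x powr \<alpha> * (2 powr (p - 1) * (norm (G x - Gb x) powr p + norm (Gb x - V x) powr p))"
          using p2 by (intro mult_left_mono norm_diff_powr_le) auto
        then show ?thesis by (simp add: distrib_left mult_ac)
      qed
      have int: "integrable lborel (\<lambda>x. norm x powr \<alpha> * norm (G x - V x) powr p)"
        by (rule integrable_if_abs_le[OF S_int]) (measurable, use le in simp)
      have "dist_M p \<alpha> \<beta> G powr p \<le> Dnorm_p p \<alpha> (\<lambda>x. G x - V x)"
        unfolding V_def by (rule dist_M_powr_le) simp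
      also have "\<dots> \<le> (\<integral>x. ?S x \<partial>lborel)" unfolding Dnorm_p_def by (intro integral_mono int S_int le)
      also have "\<dots> = 2 powr (p - 1) * (D2 + sphere_const TYPE('a) * b.energy h)"
        unfolding GV_Dn[symmetric] unfolding D2_def Dnorm_p_def using Gd_int GV_int by simp
      also have "\<dots> \<le> 2 powr (p - 1) * (D2 + sphere_const TYPE('a) * (C * d + e))"
        using ct(2) cpos unfolding h_def by (intro mult_left_mono add_left_mono) auto
      finally have "dist_M p \<alpha> \<beta> G powr p \<le> 2 powr (p - 1) * (D2 + sphere_const TYPE('a) * (C * d + e))" .
      moreover have "0 \<le> b.energy h" by (intro integral_nonneg_AE) auto
      ultimately show ?thesis using ct(2) unfolding h_def by linarith
    qed
    have d_nn: "0 \<le> C * d" by (rule field_le_epsilon) (rule conjunct2[OF near])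
    have "dist_M p \<alpha> \<beta> G powr p \<le> 2 powr (p - 1) * (D2 + sphere_const TYPE('a) * (C * d))"
    proof (rule field_le_epsilon)
      fix e :: real assume e: "0 < e"
      have "dist_M p \<alpha> \<beta> G powr p \<le> 2 powr (p - 1) * (D2 + sphere_const TYPE('a) * (C * d + e / (2 powr (p - 1) * sphere_const TYPE('a))))"
        by (rule conjunct1[OF near]) (use e cpos in simp)
      also have "\<dots> = 2 powr (p - 1) * (D2 + sphere_const TYPE('a) * (C * d)) + e" using cpos by (simp add: distrib_left)
      finally show "dist_M p \<alpha> \<beta> G powr p \<le> 2 powr (p - 1) * (D2 + sphere_const TYPE('a) * (C * d)) + e" .
    qed
    also have "\<dots> \<le> C' * (sphere_const TYPE('a) * d + D2)"
    proof -
      have "0 \<le> d" using d_nn C(1) by (simp add: zero_le_mult_iff)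
      then have "D2 + sphere_const TYPE('a) * (C * d) \<le> (1 + C) * (sphere_const TYPE('a) * d + D2)"
        using C(1) cpos D2_nn by (simp add: algebra_simps)
      then have "2 powr (p - 1) * (D2 + sphere_const TYPE('a) * (C * d)) \<le> 2 powr (p - 1) * ((1 + C) * (sphere_const TYPE('a) * d + D2))" by (intro mult_left_mono) auto
      then show ?thesis by (simp add: C'_def mult.assoc)
    qed
    also have "\<dots> \<le> C' * (Dnorm_p p \<alpha> G - S_rad TYPE('a) p \<alpha> \<beta> * weighted_Lq \<beta> b.q u powr (p / b.q))"
      using deficit C' by (intro mult_left_mono) auto
    finally show ?thesis .
  qed
  show ?thesis unfolding crit_exp_eq
  proof (intro exI[of _ "1 / C'"] conjI allI impI)
    show "0 < 1 / C'" using C' by simp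
    fix u :: "'a \<Rightarrow> real" and G
    assume "in_D p \<alpha> u G \<and> radial u"
    then show "1 / C' * dist_M p \<alpha> \<beta> G powr p \<le> Dnorm_p p \<alpha> G - S_rad TYPE('a) p \<alpha> \<beta> * weighted_Lq \<beta> b.q u powr (p / b.q)"
      using main[of u G] C' by (simp add: pos_divide_le_eq mult.commute)
  qed
qed

end

theorem theorem1p5:
  fixes p \<alpha> \<beta> :: real
  assumes "DIM('a::euclidean_space) \<ge> 3"
    and "2 \<le> p" and "p < real DIM('a)"
    and "p - real DIM('a) < \<alpha>" and "\<alpha> < p + \<beta>"
  shows "\<exists>B1 > 0. \<forall>(u :: 'a \<Rightarrow> real) G. in_D p \<alpha> u G \<and> radial u \<longrightarrow>
     Dnorm_p p \<alpha> G - S_rad TYPE('a) p \<alpha> \<beta> *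
        (weighted_Lq \<beta> (crit_exp DIM('a) p \<alpha> \<beta>) u) powr (p / crit_exp DIM('a) p \<alpha> \<beta>)
     \<ge> B1 * (dist_M p \<alpha> \<beta> G) powr p"
  using radial_stability[where 'a = 'a] assms by blast

end
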